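(* Let $\Bbbk$ be a field of characteristic $0$, $n\ge 2$, $\mathfrak g=\mathfrak{sp}_{2n}$, and let $e\in\mathfrak g$ be a minimal nilpotent element, so that $\mathfrak g_e=\mathfrak{sp}_{2n-2}\ltimes\mathfrak{heis}_{n-1}$. For $1\le i\le n-1$ let $H_i$ be the restriction of ${}^e\!\Delta_{2i+2}\in\mathcal S(\mathfrak g_e)^{\mathfrak g_e}$ to the hyperplane in $\mathfrak g_e^*$ where $e=0$; it is regarded as an element of $\mathcal S(\mathfrak s)$ with $\mathfrak s=\mathfrak{sp}_{2n-2}\ltimes\Bbbk^{2n-2}$. Then the algebra of symmetric invariants $\mathcal S(\mathfrak s)^{\mathfrak s}$ of $\mathfrak s$ is freely generated by the polynomials $H_i$ with $1\le i\le n-1$.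
   Context: $\mathfrak g_e$ is the centraliser of $e$ in $\mathfrak g$; $\mathfrak{heis}_{k}$ is the Heisenberg Lie algebra of dimension $2k+1$, and here its centre is $\Bbbk e$. Hence $\mathfrak g_e/\Bbbk e\simeq\mathfrak{sp}_{2n-2}\ltimes\Bbbk^{2n-2}$, where the defining module $\Bbbk^{2n-2}$ is an Abelian ideal. The hyperplane $\{\gamma\in\mathfrak g_e^*\mid\gamma(e)=0\}$ is $(\mathfrak g_e/\Bbbk e)^*=\mathfrak s^*$, so restriction to it is the natural map $\mathcal S(\mathfrak g_e)\to\mathcal S(\mathfrak g_e/\Bbbk e)=\mathcal S(\mathfrak s)$. Definition of ${}^e\!\Delta_k$: identify $\mathfrak g$ with $\mathfrak g^*$ by an invariant form and let $\Delta_k\in\mathcal S(\mathfrak g)=\Bbbk[\mathfrak g^*]$ be the sum of the principal $k$-minors of the $2n\times 2n$ matrix. Include $e$ in an $\mathfrak{sl}_2$-triple $\{e,h,f\}\subset\mathfrak g$; then $\mathfrak g=\Bbbk f\oplus e^{\perp}$, where $e^\perp$ is the orthogonal complement of $e$ with respect to the Killing form, so $\mathcal S(\mathfrak g)=\mathcal S(e^\perp)[f]$. Write the component of $\Delta_k$ of highest degree $d$ in $f$ as ${}^e\!\Delta_k\,f^d$. It is known that ${}^e\!\Delta_k\in\mathcal S(\mathfrak g_e)^{\mathfrak g_e}$ for even $k$, $2\le k\le 2n$. *)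

theory Defs
  imports
    "HOL-Library.Poly_Mapping"
    "HOL-Library.FuncSet"
    "HOL-Algebra.Module"
    "Jordan_Normal_Form.Matrix"
    "Jordan_Normal_Form.Determinant"
    "Jordan_Normal_Form.DL_Submatrix"
begin

section \<open>Polynomials in several variables\<close>

text \<open>A polynomial with variables indexed by \<open>'x\<close> is a finitely supported map from monomials to
  coefficients.\<close>

type_synonym ('x, 'a) mpoly = "('x \<Rightarrow>\<^sub>0 nat) \<Rightarrow>\<^sub>0 'a"

definition mpoly_eval :: "('x \<Rightarrow> 'a::comm_semiring_1) \<Rightarrow> ('x, 'a) mpoly \<Rightarrow> 'a" where
  "mpoly_eval v p =
     (\<Sum>m\<in>Poly_Mapping.keys p. Poly_Mapping.lookup p m *
        (\<Prod>i\<in>Poly_Mapping.keys m. v i ^ Poly_Mapping.lookup m i))"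

definition mpolys_in :: "'x set \<Rightarrow> ('x, 'a::zero) mpoly set" where
  "mpolys_in I = {p. \<forall>m\<in>Poly_Mapping.keys p. Poly_Mapping.keys m \<subseteq> I}"

section \<open>Lie algebras and their symmetric algebras\<close>

text \<open>The fields \<open>mult\<close> and \<open>one\<close> inherited from the record \<open>module\<close> play no role and are left
  undefined, as the library does for \<open>module_vec\<close>.\<close>

record ('a, 'v) lie_algebra = "('a, 'v) module" +
  lie_bracket :: "'v \<Rightarrow> 'v \<Rightarrow> 'v"

definition lie_hom :: "('a, 'v) lie_algebra \<Rightarrow> ('a, 'w) lie_algebra \<Rightarrow> ('v \<Rightarrow> 'w) \<Rightarrow> bool" where
  "lie_hom L M \<phi> \<longleftrightarrow>
     \<phi> \<in> carrier L \<rightarrow> carrier M \<and>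
     (\<forall>x\<in>carrier L. \<forall>y\<in>carrier L. \<phi> (x \<oplus>\<^bsub>L\<^esub> y) = \<phi> x \<oplus>\<^bsub>M\<^esub> \<phi> y) \<and>
     (\<forall>c. \<forall>x\<in>carrier L. \<phi> (c \<odot>\<^bsub>L\<^esub> x) = c \<odot>\<^bsub>M\<^esub> \<phi> x) \<and>
     (\<forall>x\<in>carrier L. \<forall>y\<in>carrier L. \<phi> (lie_bracket L x y) = lie_bracket M (\<phi> x) (\<phi> y))"

definition centraliser :: "('a, 'v) lie_algebra \<Rightarrow> 'v \<Rightarrow> ('a, 'v) lie_algebra" where
  "centraliser L e = L\<lparr>carrier := {x \<in> carrier L. lie_bracket L e x = \<zero>\<^bsub>L\<^esub>}\<rparr>"

definition lie_dual :: "('a::field, 'v) lie_algebra \<Rightarrow> ('v \<Rightarrow> 'a) set" where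
  "lie_dual L = {\<gamma> \<in> extensional (carrier L).
     (\<forall>x\<in>carrier L. \<forall>y\<in>carrier L. \<gamma> (x \<oplus>\<^bsub>L\<^esub> y) = \<gamma> x + \<gamma> y) \<and>
     (\<forall>c. \<forall>x\<in>carrier L. \<gamma> (c \<odot>\<^bsub>L\<^esub> x) = c * \<gamma> x)}"

text \<open>The symmetric algebra \<open>\<S>(L)\<close> is realised as the algebra of polynomial functions on the dual
  space of \<open>L\<close>; this is legitimate because the ground fields below are infinite and the Lie algebras
  finite-dimensional.  An element \<open>x\<close> of \<open>L\<close> becomes the function \<open>\<gamma> \<mapsto> \<gamma> x\<close>.  Functions on the dual
  space are extensional, so that equality of elements of \<open>\<S>(L)\<close> is equality in HOL.\<close>

type_synonym ('a, 'v) sym_elem = "('v \<Rightarrow> 'a) \<Rightarrow> 'a"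

definition sym_const :: "('a::field, 'v) lie_algebra \<Rightarrow> 'a \<Rightarrow> ('a, 'v) sym_elem" where
  "sym_const L c = (\<lambda>\<gamma>\<in>lie_dual L. c)"

definition sym_gen :: "('a::field, 'v) lie_algebra \<Rightarrow> 'v \<Rightarrow> ('a, 'v) sym_elem" where
  "sym_gen L x = (\<lambda>\<gamma>\<in>lie_dual L. \<gamma> x)"

definition sym_add ::
  "('a::field, 'v) lie_algebra \<Rightarrow> ('a, 'v) sym_elem \<Rightarrow> ('a, 'v) sym_elem \<Rightarrow> ('a, 'v) sym_elem" where
  "sym_add L F G = (\<lambda>\<gamma>\<in>lie_dual L. F \<gamma> + G \<gamma>)"

definition sym_mult ::
  "('a::field, 'v) lie_algebra \<Rightarrow> ('a, 'v) sym_elem \<Rightarrow> ('a, 'v) sym_elem \<Rightarrow> ('a, 'v) sym_elem" where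
  "sym_mult L F G = (\<lambda>\<gamma>\<in>lie_dual L. F \<gamma> * G \<gamma>)"

text \<open>For a subspace \<open>V\<close> of \<open>L\<close>, the subalgebra of \<open>\<S>(L)\<close> generated by \<open>V\<close> is \<open>\<S>(V)\<close>.\<close>

inductive_set sym_subalg :: "('a::field, 'v) lie_algebra \<Rightarrow> 'v set \<Rightarrow> ('a, 'v) sym_elem set"
  for L V where
  const: "sym_const L c \<in> sym_subalg L V"
| gen: "x \<in> V \<Longrightarrow> sym_gen L x \<in> sym_subalg L V"
| add: "F \<in> sym_subalg L V \<Longrightarrow> G \<in> sym_subalg L V \<Longrightarrow> sym_add L F G \<in> sym_subalg L V"
| mult: "F \<in> sym_subalg L V \<Longrightarrow> G \<in> sym_subalg L V \<Longrightarrow> sym_mult L F G \<in> sym_subalg L V"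

definition sym_alg :: "('a::field, 'v) lie_algebra \<Rightarrow> ('a, 'v) sym_elem set" where
  "sym_alg L = sym_subalg L (carrier L)"

text \<open>The algebra homomorphism \<open>\<S>(L) \<rightarrow> \<S>(M)\<close> induced by a linear map \<open>\<phi>\<close> from \<open>L\<close> to \<open>M\<close>: on
  functions it is the comorphism of the transpose \<open>M\<^sup>* \<rightarrow> L\<^sup>*\<close>.  For surjective \<open>\<phi>\<close> the
  transpose identifies \<open>M\<^sup>*\<close> with the annihilator of the kernel of \<open>\<phi>\<close>, and the homomorphism is
  restriction of functions to that annihilator.\<close>

definition sym_map ::
  "('a::field, 'v) lie_algebra \<Rightarrow> ('a, 'w) lie_algebra \<Rightarrow> ('v \<Rightarrow> 'w) \<Rightarrow>
   ('a, 'v) sym_elem \<Rightarrow> ('a, 'w) sym_elem" where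
  "sym_map L M \<phi> F = (\<lambda>\<delta>\<in>lie_dual M. F (compose (carrier L) \<delta> \<phi>))"

text \<open>The action of \<open>x\<close> on \<open>\<S>(L)\<close>: the derivation extending \<open>ad x\<close>.\<close>

definition sym_ad ::
  "('a::field, 'v) lie_algebra \<Rightarrow> 'v \<Rightarrow> ('a, 'v) sym_elem \<Rightarrow> ('a, 'v) sym_elem" where
  "sym_ad L x = (THE D.
     D \<in> sym_alg L \<rightarrow>\<^sub>E sym_alg L \<and>
     (\<forall>c. D (sym_const L c) = sym_const L 0) \<and>
     (\<forall>y\<in>carrier L. D (sym_gen L y) = sym_gen L (lie_bracket L x y)) \<and>
     (\<forall>F\<in>sym_alg L. \<forall>G\<in>sym_alg L. D (sym_add L F G) = sym_add L (D F) (D G)) \<and>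
     (\<forall>F\<in>sym_alg L. \<forall>G\<in>sym_alg L.
        D (sym_mult L F G) = sym_add L (sym_mult L (D F) G) (sym_mult L F (D G))))"

definition sym_invariants :: "('a::field, 'v) lie_algebra \<Rightarrow> ('a, 'v) sym_elem set" where
  "sym_invariants L = {F \<in> sym_alg L. \<forall>x\<in>carrier L. sym_ad L x F = sym_const L 0}"

text \<open>The evaluation homomorphism from the polynomial ring with variables in \<open>I\<close> is an isomorphism
  onto \<open>A\<close>: injectivity is algebraic independence, surjectivity is generation.\<close>

definition freely_generated_by ::
  "('a::field, 'v) lie_algebra \<Rightarrow> ('a, 'v) sym_elem set \<Rightarrow> 'i set \<Rightarrow> ('i \<Rightarrow> ('a, 'v) sym_elem) \<Rightarrow> bool"
  where
  "freely_generated_by L A I H \<longleftrightarrow>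
     bij_betw (\<lambda>p. \<lambda>\<gamma>\<in>lie_dual L. mpoly_eval (\<lambda>i. H i \<gamma>) p) (mpolys_in I) A"

section \<open>Invariant forms\<close>

text \<open>The trace of an endomorphism \<open>T\<close>, computed with a basis \<open>b 0, \<dots>, b (N - 1)\<close> and its
  dual basis \<open>\<phi>\<close>; the last condition on \<open>\<phi>\<close> makes \<open>b\<close> span \<open>L\<close>.\<close>

definition dual_bases ::
  "('a::field, 'v) lie_algebra \<Rightarrow> nat \<Rightarrow> (nat \<Rightarrow> 'v) \<Rightarrow> (nat \<Rightarrow> 'v \<Rightarrow> 'a) \<Rightarrow> bool" where
  "dual_bases L N b \<phi> \<longleftrightarrow>
     (\<forall>i<N. b i \<in> carrier L \<and> \<phi> i \<in> lie_dual L) \<and>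
     (\<forall>i<N. \<forall>j<N. \<phi> i (b j) = (if i = j then 1 else 0)) \<and>
     (\<forall>x\<in>carrier L. (\<forall>i<N. \<phi> i x = 0) \<longrightarrow> x = \<zero>\<^bsub>L\<^esub>)"

definition lie_trace :: "('a::field, 'v) lie_algebra \<Rightarrow> ('v \<Rightarrow> 'v) \<Rightarrow> 'a" where
  "lie_trace L T = (THE t. \<exists>N b \<phi>. dual_bases L N b \<phi> \<and> t = (\<Sum>i<N. \<phi> i (T (b i))))"

definition killing_form :: "('a::field, 'v) lie_algebra \<Rightarrow> 'v \<Rightarrow> 'v \<Rightarrow> 'a" where
  "killing_form L x y = lie_trace L (\<lambda>z. lie_bracket L x (lie_bracket L y z))"

definition killing_perp :: "('a::field, 'v) lie_algebra \<Rightarrow> 'v \<Rightarrow> 'v set" where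
  "killing_perp L e = {x \<in> carrier L. killing_form L e x = 0}"

definition invariant_form :: "('a::field, 'v) lie_algebra \<Rightarrow> ('v \<Rightarrow> 'v \<Rightarrow> 'a) \<Rightarrow> bool" where
  "invariant_form L B \<longleftrightarrow>
     (\<forall>x\<in>carrier L. restrict (B x) (carrier L) \<in> lie_dual L) \<and>
     (\<forall>x\<in>carrier L. \<forall>y\<in>carrier L. B x y = B y x) \<and>
     (\<forall>x\<in>carrier L. \<forall>y\<in>carrier L. \<forall>z\<in>carrier L. B (lie_bracket L x y) z = B x (lie_bracket L y z)) \<and>
     (\<forall>x\<in>carrier L. (\<forall>y\<in>carrier L. B x y = 0) \<longrightarrow> x = \<zero>\<^bsub>L\<^esub>)"

definition sl2_triple :: "('a::field, 'v) lie_algebra \<Rightarrow> 'v \<Rightarrow> 'v \<Rightarrow> 'v \<Rightarrow> bool" where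
  "sl2_triple L e h f \<longleftrightarrow>
     {e, h, f} \<subseteq> carrier L \<and>
     lie_bracket L h e = 2 \<odot>\<^bsub>L\<^esub> e \<and>
     lie_bracket L h f = (- 2) \<odot>\<^bsub>L\<^esub> f \<and>
     lie_bracket L e f = h"

section \<open>The symplectic Lie algebra\<close>

definition symp_J :: "nat \<Rightarrow> 'a::comm_ring_1 mat" where
  "symp_J m = four_block_mat (0\<^sub>m m m) (1\<^sub>m m) (- 1\<^sub>m m) (0\<^sub>m m m)"

definition sp :: "nat \<Rightarrow> ('a::field, 'a mat) lie_algebra" where
  "sp m = \<lparr>
     carrier = {X \<in> carrier_mat (2 * m) (2 * m). transpose_mat X * symp_J m + symp_J m * X = 0\<^sub>m (2 * m) (2 * m)},
     mult = undefined,
     one = undefined,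
     zero = 0\<^sub>m (2 * m) (2 * m),
     add = (+),
     module.smult = (\<cdot>\<^sub>m),
     lie_bracket = (\<lambda>X Y. X * Y - Y * X)\<rparr>"

definition Sp_group :: "nat \<Rightarrow> 'a::field mat set" where
  "Sp_group m = {g \<in> carrier_mat (2 * m) (2 * m). transpose_mat g * symp_J m * g = symp_J m}"

text \<open>The semidirect product of \<open>sp m\<close> with its defining module, an Abelian ideal.\<close>

definition sp_semidirect :: "nat \<Rightarrow> ('a::field, 'a mat \<times> 'a vec) lie_algebra" where
  "sp_semidirect m = \<lparr>
     carrier = carrier (sp m) \<times> carrier_vec (2 * m),
     mult = undefined,
     one = undefined,
     zero = (0\<^sub>m (2 * m) (2 * m), 0\<^sub>v (2 * m)),
     add = (\<lambda>(X, u) (Y, w). (X + Y, u + w)),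
     module.smult = (\<lambda>c (X, u). (c \<cdot>\<^sub>m X, c \<cdot>\<^sub>v u)),
     lie_bracket = (\<lambda>(X, u) (Y, w). (X * Y - Y * X, X *\<^sub>v w - Y *\<^sub>v u))\<rparr>"

section \<open>Minimal nilpotent elements\<close>

definition nilpotents :: "nat \<Rightarrow> 'a::field mat set" where
  "nilpotents m = {X \<in> carrier (sp m). \<exists>N. X ^\<^sub>m N = 0\<^sub>m (2 * m) (2 * m)}"

definition Sp_orbit :: "nat \<Rightarrow> 'a::field mat \<Rightarrow> 'a mat set" where
  "Sp_orbit m X = {Y. \<exists>g h. g \<in> Sp_group m \<and> similar_mat_wit Y X g h}"

definition zariski_closure :: "nat \<Rightarrow> 'a::field mat set \<Rightarrow> 'a mat set" where
  "zariski_closure m Z = {Y \<in> carrier_mat (2 * m) (2 * m).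
     \<forall>p. p \<in> mpolys_in ({..<2 * m} \<times> {..<2 * m}) \<longrightarrow>
       (\<forall>X\<in>Z. mpoly_eval (\<lambda>ij. X $$ ij) p = 0) \<longrightarrow> mpoly_eval (\<lambda>ij. Y $$ ij) p = 0}"

text \<open>The minimal nilpotent orbit is the least nonzero nilpotent orbit with respect to inclusion of
  orbit closures.  Over a field that is not algebraically closed the rational points of that orbit may
  form several orbits of the group of rational points; each of its rational points is minimal in the
  sense below, since \<open>Sp_group m\<close> is Zariski dense in the symplectic group over the algebraic
  closure.\<close>

definition minimal_nilpotent :: "nat \<Rightarrow> 'a::field mat \<Rightarrow> bool" where
  "minimal_nilpotent m e \<longleftrightarrow>
     e \<in> nilpotents m - {0\<^sub>m (2 * m) (2 * m)} \<and>
     (\<forall>X \<in> nilpotents m - {0\<^sub>m (2 * m) (2 * m)}. e \<in> zariski_closure m (Sp_orbit m X))"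

section \<open>The elements \<open>\<Delta>\<^sub>k\<close> and their highest components in \<open>f\<close>\<close>

definition principal_minors_sum :: "nat \<Rightarrow> 'a::comm_ring_1 mat \<Rightarrow> 'a" where
  "principal_minors_sum k X = (\<Sum>I | I \<subseteq> {..<dim_row X} \<and> card I = k. det (submatrix X I I))"

text \<open>The invariant form \<open>B\<close> identifies \<open>\<gamma>\<close> in the dual space with the matrix \<open>X\<close> such that
  \<open>\<gamma> = B X\<close>.\<close>

definition form_inverse :: "('a::field, 'v) lie_algebra \<Rightarrow> ('v \<Rightarrow> 'v \<Rightarrow> 'a) \<Rightarrow> ('v \<Rightarrow> 'a) \<Rightarrow> 'v" where
  "form_inverse L B \<gamma> = (THE X. X \<in> carrier L \<and> (\<forall>y\<in>carrier L. \<gamma> y = B X y))"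

definition sp_Delta ::
  "nat \<Rightarrow> ('a::field mat \<Rightarrow> 'a mat \<Rightarrow> 'a) \<Rightarrow> nat \<Rightarrow> ('a, 'a mat) sym_elem" where
  "sp_Delta m B k = (\<lambda>\<gamma>\<in>lie_dual (sp m). principal_minors_sum k (form_inverse (sp m) B \<gamma>))"

text \<open>\<open>is_top_component L e f P C\<close>: in \<open>\<S>(L) = \<S>(e\<^sup>\<bottom>)[f]\<close>, the component of \<open>P\<close> of highest degree
  \<open>d\<close> in \<open>f\<close> is \<open>C f\<^sup>d\<close>.\<close>

definition is_top_component ::
  "('a::field, 'v) lie_algebra \<Rightarrow> 'v \<Rightarrow> 'v \<Rightarrow> ('a, 'v) sym_elem \<Rightarrow> ('a, 'v) sym_elem \<Rightarrow> bool" where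
  "is_top_component L e f P C \<longleftrightarrow>
     (\<exists>d c. (\<forall>j\<le>d. c j \<in> sym_subalg L (killing_perp L e)) \<and>
        (\<forall>\<gamma>\<in>lie_dual L. P \<gamma> = (\<Sum>j\<le>d. c j \<gamma> * \<gamma> f ^ j)) \<and>
        c d \<noteq> sym_const L 0 \<and> C = c d)"

text \<open>The highest component lies in the image of \<open>\<S>(\<gg>\<^sub>e)\<close> in \<open>\<S>(\<gg>)\<close> (for even \<open>k\<close> with
  \<open>2 \<le> k \<le> 2 m\<close>), and is taken here as an element of \<open>\<S>(\<gg>\<^sub>e)\<close>, that is, as a
  function on the dual space of the centraliser.\<close>

definition e_Delta ::
  "nat \<Rightarrow> ('a::field mat \<Rightarrow> 'a mat \<Rightarrow> 'a) \<Rightarrow> 'a mat \<Rightarrow> 'a mat \<Rightarrow> nat \<Rightarrow> ('a, 'a mat) sym_elem" where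
  "e_Delta m B e f k = (THE F.
     F \<in> sym_alg (centraliser (sp m) e) \<and>
     is_top_component (sp m) e f (sp_Delta m B k) (sym_map (centraliser (sp m) e) (sp m) id F))"

section \<open>The quotient of the centraliser by the line through \<open>e\<close>\<close>

text \<open>\<open>\<pi>\<close> identifies the quotient of \<open>\<gg>\<^sub>e\<close> by the line through \<open>e\<close> with \<open>sp_semidirect (m - 1)\<close>.\<close>

definition is_quotient_map :: "nat \<Rightarrow> 'a::field mat \<Rightarrow> ('a mat \<Rightarrow> 'a mat \<times> 'a vec) \<Rightarrow> bool" where
  "is_quotient_map m e \<pi> \<longleftrightarrow>
     lie_hom (centraliser (sp m) e) (sp_semidirect (m - 1)) \<pi> \<and>
     \<pi> ` carrier (centraliser (sp m) e) = carrier (sp_semidirect (m - 1)) \<and>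
     {x \<in> carrier (centraliser (sp m) e). \<pi> x = \<zero>\<^bsub>sp_semidirect (m - 1)\<^esub>} = range (\<lambda>c. c \<cdot>\<^sub>m e)"

end

theory Submission
  imports Defs "HOL-Computational_Algebra.Polynomial"
begin

text \<open>Write \<open>m = n - 1\<close>.  By \<open>P \<mapsto> P J\<close> the symplectic Lie algebra is the space of symmetric matrices, so a
functional on it is given by a symmetric matrix \<open>S\<close>.  An invariant form is a multiple of the trace form
(\<open>invariant_form_eq\<close>), and therefore \<open>\<Delta>\<^sub>k\<close> is, up to a nonzero constant, the coefficient of \<open>z\<^bsup>2n-k\<^esup>\<close> in
\<open>det (S + z J)\<close> (\<open>principal_minors_sum_of_frame\<close>).

A minimal nilpotent element has rank one, \<open>e = c v v\<^sup>T J\<close> (\<open>minimal_nilpotent_rank_one\<close>): the equations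
"rank at most one" hold on the closure of the orbit of such an element.  The symplectic group is transitive on
nonzero vectors (\<open>sp_transitive\<close>), so \<open>v\<close> may be taken to be the first basis vector.  Among the entries of \<open>S\<close>
only \<open>S\<^sub>n\<^sub>n\<close>, with rows counted from 0, then involves \<open>f\<close>; the other entries come from \<open>e\<^sup>\<bottom>\<close>.  The determinant
is affine in this entry, with the complementary minor as slope, so \<open>\<^sup>e\<Delta>\<^sub>k\<close> is a coefficient of that minor
(\<open>e_Delta_eq\<close>), which involves only entries in the centraliser of \<open>e\<close>.  On the hyperplane \<open>e = 0\<close> the entry \<open>S\<^sub>0\<^sub>0\<close>
vanishes, and the minor becomes the determinant of \<open>T + z J\<close> bordered by a vector \<open>p\<close>, where \<open>(T, p)\<close> are the
coordinates on the dual space of the semidirect product (\<open>map_reduce_top_coeff\<close>).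

It remains to see that the coefficients of the bordered determinant freely generate the invariants
(\<open>bordered_coeffs_freely_generate\<close>).  They are invariant because the coadjoint action is an infinitesimal
congruence of the bordered matrix by matrices of determinant 1 (\<open>bordered_coeff_invariant\<close>).  They generate by
means of an affine subspace of the dual space on which their restrictions are nonzero multiples of the
coordinates (\<open>bordered_poly_section\<close>) and which is at each of its points transversal to the coadjoint orbit
(\<open>section_transversal\<close>).  On such a subspace every invariant agrees with a unique polynomial in the generators,
and an invariant that vanishes on it vanishes to all orders, hence identically
(\<open>affine_section_criterion\<close>).

Two identifications of the quotient of the centraliser with the semidirect product differ by an automorphism
of the latter (\<open>quotient_map_factor\<close>), and automorphisms preserve free generation of the invariants
(\<open>freely_generated_automorphism\<close>).\<close>

section \<open>Evaluation of polynomials in several variables\<close>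

definition monom_eval :: "('x \<Rightarrow> 'a::comm_semiring_1) \<Rightarrow> ('x \<Rightarrow>\<^sub>0 nat) \<Rightarrow> 'a" where
  "monom_eval v m = (\<Prod>i\<in>Poly_Mapping.keys m. v i ^ Poly_Mapping.lookup m i)"

lemma monom_eval_superset:
  assumes "finite A" "Poly_Mapping.keys m \<subseteq> A"
  shows "monom_eval v m = (\<Prod>i\<in>A. v i ^ Poly_Mapping.lookup m i)"
  unfolding monom_eval_def
  by (rule prod.mono_neutral_left) (use assms in \<open>auto simp: in_keys_iff\<close>)

lemma monom_eval_add: "monom_eval v (m + m') = monom_eval v m * monom_eval v m'"
proof -
  let ?A = "Poly_Mapping.keys m \<union> Poly_Mapping.keys m'"
  have "monom_eval v (m + m') = (\<Prod>i\<in>?A. v i ^ Poly_Mapping.lookup (m + m') i)"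
    by (rule monom_eval_superset) (auto simp: Poly_Mapping.keys_add)
  moreover have "monom_eval v m = (\<Prod>i\<in>?A. v i ^ Poly_Mapping.lookup m i)"
    by (rule monom_eval_superset) auto
  moreover have "monom_eval v m' = (\<Prod>i\<in>?A. v i ^ Poly_Mapping.lookup m' i)"
    by (rule monom_eval_superset) auto
  ultimately show ?thesis
    by (simp add: lookup_add power_add prod.distrib)
qed

lemma monom_eval_zero [simp]: "monom_eval v 0 = 1"
  by (simp add: monom_eval_def)

lemma mpoly_eval_superset:
  assumes "finite A" "Poly_Mapping.keys p \<subseteq> A"
  shows "mpoly_eval v p = (\<Sum>m\<in>A. Poly_Mapping.lookup p m * monom_eval v m)"
  unfolding mpoly_eval_def monom_eval_def
  by (rule sum.mono_neutral_left) (use assms in \<open>auto simp: in_keys_iff\<close>)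

lemma mpoly_eval_add: "mpoly_eval v (p + q) = mpoly_eval v p + mpoly_eval v q"
proof -
  let ?A = "Poly_Mapping.keys p \<union> Poly_Mapping.keys q"
  have "mpoly_eval v (p + q) = (\<Sum>m\<in>?A. Poly_Mapping.lookup (p + q) m * monom_eval v m)"
    by (rule mpoly_eval_superset) (auto simp: Poly_Mapping.keys_add)
  moreover have "mpoly_eval v p = (\<Sum>m\<in>?A. Poly_Mapping.lookup p m * monom_eval v m)"
    by (rule mpoly_eval_superset) auto
  moreover have "mpoly_eval v q = (\<Sum>m\<in>?A. Poly_Mapping.lookup q m * monom_eval v m)"
    by (rule mpoly_eval_superset) auto
  ultimately show ?thesis
    by (simp add: lookup_add algebra_simps sum.distrib)
qed

lemma mpoly_eval_zero [simp]: "mpoly_eval v 0 = 0"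
  by (simp add: mpoly_eval_def)

lemma mpoly_eval_single: "mpoly_eval v (Poly_Mapping.single m c) = c * monom_eval v m"
  by (cases "c = 0") (auto simp: mpoly_eval_def monom_eval_def)

lemma mpoly_eval_sum: "mpoly_eval v (sum f A) = (\<Sum>a\<in>A. mpoly_eval v (f a))"
  by (induction A rule: infinite_finite_induct) (auto simp: mpoly_eval_add)

lemma mpoly_eq_sum_single:
  "p = (\<Sum>m\<in>Poly_Mapping.keys p. Poly_Mapping.single m (Poly_Mapping.lookup p m))"
proof (rule poly_mapping_eqI)
  fix k
  show "Poly_Mapping.lookup p k = Poly_Mapping.lookup
      (\<Sum>m\<in>Poly_Mapping.keys p. Poly_Mapping.single m (Poly_Mapping.lookup p m)) k"
    by (cases "k \<in> Poly_Mapping.keys p")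
       (auto simp: lookup_sum lookup_single when_def in_keys_iff)
qed

lemma mpoly_eval_mult: "mpoly_eval v (p * q) = mpoly_eval v p * mpoly_eval v q"
proof -
  let ?s = "\<lambda>p m. Poly_Mapping.single m (Poly_Mapping.lookup p m)"
  have "p * q = (\<Sum>m\<in>Poly_Mapping.keys p. ?s p m) * (\<Sum>m\<in>Poly_Mapping.keys q. ?s q m)"
    using mpoly_eq_sum_single[of p] mpoly_eq_sum_single[of q] by simp
  also have "\<dots> = (\<Sum>m\<in>Poly_Mapping.keys p. \<Sum>m'\<in>Poly_Mapping.keys q. ?s p m * ?s q m')"
    by (rule sum_product)
  finally have "mpoly_eval v (p * q) = (\<Sum>m\<in>Poly_Mapping.keys p. \<Sum>m'\<in>Poly_Mapping.keys q.
      Poly_Mapping.lookup p m * monom_eval v m * (Poly_Mapping.lookup q m' * monom_eval v m'))"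
    by (simp add: mpoly_eval_sum mult_single mpoly_eval_single monom_eval_add algebra_simps)
  also have "\<dots> = mpoly_eval v p * mpoly_eval v q"
    by (simp add: mpoly_eval_def monom_eval_def sum_product)
  finally show ?thesis .
qed

definition mpoly_const :: "'a::zero \<Rightarrow> ('x, 'a) mpoly" where
  "mpoly_const c = Poly_Mapping.single 0 c"

definition mpoly_var :: "'x \<Rightarrow> ('x, 'a::{zero,one}) mpoly" where
  "mpoly_var i = Poly_Mapping.single (Poly_Mapping.single i 1) 1"

lemma mpoly_eval_const [simp]: "mpoly_eval v (mpoly_const c) = c"
  by (simp add: mpoly_const_def mpoly_eval_single)

lemma mpoly_eval_var [simp]: "mpoly_eval v (mpoly_var i) = v i"
  by (simp add: mpoly_var_def mpoly_eval_single monom_eval_def)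

lemma mpolys_in_const [simp]: "mpoly_const c \<in> mpolys_in I"
  by (auto simp: mpolys_in_def mpoly_const_def split: if_splits)

lemma mpolys_in_var: "i \<in> I \<Longrightarrow> mpoly_var i \<in> mpolys_in I"
  by (auto simp: mpolys_in_def mpoly_var_def split: if_splits)

lemma mpolys_in_add: "p \<in> mpolys_in I \<Longrightarrow> q \<in> mpolys_in I \<Longrightarrow> p + q \<in> mpolys_in I"
  using Poly_Mapping.keys_add[of p q] by (fastforce simp: mpolys_in_def)

lemma mpolys_in_mult:
  assumes "p \<in> mpolys_in I" "q \<in> mpolys_in I"
  shows "p * q \<in> mpolys_in I"
proof -
  have "Poly_Mapping.keys m \<subseteq> I" if "m \<in> Poly_Mapping.keys (p * q)" for m
  proof -
    have "m \<in> {a + b |a b. a \<in> Poly_Mapping.keys p \<and> b \<in> Poly_Mapping.keys q}"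
      using keys_mult[of p q] that by (rule subsetD)
    then obtain a b where "m = a + b" "a \<in> Poly_Mapping.keys p" "b \<in> Poly_Mapping.keys q"
      by blast
    then show ?thesis
      using assms Poly_Mapping.keys_add[of a b] by (fastforce simp: mpolys_in_def)
  qed
  then show ?thesis by (auto simp: mpolys_in_def)
qed

text \<open>Finitely many exponent vectors are separated by a single weighted degree: the weights are
  powers of a base exceeding all exponents, built up one variable at a time.\<close>

lemma separating_weights:
  assumes "finite I" "finite K"
  shows "\<exists>w. \<forall>m\<in>K. \<forall>m'\<in>K. (\<Sum>i\<in>I. w i * m i) = (\<Sum>i\<in>I. w i * m' i) \<longrightarrow>
    (\<forall>i\<in>I. m i = (m' i :: nat))"
  using assms(1)
proof (induction I)
  case empty
  then show ?case by simp
next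
  case (insert x I)
  then obtain w where w: "\<And>m m'. m \<in> K \<Longrightarrow> m' \<in> K \<Longrightarrow>
      (\<Sum>i\<in>I. w i * m i) = (\<Sum>i\<in>I. w i * m' i) \<Longrightarrow> (\<forall>i\<in>I. m i = m' i)"
    by blast
  define b where "b = Suc (\<Sum>m\<in>K. m x)"
  have b: "m x < b" if "m \<in> K" for m
    unfolding b_def using member_le_sum[of m K "\<lambda>m. m x"] that assms(2) by auto
  define w' where "w' = (\<lambda>i. if i = x then 1 else b * w i)"
  have eq: "(\<Sum>i\<in>insert x I. w' i * m i) = m x + b * (\<Sum>i\<in>I. w i * m i)" for m
  proof -
    have "(\<Sum>i\<in>I. w' i * m i) = (\<Sum>i\<in>I. b * (w i * m i))"
      by (rule sum.cong) (use insert in \<open>auto simp: w'_def\<close>)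
    then show ?thesis
      using insert by (simp add: w'_def sum_distrib_left)
  qed
  have "\<forall>m\<in>K. \<forall>m'\<in>K. (\<Sum>i\<in>insert x I. w' i * m i) = (\<Sum>i\<in>insert x I. w' i * m' i) \<longrightarrow>
    (\<forall>i\<in>insert x I. m i = m' i)"
  proof (intro ballI impI)
    fix m m' i
    assume that: "m \<in> K" "m' \<in> K" "(\<Sum>i\<in>insert x I. w' i * m i) = (\<Sum>i\<in>insert x I. w' i * m' i)"
      "i \<in> insert x I"
    have e: "m x + b * (\<Sum>i\<in>I. w i * m i) = m' x + b * (\<Sum>i\<in>I. w i * m' i)"
      using that eq by simp
    have "m x = (m x + b * (\<Sum>i\<in>I. w i * m i)) mod b"
      using b[OF that(1)] by simp
    also have "\<dots> = m' x"
      using b[OF that(2)] e by simp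
    finally have "m x = m' x" .
    moreover from this have "(\<Sum>i\<in>I. w i * m i) = (\<Sum>i\<in>I. w i * m' i)"
      using e b[OF that(1)] by simp
    ultimately show "m i = m' i" using w[OF that(1,2)] that(4) by auto
  qed
  then show ?case by (rule exI[of _ w'])
qed

text \<open>Substituting powers of one indeterminate, with separating weights as exponents, turns a
  nonzero polynomial into a nonzero polynomial in one variable, which has finitely many roots.\<close>

lemma mpoly_eval_eq_0_imp_0:
  fixes p :: "('x, 'a::field_char_0) mpoly"
  assumes "finite I" "p \<in> mpolys_in I" "\<And>v. mpoly_eval v p = 0"
  shows "p = 0"
proof -
  let ?l = "\<lambda>m. Poly_Mapping.lookup (m :: 'x \<Rightarrow>\<^sub>0 nat)"
  have K: "Poly_Mapping.keys m \<subseteq> I" if "m \<in> Poly_Mapping.keys p" for m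
    using assms(2) that by (auto simp: mpolys_in_def)
  obtain w where w: "\<forall>m\<in>?l ` Poly_Mapping.keys p. \<forall>m'\<in>?l ` Poly_Mapping.keys p.
      (\<Sum>i\<in>I. w i * m i) = (\<Sum>i\<in>I. w i * m' i) \<longrightarrow> (\<forall>i\<in>I. m i = m' i)"
    using separating_weights[OF assms(1) finite_imageI[OF finite_keys]] by (rule exE)
  define d where "d = (\<lambda>m. \<Sum>i\<in>I. w i * ?l m i)"
  have inj: "inj_on d (Poly_Mapping.keys p)"
  proof (rule inj_onI)
    fix m m' assume m: "m \<in> Poly_Mapping.keys p" "m' \<in> Poly_Mapping.keys p" "d m = d m'"
    have "\<forall>i\<in>I. ?l m i = ?l m' i"
      by (rule w[rule_format, OF imageI[OF m(1)] imageI[OF m(2)] m(3)[unfolded d_def], THEN ballI])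
    moreover have "?l m i = 0 \<and> ?l m' i = 0" if "i \<notin> I" for i
    proof -
      have "i \<notin> Poly_Mapping.keys m" "i \<notin> Poly_Mapping.keys m'"
        using K[OF m(1)] K[OF m(2)] that by auto
      then show ?thesis by (simp add: in_keys_iff)
    qed
    ultimately have "?l m i = ?l m' i" for i
      by (cases "i \<in> I") auto
    then show "m = m'" by (rule poly_mapping_eqI)
  qed
  define q where "q = (\<Sum>m\<in>Poly_Mapping.keys p. Polynomial.monom (Poly_Mapping.lookup p m) (d m))"
  have "poly q t = mpoly_eval (\<lambda>i. t ^ w i) p" for t
  proof -
    have "monom_eval (\<lambda>i. t ^ w i) m = t ^ d m" if "m \<in> Poly_Mapping.keys p" for m
      using monom_eval_superset[OF assms(1) K[OF that]]
      by (simp add: d_def power_sum power_mult)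
    then show ?thesis
      by (simp add: q_def poly_sum poly_monom mpoly_eval_def monom_eval_def)
  qed
  then have "\<And>t. poly q t = 0" using assms(3) by simp
  then have q0: "q = 0" using poly_all_0_iff_0 by blast
  have "Poly_Mapping.lookup p m = 0" if "m \<in> Poly_Mapping.keys p" for m
  proof -
    have "coeff q (d m) = (\<Sum>m'\<in>Poly_Mapping.keys p. if m' = m then Poly_Mapping.lookup p m else 0)"
      unfolding q_def coeff_sum
      by (rule sum.cong) (use inj that in \<open>auto dest: inj_onD\<close>)
    then show ?thesis using q0 that by simp
  qed
  then have "Poly_Mapping.lookup p m = Poly_Mapping.lookup 0 m" for m
    by (cases "m \<in> Poly_Mapping.keys p") (auto simp: in_keys_iff)
  then show ?thesis by (rule poly_mapping_eqI)
qed

lemma mpoly_eval_diff: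
  fixes p q :: "('x, 'a::comm_ring_1) mpoly"
  shows "mpoly_eval v (p - q) = mpoly_eval v p - mpoly_eval v q"
  using mpoly_eval_add[of v "p - q" q] by simp

lemma mpolys_in_diff:
  fixes p q :: "('x, 'a::comm_ring_1) mpoly"
  assumes "p \<in> mpolys_in I" "q \<in> mpolys_in I"
  shows "p - q \<in> mpolys_in I"
proof -
  have "Poly_Mapping.keys (p - q) \<subseteq> Poly_Mapping.keys p \<union> Poly_Mapping.keys q"
    by (auto simp: in_keys_iff lookup_minus)
  then show ?thesis using assms by (force simp: mpolys_in_def)
qed

lemma mpolys_in_sum:
  "(\<And>a. a \<in> A \<Longrightarrow> p a \<in> mpolys_in I) \<Longrightarrow> sum p A \<in> mpolys_in I"
proof (induction A rule: infinite_finite_induct)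
  case (insert x A)
  then show ?case by (simp add: mpolys_in_add)
qed (auto simp: mpolys_in_def)

lemma mpoly_eval_cong:
  assumes "p \<in> mpolys_in I" "\<And>i. i \<in> I \<Longrightarrow> v i = w i"
  shows "mpoly_eval v p = mpoly_eval w p"
  unfolding mpoly_eval_def
proof (rule sum.cong[OF refl])
  fix m assume "m \<in> Poly_Mapping.keys p"
  then have "Poly_Mapping.keys m \<subseteq> I" using assms(1) by (auto simp: mpolys_in_def)
  then have "(\<Prod>i\<in>Poly_Mapping.keys m. v i ^ Poly_Mapping.lookup m i) =
      (\<Prod>i\<in>Poly_Mapping.keys m. w i ^ Poly_Mapping.lookup m i)"
    using assms(2) by (intro prod.cong) auto
  then show "Poly_Mapping.lookup p m * (\<Prod>i\<in>Poly_Mapping.keys m. v i ^ Poly_Mapping.lookup m i) =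
      Poly_Mapping.lookup p m * (\<Prod>i\<in>Poly_Mapping.keys m. w i ^ Poly_Mapping.lookup m i)"
    by simp
qed

section \<open>Polynomial functions on the dual space\<close>

lemma lie_dual_add:
  "\<gamma> \<in> lie_dual L \<Longrightarrow> x \<in> carrier L \<Longrightarrow> y \<in> carrier L \<Longrightarrow> \<gamma> (x \<oplus>\<^bsub>L\<^esub> y) = \<gamma> x + \<gamma> y"
  by (simp add: lie_dual_def)

lemma lie_dual_smult:
  "\<gamma> \<in> lie_dual L \<Longrightarrow> x \<in> carrier L \<Longrightarrow> \<gamma> (c \<odot>\<^bsub>L\<^esub> x) = c * \<gamma> x"
  by (simp add: lie_dual_def)

text \<open>The axioms are those that make the adjoint action a family of linear vector fields on the dual space.\<close>

locale lin_lie =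
  fixes L :: "('a::field_char_0, 'v) lie_algebra" (structure)
  assumes add_closed: "x \<in> carrier L \<Longrightarrow> y \<in> carrier L \<Longrightarrow> x \<oplus> y \<in> carrier L"
    and smult_closed: "x \<in> carrier L \<Longrightarrow> c \<odot> x \<in> carrier L"
    and bracket_closed: "x \<in> carrier L \<Longrightarrow> y \<in> carrier L \<Longrightarrow> lie_bracket L x y \<in> carrier L"
    and bracket_add: "x \<in> carrier L \<Longrightarrow> y \<in> carrier L \<Longrightarrow> z \<in> carrier L \<Longrightarrow>
      lie_bracket L x (y \<oplus> z) = lie_bracket L x y \<oplus> lie_bracket L x z"
    and bracket_smult: "x \<in> carrier L \<Longrightarrow> y \<in> carrier L \<Longrightarrow>
      lie_bracket L x (c \<odot> y) = c \<odot> lie_bracket L x y"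

text \<open>Restricting to the dual space makes the notion independent of the values of \<open>F\<close> elsewhere, so that
  polynomial functions can be written with ordinary arithmetic instead of the operations of the algebra.\<close>

definition polyfun :: "('a::field, 'v) lie_algebra \<Rightarrow> 'v set \<Rightarrow> (('v \<Rightarrow> 'a) \<Rightarrow> 'a) \<Rightarrow> bool" where
  "polyfun L V F \<longleftrightarrow> restrict F (lie_dual L) \<in> sym_subalg L V"

definition dual_line ::
  "('a::field, 'v) lie_algebra \<Rightarrow> ('v \<Rightarrow> 'a) \<Rightarrow> ('v \<Rightarrow> 'a) \<Rightarrow> 'a \<Rightarrow> 'v \<Rightarrow> 'a" where
  "dual_line L \<gamma> \<eta> t = (\<lambda>x\<in>carrier L. \<gamma> x + t * \<eta> x)"

text \<open>The sign is such that \<open>coad L x\<close> differentiates the generator \<open>y\<close> to \<open>[x, y]\<close>; it is the negative of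
  the usual coadjoint action.\<close>

definition coad :: "('a::field, 'v) lie_algebra \<Rightarrow> 'v \<Rightarrow> ('v \<Rightarrow> 'a) \<Rightarrow> 'v \<Rightarrow> 'a" where
  "coad L x \<gamma> = (\<lambda>y\<in>carrier L. \<gamma> (lie_bracket L x y))"

lemma restrict_dual_sym_subalg:
  "F \<in> sym_subalg L V \<Longrightarrow> restrict F (lie_dual L) = F"
  by (induction rule: sym_subalg.induct)
     (auto simp: sym_const_def sym_gen_def sym_add_def sym_mult_def)

lemma polyfun_const: "polyfun L V (\<lambda>_. c)"
  using sym_subalg.const[of L c V] by (simp add: polyfun_def sym_const_def)

lemma polyfun_gen: "x \<in> V \<Longrightarrow> polyfun L V (\<lambda>\<gamma>. \<gamma> x)"
  using sym_subalg.gen[of x V L] by (simp add: polyfun_def sym_gen_def)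

lemma polyfun_add:
  assumes "polyfun L V F" "polyfun L V G"
  shows "polyfun L V (\<lambda>\<gamma>. F \<gamma> + G \<gamma>)"
proof -
  have "sym_add L (restrict F (lie_dual L)) (restrict G (lie_dual L)) =
      restrict (\<lambda>\<gamma>. F \<gamma> + G \<gamma>) (lie_dual L)"
    by (auto simp: sym_add_def)
  then show ?thesis
    using sym_subalg.add assms unfolding polyfun_def by metis
qed

lemma polyfun_mult:
  assumes "polyfun L V F" "polyfun L V G"
  shows "polyfun L V (\<lambda>\<gamma>. F \<gamma> * G \<gamma>)"
proof -
  have "sym_mult L (restrict F (lie_dual L)) (restrict G (lie_dual L)) =
      restrict (\<lambda>\<gamma>. F \<gamma> * G \<gamma>) (lie_dual L)"
    by (auto simp: sym_mult_def)
  then show ?thesis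
    using sym_subalg.mult assms unfolding polyfun_def by metis
qed

lemma polyfun_sum:
  "(\<And>i. i \<in> A \<Longrightarrow> polyfun L V (F i)) \<Longrightarrow> polyfun L V (\<lambda>\<gamma>. \<Sum>i\<in>A. F i \<gamma>)"
  by (induction A rule: infinite_finite_induct) (auto simp: polyfun_const intro!: polyfun_add)

definition polyfun_coeffs ::
  "('a::field, 'v) lie_algebra \<Rightarrow> 'v set \<Rightarrow> (('v \<Rightarrow> 'a) \<Rightarrow> 'a poly) \<Rightarrow> bool" where
  "polyfun_coeffs L V P \<longleftrightarrow> (\<forall>k. polyfun L V (\<lambda>\<gamma>. coeff (P \<gamma>) k))"

lemma polyfun_coeffs_const: "polyfun_coeffs L V (\<lambda>_. p)"
  by (simp add: polyfun_coeffs_def polyfun_const)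

lemma polyfun_coeffs_lift:
  assumes "polyfun L V F"
  shows "polyfun_coeffs L V (\<lambda>\<gamma>. [:F \<gamma>:])"
  unfolding polyfun_coeffs_def
proof
  fix k show "polyfun L V (\<lambda>\<gamma>. coeff [:F \<gamma>:] k)"
    using assms by (cases k) (auto simp: polyfun_const)
qed

lemma polyfun_coeffs_add:
  "polyfun_coeffs L V P \<Longrightarrow> polyfun_coeffs L V Q \<Longrightarrow> polyfun_coeffs L V (\<lambda>\<gamma>. P \<gamma> + Q \<gamma>)"
  by (auto simp: polyfun_coeffs_def intro: polyfun_add)

lemma polyfun_coeffs_mult:
  "polyfun_coeffs L V P \<Longrightarrow> polyfun_coeffs L V Q \<Longrightarrow> polyfun_coeffs L V (\<lambda>\<gamma>. P \<gamma> * Q \<gamma>)"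
  by (auto simp: polyfun_coeffs_def coeff_mult intro!: polyfun_sum polyfun_mult)

lemma polyfun_coeffs_sum:
  "(\<And>i. i \<in> A \<Longrightarrow> polyfun_coeffs L V (P i)) \<Longrightarrow> polyfun_coeffs L V (\<lambda>\<gamma>. \<Sum>i\<in>A. P i \<gamma>)"
  by (induction A rule: infinite_finite_induct)
     (auto simp: polyfun_coeffs_const intro!: polyfun_coeffs_add)

lemma polyfun_coeffs_prod:
  "(\<And>i. i \<in> A \<Longrightarrow> polyfun_coeffs L V (P i)) \<Longrightarrow> polyfun_coeffs L V (\<lambda>\<gamma>. \<Prod>i\<in>A. P i \<gamma>)"
  by (induction A rule: infinite_finite_induct)
     (auto simp: polyfun_coeffs_const intro!: polyfun_coeffs_mult)

lemma polyfun_coeffs_det: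
  assumes "\<And>\<gamma>. M \<gamma> \<in> carrier_mat n n"
    and "\<And>i j. i < n \<Longrightarrow> j < n \<Longrightarrow> polyfun_coeffs L V (\<lambda>\<gamma>. M \<gamma> $$ (i, j))"
  shows "polyfun_coeffs L V (\<lambda>\<gamma>. det (M \<gamma>))"
proof -
  have "polyfun_coeffs L V (\<lambda>\<gamma>. \<Sum>p | p permutes {0..<n}.
      of_int (sign p) * (\<Prod>i = 0..<n. M \<gamma> $$ (i, p i)))"
    by (intro polyfun_coeffs_sum polyfun_coeffs_mult polyfun_coeffs_const polyfun_coeffs_prod assms(2))
       (use permutes_in_image in fastforce)+
  then show ?thesis
    by (simp add: det_def'[OF assms(1)])
qed

text \<open>The determinant of a pencil is a polynomial in \<open>z\<close> and the entries, so its coefficients in \<open>z\<close> are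
  polynomial in the entries.\<close>

lemma polyfun_pencil_coeffs:
  assumes "\<And>i j. i < k \<Longrightarrow> j < k \<Longrightarrow> polyfun L V (\<lambda>\<gamma>. F \<gamma> i j)"
  shows "polyfun L V (\<lambda>\<gamma>. coeff (det (mat k k (\<lambda>(i, j). [:F \<gamma> i j, G i j:]))) l)"
proof -
  have "polyfun_coeffs L V (\<lambda>\<gamma>. det (mat k k (\<lambda>(i, j). [:F \<gamma> i j:] + [:0, G i j:])))"
    by (rule polyfun_coeffs_det[OF mat_carrier])
       (simp only: index_mat prod.case, intro polyfun_coeffs_add polyfun_coeffs_lift polyfun_coeffs_const assms)
  then show ?thesis by (simp add: polyfun_coeffs_def)
qed

lemma polyfun_scaled: "x \<in> V \<Longrightarrow> polyfun L V (\<lambda>\<gamma>. \<gamma> x / a)"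
  using polyfun_mult[OF polyfun_gen[of x V L] polyfun_const[of L V "inverse a"]] by (simp add: divide_inverse)

context lin_lie
begin

abbreviation "dual \<equiv> lie_dual L"

lemma dual_line_in: "\<gamma> \<in> dual \<Longrightarrow> \<eta> \<in> dual \<Longrightarrow> dual_line L \<gamma> \<eta> t \<in> dual"
  by (auto simp: lie_dual_def dual_line_def add_closed smult_closed algebra_simps)

lemma coad_in: "x \<in> carrier L \<Longrightarrow> \<gamma> \<in> dual \<Longrightarrow> coad L x \<gamma> \<in> dual"
  by (auto simp: lie_dual_def coad_def add_closed smult_closed bracket_closed bracket_add
    bracket_smult)

lemma dual_eqI:
  "\<gamma> \<in> dual \<Longrightarrow> \<eta> \<in> dual \<Longrightarrow> (\<And>x. x \<in> carrier L \<Longrightarrow> \<gamma> x = \<eta> x) \<Longrightarrow> \<gamma> = \<eta>"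
  by (auto simp: lie_dual_def intro: extensionalityI)

lemma dual_line_line:
  "dual_line L (dual_line L \<gamma> \<eta> s) \<eta> t = dual_line L \<gamma> \<eta> (s + t)"
  by (auto simp: dual_line_def algebra_simps)

lemma dual_line_0: "\<gamma> \<in> dual \<Longrightarrow> dual_line L \<gamma> \<eta> 0 = \<gamma>"
  by (auto simp: dual_line_def lie_dual_def extensional_restrict)

lemma sym_const_apply: "\<gamma> \<in> dual \<Longrightarrow> sym_const L c \<gamma> = c"
  and sym_gen_apply: "\<gamma> \<in> dual \<Longrightarrow> sym_gen L x \<gamma> = \<gamma> x"
  and sym_add_apply: "\<gamma> \<in> dual \<Longrightarrow> sym_add L F G \<gamma> = F \<gamma> + G \<gamma>"
  and sym_mult_apply: "\<gamma> \<in> dual \<Longrightarrow> sym_mult L F G \<gamma> = F \<gamma> * G \<gamma>"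
  by (auto simp: sym_const_def sym_gen_def sym_add_def sym_mult_def)

lemmas sym_apply = sym_const_apply sym_gen_apply sym_add_apply sym_mult_apply

lemma sym_alg_eqI:
  assumes "F \<in> sym_alg L" "G \<in> sym_alg L" "\<And>\<gamma>. \<gamma> \<in> dual \<Longrightarrow> F \<gamma> = G \<gamma>"
  shows "F = G"
proof -
  have "F = restrict F dual" "G = restrict G dual"
    using assms(1,2) by (auto simp: sym_alg_def restrict_dual_sym_subalg)
  then show ?thesis using assms(3) by (metis restrict_ext)
qed

text \<open>Derivatives of elements of the symmetric algebra are taken through this polynomial: the ground field
  carries no topology.\<close>

lemma polynomial_along_line:
  assumes "F \<in> sym_alg L" "\<gamma> \<in> dual" "\<eta> \<in> dual"
  shows "\<exists>p. \<forall>t. F (dual_line L \<gamma> \<eta> t) = poly p t"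
  using assms(1) unfolding sym_alg_def
proof (induction rule: sym_subalg.induct)
  case (const c)
  show ?case by (intro exI[of _ "[:c:]"]) (simp add: sym_apply dual_line_in assms)
next
  case (gen x)
  then show ?case
    by (intro exI[of _ "[:\<gamma> x, \<eta> x:]"]) (simp add: sym_apply dual_line_in assms, simp add: dual_line_def)
next
  case (add F G)
  then obtain p q where "\<forall>t. F (dual_line L \<gamma> \<eta> t) = poly p t" "\<forall>t. G (dual_line L \<gamma> \<eta> t) = poly q t"
    by blast
  then show ?case by (intro exI[of _ "p + q"]) (simp add: sym_apply dual_line_in assms)
next
  case (mult F G)
  then obtain p q where "\<forall>t. F (dual_line L \<gamma> \<eta> t) = poly p t" "\<forall>t. G (dual_line L \<gamma> \<eta> t) = poly q t"
    by blast
  then show ?case by (intro exI[of _ "p * q"]) (simp add: sym_apply dual_line_in assms)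
qed

definition line_poly :: "('a, 'v) sym_elem \<Rightarrow> ('v \<Rightarrow> 'a) \<Rightarrow> ('v \<Rightarrow> 'a) \<Rightarrow> 'a poly" where
  "line_poly F \<gamma> \<eta> = (THE p. \<forall>t. F (dual_line L \<gamma> \<eta> t) = poly p t)"

definition dir_deriv :: "('a, 'v) sym_elem \<Rightarrow> ('v \<Rightarrow> 'a) \<Rightarrow> ('v \<Rightarrow> 'a) \<Rightarrow> 'a" where
  "dir_deriv F \<gamma> \<eta> = coeff (line_poly F \<gamma> \<eta>) 1"

lemma line_poly_unique:
  assumes "\<forall>t. F (dual_line L \<gamma> \<eta> t) = poly p t"
  shows "line_poly F \<gamma> \<eta> = p"
  unfolding line_poly_def
proof (rule the_equality[where P = "\<lambda>p. \<forall>t. F (dual_line L \<gamma> \<eta> t) = poly p t", OF assms])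
  fix q assume "\<forall>t. F (dual_line L \<gamma> \<eta> t) = poly q t"
  then have "poly q = poly p" using assms by auto
  then show "q = p" by (simp add: poly_eq_poly_eq_iff)
qed

lemma poly_line_poly:
  assumes "F \<in> sym_alg L" "\<gamma> \<in> dual" "\<eta> \<in> dual"
  shows "poly (line_poly F \<gamma> \<eta>) t = F (dual_line L \<gamma> \<eta> t)"
proof -
  obtain p where "\<forall>t. F (dual_line L \<gamma> \<eta> t) = poly p t"
    using polynomial_along_line[OF assms] by blast
  then show ?thesis using line_poly_unique by metis
qed

lemma coeff_0_line_poly:
  assumes "F \<in> sym_alg L" "\<gamma> \<in> dual" "\<eta> \<in> dual"
  shows "coeff (line_poly F \<gamma> \<eta>) 0 = F \<gamma>"
  using poly_line_poly[OF assms, of 0] dual_line_0[OF assms(2)] by (simp add: poly_0_coeff_0)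

lemma line_poly_const: "\<gamma> \<in> dual \<Longrightarrow> \<eta> \<in> dual \<Longrightarrow> line_poly (sym_const L c) \<gamma> \<eta> = [:c:]"
  by (rule line_poly_unique) (simp add: sym_apply dual_line_in)

lemma line_poly_gen:
  "\<gamma> \<in> dual \<Longrightarrow> \<eta> \<in> dual \<Longrightarrow> x \<in> carrier L \<Longrightarrow> line_poly (sym_gen L x) \<gamma> \<eta> = [:\<gamma> x, \<eta> x:]"
  by (rule line_poly_unique) (simp add: sym_apply dual_line_in, simp add: dual_line_def)

lemma line_poly_add:
  "F \<in> sym_alg L \<Longrightarrow> G \<in> sym_alg L \<Longrightarrow> \<gamma> \<in> dual \<Longrightarrow> \<eta> \<in> dual \<Longrightarrow>
    line_poly (sym_add L F G) \<gamma> \<eta> = line_poly F \<gamma> \<eta> + line_poly G \<gamma> \<eta>"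
  by (rule line_poly_unique) (simp add: sym_apply dual_line_in poly_line_poly)

lemma line_poly_mult:
  "F \<in> sym_alg L \<Longrightarrow> G \<in> sym_alg L \<Longrightarrow> \<gamma> \<in> dual \<Longrightarrow> \<eta> \<in> dual \<Longrightarrow>
    line_poly (sym_mult L F G) \<gamma> \<eta> = line_poly F \<gamma> \<eta> * line_poly G \<gamma> \<eta>"
  by (rule line_poly_unique) (simp add: sym_apply dual_line_in poly_line_poly)

lemma dir_deriv_const: "\<gamma> \<in> dual \<Longrightarrow> \<eta> \<in> dual \<Longrightarrow> dir_deriv (sym_const L c) \<gamma> \<eta> = 0"
  by (simp add: dir_deriv_def line_poly_const)

lemma dir_deriv_gen:
  "\<gamma> \<in> dual \<Longrightarrow> \<eta> \<in> dual \<Longrightarrow> x \<in> carrier L \<Longrightarrow> dir_deriv (sym_gen L x) \<gamma> \<eta> = \<eta> x"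
  by (simp add: dir_deriv_def line_poly_gen)

lemma dir_deriv_add:
  "F \<in> sym_alg L \<Longrightarrow> G \<in> sym_alg L \<Longrightarrow> \<gamma> \<in> dual \<Longrightarrow> \<eta> \<in> dual \<Longrightarrow>
    dir_deriv (sym_add L F G) \<gamma> \<eta> = dir_deriv F \<gamma> \<eta> + dir_deriv G \<gamma> \<eta>"
  by (simp add: dir_deriv_def line_poly_add)

lemma dir_deriv_mult:
  "F \<in> sym_alg L \<Longrightarrow> G \<in> sym_alg L \<Longrightarrow> \<gamma> \<in> dual \<Longrightarrow> \<eta> \<in> dual \<Longrightarrow>
    dir_deriv (sym_mult L F G) \<gamma> \<eta> = dir_deriv F \<gamma> \<eta> * G \<gamma> + F \<gamma> * dir_deriv G \<gamma> \<eta>"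
  by (simp add: dir_deriv_def line_poly_mult coeff_mult coeff_0_line_poly algebra_simps)

lemmas dir_deriv_rules = dir_deriv_const dir_deriv_gen dir_deriv_add dir_deriv_mult

lemma dir_deriv_linear:
  assumes "F \<in> sym_alg L" "\<gamma> \<in> dual" "\<eta> \<in> dual" "\<zeta> \<in> dual"
  shows "dir_deriv F \<gamma> (dual_line L \<eta> \<zeta> t) = dir_deriv F \<gamma> \<eta> + t * dir_deriv F \<gamma> \<zeta>"
  using assms(1) unfolding sym_alg_def
proof (induction rule: sym_subalg.induct)
  case (gen x)
  then show ?case by (simp add: dir_deriv_rules assms dual_line_in) (simp add: dual_line_def)
qed (use assms in \<open>simp_all add: dir_deriv_rules dual_line_in sym_alg_def algebra_simps\<close>)

text \<open>The derivation of the symmetric algebra attached to a vector field \<open>\<theta>\<close> on the dual space.\<close>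

definition field_deriv :: "(('v \<Rightarrow> 'a) \<Rightarrow> 'v \<Rightarrow> 'a) \<Rightarrow> ('a, 'v) sym_elem \<Rightarrow> ('a, 'v) sym_elem" where
  "field_deriv \<theta> F = (\<lambda>\<gamma>\<in>dual. dir_deriv F \<gamma> (\<theta> \<gamma>))"

lemma field_deriv_const:
  assumes "\<And>\<gamma>. \<gamma> \<in> dual \<Longrightarrow> \<theta> \<gamma> \<in> dual"
  shows "field_deriv \<theta> (sym_const L c) = sym_const L 0"
  using assms by (auto simp: field_deriv_def dir_deriv_rules sym_const_def[of L 0])

lemma field_deriv_gen:
  assumes "\<And>\<gamma>. \<gamma> \<in> dual \<Longrightarrow> \<theta> \<gamma> \<in> dual" "x \<in> carrier L"
  shows "field_deriv \<theta> (sym_gen L x) = (\<lambda>\<gamma>\<in>dual. \<theta> \<gamma> x)"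
  using assms by (auto simp: field_deriv_def dir_deriv_rules)

lemma field_deriv_add:
  assumes "\<And>\<gamma>. \<gamma> \<in> dual \<Longrightarrow> \<theta> \<gamma> \<in> dual" "F \<in> sym_alg L" "G \<in> sym_alg L"
  shows "field_deriv \<theta> (sym_add L F G) = sym_add L (field_deriv \<theta> F) (field_deriv \<theta> G)"
  unfolding field_deriv_def sym_add_def[of L "restrict _ _"]
  by (rule restrict_ext) (simp add: dir_deriv_rules assms)

lemma field_deriv_mult:
  assumes "\<And>\<gamma>. \<gamma> \<in> dual \<Longrightarrow> \<theta> \<gamma> \<in> dual" "F \<in> sym_alg L" "G \<in> sym_alg L"
  shows "field_deriv \<theta> (sym_mult L F G) =
    sym_add L (sym_mult L (field_deriv \<theta> F) G) (sym_mult L F (field_deriv \<theta> G))"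
  unfolding field_deriv_def sym_add_def[of L "sym_mult L _ _"]
  by (rule restrict_ext) (simp add: dir_deriv_rules assms sym_apply)

text \<open>By the Leibniz rule it suffices that the components of the vector field are polynomial.\<close>

lemma field_deriv_closed:
  assumes "\<And>\<gamma>. \<gamma> \<in> dual \<Longrightarrow> \<theta> \<gamma> \<in> dual"
    and "\<And>x. x \<in> carrier L \<Longrightarrow> (\<lambda>\<gamma>\<in>dual. \<theta> \<gamma> x) \<in> sym_alg L"
    and "F \<in> sym_alg L"
  shows "field_deriv \<theta> F \<in> sym_alg L"
  using assms(3) unfolding sym_alg_def
proof (induction rule: sym_subalg.induct)
  case (const c)
  then show ?case by (simp add: field_deriv_const assms(1) sym_subalg.const)
next
  case (gen x)
  then have "field_deriv \<theta> (sym_gen L x) = (\<lambda>\<gamma>\<in>dual. \<theta> \<gamma> x)"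
    using field_deriv_gen assms(1) by blast
  then show ?case using assms(2)[OF gen] by (metis sym_alg_def)
next
  case (add F G)
  then show ?case by (simp add: field_deriv_add assms(1) sym_alg_def sym_subalg.add)
next
  case (mult F G)
  then show ?case
    by (simp add: field_deriv_mult assms(1) sym_alg_def sym_subalg.add sym_subalg.mult)
qed

lemma coad_field_gen: "(\<lambda>\<gamma>\<in>dual. coad L x \<gamma> y) = sym_gen L (lie_bracket L x y)"
  if "y \<in> carrier L"
  using that by (auto simp: sym_gen_def coad_def)

lemma field_deriv_coad_closed:
  assumes "x \<in> carrier L" "F \<in> sym_alg L"
  shows "field_deriv (coad L x) F \<in> sym_alg L"
proof (rule field_deriv_closed)
  show "(\<lambda>\<gamma>\<in>dual. coad L x \<gamma> y) \<in> sym_alg L" if "y \<in> carrier L" for y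
    using that assms by (simp add: coad_field_gen sym_alg_def sym_subalg.gen bracket_closed)
qed (use assms in \<open>auto intro: coad_in\<close>)

lemma field_deriv_fixed_closed:
  assumes "\<eta> \<in> dual" "F \<in> sym_alg L"
  shows "field_deriv (\<lambda>_. \<eta>) F \<in> sym_alg L"
proof (rule field_deriv_closed)
  show "(\<lambda>\<gamma>\<in>dual. \<eta> y) \<in> sym_alg L" for y
    using sym_subalg.const[of L "\<eta> y" "carrier L"] by (simp add: sym_const_def sym_alg_def)
qed (use assms in auto)

text \<open>A derivation is determined by its values on generators, so \<open>sym_ad\<close> is the derivative along
  the linear vector field given by the coadjoint action.\<close>

lemma sym_ad_eq:
  assumes x: "x \<in> carrier L" and F: "F \<in> sym_alg L"
  shows "sym_ad L x F = field_deriv (coad L x) F"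
proof -
  define P where "P = (\<lambda>D.
     D \<in> sym_alg L \<rightarrow>\<^sub>E sym_alg L \<and>
     (\<forall>c. D (sym_const L c) = sym_const L 0) \<and>
     (\<forall>y\<in>carrier L. D (sym_gen L y) = sym_gen L (lie_bracket L x y)) \<and>
     (\<forall>F\<in>sym_alg L. \<forall>G\<in>sym_alg L. D (sym_add L F G) = sym_add L (D F) (D G)) \<and>
     (\<forall>F\<in>sym_alg L. \<forall>G\<in>sym_alg L.
        D (sym_mult L F G) = sym_add L (sym_mult L (D F) G) (sym_mult L F (D G))))"
  define D where "D = restrict (field_deriv (coad L x)) (sym_alg L)"
  have mem: "sym_const L c \<in> sym_alg L" "y \<in> carrier L \<Longrightarrow> sym_gen L y \<in> sym_alg L"
    "G \<in> sym_alg L \<Longrightarrow> H \<in> sym_alg L \<Longrightarrow> sym_add L G H \<in> sym_alg L"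
    "G \<in> sym_alg L \<Longrightarrow> H \<in> sym_alg L \<Longrightarrow> sym_mult L G H \<in> sym_alg L" for c y G H
    by (auto simp: sym_alg_def intro: sym_subalg.intros)
  have "P D"
    unfolding P_def D_def using x
    by (auto simp: mem field_deriv_coad_closed field_deriv_const field_deriv_gen field_deriv_add
      field_deriv_mult coad_in coad_field_gen)
  moreover have "D' = D" if D': "P D'" for D'
  proof (rule extensionalityI)
    show "D' \<in> extensional (sym_alg L)" "D \<in> extensional (sym_alg L)"
      using D' by (auto simp: P_def D_def PiE_def)
    fix G assume "G \<in> sym_alg L"
    then show "D' G = D G"
      unfolding sym_alg_def
    proof (induction rule: sym_subalg.induct)
      case (const c)
      then show ?case using D' \<open>P D\<close> unfolding P_def by metis
    next
      case (gen y)
      then show ?case using D' \<open>P D\<close> unfolding P_def by metis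
    next
      case (add F G)
      then show ?case using D' \<open>P D\<close> unfolding P_def sym_alg_def by metis
    next
      case (mult F G)
      then show ?case using D' \<open>P D\<close> unfolding P_def sym_alg_def by metis
    qed
  qed
  ultimately have "sym_ad L x = D"
    unfolding sym_ad_def P_def[symmetric] by (rule the_equality)
  then show ?thesis using F by (simp add: D_def)
qed

text \<open>This turns the algebraic definition of invariance into the vanishing of directional derivatives along the
  coadjoint orbits, the form in which it is checked and used from here on.\<close>

lemma sym_invariants_iff:
  "F \<in> sym_invariants L \<longleftrightarrow> F \<in> sym_alg L \<and>
    (\<forall>x\<in>carrier L. \<forall>\<gamma>\<in>dual. dir_deriv F \<gamma> (coad L x \<gamma>) = 0)"
proof -
  have "field_deriv (coad L x) F = sym_const L 0 \<longleftrightarrow> (\<forall>\<gamma>\<in>dual. dir_deriv F \<gamma> (coad L x \<gamma>) = 0)" for x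
    unfolding field_deriv_def sym_const_def by (auto simp: fun_eq_iff restrict_def)
  then show ?thesis by (auto simp: sym_invariants_def sym_ad_eq)
qed

lemma invariants_const: "sym_const L c \<in> sym_invariants L"
  and invariants_add: "F \<in> sym_invariants L \<Longrightarrow> G \<in> sym_invariants L \<Longrightarrow>
    sym_add L F G \<in> sym_invariants L"
  and invariants_mult: "F \<in> sym_invariants L \<Longrightarrow> G \<in> sym_invariants L \<Longrightarrow>
    sym_mult L F G \<in> sym_invariants L"
  by (auto simp: sym_invariants_iff dir_deriv_rules coad_in)
     (auto simp: sym_alg_def intro: sym_subalg.intros)

end

section \<open>A criterion for free generation of the invariants\<close>

context lin_lie
begin

lemma sym_alg_closed:
  "sym_const L c \<in> sym_alg L"
  "F \<in> sym_alg L \<Longrightarrow> G \<in> sym_alg L \<Longrightarrow> sym_add L F G \<in> sym_alg L"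
  "F \<in> sym_alg L \<Longrightarrow> G \<in> sym_alg L \<Longrightarrow> sym_mult L F G \<in> sym_alg L"
  by (auto simp: sym_alg_def intro: sym_subalg.intros)

text \<open>The span of the iterated derivatives of \<open>G\<close> of order \<open>r\<close> along constant vector fields.  It is used in
  place of the vanishing order of \<open>G\<close> along a subspace; closure under sums makes it stable under the coadjoint
  vector fields when \<open>G\<close> is invariant.\<close>

inductive derivs :: "('a, 'v) sym_elem \<Rightarrow> nat \<Rightarrow> ('a, 'v) sym_elem \<Rightarrow> bool" for G where
  base: "derivs G 0 G"
| zero: "derivs G r (sym_const L 0)"
| add: "derivs G r F \<Longrightarrow> derivs G r F' \<Longrightarrow> derivs G r (sym_add L F F')"
| scale: "derivs G r F \<Longrightarrow> derivs G r (sym_mult L (sym_const L c) F)"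
| step: "derivs G r F \<Longrightarrow> \<eta> \<in> dual \<Longrightarrow> derivs G (Suc r) (field_deriv (\<lambda>_. \<eta>) F)"

lemma derivs_sym_alg: "derivs G r F \<Longrightarrow> G \<in> sym_alg L \<Longrightarrow> F \<in> sym_alg L"
  by (induction rule: derivs.induct) (auto intro: sym_alg_closed field_deriv_fixed_closed)

text \<open>The coadjoint vector field is linear, so its commutator with a constant field is again constant.  A
  commutator of derivations is a derivation, so it is enough to compare on generators.\<close>

lemma coad_deriv_commutator:
  assumes x: "x \<in> carrier L" and \<eta>: "\<eta> \<in> dual" and F: "F \<in> sym_alg L"
  shows "field_deriv (coad L x) (field_deriv (\<lambda>_. \<eta>) F) =
    sym_add L (field_deriv (\<lambda>_. \<eta>) (field_deriv (coad L x) F))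
      (sym_mult L (sym_const L (- 1)) (field_deriv (\<lambda>_. coad L x \<eta>) F))"
proof (rule sym_alg_eqI)
  have xi: "coad L x \<eta> \<in> dual" using x \<eta> by (rule coad_in)
  note cl = field_deriv_coad_closed[OF x] field_deriv_fixed_closed[OF \<eta>]
    field_deriv_fixed_closed[OF xi] sym_alg_closed
  show "field_deriv (coad L x) (field_deriv (\<lambda>_. \<eta>) F) \<in> sym_alg L"
    "sym_add L (field_deriv (\<lambda>_. \<eta>) (field_deriv (coad L x) F))
      (sym_mult L (sym_const L (- 1)) (field_deriv (\<lambda>_. coad L x \<eta>) F)) \<in> sym_alg L"
    using F by (auto intro!: cl)
  have fx: "\<And>\<gamma>. \<gamma> \<in> dual \<Longrightarrow> coad L x \<gamma> \<in> dual" using x by (rule coad_in)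
  define X where "X = field_deriv (coad L x)"
  define D where "D = field_deriv (\<lambda>_. \<eta>)"
  define E where "E = field_deriv (\<lambda>_. coad L x \<eta>)"
  have Xc: "F \<in> sym_alg L \<Longrightarrow> X F \<in> sym_alg L" for F unfolding X_def by (rule cl)
  have Dc: "F \<in> sym_alg L \<Longrightarrow> D F \<in> sym_alg L" for F unfolding D_def by (rule cl)
  have Ec: "F \<in> sym_alg L \<Longrightarrow> E F \<in> sym_alg L" for F unfolding E_def by (rule cl)
  have cst: "X (sym_const L c) = sym_const L 0" "D (sym_const L c) = sym_const L 0"
    "E (sym_const L c) = sym_const L 0" for c
    unfolding X_def D_def E_def using fx \<eta> xi by (auto intro!: field_deriv_const)
  have gX: "X (sym_gen L y) = sym_gen L (lie_bracket L x y)" if "y \<in> carrier L" for y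
    unfolding X_def using that fx by (simp add: field_deriv_gen coad_field_gen)
  have gD: "D (sym_gen L y) = sym_const L (\<eta> y)" if "y \<in> carrier L" for y
    unfolding D_def using that \<eta> by (simp add: field_deriv_gen sym_const_def)
  have gE: "E (sym_gen L y) = sym_const L (coad L x \<eta> y)" if "y \<in> carrier L" for y
    unfolding E_def using that xi by (simp add: field_deriv_gen sym_const_def)
  have ad: "X (sym_add L F G) = sym_add L (X F) (X G)" "D (sym_add L F G) = sym_add L (D F) (D G)"
    "E (sym_add L F G) = sym_add L (E F) (E G)" if "F \<in> sym_alg L" "G \<in> sym_alg L" for F G
    unfolding X_def D_def E_def using fx \<eta> xi that by (auto intro!: field_deriv_add)
  have mu: "X (sym_mult L F G) = sym_add L (sym_mult L (X F) G) (sym_mult L F (X G))"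
    "D (sym_mult L F G) = sym_add L (sym_mult L (D F) G) (sym_mult L F (D G))"
    "E (sym_mult L F G) = sym_add L (sym_mult L (E F) G) (sym_mult L F (E G))"
    if "F \<in> sym_alg L" "G \<in> sym_alg L" for F G
    unfolding X_def D_def E_def using fx \<eta> xi that by (auto intro!: field_deriv_mult)
  have "X (D F) \<gamma> = D (X F) \<gamma> - E F \<gamma>" if \<gamma>: "\<gamma> \<in> dual" for \<gamma>
    using F unfolding sym_alg_def
  proof (induction rule: sym_subalg.induct)
    case (const c)
    then show ?case using \<gamma> by (simp add: cst sym_apply)
  next
    case (gen y)
    then have "coad L x \<eta> y = \<eta> (lie_bracket L x y)" by (simp add: coad_def)
    then show ?case using \<gamma> gen x by (simp add: cst gX gD gE sym_apply bracket_closed)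
  next
    case (add F G)
    then have "F \<in> sym_alg L" "G \<in> sym_alg L" by (auto simp: sym_alg_def)
    then show ?case using \<gamma> add by (simp add: ad Xc Dc sym_apply)
  next
    case (mult F G)
    then have "F \<in> sym_alg L" "G \<in> sym_alg L" by (auto simp: sym_alg_def)
    then have eq: "X (D (sym_mult L F G)) \<gamma> =
        X (D F) \<gamma> * G \<gamma> + D F \<gamma> * X G \<gamma> + (X F \<gamma> * D G \<gamma> + F \<gamma> * X (D G) \<gamma>)"
      "D (X (sym_mult L F G)) \<gamma> =
        D (X F) \<gamma> * G \<gamma> + X F \<gamma> * D G \<gamma> + (D F \<gamma> * X G \<gamma> + F \<gamma> * D (X G) \<gamma>)"
      "E (sym_mult L F G) \<gamma> = E F \<gamma> * G \<gamma> + F \<gamma> * E G \<gamma>"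
      using \<gamma> by (simp_all add: ad mu Xc Dc sym_alg_closed sym_apply)
    show ?case unfolding eq mult.IH by (simp add: algebra_simps)
  qed
  then show "field_deriv (coad L x) (field_deriv (\<lambda>_. \<eta>) F) \<gamma> =
     sym_add L (field_deriv (\<lambda>_. \<eta>) (field_deriv (coad L x) F))
      (sym_mult L (sym_const L (- 1)) (field_deriv (\<lambda>_. coad L x \<eta>) F)) \<gamma>" if "\<gamma> \<in> dual" for \<gamma>
    using that by (simp add: sym_apply X_def D_def E_def)
qed

text \<open>Moving the coadjoint field past the constant fields one at a time ends with its action on \<open>G\<close>, which is
  zero; each commutator leaves a derivative of the same order.\<close>

lemma derivs_coad:
  assumes G: "G \<in> sym_invariants L" and x: "x \<in> carrier L"
  shows "derivs G r F \<Longrightarrow> derivs G r (field_deriv (coad L x) F)"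
proof (induction rule: derivs.induct)
  case base
  have "field_deriv (coad L x) G = sym_const L 0"
    using G x by (auto simp: sym_invariants_def sym_ad_eq)
  then show ?case by (simp add: derivs.zero)
next
  case (zero r)
  then show ?case using x by (simp add: field_deriv_const coad_in derivs.zero)
next
  case (add r F F')
  moreover have "F \<in> sym_alg L" "F' \<in> sym_alg L"
    using add derivs_sym_alg G by (auto simp: sym_invariants_def)
  ultimately show ?case using x by (simp add: field_deriv_add coad_in derivs.add)
next
  case (scale r F c)
  moreover have "F \<in> sym_alg L"
    using scale derivs_sym_alg G by (auto simp: sym_invariants_def)
  ultimately show ?case using x
    by (simp add: field_deriv_mult coad_in sym_alg_closed field_deriv_const derivs.add derivs.scale)
next
  case (step r F \<eta>)
  moreover have "F \<in> sym_alg L"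
    using step derivs_sym_alg G by (auto simp: sym_invariants_def)
  ultimately show ?case using x
    by (simp add: coad_deriv_commutator derivs.add derivs.scale derivs.step coad_in)
qed

lemma line_poly_field_deriv:
  assumes F: "F \<in> sym_alg L" and \<gamma>: "\<gamma> \<in> dual" and \<eta>: "\<eta> \<in> dual"
  shows "line_poly (field_deriv (\<lambda>_. \<eta>) F) \<gamma> \<eta> = pderiv (line_poly F \<gamma> \<eta>)"
proof (rule line_poly_unique, rule allI)
  fix t
  let ?p = "line_poly F \<gamma> \<eta>"
  have "line_poly F (dual_line L \<gamma> \<eta> t) \<eta> = pcompose ?p [:t, 1:]"
    by (rule line_poly_unique)
       (simp add: dual_line_line poly_pcompose poly_line_poly F \<gamma> \<eta>)
  moreover have "coeff (pcompose ?p [:t, 1:]) 1 = poly (pderiv ?p) t"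
  proof -
    have "coeff (pcompose ?p [:t, 1:]) 1 = poly (pderiv (pcompose ?p [:t, 1:])) 0"
      by (simp add: poly_0_coeff_0 coeff_pderiv)
    then show ?thesis by (simp add: pderiv_pcompose poly_pcompose pderiv_pCons)
  qed
  ultimately show "field_deriv (\<lambda>_. \<eta>) F (dual_line L \<gamma> \<eta> t) = poly (pderiv ?p) t"
    using dual_line_in[OF \<gamma> \<eta>] by (simp add: field_deriv_def dir_deriv_def)
qed

text \<open>In characteristic zero a polynomial is determined by its Taylor coefficients at one point, here along the
  line from \<open>a\<close> to \<open>\<gamma>\<close>.\<close>

lemma derivs_vanish_imp_zero:
  assumes G: "G \<in> sym_alg L" and a: "a \<in> dual" and van: "\<And>r F. derivs G r F \<Longrightarrow> F a = 0"
    and \<gamma>: "\<gamma> \<in> dual"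
  shows "G \<gamma> = 0"
proof -
  define \<eta> where "\<eta> = dual_line L \<gamma> a (- 1)"
  have \<eta>: "\<eta> \<in> dual" unfolding \<eta>_def using \<gamma> a by (rule dual_line_in)
  define D where "D = (\<lambda>r. (field_deriv (\<lambda>_. \<eta>) ^^ r) G)"
  have D: "derivs G r (D r)" for r
    by (induction r) (auto simp: D_def intro: derivs.base derivs.step \<eta>)
  have Ds: "D r \<in> sym_alg L" for r using D G by (rule derivs_sym_alg)
  have lp: "line_poly (D r) a \<eta> = (pderiv ^^ r) (line_poly G a \<eta>)" for r
  proof (induction r)
    case 0
    then show ?case by (simp add: D_def)
  next
    case (Suc r)
    have "D (Suc r) = field_deriv (\<lambda>_. \<eta>) (D r)" by (simp add: D_def)
    then show ?case using Suc by (simp add: line_poly_field_deriv Ds a \<eta>)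
  qed
  have "coeff (line_poly G a \<eta>) r = 0" for r
  proof -
    have "coeff ((pderiv ^^ r) (line_poly G a \<eta>)) 0 = 0"
      using coeff_0_line_poly[OF Ds a \<eta>, of r] van[OF D] by (simp add: lp)
    then have "fact r * coeff (line_poly G a \<eta>) r = 0"
      by (simp add: coeff_higher_pderiv pochhammer_fact)
    then show ?thesis by simp
  qed
  then have "line_poly G a \<eta> = 0" by (simp add: poly_eq_iff)
  moreover have "dual_line L a \<eta> 1 = \<gamma>"
    using \<gamma> by (auto simp: \<eta>_def dual_line_def lie_dual_def extensional_def)
  ultimately show ?thesis using poly_line_poly[OF G a \<eta>, of 1] by simp
qed

definition affine_point ::
  "'i set \<Rightarrow> ('v \<Rightarrow> 'a) \<Rightarrow> ('i \<Rightarrow> 'v \<Rightarrow> 'a) \<Rightarrow> ('i \<Rightarrow> 'a) \<Rightarrow> 'v \<Rightarrow> 'a" where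
  "affine_point I a \<tau> d = (\<lambda>x\<in>carrier L. a x + (\<Sum>i\<in>I. d i * \<tau> i x))"

lemma affine_point_in:
  assumes "a \<in> dual" "\<And>i. i \<in> I \<Longrightarrow> \<tau> i \<in> dual"
  shows "affine_point I a \<tau> d \<in> dual"
  using assms
  by (auto simp: lie_dual_def affine_point_def add_closed smult_closed algebra_simps sum.distrib
    sum_distrib_left)

lemma affine_point_line:
  assumes "finite I" "i \<in> I"
  shows "dual_line L (affine_point I a \<tau> d) (\<tau> i) t = affine_point I a \<tau> (d(i := d i + t))"
proof -
  have "(\<Sum>j\<in>I. (d(i := d i + t)) j * \<tau> j x) = (\<Sum>j\<in>I. d j * \<tau> j x) + t * \<tau> i x" for x
    using assms by (simp add: sum.remove[of I i] algebra_simps)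
  then show ?thesis by (auto simp: dual_line_def affine_point_def)
qed

text \<open>The factors \<open>c i\<close> allow for invariants that restrict to multiples of the coordinates.\<close>

lemma sym_alg_on_affine_points:
  assumes "F \<in> sym_alg L" "finite I" "a \<in> dual" "\<And>i. i \<in> I \<Longrightarrow> \<tau> i \<in> dual"
  shows "\<exists>p\<in>mpolys_in I. \<forall>d. F (affine_point I a \<tau> (\<lambda>i. c i * d i)) = mpoly_eval d p"
  using assms(1) unfolding sym_alg_def
proof (induction rule: sym_subalg.induct)
  case (const k)
  show ?case
    by (rule bexI[of _ "mpoly_const k"])
       (simp_all add: sym_apply affine_point_in assms)
next
  case (gen x)
  let ?p = "mpoly_const (a x) + (\<Sum>i\<in>I. mpoly_const (c i * \<tau> i x) * mpoly_var i)"
  show ?case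
  proof (rule bexI[of _ ?p])
    show "?p \<in> mpolys_in I"
      by (intro mpolys_in_add mpolys_in_const mpolys_in_sum mpolys_in_mult mpolys_in_var)
    show "\<forall>d. sym_gen L x (affine_point I a \<tau> (\<lambda>i. c i * d i)) = mpoly_eval d ?p"
      using gen
      by (simp add: sym_apply affine_point_in assms mpoly_eval_add mpoly_eval_sum mpoly_eval_mult)
         (simp add: affine_point_def algebra_simps)
  qed
next
  case (add F G)
  then obtain p q where "p \<in> mpolys_in I" "q \<in> mpolys_in I"
    "\<forall>d. F (affine_point I a \<tau> (\<lambda>i. c i * d i)) = mpoly_eval d p"
    "\<forall>d. G (affine_point I a \<tau> (\<lambda>i. c i * d i)) = mpoly_eval d q"
    by blast
  then show ?case
    by (intro bexI[of _ "p + q"])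
       (simp_all add: sym_apply affine_point_in assms mpoly_eval_add mpolys_in_add)
next
  case (mult F G)
  then obtain p q where "p \<in> mpolys_in I" "q \<in> mpolys_in I"
    "\<forall>d. F (affine_point I a \<tau> (\<lambda>i. c i * d i)) = mpoly_eval d p"
    "\<forall>d. G (affine_point I a \<tau> (\<lambda>i. c i * d i)) = mpoly_eval d q"
    by blast
  then show ?case
    by (intro bexI[of _ "p * q"])
       (simp_all add: sym_apply affine_point_in assms mpoly_eval_mult mpolys_in_mult)
qed

lemma invariants_mpoly_eval:
  assumes H: "\<And>i. i \<in> I \<Longrightarrow> H i \<in> sym_invariants L" and p: "p \<in> mpolys_in I"
  shows "(\<lambda>\<gamma>\<in>dual. mpoly_eval (\<lambda>i. H i \<gamma>) p) \<in> sym_invariants L"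
proof -
  define good where "good = (\<lambda>F. restrict F dual \<in> sym_invariants L)"
  have c: "good (\<lambda>_. c)" for c
    using invariants_const[of c] by (simp add: good_def sym_const_def)
  have a: "good (\<lambda>\<gamma>. F \<gamma> + G \<gamma>)" if "good F" "good G" for F G
  proof -
    have "sym_add L (restrict F dual) (restrict G dual) = restrict (\<lambda>\<gamma>. F \<gamma> + G \<gamma>) dual"
      by (auto simp: sym_add_def)
    then show ?thesis using invariants_add that unfolding good_def by metis
  qed
  have m: "good (\<lambda>\<gamma>. F \<gamma> * G \<gamma>)" if "good F" "good G" for F G
  proof -
    have "sym_mult L (restrict F dual) (restrict G dual) = restrict (\<lambda>\<gamma>. F \<gamma> * G \<gamma>) dual"
      by (auto simp: sym_mult_def)
    then show ?thesis using invariants_mult that unfolding good_def by metis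
  qed
  have s: "good (\<lambda>\<gamma>. \<Sum>i\<in>A. F i \<gamma>)" if "\<And>i. i \<in> A \<Longrightarrow> good (F i)" for A :: "('i \<Rightarrow>\<^sub>0 nat) set" and F
    using that by (induction A rule: infinite_finite_induct) (auto simp: c intro!: a)
  have pr: "good (\<lambda>\<gamma>. \<Prod>i\<in>A. F i \<gamma>)" if "\<And>i. i \<in> A \<Longrightarrow> good (F i)" for A :: "'i set" and F
    using that by (induction A rule: infinite_finite_induct) (auto simp: c intro!: m)
  have pw: "good (\<lambda>\<gamma>. F \<gamma> ^ k)" if "good F" for F k
    using that by (induction k) (auto simp: c intro!: m)
  have H': "good (H i)" if "i \<in> I" for i
    using H[OF that] restrict_dual_sym_subalg[of "H i" L "carrier L"]
    by (simp add: good_def sym_invariants_def sym_alg_def)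
  have "good (\<lambda>\<gamma>. mpoly_eval (\<lambda>i. H i \<gamma>) p)"
    unfolding mpoly_eval_def using p
    by (intro s m c pr pw H') (auto simp: mpolys_in_def)
  then show ?thesis by (simp add: good_def)
qed

text \<open>Let an affine subspace meet the coadjoint orbits transversally, in the dual formulation: a linear form on
  the dual space that kills the directions of the subspace and of the orbit is zero.  If an invariant vanishes on
  the subspace, then so do all its derivatives: assume this for order \<open>r\<close> and consider the differential of such
  a derivative at a point of the subspace.  It kills the directions of the subspace, and it kills the directions of
  the orbit since the coadjoint fields preserve derivatives of order \<open>r\<close>; by transversality it is zero.  So
  restriction to the subspace is injective on invariants, and invariants that restrict to coordinates there
  generate freely.\<close>

theorem affine_section_criterion:
  fixes H :: "'i \<Rightarrow> ('a, 'v) sym_elem"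
  assumes I: "finite I"
    and H: "\<And>i. i \<in> I \<Longrightarrow> H i \<in> sym_invariants L"
    and a: "a \<in> dual" and \<tau>: "\<And>i. i \<in> I \<Longrightarrow> \<tau> i \<in> dual"
    and coord: "\<And>d i. i \<in> I \<Longrightarrow> H i (affine_point I a \<tau> d) = \<mu> i * d i"
    and \<mu>: "\<And>i. i \<in> I \<Longrightarrow> \<mu> i \<noteq> 0"
    and transversal: "\<And>d l \<gamma>. (\<And>\<eta> \<zeta> t. \<eta> \<in> dual \<Longrightarrow> \<zeta> \<in> dual \<Longrightarrow>
        l (dual_line L \<eta> \<zeta> t) = l \<eta> + t * l \<zeta>) \<Longrightarrow>
      (\<And>i. i \<in> I \<Longrightarrow> l (\<tau> i) = 0) \<Longrightarrow>
      (\<And>x. x \<in> carrier L \<Longrightarrow> l (coad L x (affine_point I a \<tau> d)) = 0) \<Longrightarrow>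
      \<gamma> \<in> dual \<Longrightarrow> l \<gamma> = 0"
  shows "freely_generated_by L (sym_invariants L) I H"
proof -
  define ev where "ev = (\<lambda>p. \<lambda>\<gamma>\<in>dual. mpoly_eval (\<lambda>i. H i \<gamma>) p)"
  define A where "A = affine_point I a \<tau>"
  have A: "A d \<in> dual" for d
    unfolding A_def by (rule affine_point_in) (use a \<tau> in auto)
  have zero: "G \<gamma> = 0" if G: "G \<in> sym_invariants L" and GA: "\<And>d. G (A d) = 0" and "\<gamma> \<in> dual"
    for G \<gamma>
  proof -
    have Gs: "G \<in> sym_alg L" using G by (simp add: sym_invariants_def)
    have van: "derivs G r F \<Longrightarrow> F (A d) = 0" for r F d
    proof (induction r arbitrary: F d)
      case 0
      then show ?case
        by (induction "0::nat" F rule: derivs.induct) (auto simp: GA sym_apply A)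
    next
      case (Suc r)
      from Suc.prems show ?case
      proof (induction "Suc r" F rule: derivs.induct)
        case (step F \<eta>)
        have Fs: "F \<in> sym_alg L" using step(1) Gs by (rule derivs_sym_alg)
        have "dir_deriv F (A d) \<eta> = 0"
        proof (rule transversal[of "dir_deriv F (A d)" d])
          show "dir_deriv F (A d) (dual_line L \<eta> \<zeta> t) = dir_deriv F (A d) \<eta> + t * dir_deriv F (A d) \<zeta>"
            if "\<eta> \<in> dual" "\<zeta> \<in> dual" for \<eta> \<zeta> t
            using dir_deriv_linear[OF Fs A] that by simp
          show "dir_deriv F (A d) (\<tau> i) = 0" if "i \<in> I" for i
          proof -
            have "line_poly F (A d) (\<tau> i) = 0"
              by (rule line_poly_unique)
                 (simp add: A_def affine_point_line I that Suc.IH[OF step(1), unfolded A_def])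
            then show ?thesis by (simp add: dir_deriv_def)
          qed
          show "dir_deriv F (A d) (coad L x (affine_point I a \<tau> d)) = 0" if "x \<in> carrier L" for x
            using Suc.IH[OF derivs_coad[OF G that step(1)], of d] A[of d]
            by (simp add: field_deriv_def A_def)
          show "\<eta> \<in> dual" by (rule step)
        qed
        then show ?case by (simp add: field_deriv_def A)
      qed (auto simp: sym_apply A)
    qed
    show ?thesis by (rule derivs_vanish_imp_zero[OF Gs A[of undefined] _ that(3)]) (rule van)
  qed
  \<comment> \<open>After rescaling the parameters the \<open>H i\<close> are the coordinates of the section.\<close>
  have Hinv: "mpoly_eval (\<lambda>i. H i (A (\<lambda>i. inverse (\<mu> i) * d i))) p = mpoly_eval d p"
    if "p \<in> mpolys_in I" for p d
    by (rule mpoly_eval_cong[OF that]) (simp add: A_def coord \<mu>)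
  have "inj_on ev (mpolys_in I)"
  proof (rule inj_onI)
    fix p q assume pq: "p \<in> mpolys_in I" "q \<in> mpolys_in I" "ev p = ev q"
    have "mpoly_eval d p = mpoly_eval d q" for d
    proof -
      let ?\<gamma> = "A (\<lambda>i. inverse (\<mu> i) * d i)"
      have "ev p ?\<gamma> = ev q ?\<gamma>" using pq by simp
      then show ?thesis by (simp add: ev_def A Hinv pq)
    qed
    then have "p - q = 0"
      by (intro mpoly_eval_eq_0_imp_0[OF I] mpolys_in_diff pq) (simp add: mpoly_eval_diff)
    then show "p = q" by simp
  qed
  moreover have "ev ` mpolys_in I = sym_invariants L"
  proof
    show "ev ` mpolys_in I \<subseteq> sym_invariants L"
      using invariants_mpoly_eval[OF H] by (auto simp: ev_def)
    show "sym_invariants L \<subseteq> ev ` mpolys_in I"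
    proof
      fix F assume F: "F \<in> sym_invariants L"
      then have Fs: "F \<in> sym_alg L" by (simp add: sym_invariants_def)
      have "\<exists>p\<in>mpolys_in I. \<forall>d. F (affine_point I a \<tau> (\<lambda>i. inverse (\<mu> i) * d i)) = mpoly_eval d p"
        by (rule sym_alg_on_affine_points[OF Fs I a]) (rule \<tau>)
      then obtain p where p: "p \<in> mpolys_in I"
        "\<And>d. F (A (\<lambda>i. inverse (\<mu> i) * d i)) = mpoly_eval d p"
        unfolding A_def by blast
      have evp: "ev p \<in> sym_invariants L"
        using invariants_mpoly_eval[OF H p(1)] by (auto simp: ev_def)
      \<comment> \<open>Subtracting the polynomial in the \<open>H i\<close> that agrees with \<open>F\<close> on the section leaves an invariant vanishing there.\<close>
      define G where "G = sym_add L F (sym_mult L (sym_const L (- 1)) (ev p))"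
      have G: "G \<in> sym_invariants L"
        unfolding G_def by (intro invariants_add invariants_mult invariants_const F evp)
      have "G (A d) = 0" for d
      proof -
        have "affine_point I a \<tau> d = affine_point I a \<tau> (\<lambda>i. inverse (\<mu> i) * (\<mu> i * d i))"
          unfolding affine_point_def using \<mu> by (auto intro!: restrict_ext sum.cong)
        then have "A d = A (\<lambda>i. inverse (\<mu> i) * (\<mu> i * d i))" by (simp add: A_def)
        then have "F (A d) = ev p (A d)"
          using p(2)[of "\<lambda>i. \<mu> i * d i"] Hinv[OF p(1), of "\<lambda>i. \<mu> i * d i"] A by (simp add: ev_def)
        then show ?thesis by (simp add: G_def sym_apply A)
      qed
      then have "G \<gamma> = 0" if "\<gamma> \<in> dual" for \<gamma> using zero[OF G] that by blast
      then have "F \<gamma> = ev p \<gamma>" if "\<gamma> \<in> dual" for \<gamma>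
        using that by (fastforce simp: G_def sym_apply)
      then have "F = ev p"
        using Fs evp by (intro sym_alg_eqI) (auto simp: sym_invariants_def)
      then show "F \<in> ev ` mpolys_in I" using p(1) by blast
    qed
  qed
  ultimately show ?thesis
    unfolding freely_generated_by_def ev_def[symmetric] by (simp add: bij_betw_def)
qed

end

section \<open>The symplectic Lie algebra as the space of symmetric matrices\<close>

subsection \<open>The standard symplectic matrix\<close>

text \<open>\<open>symp_J m\<close> is a signed permutation matrix; \<open>partner\<close> is its involution and \<open>partner_sign\<close> the sign in each
  row.\<close>

definition partner :: "nat \<Rightarrow> nat \<Rightarrow> nat" where
  "partner m i = (if i < m then i + m else i - m)"

definition partner_sign :: "nat \<Rightarrow> nat \<Rightarrow> 'a::comm_ring_1" where
  "partner_sign m i = (if i < m then 1 else - 1)"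

lemma partner_less [simp]: "i < 2 * m \<Longrightarrow> partner m i < 2 * m"
  by (auto simp: partner_def)

lemma partner_partner [simp]: "i < 2 * m \<Longrightarrow> partner m (partner m i) = i"
  by (auto simp: partner_def)

lemma partner_sign_partner [simp]:
  "i < 2 * m \<Longrightarrow> partner_sign m (partner m i) = - (partner_sign m i :: 'a::comm_ring_1)"
  by (auto simp: partner_def partner_sign_def)

lemma partner_sign_square [simp]: "partner_sign m i * partner_sign m i = (1 :: 'a::comm_ring_1)"
  by (auto simp: partner_sign_def)

lemma symp_J_carrier [simp]: "symp_J m \<in> carrier_mat (2 * m) (2 * m)"
  unfolding symp_J_def mult_2 by (intro four_block_carrier_mat) auto

lemma symp_J_dim [simp]: "dim_row (symp_J m) = 2 * m" "dim_col (symp_J m) = 2 * m"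
  using symp_J_carrier by (blast dest: carrier_matD)+

lemma symp_J_index:
  assumes "i < 2 * m" "j < 2 * m"
  shows "symp_J m $$ (i, j) = (if j = partner m i then partner_sign m i else 0 :: 'a::comm_ring_1)"
  using assms by (auto simp: symp_J_def partner_def partner_sign_def)

lemma symp_J_mult_index:
  fixes A :: "'a::comm_ring_1 mat"
  assumes "A \<in> carrier_mat (2 * m) k" "i < 2 * m" "j < k"
  shows "(symp_J m * A) $$ (i, j) = partner_sign m i * A $$ (partner m i, j)"
proof -
  have "(symp_J m * A) $$ (i, j) = (\<Sum>l = 0..<2 * m. symp_J m $$ (i, l) * A $$ (l, j))"
    using assms by (simp add: scalar_prod_def)
  also have "\<dots> = (\<Sum>l = 0..<2 * m. if l = partner m i then partner_sign m i * A $$ (l, j) else 0)"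
    using assms by (intro sum.cong) (auto simp: symp_J_index)
  finally show ?thesis using assms by simp
qed

lemma mult_symp_J_index:
  fixes A :: "'a::comm_ring_1 mat"
  assumes "A \<in> carrier_mat k (2 * m)" "i < k" "j < 2 * m"
  shows "(A * symp_J m) $$ (i, j) = - partner_sign m j * A $$ (i, partner m j)"
proof -
  have "(A * symp_J m) $$ (i, j) = (\<Sum>l = 0..<2 * m. A $$ (i, l) * symp_J m $$ (l, j))"
    using assms by (simp add: scalar_prod_def)
  also have "\<dots> = (\<Sum>l = 0..<2 * m. if l = partner m j then - partner_sign m j * A $$ (i, l) else 0)"
    using assms by (intro sum.cong) (auto simp: symp_J_index)
  finally show ?thesis using assms by simp
qed

lemma symp_J_mult_vec_index:
  fixes v :: "'a::comm_ring_1 vec"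
  assumes "v \<in> carrier_vec (2 * m)" "i < 2 * m"
  shows "(symp_J m *\<^sub>v v) $ i = partner_sign m i * v $ partner m i"
proof -
  have "(symp_J m *\<^sub>v v) $ i = (\<Sum>l = 0..<2 * m. symp_J m $$ (i, l) * v $ l)"
    using assms by (simp add: scalar_prod_def)
  also have "\<dots> = (\<Sum>l = 0..<2 * m. if l = partner m i then partner_sign m i * v $ l else 0)"
    using assms by (intro sum.cong) (auto simp: symp_J_index)
  finally show ?thesis using assms by simp
qed

lemma transpose_symp_J: "transpose_mat (symp_J m) = - (symp_J m :: 'a::comm_ring_1 mat)"
  by (rule eq_matI) (auto simp: symp_J_index partner_def partner_sign_def)

lemma symp_J_square: "symp_J m * symp_J m = - (1\<^sub>m (2 * m) :: 'a::comm_ring_1 mat)"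
proof (rule eq_matI)
  fix i j assume "i < dim_row (- (1\<^sub>m (2 * m) :: 'a mat))" "j < dim_col (- (1\<^sub>m (2 * m) :: 'a mat))"
  then have ij: "i < 2 * m" "j < 2 * m" by auto
  have "(symp_J m * symp_J m) $$ (i, j) = partner_sign m i * (symp_J m $$ (partner m i, j) :: 'a)"
    by (rule symp_J_mult_index) (use ij in auto)
  then show "(symp_J m * symp_J m) $$ (i, j) = (- (1\<^sub>m (2 * m) :: 'a mat)) $$ (i, j)"
    using ij by (auto simp: symp_J_index)
qed auto

lemma det_symp_J_nonzero: "det (symp_J m :: 'a::idom mat) \<noteq> 0"
proof
  assume "det (symp_J m :: 'a mat) = 0"
  then have "det (symp_J m * symp_J m :: 'a mat) = 0"
    by (simp add: det_mult[of _ "2 * m"])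
  moreover have "det (- (1\<^sub>m (2 * m)) :: 'a mat) \<noteq> 0"
  proof -
    have "- (1\<^sub>m (2 * m)) = (- 1) \<cdot>\<^sub>m (1\<^sub>m (2 * m) :: 'a mat)" by (rule eq_matI) auto
    then show ?thesis by simp
  qed
  ultimately show False by (simp add: symp_J_square)
qed

subsection \<open>The trace pairing of matrices\<close>

definition mat_pair :: "nat \<Rightarrow> 'a::comm_ring_1 mat \<Rightarrow> 'a mat \<Rightarrow> 'a" where
  "mat_pair n A B = (\<Sum>i<n. \<Sum>j<n. A $$ (i, j) * B $$ (i, j))"

lemma mult_index_sum:
  "A \<in> carrier_mat n k \<Longrightarrow> B \<in> carrier_mat k l \<Longrightarrow> i < n \<Longrightarrow> j < l \<Longrightarrow>
    (A * B) $$ (i, j) = (\<Sum>r<k. A $$ (i, r) * B $$ (r, j))"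
  by (simp add: scalar_prod_def atLeast0LessThan)

lemma mat_pair_sym: "mat_pair n A B = mat_pair n B A"
  by (simp add: mat_pair_def mult.commute)

lemma mat_pair_transpose:
  assumes "A \<in> carrier_mat n n" "B \<in> carrier_mat n n"
  shows "mat_pair n (transpose_mat A) (transpose_mat B) = mat_pair n A B"
  unfolding mat_pair_def by (subst sum.swap) (use assms in simp)

lemma mat_pair_add:
  assumes "A \<in> carrier_mat n n" "B \<in> carrier_mat n n" "C \<in> carrier_mat n n"
  shows "mat_pair n (A + B) C = mat_pair n A C + mat_pair n B C"
  using assms by (simp add: mat_pair_def algebra_simps sum.distrib)

lemma mat_pair_smult:
  assumes "A \<in> carrier_mat n n" "B \<in> carrier_mat n n"
  shows "mat_pair n (c \<cdot>\<^sub>m A) B = c * mat_pair n A B"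
  using assms by (simp add: mat_pair_def algebra_simps sum_distrib_left)

lemma mat_pair_uminus:
  assumes "A \<in> carrier_mat n n" "B \<in> carrier_mat n n"
  shows "mat_pair n (- A) B = - mat_pair n A B"
  using assms by (simp add: mat_pair_def sum_negf)

lemma mat_pair_mult_left:
  assumes "A \<in> carrier_mat n n" "B \<in> carrier_mat n n" "C \<in> carrier_mat n n"
  shows "mat_pair n (A * B) C = mat_pair n B (transpose_mat A * C)"
proof -
  have "mat_pair n (A * B) C = (\<Sum>i<n. \<Sum>j<n. \<Sum>r<n. A $$ (i, r) * B $$ (r, j) * C $$ (i, j))"
    unfolding mat_pair_def
    by (intro sum.cong refl) (use assms in \<open>simp add: mult_index_sum[of _ n n _ n] sum_distrib_right del: index_mult_mat\<close>)
  also have "\<dots> = (\<Sum>i<n. \<Sum>r<n. \<Sum>j<n. A $$ (i, r) * B $$ (r, j) * C $$ (i, j))"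
    by (intro sum.cong refl sum.swap)
  also have "\<dots> = (\<Sum>r<n. \<Sum>i<n. \<Sum>j<n. A $$ (i, r) * B $$ (r, j) * C $$ (i, j))"
    by (rule sum.swap)
  also have "\<dots> = (\<Sum>r<n. \<Sum>j<n. \<Sum>i<n. A $$ (i, r) * B $$ (r, j) * C $$ (i, j))"
    by (intro sum.cong refl sum.swap)
  also have "\<dots> = mat_pair n B (transpose_mat A * C)"
    unfolding mat_pair_def
  proof (intro sum.cong refl)
    fix r j assume "r \<in> {..<n}" "j \<in> {..<n}"
    then show "(\<Sum>i<n. A $$ (i, r) * B $$ (r, j) * C $$ (i, j)) =
        B $$ (r, j) * (transpose_mat A * C) $$ (r, j)"
      using assms
      by (simp add: mult_index_sum[of _ n n _ n] sum_distrib_left mult_ac del: index_mult_mat)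
  qed
  finally show ?thesis .
qed

lemma mat_pair_mult_right:
  assumes "A \<in> carrier_mat n n" "B \<in> carrier_mat n n" "C \<in> carrier_mat n n"
  shows "mat_pair n (A * B) C = mat_pair n A (C * transpose_mat B)"
proof -
  have "mat_pair n (A * B) C = mat_pair n (transpose_mat B * transpose_mat A) (transpose_mat C)"
    using mat_pair_transpose[of "A * B" n C] assms by (simp add: transpose_mult[of _ n n _ n])
  also have "\<dots> = mat_pair n (transpose_mat A) (B * transpose_mat C)"
    using assms by (subst mat_pair_mult_left) auto
  also have "\<dots> = mat_pair n A (C * transpose_mat B)"
    using mat_pair_transpose[of A n "C * transpose_mat B"] assms
    by (simp add: transpose_mult[of _ n n _ n])
  finally show ?thesis .
qed

subsection \<open>Symmetric matrices\<close>

definition sym_mats :: "nat \<Rightarrow> 'a mat set" where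
  "sym_mats n = {P \<in> carrier_mat n n. transpose_mat P = P}"

text \<open>The diagonal ones have the entry 2.  With this normalisation the double sums over all pairs of indices below
  count every basis vector of the space of symmetric matrices twice, diagonal or not.\<close>

definition sym_unit :: "nat \<Rightarrow> nat \<Rightarrow> nat \<Rightarrow> 'a::comm_ring_1 mat" where
  "sym_unit n i j = mat n n (\<lambda>(k, l). (if k = i \<and> l = j then 1 else 0) + (if k = j \<and> l = i then 1 else 0))"

lemma sym_matsD: "P \<in> sym_mats n \<Longrightarrow> P \<in> carrier_mat n n" "P \<in> sym_mats n \<Longrightarrow> transpose_mat P = P"
  by (auto simp: sym_mats_def)

lemma sym_matsI: "P \<in> carrier_mat n n \<Longrightarrow> transpose_mat P = P \<Longrightarrow> P \<in> sym_mats n"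
  by (auto simp: sym_mats_def)

lemma sym_mats_index:
  assumes "P \<in> sym_mats n" "i < n" "j < n"
  shows "P $$ (i, j) = P $$ (j, i)"
proof -
  have "P $$ (i, j) = transpose_mat P $$ (i, j)" using assms by (simp add: sym_matsD)
  then show ?thesis using sym_matsD(1)[OF assms(1)] assms(2,3) by simp
qed

lemma sym_mats_iff:
  "P \<in> sym_mats n \<longleftrightarrow> P \<in> carrier_mat n n \<and> (\<forall>i<n. \<forall>j<n. P $$ (i, j) = P $$ (j, i))"
proof
  assume "P \<in> carrier_mat n n \<and> (\<forall>i<n. \<forall>j<n. P $$ (i, j) = P $$ (j, i))"
  then show "P \<in> sym_mats n"
    by (intro sym_matsI eq_matI) auto
qed (auto simp: sym_matsD sym_mats_index)

lemma sym_matsI': "P \<in> carrier_mat n n \<Longrightarrow> (\<And>i j. i < n \<Longrightarrow> j < n \<Longrightarrow> P $$ (i, j) = P $$ (j, i)) \<Longrightarrow>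
    P \<in> sym_mats n"
  by (simp add: sym_mats_iff)

lemma sym_unit_index:
  "k < n \<Longrightarrow> l < n \<Longrightarrow> sym_unit n i j $$ (k, l) =
    (if k = i \<and> l = j then 1 else 0) + (if k = j \<and> l = i then 1 else 0)"
  by (simp add: sym_unit_def)

lemma sym_unit_in [simp]: "sym_unit n i j \<in> sym_mats n"
proof (rule sym_matsI')
  show "sym_unit n i j \<in> carrier_mat n n" by (simp add: sym_unit_def)
  fix k l assume "k < n" "l < n"
  then show "sym_unit n i j $$ (k, l) = (sym_unit n i j $$ (l, k) :: 'a)"
    by (simp only: sym_unit_index) (cases "k = i"; cases "l = j"; cases "k = j"; cases "l = i"; simp)
qed

lemma sym_unit_carrier [simp]: "sym_unit n i j \<in> carrier_mat n n"
  by (auto simp: sym_unit_def)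

lemma sym_unit_dim [simp]: "dim_row (sym_unit n i j) = n" "dim_col (sym_unit n i j) = n"
  by (auto simp: sym_unit_def)

lemma sym_unit_commute: "sym_unit n i j = sym_unit n j i"
  by (rule eq_matI) (auto simp: sym_unit_def)

lemma sym_mats_add:
  fixes P Q :: "'a::comm_ring_1 mat"
  assumes "P \<in> sym_mats n" "Q \<in> sym_mats n"
  shows "P + Q \<in> sym_mats n"
proof (rule sym_matsI')
  fix i j assume "i < n" "j < n"
  then show "(P + Q) $$ (i, j) = (P + Q) $$ (j, i)"
    using assms[THEN sym_matsD(1)] sym_mats_index[OF assms(1), of i j]
      sym_mats_index[OF assms(2), of i j] by simp
qed (use assms[THEN sym_matsD(1)] in simp)

lemma sym_mats_smult:
  fixes P :: "'a::comm_ring_1 mat"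
  assumes "P \<in> sym_mats n"
  shows "c \<cdot>\<^sub>m P \<in> sym_mats n"
proof (rule sym_matsI')
  fix i j assume "i < n" "j < n"
  then show "(c \<cdot>\<^sub>m P) $$ (i, j) = (c \<cdot>\<^sub>m P) $$ (j, i)"
    using sym_matsD(1)[OF assms] sym_mats_index[OF assms, of i j] by simp
qed (use sym_matsD(1)[OF assms] in simp)

lemma sym_mats_zero [simp]: "0\<^sub>m n n \<in> sym_mats n"
  by (auto simp: sym_mats_iff)

lemma mat_pair_sym_unit:
  assumes "C \<in> carrier_mat n n" "i < n" "j < n"
  shows "mat_pair n (sym_unit n i j) C = C $$ (i, j) + C $$ (j, i)"
proof -
  have *: "(\<Sum>k<n. \<Sum>l<n. (if k = a \<and> l = b then C $$ (k, l) else 0)) = C $$ (a, b)"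
    if "a < n" "b < n" for a b
  proof -
    have "(\<Sum>l<n. (if k = a \<and> l = b then C $$ (k, l) else 0)) = (if k = a then C $$ (a, b) else 0)" for k
      using that by (cases "k = a") (auto simp: sum.delta)
    then show ?thesis using that by simp
  qed
  have "mat_pair n (sym_unit n i j) C = (\<Sum>k<n. \<Sum>l<n. (if k = i \<and> l = j then C $$ (k, l) else 0)
      + (if k = j \<and> l = i then C $$ (k, l) else 0))"
    unfolding mat_pair_def
    by (intro sum.cong refl) (simp add: sym_unit_index distrib_right if_distrib[of "\<lambda>x. x * _"] cong: if_cong)
  then show ?thesis by (simp add: sum.distrib * assms)
qed

text \<open>A linear function on symmetric matrices is determined by its values on symmetrised matrix
  units; the factor one half accounts for each off-diagonal unit occurring twice.\<close>

lemma sym_linear_expand: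
  fixes f :: "'a::field_char_0 mat \<Rightarrow> 'a"
  assumes lin: "\<And>A B c. A \<in> sym_mats n \<Longrightarrow> B \<in> sym_mats n \<Longrightarrow> f (A + c \<cdot>\<^sub>m B) = f A + c * f B"
    and P: "P \<in> sym_mats n"
  shows "f P = (\<Sum>i<n. \<Sum>j<n. P $$ (i, j) * f (sym_unit n i j)) / 2"
proof -
  define PS where "PS = (\<lambda>S. mat n n (\<lambda>(k, l). \<Sum>(i, j)\<in>S. P $$ (i, j) * sym_unit n i j $$ (k, l)))"
  have f0: "f (0\<^sub>m n n) = 0"
  proof -
    have "0\<^sub>m n n + (- 1) \<cdot>\<^sub>m 0\<^sub>m n n = (0\<^sub>m n n :: 'a mat)" by auto
    then show ?thesis using lin[of "0\<^sub>m n n" "0\<^sub>m n n" "- 1"] by simp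
  qed
  have sym: "PS S \<in> sym_mats n" for S
  proof (rule sym_matsI')
    fix k l assume kl: "k < n" "l < n"
    have "(case x of (i, j) \<Rightarrow> P $$ (i, j) * sym_unit n i j $$ (k, l)) =
        (case x of (i, j) \<Rightarrow> P $$ (i, j) * sym_unit n i j $$ (l, k))" for x
      by (cases x) (simp add: sym_mats_index[OF sym_unit_in kl])
    then show "PS S $$ (k, l) = PS S $$ (l, k)" using kl by (simp add: PS_def)
  qed (simp add: PS_def)
  have step: "f (PS S) = (\<Sum>(i, j)\<in>S. P $$ (i, j) * f (sym_unit n i j))" if "finite S" for S
    using that
  proof (induction S)
    case empty
    have "PS {} = 0\<^sub>m n n" by (rule eq_matI) (auto simp: PS_def)
    then show ?case by (simp add: f0)
  next
    case (insert x S)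
    obtain i j where x: "x = (i, j)" by (cases x)
    have "PS (insert x S) = PS S + P $$ (i, j) \<cdot>\<^sub>m sym_unit n i j"
    proof (rule eq_matI)
      fix k l assume "k < dim_row (PS S + P $$ (i, j) \<cdot>\<^sub>m sym_unit n i j)"
        "l < dim_col (PS S + P $$ (i, j) \<cdot>\<^sub>m sym_unit n i j)"
      then have "k < n" "l < n" by (auto simp: sym_unit_def)
      then show "PS (insert x S) $$ (k, l) = (PS S + P $$ (i, j) \<cdot>\<^sub>m sym_unit n i j) $$ (k, l)"
        using insert(1,2)
        by (simp add: PS_def x add.commute)
    qed (auto simp: PS_def sym_unit_def)
    then show ?case using insert by (simp add: lin sym x add.commute)
  qed
  have "PS ({..<n} \<times> {..<n}) = P + 1 \<cdot>\<^sub>m P"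
  proof (rule eq_matI)
    fix k l assume "k < dim_row (P + 1 \<cdot>\<^sub>m P)" "l < dim_col (P + 1 \<cdot>\<^sub>m P)"
    then have kl: "k < n" "l < n" using sym_matsD(1)[OF P] by auto
    have "PS ({..<n} \<times> {..<n}) $$ (k, l) = (\<Sum>i<n. \<Sum>j<n. P $$ (i, j) * sym_unit n k l $$ (i, j))"
    proof -
      have "(case x of (i, j) \<Rightarrow> P $$ (i, j) * sym_unit n i j $$ (k, l)) =
          (case x of (i, j) \<Rightarrow> P $$ (i, j) * sym_unit n k l $$ (i, j))"
        if "x \<in> {..<n} \<times> {..<n}" for x
        using that kl by (cases x) (simp add: sym_unit_index eq_commute conj_commute)
      then show ?thesis
        using kl by (simp add: PS_def sum.cartesian_product cong: sum.cong)
    qed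
    also have "\<dots> = mat_pair n (sym_unit n k l) P"
      by (simp add: mat_pair_def mult.commute)
    also have "\<dots> = P $$ (k, l) + P $$ (l, k)"
      using kl sym_matsD(1)[OF P] by (simp add: mat_pair_sym_unit)
    finally show "PS ({..<n} \<times> {..<n}) $$ (k, l) = (P + 1 \<cdot>\<^sub>m P) $$ (k, l)"
      using kl sym_matsD(1)[OF P] sym_mats_index[OF P, of l k] by simp
  qed (use sym_matsD(1)[OF P] in \<open>auto simp: PS_def\<close>)
  then have "f P + f P = (\<Sum>(i, j)\<in>{..<n} \<times> {..<n}. P $$ (i, j) * f (sym_unit n i j))"
    using lin[OF P P, of 1] step[of "{..<n} \<times> {..<n}"] by simp
  then show ?thesis by (simp add: sum.cartesian_product mult.commute)
qed

lemma vec_linear_expand: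
  fixes f :: "'a::field_char_0 vec \<Rightarrow> 'a"
  assumes lin: "\<And>u v c. u \<in> carrier_vec n \<Longrightarrow> v \<in> carrier_vec n \<Longrightarrow> f (u + c \<cdot>\<^sub>v v) = f u + c * f v"
    and w: "w \<in> carrier_vec n"
  shows "f w = (\<Sum>i<n. w $ i * f (unit_vec n i))"
proof -
  define VS where "VS = (\<lambda>S. vec n (\<lambda>k. \<Sum>i\<in>S. w $ i * unit_vec n i $ k))"
  have f0: "f (0\<^sub>v n) = 0"
  proof -
    have "0\<^sub>v n + (- 1) \<cdot>\<^sub>v 0\<^sub>v n = (0\<^sub>v n :: 'a vec)" by auto
    then show ?thesis using lin[of "0\<^sub>v n" "0\<^sub>v n" "- 1"] by simp
  qed
  have step: "f (VS S) = (\<Sum>i\<in>S. w $ i * f (unit_vec n i))" if "finite S" for S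
    using that
  proof (induction S)
    case empty
    have "VS {} = 0\<^sub>v n" by (rule eq_vecI) (auto simp: VS_def)
    then show ?case by (simp add: f0)
  next
    case (insert i S)
    have "VS (insert i S) = VS S + w $ i \<cdot>\<^sub>v unit_vec n i"
      by (rule eq_vecI) (use insert(1,2) in \<open>auto simp: VS_def add.commute\<close>)
    moreover have "VS S \<in> carrier_vec n" by (simp add: VS_def)
    ultimately show ?case using insert by (simp add: lin add.commute)
  qed
  have "VS {..<n} = w"
  proof (rule eq_vecI)
    fix k assume "k < dim_vec w"
    then have k: "k < n" using w by simp
    have "VS {..<n} $ k = (\<Sum>i<n. if k = i then w $ i else 0)"
      using k by (simp add: VS_def unit_vec_def if_distrib[of "\<lambda>x. _ * x"] cong: if_cong)
    then show "VS {..<n} $ k = w $ k" using k by simp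
  qed (use w in \<open>auto simp: VS_def\<close>)
  then show ?thesis using step[of "{..<n}"] by simp
qed

lemma lie_bracket_sp: "lie_bracket (sp m) X Y = X * Y - Y * X"
  and add_sp: "X \<oplus>\<^bsub>sp m\<^esub> Y = X + Y"
  and smult_sp: "c \<odot>\<^bsub>sp m\<^esub> X = c \<cdot>\<^sub>m X"
  and zero_sp: "\<zero>\<^bsub>sp m\<^esub> = 0\<^sub>m (2 * m) (2 * m)"
  and carrier_sp: "carrier (sp m) = {X \<in> carrier_mat (2 * m) (2 * m).
    transpose_mat X * symp_J m + symp_J m * X = 0\<^sub>m (2 * m) (2 * m)}"
  by (simp_all add: sp_def)

lemmas sp_simps = lie_bracket_sp add_sp smult_sp zero_sp

lemma sp_carrier_mat: "X \<in> carrier (sp m) \<Longrightarrow> X \<in> carrier_mat (2 * m) (2 * m)"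
  by (simp add: carrier_sp)

text \<open>The inverse of \<open>P \<mapsto> P J\<close>, by \<open>J\<^sup>2 = -1\<close>.\<close>

definition sp_sym :: "nat \<Rightarrow> 'a::comm_ring_1 mat \<Rightarrow> 'a mat" where
  "sp_sym m X = - (X * symp_J m)"

lemma sp_sym_carrier: "X \<in> carrier_mat (2 * m) (2 * m) \<Longrightarrow> sp_sym m X \<in> carrier_mat (2 * m) (2 * m)"
  by (simp add: sp_sym_def)

lemma sp_sym_index:
  "X \<in> carrier_mat (2 * m) (2 * m) \<Longrightarrow> i < 2 * m \<Longrightarrow> j < 2 * m \<Longrightarrow>
    sp_sym m X $$ (i, j) = partner_sign m j * X $$ (i, partner m j)"
  by (simp add: sp_sym_def mult_symp_J_index[of _ "2 * m"] carrier_matD[of _ "2 * m" "2 * m"] del: index_mult_mat(1))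

lemma sp_iff_index:
  assumes "X \<in> carrier_mat (2 * m) (2 * m)"
  shows "X \<in> carrier (sp m) \<longleftrightarrow> (\<forall>i<2 * m. \<forall>j<2 * m.
    partner_sign m i * X $$ (partner m i, j) = partner_sign m j * X $$ (partner m j, i))"
proof -
  have "(transpose_mat X * symp_J m + symp_J m * X) $$ (i, j) =
      partner_sign m i * X $$ (partner m i, j) - partner_sign m j * X $$ (partner m j, i)"
    if "i < 2 * m" "j < 2 * m" for i j
    using that assms
    by (simp add: mult_symp_J_index[of _ "2 * m"] symp_J_mult_index[of _ _ "2 * m"] del: index_mult_mat(1))
  then have "transpose_mat X * symp_J m + symp_J m * X = 0\<^sub>m (2 * m) (2 * m) \<longleftrightarrow>
    (\<forall>i<2 * m. \<forall>j<2 * m. partner_sign m i * X $$ (partner m i, j)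
       - partner_sign m j * X $$ (partner m j, i) = 0)"
    using assms by (auto simp: mat_eq_iff simp del: index_add_mat(1) index_mult_mat(1))
  then show ?thesis using assms by (simp add: carrier_sp)
qed

lemma sp_sym_in:
  assumes "X \<in> carrier (sp m)"
  shows "sp_sym m X \<in> sym_mats (2 * m)"
proof (rule sym_matsI')
  have X: "X \<in> carrier_mat (2 * m) (2 * m)" using assms by (rule sp_carrier_mat)
  then show "sp_sym m X \<in> carrier_mat (2 * m) (2 * m)" by (rule sp_sym_carrier)
  fix i j assume ij: "i < 2 * m" "j < 2 * m"
  then have "partner_sign m (partner m i) * X $$ (partner m (partner m i), partner m j) =
      partner_sign m (partner m j) * X $$ (partner m (partner m j), partner m i)"
    using assms by (simp only: sp_iff_index[OF X] partner_less)
  then have "partner_sign m i * X $$ (i, partner m j) = partner_sign m j * X $$ (j, partner m i)"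
    using ij by simp
  then show "sp_sym m X $$ (i, j) = sp_sym m X $$ (j, i)"
    using ij by (simp add: sp_sym_index[OF X]) (auto simp: partner_sign_def, (metis minus_minus)+)
qed

lemma sp_sym_mult:
  assumes "P \<in> carrier_mat (2 * m) (2 * m)"
  shows "sp_sym m (P * symp_J m) = P"
proof (rule eq_matI)
  fix i j assume "i < dim_row P" "j < dim_col P"
  then have ij: "i < 2 * m" "j < 2 * m" using assms by auto
  then show "sp_sym m (P * symp_J m) $$ (i, j) = P $$ (i, j)"
    using assms
    by (subst sp_sym_index) (auto simp: mult_symp_J_index[of _ "2 * m"] mult.assoc[symmetric] simp del: index_mult_mat(1))
qed (use assms in \<open>auto simp: sp_sym_def\<close>)

lemma mult_sp_sym:
  assumes "X \<in> carrier_mat (2 * m) (2 * m)"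
  shows "sp_sym m X * symp_J m = X"
proof (rule eq_matI)
  fix i j assume "i < dim_row X" "j < dim_col X"
  then have ij: "i < 2 * m" "j < 2 * m" using assms by auto
  then show "(sp_sym m X * symp_J m) $$ (i, j) = X $$ (i, j)"
    using assms sp_sym_carrier[OF assms]
    by (simp add: mult_symp_J_index[of _ "2 * m"] sp_sym_index mult.assoc[symmetric] del: index_mult_mat(1))
qed (use assms in \<open>auto simp: sp_sym_def\<close>)

lemma sp_of_sym:
  fixes P :: "'a::field mat"
  assumes P: "P \<in> sym_mats (2 * m)"
  shows "P * symp_J m \<in> carrier (sp m)"
proof -
  have Pc: "P \<in> carrier_mat (2 * m) (2 * m)" using P by (rule sym_matsD)
  then have c: "P * symp_J m \<in> carrier_mat (2 * m) (2 * m)" by simp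
  show ?thesis
    unfolding sp_iff_index[OF c]
  proof (intro allI impI)
    fix i j assume ij: "i < 2 * m" "j < 2 * m"
    show "partner_sign m i * (P * symp_J m) $$ (partner m i, j) =
        partner_sign m j * (P * symp_J m) $$ (partner m j, i)"
      using ij Pc sym_mats_index[OF P, of "partner m i" "partner m j"]
      by (simp add: mult_symp_J_index[of _ "2 * m"] del: index_mult_mat(1))
  qed
qed

lemma sp_carrierE:
  assumes "X \<in> carrier (sp m)"
  obtains P where "P \<in> sym_mats (2 * m)" "X = P * symp_J m"
  using sp_sym_in[OF assms] mult_sp_sym[OF sp_carrier_mat[OF assms]] by metis

lemma sp_skew:
  fixes X :: "'a::field mat"
  assumes "X \<in> carrier (sp m)"
  shows "symp_J m * X = - (transpose_mat X * symp_J m)"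
proof (rule eq_matI)
  have X: "X \<in> carrier_mat (2 * m) (2 * m)" using assms by (rule sp_carrier_mat)
  fix i j assume "i < dim_row (- (transpose_mat X * symp_J m))" "j < dim_col (- (transpose_mat X * symp_J m))"
  then have ij: "i < 2 * m" "j < 2 * m" using X by auto
  then show "(symp_J m * X) $$ (i, j) = (- (transpose_mat X * symp_J m)) $$ (i, j)"
    using X assms[unfolded sp_iff_index[OF X]]
    by (simp add: mult_symp_J_index[of _ "2 * m"] symp_J_mult_index[of _ _ "2 * m"] del: index_mult_mat(1))
qed (use sp_carrier_mat[OF assms] in auto)

lemma sym_mats_plus_transpose:
  fixes R :: "'a::comm_ring_1 mat"
  assumes "R \<in> carrier_mat n n"
  shows "R + transpose_mat R \<in> sym_mats n"
  by (rule sym_matsI') (use assms in \<open>auto simp: add.commute\<close>)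

lemma sp_bracket_sym:
  fixes X :: "'a::field mat"
  assumes X: "X \<in> carrier (sp m)" and Q: "Q \<in> sym_mats (2 * m)"
  shows "lie_bracket (sp m) X (Q * symp_J m) = (X * Q + transpose_mat (X * Q)) * symp_J m"
proof -
  let ?n = "2 * m" and ?J = "symp_J m :: 'a mat"
  have Xc: "X \<in> carrier_mat ?n ?n" using X by (rule sp_carrier_mat)
  have Qc: "Q \<in> carrier_mat ?n ?n" using Q by (rule sym_matsD)
  have "Q * ?J * X = Q * (?J * X)" using Xc Qc by (simp add: assoc_mult_mat[of _ ?n ?n _ ?n _ ?n])
  also have "\<dots> = - (Q * transpose_mat X * ?J)"
    using Xc Qc by (simp add: sp_skew[OF X] assoc_mult_mat[of _ ?n ?n _ ?n _ ?n])
  also have "Q * transpose_mat X = transpose_mat (X * Q)"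
    using Xc Qc sym_matsD(2)[OF Q] by (simp add: transpose_mult[of _ ?n ?n _ ?n])
  finally have "Q * ?J * X = - (transpose_mat (X * Q) * ?J)" .
  moreover have "X * (Q * ?J) = X * Q * ?J"
    using Xc Qc by (simp add: assoc_mult_mat[of _ ?n ?n _ ?n _ ?n])
  moreover have "(X * Q + transpose_mat (X * Q)) * ?J = X * Q * ?J + transpose_mat (X * Q) * ?J"
    using Xc Qc by (intro add_mult_distrib_mat[of _ ?n ?n _ _ ?n]) auto
  ultimately show ?thesis
    unfolding lie_bracket_sp using Xc Qc
    by (intro eq_matI) (auto simp del: index_mult_mat(1))
qed

lemma sp_bracket_closed:
  fixes X Y :: "'a::field mat"
  assumes X: "X \<in> carrier (sp m)" and Y: "Y \<in> carrier (sp m)"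
  shows "lie_bracket (sp m) X Y \<in> carrier (sp m)"
proof -
  obtain Q where Q: "Q \<in> sym_mats (2 * m)" "Y = Q * symp_J m" using Y by (rule sp_carrierE)
  have "X * Q \<in> carrier_mat (2 * m) (2 * m)"
    using sp_carrier_mat[OF X] sym_matsD(1)[OF Q(1)] by simp
  then show ?thesis
    unfolding Q(2) sp_bracket_sym[OF X Q(1)] by (intro sp_of_sym sym_mats_plus_transpose)
qed

lemma sp_add_closed:
  fixes X Y :: "'a::field mat"
  assumes "X \<in> carrier (sp m)" "Y \<in> carrier (sp m)"
  shows "X + Y \<in> carrier (sp m)"
proof -
  obtain P where P: "P \<in> sym_mats (2 * m)" "X = P * symp_J m" using assms(1) by (rule sp_carrierE)
  obtain Q where Q: "Q \<in> sym_mats (2 * m)" "Y = Q * symp_J m" using assms(2) by (rule sp_carrierE)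
  have "X + Y = (P + Q) * symp_J m"
    using P(2) Q(2) sym_matsD(1)[OF P(1)] sym_matsD(1)[OF Q(1)]
    by (simp add: add_mult_distrib_mat[of _ "2 * m" "2 * m" _ _ "2 * m"])
  then show ?thesis using sp_of_sym[OF sym_mats_add[OF P(1) Q(1)]] by simp
qed

lemma sp_smult_closed:
  fixes X :: "'a::field mat"
  assumes "X \<in> carrier (sp m)"
  shows "c \<cdot>\<^sub>m X \<in> carrier (sp m)"
proof -
  obtain P where P: "P \<in> sym_mats (2 * m)" "X = P * symp_J m" using assms(1) by (rule sp_carrierE)
  have "c \<cdot>\<^sub>m X = (c \<cdot>\<^sub>m P) * symp_J m"
    using P sym_matsD(1)[OF P(1)] by (simp add: mult_smult_assoc_mat[of _ "2 * m" "2 * m" _ "2 * m"])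
  then show ?thesis using sp_of_sym[OF sym_mats_smult[OF P(1)]] by simp
qed

lemma bracket_add_mat:
  fixes X Y Z :: "'a::comm_ring_1 mat"
  assumes "X \<in> carrier_mat n n" "Y \<in> carrier_mat n n" "Z \<in> carrier_mat n n"
  shows "X * (Y + Z) - (Y + Z) * X = (X * Y - Y * X) + (X * Z - Z * X)"
  using assms
  by (simp add: mult_add_distrib_mat[of _ n n _ n] add_mult_distrib_mat[of _ n n _ _ n])
     (auto intro!: eq_matI simp del: index_mult_mat(1))

lemma bracket_smult_mat:
  fixes X Y :: "'a::comm_ring_1 mat"
  assumes "X \<in> carrier_mat n n" "Y \<in> carrier_mat n n"
  shows "X * (c \<cdot>\<^sub>m Y) - (c \<cdot>\<^sub>m Y) * X = c \<cdot>\<^sub>m (X * Y - Y * X)"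
  using assms
  by (simp add: mult_smult_distrib[of _ n n _ n] mult_smult_assoc_mat[of _ n n _ n])
     (auto intro!: eq_matI simp: algebra_simps simp del: index_mult_mat(1))

lemma lin_lie_sp: "lin_lie (sp m :: ('a::field_char_0, 'a mat) lie_algebra)"
  by unfold_locales
     (auto simp: add_sp smult_sp intro: sp_add_closed sp_smult_closed sp_bracket_closed,
      auto simp: lie_bracket_sp intro!: bracket_add_mat bracket_smult_mat dest: sp_carrier_mat)

lemma sp_dual_expand:
  fixes \<gamma> :: "'a::field_char_0 mat \<Rightarrow> 'a"
  assumes \<gamma>: "\<gamma> \<in> lie_dual (sp m)" and P: "P \<in> sym_mats (2 * m)"
  shows "\<gamma> (P * symp_J m) =
    (\<Sum>i<2 * m. \<Sum>j<2 * m. P $$ (i, j) * \<gamma> (sym_unit (2 * m) i j * symp_J m)) / 2"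
proof (rule sym_linear_expand[OF _ P])
  fix A B :: "'a mat" and c
  assume A: "A \<in> sym_mats (2 * m)" and B: "B \<in> sym_mats (2 * m)"
  have "(A + c \<cdot>\<^sub>m B) * symp_J m = A * symp_J m + c \<cdot>\<^sub>m (B * symp_J m)"
    using sym_matsD(1)[OF A] sym_matsD(1)[OF B]
    by (simp add: add_mult_distrib_mat[of _ "2 * m" "2 * m" _ _ "2 * m"]
      mult_smult_assoc_mat[of _ "2 * m" "2 * m" _ "2 * m"])
  then show "\<gamma> ((A + c \<cdot>\<^sub>m B) * symp_J m) = \<gamma> (A * symp_J m) + c * \<gamma> (B * symp_J m)"
    using \<gamma> sp_of_sym[OF A] sp_of_sym[OF B] sp_smult_closed[OF sp_of_sym[OF B]]
    by (simp add: lie_dual_def sp_simps)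
qed

section \<open>The semidirect product and its dual space\<close>

lemma sp_semidirect_simps:
  "carrier (sp_semidirect m) = carrier (sp m) \<times> carrier_vec (2 * m)"
  "(X, u) \<oplus>\<^bsub>sp_semidirect m\<^esub> (Y, w) = (X + Y, u + w)"
  "c \<odot>\<^bsub>sp_semidirect m\<^esub> (X, u) = (c \<cdot>\<^sub>m X, c \<cdot>\<^sub>v u)"
  "\<zero>\<^bsub>sp_semidirect m\<^esub> = (0\<^sub>m (2 * m) (2 * m), 0\<^sub>v (2 * m))"
  "lie_bracket (sp_semidirect m) (X, u) (Y, w) = (X * Y - Y * X, X *\<^sub>v w - Y *\<^sub>v u)"
  by (simp_all add: sp_semidirect_def)

lemma lin_lie_sp_semidirect:
  "lin_lie (sp_semidirect m :: ('a::field_char_0, 'a mat \<times> 'a vec) lie_algebra)"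
proof -
  interpret S: lin_lie "sp m :: ('a, 'a mat) lie_algebra" by (rule lin_lie_sp)
  show ?thesis
  proof unfold_locales
    fix x y z :: "'a mat \<times> 'a vec" and c
    assume x: "x \<in> carrier (sp_semidirect m)" and y: "y \<in> carrier (sp_semidirect m)"
      and z: "z \<in> carrier (sp_semidirect m)"
    obtain X u where xX: "x = (X, u)" by (cases x)
    obtain Y v where yY: "y = (Y, v)" by (cases y)
    obtain Z w where zZ: "z = (Z, w)" by (cases z)
    have c: "X \<in> carrier (sp m)" "u \<in> carrier_vec (2 * m)" "Y \<in> carrier (sp m)"
      "v \<in> carrier_vec (2 * m)" "Z \<in> carrier (sp m)" "w \<in> carrier_vec (2 * m)"
      using x y z by (auto simp: xX yY zZ sp_semidirect_simps)
    note d = c(1)[THEN sp_carrier_mat] c(3)[THEN sp_carrier_mat] c(5)[THEN sp_carrier_mat]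
    have "X *\<^sub>v (v + w) - (Y + Z) *\<^sub>v u = (X *\<^sub>v v - Y *\<^sub>v u) + (X *\<^sub>v w - Z *\<^sub>v u)"
      using c d
      by (simp add: mult_add_distrib_mat_vec[of _ "2 * m" "2 * m"]
        add_mult_distrib_mat_vec[of _ "2 * m" "2 * m"])
         (auto intro!: eq_vecI simp del: index_mult_mat_vec)
    then show "lie_bracket (sp_semidirect m) x (y \<oplus>\<^bsub>sp_semidirect m\<^esub> z) =
        lie_bracket (sp_semidirect m) x y \<oplus>\<^bsub>sp_semidirect m\<^esub> lie_bracket (sp_semidirect m) x z"
      using bracket_add_mat[OF d] by (simp add: xX yY zZ sp_semidirect_simps)
  next
    fix x y :: "'a mat \<times> 'a vec" and c
    assume x: "x \<in> carrier (sp_semidirect m)" and y: "y \<in> carrier (sp_semidirect m)"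
    obtain X u where xX: "x = (X, u)" by (cases x)
    obtain Y v where yY: "y = (Y, v)" by (cases y)
    have c: "X \<in> carrier (sp m)" "u \<in> carrier_vec (2 * m)" "Y \<in> carrier (sp m)"
      "v \<in> carrier_vec (2 * m)"
      using x y by (auto simp: xX yY sp_semidirect_simps)
    note d = c(1)[THEN sp_carrier_mat] c(3)[THEN sp_carrier_mat]
    have "X *\<^sub>v (c \<cdot>\<^sub>v v) - (c \<cdot>\<^sub>m Y) *\<^sub>v u = c \<cdot>\<^sub>v (X *\<^sub>v v - Y *\<^sub>v u)"
    proof (rule eq_vecI)
      fix i assume "i < dim_vec (c \<cdot>\<^sub>v (X *\<^sub>v v - Y *\<^sub>v u))"
      then have "i < 2 * m" using c d by auto
      then show "(X *\<^sub>v (c \<cdot>\<^sub>v v) - (c \<cdot>\<^sub>m Y) *\<^sub>v u) $ i = (c \<cdot>\<^sub>v (X *\<^sub>v v - Y *\<^sub>v u)) $ i"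
        using c d by (simp add: algebra_simps)
    qed (use c d in auto)
    then show "lie_bracket (sp_semidirect m) x (c \<odot>\<^bsub>sp_semidirect m\<^esub> y) =
        c \<odot>\<^bsub>sp_semidirect m\<^esub> lie_bracket (sp_semidirect m) x y"
      using bracket_smult_mat[OF d] by (simp add: xX yY sp_semidirect_simps)
    show "x \<oplus>\<^bsub>sp_semidirect m\<^esub> y \<in> carrier (sp_semidirect m)"
      using c by (simp add: xX yY sp_semidirect_simps sp_add_closed)
    show "lie_bracket (sp_semidirect m) x y \<in> carrier (sp_semidirect m)"
      using c d sp_bracket_closed[OF c(1,3)] by (simp add: xX yY sp_semidirect_simps lie_bracket_sp)
  next
    fix x :: "'a mat \<times> 'a vec" and c
    assume x: "x \<in> carrier (sp_semidirect m)"
    then show "c \<odot>\<^bsub>sp_semidirect m\<^esub> x \<in> carrier (sp_semidirect m)"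
      by (cases x) (auto simp: sp_semidirect_simps sp_smult_closed)
  qed
qed

lemma semidirect_dual_expand:
  fixes \<gamma> :: "'a::field_char_0 mat \<times> 'a vec \<Rightarrow> 'a"
  assumes \<gamma>: "\<gamma> \<in> lie_dual (sp_semidirect m)" and P: "P \<in> sym_mats (2 * m)"
    and w: "w \<in> carrier_vec (2 * m)"
  shows "\<gamma> (P * symp_J m, w) =
    (\<Sum>i<2 * m. \<Sum>j<2 * m. P $$ (i, j) * \<gamma> (sym_unit (2 * m) i j * symp_J m, 0\<^sub>v (2 * m))) / 2 +
    (\<Sum>i<2 * m. w $ i * \<gamma> (0\<^sub>m (2 * m) (2 * m), unit_vec (2 * m) i))"
proof -
  let ?n = "2 * m"
  have add: "\<gamma> (X + Y, u + v) = \<gamma> (X, u) + \<gamma> (Y, v)"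
    if "X \<in> carrier (sp m)" "Y \<in> carrier (sp m)" "u \<in> carrier_vec ?n" "v \<in> carrier_vec ?n" for X Y u v
    using \<gamma> that by (auto simp: lie_dual_def sp_semidirect_simps)
  have smult: "\<gamma> (c \<cdot>\<^sub>m X, c \<cdot>\<^sub>v u) = c * \<gamma> (X, u)"
    if "X \<in> carrier (sp m)" "u \<in> carrier_vec ?n" for X u c
    using \<gamma> that by (auto simp: lie_dual_def sp_semidirect_simps)
  have zero: "0\<^sub>m ?n ?n \<in> carrier (sp m :: ('a, 'a mat) lie_algebra)"
    by (simp add: carrier_sp)
  have PJ: "P * symp_J m \<in> carrier (sp m)" using P by (rule sp_of_sym)
  have "\<gamma> (P * symp_J m, 0\<^sub>v ?n) = (\<Sum>i<?n. \<Sum>j<?n. P $$ (i, j) * \<gamma> (sym_unit ?n i j * symp_J m, 0\<^sub>v ?n)) / 2"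
  proof (rule sym_linear_expand[OF _ P])
    fix A B :: "'a mat" and c
    assume A: "A \<in> sym_mats ?n" and B: "B \<in> sym_mats ?n"
    have "(A + c \<cdot>\<^sub>m B) * symp_J m = A * symp_J m + c \<cdot>\<^sub>m (B * symp_J m)"
      using sym_matsD(1)[OF A] sym_matsD(1)[OF B]
      by (simp add: add_mult_distrib_mat[of _ "2 * m" "2 * m" _ _ "2 * m"]
        mult_smult_assoc_mat[of _ "2 * m" "2 * m" _ "2 * m"])
    moreover have "(0\<^sub>v ?n :: 'a vec) = 0\<^sub>v ?n + c \<cdot>\<^sub>v 0\<^sub>v ?n" by auto
    ultimately show "\<gamma> ((A + c \<cdot>\<^sub>m B) * symp_J m, 0\<^sub>v ?n) =
        \<gamma> (A * symp_J m, 0\<^sub>v ?n) + c * \<gamma> (B * symp_J m, 0\<^sub>v ?n)"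
      using add[of "A * symp_J m" "c \<cdot>\<^sub>m (B * symp_J m)" "0\<^sub>v ?n" "c \<cdot>\<^sub>v 0\<^sub>v ?n"]
        smult[of "B * symp_J m" "0\<^sub>v ?n" c] sp_of_sym[OF A] sp_of_sym[OF B]
        sp_smult_closed[OF sp_of_sym[OF B]] by simp
  qed
  moreover have "\<gamma> (0\<^sub>m ?n ?n, w) = (\<Sum>i<?n. w $ i * \<gamma> (0\<^sub>m ?n ?n, unit_vec ?n i))"
  proof (rule vec_linear_expand[OF _ w])
    fix u v :: "'a vec" and c
    assume uv: "u \<in> carrier_vec ?n" "v \<in> carrier_vec ?n"
    have "(0\<^sub>m ?n ?n :: 'a mat) = 0\<^sub>m ?n ?n + c \<cdot>\<^sub>m 0\<^sub>m ?n ?n" by (rule eq_matI) auto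
    then show "\<gamma> (0\<^sub>m ?n ?n, u + c \<cdot>\<^sub>v v) = \<gamma> (0\<^sub>m ?n ?n, u) + c * \<gamma> (0\<^sub>m ?n ?n, v)"
      using add[of "0\<^sub>m ?n ?n" "c \<cdot>\<^sub>m 0\<^sub>m ?n ?n" u "c \<cdot>\<^sub>v v"] smult[of "0\<^sub>m ?n ?n" v c] uv zero
      by simp
  qed
  moreover have "\<gamma> (P * symp_J m, w) = \<gamma> (P * symp_J m, 0\<^sub>v ?n) + \<gamma> (0\<^sub>m ?n ?n, w)"
    using add[OF PJ zero, of "0\<^sub>v ?n" w] w sp_carrier_mat[OF PJ] by simp
  ultimately show ?thesis by simp
qed

text \<open>Coordinates \<open>(T, p)\<close> on the dual space: the functional with coordinates \<open>(T, p)\<close> sends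
  \<open>(P J, w)\<close> to \<open>b\<close> times the sum of the trace pairing of \<open>T\<close> with \<open>P\<close> and of \<open>2 p \<bullet> w\<close>.  The scalar
  \<open>b\<close> keeps track of the chosen invariant form.\<close>

definition mat_coord :: "'a::field_char_0 \<Rightarrow> nat \<Rightarrow> ('a mat \<times> 'a vec \<Rightarrow> 'a) \<Rightarrow> 'a mat" where
  "mat_coord b m \<gamma> = mat (2 * m) (2 * m)
     (\<lambda>(i, j). \<gamma> (sym_unit (2 * m) i j * symp_J m, 0\<^sub>v (2 * m)) / (2 * b))"

definition vec_coord :: "'a::field_char_0 \<Rightarrow> nat \<Rightarrow> ('a mat \<times> 'a vec \<Rightarrow> 'a) \<Rightarrow> 'a vec" where
  "vec_coord b m \<gamma> = vec (2 * m) (\<lambda>i. \<gamma> (0\<^sub>m (2 * m) (2 * m), unit_vec (2 * m) i) / (2 * b))"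

definition of_coords :: "'a::field_char_0 \<Rightarrow> nat \<Rightarrow> 'a mat \<Rightarrow> 'a vec \<Rightarrow> 'a mat \<times> 'a vec \<Rightarrow> 'a" where
  "of_coords b m T p = (\<lambda>(X, w)\<in>carrier (sp_semidirect m).
     b * (mat_pair (2 * m) T (sp_sym m X) + 2 * (\<Sum>i<2 * m. p $ i * w $ i)))"

lemma mat_coord_carrier [simp]: "mat_coord b m \<gamma> \<in> carrier_mat (2 * m) (2 * m)"
  by (simp add: mat_coord_def)

lemma vec_coord_carrier [simp]: "vec_coord b m \<gamma> \<in> carrier_vec (2 * m)"
  by (simp add: vec_coord_def)

lemma mat_coord_sym: "mat_coord b m \<gamma> \<in> sym_mats (2 * m)"
  by (rule sym_matsI') (simp_all add: mat_coord_def sym_unit_commute[of "2 * m"])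

lemma zero_in_sp: "0\<^sub>m (2 * m) (2 * m) \<in> carrier (sp m)"
  by (simp add: carrier_sp)

lemma sp_sym_add:
  assumes "X \<in> carrier_mat (2 * m) (2 * m)" "Y \<in> carrier_mat (2 * m) (2 * m)"
  shows "sp_sym m (X + Y) = sp_sym m X + sp_sym m Y"
  by (rule eq_matI)
     (use assms in \<open>auto simp: sp_sym_index sp_sym_def[of m "X"] sp_sym_def[of m "Y"] sp_sym_def[of m "X + Y"]
        add_mult_distrib_mat[of _ "2 * m" "2 * m" _ _ "2 * m"] simp del: index_mult_mat(1)\<close>)

lemma sp_sym_smult:
  assumes "X \<in> carrier_mat (2 * m) (2 * m)"
  shows "sp_sym m (c \<cdot>\<^sub>m X) = c \<cdot>\<^sub>m sp_sym m X"
  by (rule eq_matI)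
     (use assms in \<open>auto simp: sp_sym_def mult_smult_assoc_mat[of _ "2 * m" "2 * m" _ "2 * m"]
        simp del: index_mult_mat(1)\<close>)

lemma sp_sym_zero: "sp_sym m (0\<^sub>m (2 * m) (2 * m) :: 'a::comm_ring_1 mat) = 0\<^sub>m (2 * m) (2 * m)"
  by (rule eq_matI) (auto simp: sp_sym_def)

lemma of_coords_in: "of_coords b m T p \<in> lie_dual (sp_semidirect m)"
proof -
  have 1: "mat_pair (2 * m) T (sp_sym m (X + Y)) = mat_pair (2 * m) T (sp_sym m X) + mat_pair (2 * m) T (sp_sym m Y)"
    if "X \<in> carrier (sp m)" "Y \<in> carrier (sp m)" for X Y :: "'a mat"
    using that[THEN sp_carrier_mat]
    by (simp add: sp_sym_add mat_pair_def algebra_simps sum.distrib sp_sym_carrier[THEN carrier_matD(1)] sp_sym_carrier[THEN carrier_matD(2)])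
  have 2: "mat_pair (2 * m) T (sp_sym m (c \<cdot>\<^sub>m X)) = c * mat_pair (2 * m) T (sp_sym m X)"
    if "X \<in> carrier (sp m)" for X :: "'a mat" and c
    using that[THEN sp_carrier_mat]
    by (simp add: sp_sym_smult mat_pair_def algebra_simps sum_distrib_left sp_sym_carrier[THEN carrier_matD(1)] sp_sym_carrier[THEN carrier_matD(2)])
  show ?thesis
    by (auto simp: lie_dual_def of_coords_def sp_semidirect_simps sp_add_closed sp_smult_closed 1 2
        distrib_left sum.distrib)
       (simp_all add: algebra_simps sum_distrib_left)
qed

lemma of_coords_apply:
  assumes "P \<in> sym_mats (2 * m)" "w \<in> carrier_vec (2 * m)"
  shows "of_coords b m T p (P * symp_J m, w) = b * (mat_pair (2 * m) T P + 2 * (\<Sum>i<2 * m. p $ i * w $ i))"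
  using assms sp_of_sym[OF assms(1)] sp_sym_mult[OF sym_matsD(1)[OF assms(1)]]
  by (simp add: of_coords_def sp_semidirect_simps)

lemma of_coords_coords:
  assumes b: "b \<noteq> 0" and \<gamma>: "\<gamma> \<in> lie_dual (sp_semidirect m)"
  shows "of_coords b m (mat_coord b m \<gamma>) (vec_coord b m \<gamma>) = \<gamma>"
proof (rule lin_lie.dual_eqI[OF lin_lie_sp_semidirect of_coords_in \<gamma>])
  fix x assume "x \<in> carrier (sp_semidirect m :: ('a, 'a mat \<times> 'a vec) lie_algebra)"
  then obtain X w where x: "x = (X, w)" "X \<in> carrier (sp m)" "w \<in> carrier_vec (2 * m)"
    by (auto simp: sp_semidirect_simps)
  obtain P where P: "P \<in> sym_mats (2 * m)" "X = P * symp_J m" using x(2) by (rule sp_carrierE)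
  show "of_coords b m (mat_coord b m \<gamma>) (vec_coord b m \<gamma>) x = \<gamma> x"
    unfolding x(1) P(2) of_coords_apply[OF P(1) x(3)] semidirect_dual_expand[OF \<gamma> P(1) x(3)] mat_pair_def
    using b by (simp add: mat_coord_def vec_coord_def sum_distrib_left sum_divide_distrib algebra_simps)
qed

lemma mat_coord_of_coords:
  assumes b: "b \<noteq> 0" and T: "T \<in> sym_mats (2 * m)"
  shows "mat_coord b m (of_coords b m T p) = T"
proof (rule eq_matI)
  have Tc: "T \<in> carrier_mat (2 * m) (2 * m)" using T by (rule sym_matsD)
  fix i j assume "i < dim_row T" "j < dim_col T"
  then have ij: "i < 2 * m" "j < 2 * m" using Tc by auto
  have "mat_pair (2 * m) T (sym_unit (2 * m) i j) = 2 * T $$ (i, j)"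
    using mat_pair_sym_unit[OF Tc ij] sym_mats_index[OF T ij] by (simp add: mat_pair_sym[of _ T])
  then show "mat_coord b m (of_coords b m T p) $$ (i, j) = T $$ (i, j)"
    using ij b by (simp add: mat_coord_def of_coords_apply)
qed (use sym_matsD(1)[OF T] in \<open>auto simp: mat_coord_def\<close>)

lemma zero_mult_symp_J: "0\<^sub>m (2 * m) (2 * m) * symp_J m = (0\<^sub>m (2 * m) (2 * m) :: 'a::comm_ring_1 mat)"
  by (rule left_mult_zero_mat) simp

lemma vec_coord_of_coords:
  assumes b: "b \<noteq> 0" and p: "p \<in> carrier_vec (2 * m)"
  shows "vec_coord b m (of_coords b m T p) = p"
proof (rule eq_vecI)
  fix i assume "i < dim_vec p"
  then have i: "i < 2 * m" using p by auto
  have "of_coords b m T p (0\<^sub>m (2 * m) (2 * m), unit_vec (2 * m) i) =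
      b * (mat_pair (2 * m) T (0\<^sub>m (2 * m) (2 * m)) + 2 * (\<Sum>k<2 * m. p $ k * unit_vec (2 * m) i $ k))"
    using of_coords_apply[OF sym_mats_zero unit_vec_carrier, of b m T p i] by (simp only: zero_mult_symp_J)
  also have "(\<Sum>k<2 * m. p $ k * unit_vec (2 * m) i $ k) = (\<Sum>k<2 * m. if k = i then p $ k else 0)"
    using i by (intro sum.cong) (auto simp: unit_vec_def)
  also have "\<dots> = p $ i" using i by simp
  finally show "vec_coord b m (of_coords b m T p) $ i = p $ i"
    using i b by (simp add: vec_coord_def mat_pair_def)
qed (use p in \<open>auto simp: vec_coord_def\<close>)

text \<open>Under the identification \<open>(T, p)\<close> of the dual space the element \<open>(X, a)\<close> acts by \<open>X\<^sup>T T + T X\<close> and \<open>X\<^sup>T p\<close>,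
  and the translation part subtracts the symmetric product of \<open>p\<close> and \<open>J a\<close> from the first of these.  The bracket with \<open>(P J, w)\<close> is the
  symmetric matrix \<open>X P + (X P)\<^sup>T\<close> and the vector \<open>X w - P J a\<close>; transposing the linear maps gives the formula.\<close>

lemma coad_of_coords:
  fixes X T :: "'a::field_char_0 mat"
  assumes X: "X \<in> carrier (sp m)" and a: "a \<in> carrier_vec (2 * m)"
    and T: "T \<in> sym_mats (2 * m)" and p: "p \<in> carrier_vec (2 * m)"
  defines "a' \<equiv> symp_J m *\<^sub>v a"
  shows "coad (sp_semidirect m) (X, a) (of_coords b m T p) =
    of_coords b m (mat (2 * m) (2 * m) (\<lambda>(i, j). (transpose_mat X * T) $$ (i, j) + (T * X) $$ (i, j)
        - (p $ i * a' $ j + a' $ i * p $ j)))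
      (transpose_mat X *\<^sub>v p)" (is "_ = of_coords b m ?T' ?p'")
proof (rule lin_lie.dual_eqI[OF lin_lie_sp_semidirect])
  let ?n = "2 * m" and ?J = "symp_J m :: 'a mat" and ?s = "sp_semidirect m :: ('a, 'a mat \<times> 'a vec) lie_algebra"
  have xa: "(X, a) \<in> carrier ?s" using X a by (simp add: sp_semidirect_simps)
  show "coad ?s (X, a) (of_coords b m T p) \<in> lie_dual ?s"
    by (rule lin_lie.coad_in[OF lin_lie_sp_semidirect xa of_coords_in])
  show "of_coords b m ?T' ?p' \<in> lie_dual ?s" by (rule of_coords_in)
  fix y assume "y \<in> carrier ?s"
  then obtain Y w where y: "y = (Y, w)" "Y \<in> carrier (sp m)" "w \<in> carrier_vec ?n"
    by (auto simp: sp_semidirect_simps)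
  obtain P where P: "P \<in> sym_mats ?n" "Y = P * ?J" using y(2) by (rule sp_carrierE)
  have Xc: "X \<in> carrier_mat ?n ?n" using X by (rule sp_carrier_mat)
  have Pc: "P \<in> carrier_mat ?n ?n" and Tc: "T \<in> carrier_mat ?n ?n" using P T by (auto dest: sym_matsD)
  have a'c: "a' \<in> carrier_vec ?n" unfolding a'_def using a by (intro mult_mat_vec_carrier) auto
  have R: "X * P + transpose_mat (X * P) \<in> sym_mats ?n"
    using Xc Pc by (intro sym_mats_plus_transpose) simp
  have wc: "X *\<^sub>v w - (P * ?J) *\<^sub>v a \<in> carrier_vec ?n"
    using Xc Pc a y(3) by (intro minus_carrier_vec mult_mat_vec_carrier[of _ ?n ?n]) auto
  have Pa: "(P * ?J) *\<^sub>v a = P *\<^sub>v a'"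
    unfolding a'_def using Pc a by (simp add: assoc_mult_mat_vec[of _ ?n ?n _ ?n])
  have "coad ?s (X, a) (of_coords b m T p) y =
      of_coords b m T p ((X * P + transpose_mat (X * P)) * ?J, X *\<^sub>v w - (P * ?J) *\<^sub>v a)"
    using sp_bracket_sym[OF X P(1)] \<open>y \<in> carrier ?s\<close>
    by (simp add: coad_def y(1) P(2) sp_semidirect_simps lie_bracket_sp)
  also have "\<dots> = b * (mat_pair ?n T (X * P + transpose_mat (X * P)) +
      2 * (\<Sum>i<?n. p $ i * (X *\<^sub>v w - P *\<^sub>v a') $ i))"
    using of_coords_apply[OF R wc] by (simp add: Pa)
  also have "mat_pair ?n T (X * P + transpose_mat (X * P)) = mat_pair ?n (transpose_mat X * T + T * X) P"
  proof -
    have "mat_pair ?n T (X * P + transpose_mat (X * P)) = mat_pair ?n (X * P) T + mat_pair ?n (transpose_mat (X * P)) T"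
      using Xc Pc Tc by (subst mat_pair_sym) (simp add: mat_pair_add)
    moreover have "mat_pair ?n (transpose_mat (X * P)) T = mat_pair ?n (P * transpose_mat X) T"
      using Xc Pc sym_matsD(2)[OF P(1)] by (simp add: transpose_mult[of _ ?n ?n _ ?n])
    moreover have "mat_pair ?n (X * P) T = mat_pair ?n P (transpose_mat X * T)"
      using Xc Pc Tc by (intro mat_pair_mult_left)
    moreover have "mat_pair ?n (P * transpose_mat X) T = mat_pair ?n P (T * X)"
      using Xc Pc Tc mat_pair_mult_right[of P ?n "transpose_mat X" T] by simp
    ultimately show ?thesis
      using Xc Pc Tc by (simp add: mat_pair_add mat_pair_sym[of _ P])
  qed
  also have "(\<Sum>i<?n. p $ i * (X *\<^sub>v w - P *\<^sub>v a') $ i) =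
      (\<Sum>i<?n. ?p' $ i * w $ i) - (\<Sum>i<?n. \<Sum>j<?n. p $ i * P $$ (i, j) * a' $ j)"
  proof -
    have "(\<Sum>i<?n. p $ i * (X *\<^sub>v w - P *\<^sub>v a') $ i) =
        (\<Sum>i<?n. \<Sum>j<?n. p $ i * X $$ (i, j) * w $ j) - (\<Sum>i<?n. \<Sum>j<?n. p $ i * P $$ (i, j) * a' $ j)"
      using Xc Pc y(3) a'c
      by (simp add: scalar_prod_def algebra_simps sum_subtractf sum_distrib_left atLeast0LessThan)
    also have "(\<Sum>i<?n. \<Sum>j<?n. p $ i * X $$ (i, j) * w $ j) = (\<Sum>j<?n. \<Sum>i<?n. p $ i * X $$ (i, j) * w $ j)"
      by (rule sum.swap)
    also have "\<dots> = (\<Sum>i<?n. ?p' $ i * w $ i)"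
      using Xc p by (simp add: scalar_prod_def algebra_simps sum_distrib_left atLeast0LessThan)
    finally show ?thesis .
  qed
  finally have **: "coad ?s (X, a) (of_coords b m T p) y = b * (mat_pair ?n (transpose_mat X * T + T * X) P +
      2 * ((\<Sum>i<?n. ?p' $ i * w $ i) - (\<Sum>i<?n. \<Sum>j<?n. p $ i * P $$ (i, j) * a' $ j)))" .
  have sw: "2 * (\<Sum>i<?n. \<Sum>j<?n. p $ i * P $$ (i, j) * a' $ j) =
      (\<Sum>i<?n. \<Sum>j<?n. (p $ i * a' $ j + a' $ i * p $ j) * P $$ (i, j))"
  proof -
    have "(\<Sum>i<?n. \<Sum>j<?n. p $ i * P $$ (i, j) * a' $ j) = (\<Sum>i<?n. \<Sum>j<?n. p $ j * P $$ (i, j) * a' $ i)"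
      by (subst sum.swap) (intro sum.cong refl, use sym_mats_index[OF P(1)] in auto)
    then have "2 * (\<Sum>i<?n. \<Sum>j<?n. p $ i * P $$ (i, j) * a' $ j) =
        (\<Sum>i<?n. \<Sum>j<?n. p $ i * P $$ (i, j) * a' $ j) + (\<Sum>i<?n. \<Sum>j<?n. p $ j * P $$ (i, j) * a' $ i)"
      by simp
    then show ?thesis by (simp add: sum.distrib[symmetric] algebra_simps)
  qed
  have *: "coad ?s (X, a) (of_coords b m T p) y = b * (mat_pair ?n (transpose_mat X * T + T * X) P +
      (2 * (\<Sum>i<?n. ?p' $ i * w $ i) - (\<Sum>i<?n. \<Sum>j<?n. (p $ i * a' $ j + a' $ i * p $ j) * P $$ (i, j))))"
    unfolding ** by (simp only: right_diff_distrib[of 2] sw)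
  have "mat_pair ?n ?T' P = mat_pair ?n (transpose_mat X * T + T * X) P -
      (\<Sum>i<?n. \<Sum>j<?n. (p $ i * a' $ j + a' $ i * p $ j) * P $$ (i, j))"
    using Xc Tc unfolding mat_pair_def
    by (simp add: sum_subtractf[symmetric] left_diff_distrib del: index_mult_mat(1))
  then show "coad ?s (X, a) (of_coords b m T p) y = of_coords b m ?T' ?p' y"
    unfolding * unfolding y(1) P(2) of_coords_apply[OF P(1) y(3)] by simp
qed

section \<open>Determinants modulo an element\<close>

text \<open>Divisibility by \<open>t\<^sup>2\<close> in a polynomial ring replaces calculation up to second order.\<close>

lemma prod_congruent:
  fixes f g :: "'b \<Rightarrow> 'r::comm_ring_1"
  assumes "\<And>i. i \<in> S \<Longrightarrow> r dvd f i - g i"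
  shows "r dvd prod f S - prod g S"
  using assms
proof (induction S rule: infinite_finite_induct)
  case (insert x S)
  have "prod f (insert x S) - prod g (insert x S) = (f x - g x) * prod f S + g x * (prod f S - prod g S)"
    using insert by (simp add: algebra_simps)
  then show ?case using insert by (metis dvd_add dvd_mult dvd_mult2 insertCI)
qed auto

lemma det_congruent:
  fixes A B :: "'r::comm_ring_1 mat"
  assumes A: "A \<in> carrier_mat n n" and B: "B \<in> carrier_mat n n"
    and dvd: "\<And>i j. i < n \<Longrightarrow> j < n \<Longrightarrow> r dvd A $$ (i, j) - B $$ (i, j)"
  shows "r dvd det A - det B"
proof -
  have "det A - det B = (\<Sum>p | p permutes {0..<n}.
      signof p * ((\<Prod>i = 0..<n. A $$ (i, p i)) - (\<Prod>i = 0..<n. B $$ (i, p i))))"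
    by (simp add: det_def'[OF A] det_def'[OF B] sum_subtractf right_diff_distrib)
  also have "r dvd \<dots>"
  proof (intro dvd_sum dvd_mult prod_congruent)
    fix p i assume "p \<in> {p. p permutes {0..<n}}" "i \<in> {0..<n}"
    then have "p i \<in> {0..<n}" using permutes_in_image[of p "{0..<n}" i] by simp
    then show "r dvd A $$ (i, p i) - B $$ (i, p i)" using dvd \<open>i \<in> {0..<n}\<close> by simp
  qed
  finally show ?thesis .
qed

lemma poly_det:
  assumes "M \<in> carrier_mat n n"
  shows "poly (det M) (z :: 'a::comm_ring_1) = det (mat n n (\<lambda>ij. poly (M $$ ij) z))"
proof -
  interpret h: comm_ring_hom "\<lambda>p. poly p z" by unfold_locales auto
  have "mat n n (\<lambda>ij. poly (M $$ ij) z) = map_mat (\<lambda>p. poly p z) M"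
    by (rule eq_matI) (use assms in auto)
  then show ?thesis using h.hom_det[of M] by simp
qed

lemma expand_unipotent_conjugation:
  fixes A Y :: "'r::comm_ring_1 mat"
  assumes A: "A \<in> carrier_mat n n" and Y: "Y \<in> carrier_mat n n"
  shows "(1\<^sub>m n + t \<cdot>\<^sub>m transpose_mat Y) * A * (1\<^sub>m n + t \<cdot>\<^sub>m Y) =
    A + t \<cdot>\<^sub>m (transpose_mat Y * A + A * Y) + (t * t) \<cdot>\<^sub>m (transpose_mat Y * A * Y)"
proof -
  let ?Yt = "transpose_mat Y"
  have c: "?Yt \<in> carrier_mat n n" "?Yt * A \<in> carrier_mat n n" "A * Y \<in> carrier_mat n n"
    "?Yt * A * Y \<in> carrier_mat n n" "t \<cdot>\<^sub>m ?Yt \<in> carrier_mat n n" "t \<cdot>\<^sub>m Y \<in> carrier_mat n n"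
    "A + t \<cdot>\<^sub>m (?Yt * A) \<in> carrier_mat n n"
    using A Y by auto
  have "(1\<^sub>m n + t \<cdot>\<^sub>m ?Yt) * A = A + t \<cdot>\<^sub>m (?Yt * A)"
    using A c add_mult_distrib_mat[of "1\<^sub>m n" n n "t \<cdot>\<^sub>m ?Yt" A n] mult_smult_assoc_mat[of ?Yt n n A n t]
    by simp
  then have "(1\<^sub>m n + t \<cdot>\<^sub>m ?Yt) * A * (1\<^sub>m n + t \<cdot>\<^sub>m Y) =
      (A + t \<cdot>\<^sub>m (?Yt * A)) * 1\<^sub>m n + (A + t \<cdot>\<^sub>m (?Yt * A)) * (t \<cdot>\<^sub>m Y)"
    using mult_add_distrib_mat[OF c(7), of "1\<^sub>m n" n "t \<cdot>\<^sub>m Y"] c by simp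
  also have "(A + t \<cdot>\<^sub>m (?Yt * A)) * (t \<cdot>\<^sub>m Y) = t \<cdot>\<^sub>m ((A + t \<cdot>\<^sub>m (?Yt * A)) * Y)"
    by (rule mult_smult_distrib[OF c(7) Y])
  also have "(A + t \<cdot>\<^sub>m (?Yt * A)) * Y = A * Y + t \<cdot>\<^sub>m (?Yt * A * Y)"
    using add_mult_distrib_mat[of A n n "t \<cdot>\<^sub>m (?Yt * A)" Y n] mult_smult_assoc_mat[OF c(2) Y, of t] A Y c
    by simp
  finally have "(1\<^sub>m n + t \<cdot>\<^sub>m ?Yt) * A * (1\<^sub>m n + t \<cdot>\<^sub>m Y) =
      (A + t \<cdot>\<^sub>m (?Yt * A)) + t \<cdot>\<^sub>m (A * Y + t \<cdot>\<^sub>m (?Yt * A * Y))"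
    by (simp only: right_mult_one_mat[OF c(7)])
  also have "\<dots> = A + t \<cdot>\<^sub>m (?Yt * A + A * Y) + (t * t) \<cdot>\<^sub>m (?Yt * A * Y)"
    by (rule eq_matI) (use A Y c in \<open>auto simp: algebra_simps simp del: index_mult_mat(1)\<close>)
  finally show ?thesis .
qed

lemma index_combination:
  fixes A B C :: "'r::comm_ring_1 mat"
  assumes "A \<in> carrier_mat n n" "B \<in> carrier_mat n n" "C \<in> carrier_mat n n" "i < n" "j < n"
  shows "(A + t \<cdot>\<^sub>m B + s \<cdot>\<^sub>m C) $$ (i, j) = A $$ (i, j) + t * B $$ (i, j) + s * C $$ (i, j)"
  using assms by simp

text \<open>Since the determinant of \<open>J\<close> is not zero, \<open>1 + t X\<close> and \<open>1 - t X\<close>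
  have the same determinant for \<open>X\<close> in the symplectic Lie algebra, since transposition and conjugation
  by \<open>J\<close> exchange them.  Their product is congruent to \<open>1\<close> modulo the square of \<open>t\<close>.\<close>

lemma det_one_plus_skew_square:
  fixes X :: "'r::idom mat"
  assumes X: "X \<in> carrier_mat (2 * m) (2 * m)"
    and skew: "symp_J m * X = - (transpose_mat X * symp_J m)"
  shows "t * t dvd det (1\<^sub>m (2 * m) + t \<cdot>\<^sub>m X) * det (1\<^sub>m (2 * m) + t \<cdot>\<^sub>m X) - 1"
proof -
  let ?n = "2 * m" and ?J = "symp_J m :: 'r mat"
  define P where "P = 1\<^sub>m ?n + t \<cdot>\<^sub>m X"
  define Q where "Q = 1\<^sub>m ?n + (- t) \<cdot>\<^sub>m X"
  have P: "P \<in> carrier_mat ?n ?n" and Q: "Q \<in> carrier_mat ?n ?n" using X by (auto simp: P_def Q_def)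
  have "?J * P = transpose_mat Q * ?J"
  proof -
    have "?J * P = ?J + t \<cdot>\<^sub>m (?J * X)"
      unfolding P_def using X mult_add_distrib_mat[of ?J ?n ?n "1\<^sub>m ?n" ?n "t \<cdot>\<^sub>m X"]
        mult_smult_distrib[of ?J ?n ?n X ?n t] by simp
    moreover have "transpose_mat Q = 1\<^sub>m ?n + (- t) \<cdot>\<^sub>m transpose_mat X"
      unfolding Q_def by (rule eq_matI) (use X in auto)
    moreover have "(1\<^sub>m ?n + (- t) \<cdot>\<^sub>m transpose_mat X) * ?J = ?J + (- t) \<cdot>\<^sub>m (transpose_mat X * ?J)"
      using X add_mult_distrib_mat[of "1\<^sub>m ?n" ?n ?n "(- t) \<cdot>\<^sub>m transpose_mat X" ?J ?n]
        mult_smult_assoc_mat[of "transpose_mat X" ?n ?n ?J ?n "- t"] by simp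
    moreover have "t \<cdot>\<^sub>m (?J * X) = (- t) \<cdot>\<^sub>m (transpose_mat X * ?J)"
      unfolding skew by (rule eq_matI) (use X in auto)
    ultimately show ?thesis by simp
  qed
  then have "det (?J * P) = det (transpose_mat Q * ?J)" by simp
  moreover have "det (?J * P) = det ?J * det P" using P by (intro det_mult) auto
  moreover have "det (transpose_mat Q * ?J) = det (transpose_mat Q) * det ?J" using Q by (intro det_mult) auto
  ultimately have "det ?J * det P = det Q * det ?J" by (simp only: det_transpose[OF Q])
  then have "det ?J * det P = det ?J * det Q" by (simp add: mult.commute)
  moreover have "det ?J \<noteq> 0" by (rule det_symp_J_nonzero)
  ultimately have eq: "det P = det Q" by simp
  have "P * Q = 1\<^sub>m ?n + (- (t * t)) \<cdot>\<^sub>m (X * X)"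
  proof -
    have "P * Q = P * 1\<^sub>m ?n + P * ((- t) \<cdot>\<^sub>m X)"
      unfolding Q_def by (rule mult_add_distrib_mat[OF P]) (use X in auto)
    also have "P * ((- t) \<cdot>\<^sub>m X) = (- t) \<cdot>\<^sub>m (P * X)" by (rule mult_smult_distrib[OF P X])
    also have "P * X = X + t \<cdot>\<^sub>m (X * X)"
      unfolding P_def using X add_mult_distrib_mat[of "1\<^sub>m ?n" ?n ?n "t \<cdot>\<^sub>m X" X ?n]
        mult_smult_assoc_mat[of X ?n ?n X ?n t] by simp
    finally have "P * Q = P + (- t) \<cdot>\<^sub>m (X + t \<cdot>\<^sub>m (X * X))" using P by simp
    also have "\<dots> = 1\<^sub>m ?n + (- (t * t)) \<cdot>\<^sub>m (X * X)"
      unfolding P_def by (rule eq_matI) (use X in \<open>auto simp: algebra_simps simp del: index_mult_mat(1)\<close>)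
    finally show ?thesis .
  qed
  then have "det P * det Q = det (1\<^sub>m ?n + (- (t * t)) \<cdot>\<^sub>m (X * X))"
    using det_mult[OF P Q] by simp
  moreover have "t * t dvd det (1\<^sub>m ?n + (- (t * t)) \<cdot>\<^sub>m (X * X)) - det (1\<^sub>m ?n)"
    by (rule det_congruent[of _ ?n]) (use X in \<open>auto simp del: index_mult_mat(1)\<close>)
  ultimately show ?thesis using eq by (simp add: P_def)
qed

section \<open>The bordered determinant\<close>

definition bordered :: "nat \<Rightarrow> 'r::zero mat \<Rightarrow> 'r vec \<Rightarrow> 'r mat" where
  "bordered n M p = mat (Suc n) (Suc n) (\<lambda>(i, j).
     if i = 0 then (if j = 0 then 0 else p $ (j - 1))
     else if j = 0 then p $ (i - 1) else M $$ (i - 1, j - 1))"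

lemma bordered_carrier [simp]: "bordered n M p \<in> carrier_mat (Suc n) (Suc n)"
  by (simp add: bordered_def)

lemma bordered_index:
  "i < n \<Longrightarrow> j < n \<Longrightarrow> bordered n M p $$ (Suc i, Suc j) = M $$ (i, j)"
  "j < n \<Longrightarrow> bordered n M p $$ (0, Suc j) = p $ j"
  "i < n \<Longrightarrow> bordered n M p $$ (Suc i, 0) = p $ i"
  "bordered n M p $$ (0, 0) = 0"
  by (auto simp: bordered_def)

text \<open>The infinitesimal action of an element \<open>(X, a)\<close> of the semidirect product on the bordered matrix
  is \<open>N \<mapsto> Y\<^sup>T N + N Y\<close> for the matrix \<open>Y\<close> with block \<open>X\<close> and first row \<open>(0, -a')\<close>.  Up to second
  order this is a congruence by \<open>1 + t Y\<close>, whose determinant squared is \<open>1\<close> up to second order.\<close>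

lemma bordered_det_infinitesimal:
  fixes X M M' :: "'a::field mat"
  assumes X: "X \<in> carrier (sp m)" and M: "M \<in> carrier_mat (2 * m) (2 * m)"
    and a': "a' \<in> carrier_vec (2 * m)"
    and M': "\<And>i j. i < 2 * m \<Longrightarrow> j < 2 * m \<Longrightarrow> M' $$ (i, j) =
      (transpose_mat X * M) $$ (i, j) + (M * X) $$ (i, j) - (p $ i * a' $ j + a' $ i * p $ j)"
    and p': "\<And>i. i < 2 * m \<Longrightarrow> p' $ i = (\<Sum>k<2 * m. X $$ (k, i) * p $ k)"
  shows "coeff (det (mat (Suc (2 * m)) (Suc (2 * m)) (\<lambda>ij.
      [:bordered (2 * m) M p $$ ij, bordered (2 * m) M' p' $$ ij:]))) 1 = 0"
proof -
  let ?n = "2 * m" and ?N = "Suc (2 * m)"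
  let ?c = "map_mat (\<lambda>x::'a. [:x:])"
  interpret c: comm_ring_hom "\<lambda>x::'a. [:x:]" by unfold_locales auto
  have Xc: "X \<in> carrier_mat ?n ?n" using X by (rule sp_carrier_mat)
  define t where "t = ([:0, 1:] :: 'a poly)"
  define N0 where "N0 = bordered ?n M p"
  define N1 where "N1 = bordered ?n M' p'"
  \<comment> \<open>The image of \<open>(X, a)\<close> in the matrices acting on the bordered matrix; the first column is zero.\<close>
  define Y where "Y = mat ?N ?N (\<lambda>(i, j). if j = 0 then 0 else if i = 0 then - a' $ (j - 1) else X $$ (i - 1, j - 1))"
  have N0: "N0 \<in> carrier_mat ?N ?N" and Y: "Y \<in> carrier_mat ?N ?N"
    by (auto simp: N0_def Y_def)
  have N1eq: "(transpose_mat Y * N0 + N0 * Y) $$ (i, j) = N1 $$ (i, j)" if "i < ?N" "j < ?N" for i j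
  proof -
    have e: "(transpose_mat Y * N0 + N0 * Y) $$ (i, j) =
        (\<Sum>r<?N. Y $$ (r, i) * N0 $$ (r, j)) + (\<Sum>r<?N. N0 $$ (i, r) * Y $$ (r, j))"
      using that N0 Y by (simp add: mult_index_sum[of _ ?N ?N _ ?N] del: index_mult_mat(1))
    have Yi: "Y $$ (Suc k, Suc l) = X $$ (k, l)" "Y $$ (0, Suc l) = - a' $ l" "Y $$ (Suc k, 0) = 0" "Y $$ (0, 0) = 0"
      if "k < ?n" "l < ?n" for k l using that by (auto simp: Y_def)
    have Y0: "Y $$ (k, 0) = 0" if "k < ?N" for k using that by (simp add: Y_def)
    note s = sum.lessThan_Suc_shift
    show ?thesis
    proof (cases i)
      case 0
      show ?thesis
      proof (cases j)
        case 0
        then show ?thesis unfolding e using \<open>i = 0\<close> by (simp add: Y0 N1_def bordered_index)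
      next
        case (Suc l)
        then have l: "l < ?n" using that by simp
        show ?thesis unfolding e using \<open>i = 0\<close> Suc l
          by (simp add: Y0 N1_def N0_def bordered_index s Yi p' mult.commute del: sum.lessThan_Suc)
      qed
    next
      case (Suc k)
      then have k: "k < ?n" using that by simp
      show ?thesis
      proof (cases j)
        case 0
        then show ?thesis unfolding e using Suc k
          by (simp add: Y0 N1_def N0_def bordered_index s Yi p' del: sum.lessThan_Suc)
      next
        case j: (Suc l)
        then have l: "l < ?n" using that by simp
        show ?thesis unfolding e using Suc k j l Xc M
          by (simp add: N1_def N0_def bordered_index s Yi M' mult_index_sum[of _ ?n ?n _ ?n] del: sum.lessThan_Suc index_mult_mat(1))
      qed
    qed
  qed
  define U where "U = 1\<^sub>m ?N + t \<cdot>\<^sub>m ?c Y"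
  have U: "U \<in> carrier_mat ?N ?N" using Y by (simp add: U_def)
  have Ut: "transpose_mat U = 1\<^sub>m ?N + t \<cdot>\<^sub>m transpose_mat (?c Y)"
    unfolding U_def by (rule eq_matI) (use Y in auto)
  define D where "D = mat ?N ?N (\<lambda>ij. [:N0 $$ ij, N1 $$ ij:])"
  have "t * t dvd det (transpose_mat U * ?c N0 * U) - det D"
  proof (rule det_congruent[of _ ?N])
    show "transpose_mat U * ?c N0 * U \<in> carrier_mat ?N ?N" using U N0 by auto
    show "D \<in> carrier_mat ?N ?N" by (simp add: D_def)
    fix i j assume ij: "i < ?N" "j < ?N"
    have cc: "?c Y \<in> carrier_mat ?N ?N" "?c N0 \<in> carrier_mat ?N ?N" using Y N0 by auto
    have tr: "transpose_mat (?c Y) = ?c (transpose_mat Y)" by (rule eq_matI) auto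
    have "transpose_mat (?c Y) * ?c N0 + ?c N0 * ?c Y = ?c (transpose_mat Y * N0 + N0 * Y)"
      unfolding tr using Y N0
      by (simp add: c.mat_hom_mult[of _ ?N ?N _ ?N, symmetric])
         (rule eq_matI, auto simp del: index_mult_mat(1))
    then have "(transpose_mat (?c Y) * ?c N0 + ?c N0 * ?c Y) $$ (i, j) = [:N1 $$ (i, j):]"
      using N1eq[OF ij] ij Y N0 by (simp del: index_mult_mat(1) index_add_mat(1))
    moreover have "transpose_mat (?c Y) * ?c N0 + ?c N0 * ?c Y \<in> carrier_mat ?N ?N"
      using cc by auto
    moreover have "transpose_mat (?c Y) * ?c N0 * ?c Y \<in> carrier_mat ?N ?N"
      using cc by auto
    ultimately have Uij: "(transpose_mat U * ?c N0 * U) $$ (i, j) = [:N0 $$ (i, j):] + t * [:N1 $$ (i, j):]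
        + (t * t) * (transpose_mat (?c Y) * ?c N0 * ?c Y) $$ (i, j)"
      unfolding Ut unfolding U_def expand_unipotent_conjugation[OF cc(2,1)]
      using ij N0 by (subst index_combination[of _ ?N]) auto
    show "t * t dvd (transpose_mat U * ?c N0 * U) $$ (i, j) - D $$ (i, j)"
    proof (rule dvdI)
      have "D $$ (i, j) = [:N0 $$ (i, j):] + t * [:N1 $$ (i, j):]"
        using ij by (simp add: D_def t_def)
      then show "(transpose_mat U * ?c N0 * U) $$ (i, j) - D $$ (i, j) =
          t * t * (transpose_mat (?c Y) * ?c N0 * ?c Y) $$ (i, j)"
        by (simp only: Uij add_diff_cancel_left')
    qed
  qed
  moreover have "t * t dvd det (transpose_mat U * ?c N0 * U) - [:det N0:]"
  proof -
    \<comment> \<open>\<open>U\<close> is block triangular, so the part \<open>a\<close> does not contribute to its determinant.\<close>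
    have blk: "U = four_block_mat (1\<^sub>m 1) (mat 1 ?n (\<lambda>(i, j). t * [:- a' $ j:])) (0\<^sub>m ?n 1) (1\<^sub>m ?n + t \<cdot>\<^sub>m ?c X)"
      unfolding U_def by (rule eq_matI) (use Xc in \<open>auto simp: Y_def\<close>)
    have "det U = det (1\<^sub>m ?n + t \<cdot>\<^sub>m ?c X)"
      unfolding blk using Xc by (subst det_four_block_mat_lower_left_zero[of _ 1 _ ?n]) auto
    moreover have "t * t dvd det (1\<^sub>m ?n + t \<cdot>\<^sub>m ?c X) * det (1\<^sub>m ?n + t \<cdot>\<^sub>m ?c X) - 1"
    proof (rule det_one_plus_skew_square)
      show "?c X \<in> carrier_mat ?n ?n" using Xc by simp
      have "(- 1 :: 'a poly) = [:- 1:]" by (metis c.hom_one c.hom_uminus)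
      then have J: "symp_J m = ?c (symp_J m)"
        by (intro eq_matI) (auto simp: symp_J_index partner_sign_def)
      have tr: "transpose_mat (?c X) = ?c (transpose_mat X)" by (rule eq_matI) auto
      show "symp_J m * ?c X = - (transpose_mat (?c X) * symp_J m)"
        unfolding tr unfolding J using Xc sp_skew[OF X]
        by (simp add: c.mat_hom_mult[of _ ?n ?n _ ?n, symmetric])
           (rule eq_matI, auto simp del: index_mult_mat(1))
    qed
    ultimately have "t * t dvd det U * det U - 1" by simp
    moreover have "det (transpose_mat U * ?c N0 * U) = det U * [:det N0:] * det U"
      using U N0 det_transpose[OF U] by (simp add: det_mult[of _ ?N] c.hom_det)
    then have "det (transpose_mat U * ?c N0 * U) - [:det N0:] = (det U * det U - 1) * [:det N0:]"
      by (simp add: algebra_simps)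
    ultimately show ?thesis by (metis dvd_mult2)
  qed
  ultimately have "t * t dvd det D - [:det N0:]"
    by (smt (verit) diff_diff_eq2 diff_add_cancel dvd_diff add_diff_cancel_left' diff_diff_add)
  then obtain q where "det D = [:det N0:] + t * t * q" by (metis dvdE diff_add_cancel add.commute)
  then show ?thesis
    unfolding D_def N0_def N1_def by (simp add: t_def)
qed

section \<open>Invariants from bordered determinants\<close>

text \<open>The indeterminate is the parameter \<open>z\<close> of the pencil \<open>T + z J\<close>.\<close>

definition bordered_poly :: "nat \<Rightarrow> 'a::field mat \<Rightarrow> 'a vec \<Rightarrow> 'a poly" where
  "bordered_poly m T p = det (bordered (2 * m)
     (mat (2 * m) (2 * m) (\<lambda>ij. [:T $$ ij, symp_J m $$ ij:])) (vec (2 * m) (\<lambda>i. [:p $ i:])))"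

definition bordered_coeff ::
  "'a::field_char_0 \<Rightarrow> nat \<Rightarrow> nat \<Rightarrow> ('a, 'a mat \<times> 'a vec) sym_elem" where
  "bordered_coeff b m k = (\<lambda>\<gamma>\<in>lie_dual (sp_semidirect m).
     coeff (bordered_poly m (mat_coord b m \<gamma>) (vec_coord b m \<gamma>)) k)"

lemma poly_bordered_poly:
  assumes "T \<in> carrier_mat (2 * m) (2 * m)"
  shows "poly (bordered_poly m T p) z = det (bordered (2 * m) (T + z \<cdot>\<^sub>m symp_J m) p)"
  unfolding bordered_poly_def poly_det[OF bordered_carrier]
  by (intro arg_cong[where f = det] eq_matI) (use assms in \<open>auto simp: bordered_def\<close>)

lemma poly_eq_sum_le:
  fixes p :: "'a::field poly"
  assumes "degree p \<le> K"
  shows "poly p z = (\<Sum>l\<le>K. coeff p l * z ^ l)"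
  unfolding poly_altdef
  by (rule sum.mono_neutral_left) (use assms in \<open>auto simp: coeff_eq_0\<close>)

lemma degree_bordered_poly: "degree (bordered_poly m T p) \<le> Suc (2 * m)"
proof -
  have "degree (bordered_poly m T p) \<le> 1 * Suc (2 * m)"
    unfolding bordered_poly_def by (rule degree_det_le[OF _ bordered_carrier]) (auto simp: bordered_def)
  then show ?thesis by simp
qed

lemma bordered_coeff_in:
  assumes "b \<noteq> 0"
  shows "bordered_coeff b m k \<in> sym_alg (sp_semidirect m)"
proof -
  let ?n = "2 * m" and ?L = "sp_semidirect m :: ('a, 'a mat \<times> 'a vec) lie_algebra"
  let ?V = "carrier ?L"
  have sc: "polyfun ?L ?V (\<lambda>\<gamma>. \<gamma> x / c)" if "x \<in> ?V" for x c
    using polyfun_mult[OF polyfun_gen[OF that, of ?L] polyfun_const[of ?L ?V "inverse c"]]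
    by (simp add: divide_inverse)
  have zero: "0\<^sub>m ?n ?n \<in> carrier (sp m :: ('a, 'a mat) lie_algebra)" by (rule zero_in_sp)
  have T: "polyfun ?L ?V (\<lambda>\<gamma>. mat_coord b m \<gamma> $$ (i, j))" if "i < ?n" "j < ?n" for i j
    using that sc[of "(sym_unit ?n i j * symp_J m, 0\<^sub>v ?n)" "2 * b"]
    by (simp add: mat_coord_def sp_semidirect_simps sp_of_sym)
  have p: "polyfun ?L ?V (\<lambda>\<gamma>. vec_coord b m \<gamma> $ i)" if "i < ?n" for i
    using that sc[of "(0\<^sub>m ?n ?n, unit_vec ?n i)" "2 * b"] zero
    by (simp add: vec_coord_def sp_semidirect_simps)
  have lin: "polyfun_coeffs ?L ?V (\<lambda>\<gamma>. [:F \<gamma>, c:])" if "polyfun ?L ?V F" for F c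
  proof -
    have "polyfun_coeffs ?L ?V (\<lambda>\<gamma>. [:F \<gamma>:] + [:0, c:])"
      by (intro polyfun_coeffs_add polyfun_coeffs_lift polyfun_coeffs_const that)
    then show ?thesis by simp
  qed
  have "polyfun_coeffs ?L ?V (\<lambda>\<gamma>. bordered_poly m (mat_coord b m \<gamma>) (vec_coord b m \<gamma>))"
    unfolding bordered_poly_def
  proof (rule polyfun_coeffs_det[OF bordered_carrier])
    fix i j assume ij: "i < Suc ?n" "j < Suc ?n"
    show "polyfun_coeffs ?L ?V (\<lambda>\<gamma>. bordered ?n (mat ?n ?n (\<lambda>ij. [:mat_coord b m \<gamma> $$ ij, symp_J m $$ ij:]))
        (vec ?n (\<lambda>i. [:vec_coord b m \<gamma> $ i:])) $$ (i, j))"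
      using ij by (cases i; cases j)
        (auto simp: bordered_index intro!: polyfun_coeffs_const lin T polyfun_coeffs_lift p)
  qed
  then have "polyfun ?L ?V (\<lambda>\<gamma>. coeff (bordered_poly m (mat_coord b m \<gamma>) (vec_coord b m \<gamma>)) k)"
    by (simp add: polyfun_coeffs_def)
  then show ?thesis by (simp add: bordered_coeff_def sym_alg_def polyfun_def)
qed

lemma mat_coord_dual_line:
  "mat_coord b m (dual_line (sp_semidirect m) \<gamma> \<eta> t) = mat_coord b m \<gamma> + t \<cdot>\<^sub>m mat_coord b m \<eta>"
  by (rule eq_matI)
     (auto simp: mat_coord_def dual_line_def sp_semidirect_simps sp_of_sym add_divide_distrib)

lemma vec_coord_dual_line:
  "vec_coord b m (dual_line (sp_semidirect m) \<gamma> \<eta> t) = vec_coord b m \<gamma> + t \<cdot>\<^sub>v vec_coord b m \<eta>"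
  by (rule eq_vecI)
     (auto simp: vec_coord_def dual_line_def sp_semidirect_simps zero_in_sp add_divide_distrib)

text \<open>For each value of \<open>z\<close> the derivative of \<open>det\<close> of the bordered pencil along the coadjoint field is zero: \<open>z J\<close> is
  fixed by the infinitesimal congruence, as \<open>X\<close> is symplectic, so the pencil changes in the same way as \<open>T\<close>.  Being a
  polynomial in \<open>z\<close>, the derivative is zero coefficient by coefficient.\<close>

lemma bordered_coeff_invariant:
  assumes b: "b \<noteq> 0"
  shows "bordered_coeff b m k \<in> sym_invariants (sp_semidirect m)"
proof -
  let ?n = "2 * m" and ?L = "sp_semidirect m :: ('a, 'a mat \<times> 'a vec) lie_algebra" and ?J = "symp_J m :: 'a mat"
  interpret S: lin_lie ?L by (rule lin_lie_sp_semidirect)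
  have "S.dir_deriv (bordered_coeff b m k) \<gamma> (coad ?L x \<gamma>) = 0"
    if x: "x \<in> carrier ?L" and \<gamma>: "\<gamma> \<in> lie_dual ?L" for x \<gamma>
  proof -
    obtain X a where xa: "x = (X, a)" by (cases x)
    have X: "X \<in> carrier (sp m)" and a: "a \<in> carrier_vec ?n"
      using x by (auto simp: xa sp_semidirect_simps)
    have Xc: "X \<in> carrier_mat ?n ?n" using X by (rule sp_carrier_mat)
    define T where "T = mat_coord b m \<gamma>"
    define p where "p = vec_coord b m \<gamma>"
    define a' where "a' = ?J *\<^sub>v a"
    define T' where "T' = mat ?n ?n (\<lambda>(i, j). (transpose_mat X * T) $$ (i, j) + (T * X) $$ (i, j)
        - (p $ i * a' $ j + a' $ i * p $ j))"
    define p' where "p' = transpose_mat X *\<^sub>v p"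
    define \<eta> where "\<eta> = coad ?L x \<gamma>"
    have T: "T \<in> sym_mats ?n" and p: "p \<in> carrier_vec ?n"
      by (simp_all add: T_def p_def mat_coord_sym)
    have Tc: "T \<in> carrier_mat ?n ?n" using T by (rule sym_matsD)
    have a': "a' \<in> carrier_vec ?n" unfolding a'_def using a by (intro mult_mat_vec_carrier) auto
    have \<eta>: "\<eta> \<in> lie_dual ?L" unfolding \<eta>_def using x \<gamma> by (rule S.coad_in)
    have "\<gamma> = of_coords b m T p" using of_coords_coords[OF b \<gamma>] by (simp add: T_def p_def)
    then have \<eta>': "\<eta> = of_coords b m T' p'"
      unfolding \<eta>_def xa T'_def p'_def a'_def using coad_of_coords[OF X a T p, of b] by simp
    have T'sym: "T' \<in> sym_mats ?n"
    proof (rule sym_matsI')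
      fix i j assume ij: "i < ?n" "j < ?n"
      have "transpose_mat (T * X) = transpose_mat X * T"
        using Tc Xc sym_matsD(2)[OF T] by (simp add: transpose_mult[of _ ?n ?n _ ?n])
      then have e: "(transpose_mat X * T) $$ (k, l) = (T * X) $$ (l, k)" if "k < ?n" "l < ?n" for k l
        using that Tc Xc by (metis index_transpose_mat(1) carrier_matD index_mult_mat(2,3))
      show "T' $$ (i, j) = T' $$ (j, i)"
        using ij by (simp add: T'_def e algebra_simps del: index_mult_mat(1))
    qed (simp add: T'_def)
    have p'c: "p' \<in> carrier_vec ?n" unfolding p'_def using Xc p by (intro mult_mat_vec_carrier) auto
    have T'eq: "mat_coord b m \<eta> = T'" and p'eq: "vec_coord b m \<eta> = p'"
      unfolding \<eta>' using mat_coord_of_coords[OF b T'sym] vec_coord_of_coords[OF b p'c] by auto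
    have T'c: "T' \<in> carrier_mat ?n ?n" by (simp add: T'_def)
    define F where "F = (\<lambda>k. bordered_coeff b m k)"
    have Fs: "F k \<in> sym_alg ?L" for k unfolding F_def using b by (rule bordered_coeff_in)
    \<comment> \<open>Large enough for \<open>k\<close> and for the degree in \<open>z\<close> at every point of the line.\<close>
    define K where "K = max k (Suc ?n)"
    define D where "D = (\<lambda>z. det (mat (Suc ?n) (Suc ?n) (\<lambda>ij.
      [:bordered ?n (T + z \<cdot>\<^sub>m ?J) p $$ ij, bordered ?n T' p' $$ ij:])))"
    have "(\<Sum>l\<le>K. [:z ^ l:] * S.line_poly (F l) \<gamma> \<eta>) = D z" for z
    proof -
      have "poly (\<Sum>l\<le>K. [:z ^ l:] * S.line_poly (F l) \<gamma> \<eta>) t = poly (D z) t" for t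
      proof -
        have "poly (\<Sum>l\<le>K. [:z ^ l:] * S.line_poly (F l) \<gamma> \<eta>) t =
            (\<Sum>l\<le>K. z ^ l * F l (dual_line ?L \<gamma> \<eta> t))"
          by (simp add: poly_sum S.poly_line_poly[OF Fs \<gamma> \<eta>])
        also have "\<dots> = (\<Sum>l\<le>K. coeff (bordered_poly m (T + t \<cdot>\<^sub>m T') (p + t \<cdot>\<^sub>v p')) l * z ^ l)"
          using S.dual_line_in[OF \<gamma> \<eta>]
          by (simp add: F_def bordered_coeff_def mat_coord_dual_line vec_coord_dual_line
            T'eq p'eq T_def[symmetric] p_def[symmetric] mult.commute)
        also have "\<dots> = poly (bordered_poly m (T + t \<cdot>\<^sub>m T') (p + t \<cdot>\<^sub>v p')) z"
        proof -
          have "degree (bordered_poly m (T + t \<cdot>\<^sub>m T') (p + t \<cdot>\<^sub>v p')) \<le> K"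
            using degree_bordered_poly[of m "T + t \<cdot>\<^sub>m T'" "p + t \<cdot>\<^sub>v p'"] by (simp add: K_def)
          then show ?thesis by (rule poly_eq_sum_le[symmetric])
        qed
        also have "\<dots> = det (bordered ?n (T + t \<cdot>\<^sub>m T' + z \<cdot>\<^sub>m ?J) (p + t \<cdot>\<^sub>v p'))"
          using Tc T'c by (intro poly_bordered_poly) simp
        also have "\<dots> = poly (D z) t"
          unfolding D_def poly_det[OF mat_carrier]
          by (intro arg_cong[where f = det] eq_matI)
             (use Tc T'c p p'c in \<open>auto simp: bordered_def algebra_simps\<close>)
        finally show ?thesis .
      qed
      then have "poly (\<Sum>l\<le>K. [:z ^ l:] * S.line_poly (F l) \<gamma> \<eta>) = poly (D z)" by (rule ext)
      then show ?thesis by (simp only: poly_eq_poly_eq_iff)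
    qed
    moreover have "coeff (D z) 1 = 0" for z
      unfolding D_def
    proof (rule bordered_det_infinitesimal[OF X _ a'])
      show "T + z \<cdot>\<^sub>m ?J \<in> carrier_mat ?n ?n" using Tc by simp
      fix i assume i: "i < ?n"
      then show "p' $ i = (\<Sum>k<?n. X $$ (k, i) * p $ k)"
        using Xc p by (simp add: p'_def scalar_prod_def atLeast0LessThan)
    next
      fix i j assume ij: "i < ?n" "j < ?n"
      have "transpose_mat X * (T + z \<cdot>\<^sub>m ?J) = transpose_mat X * T + z \<cdot>\<^sub>m (transpose_mat X * ?J)"
        using Xc Tc by (simp add: mult_add_distrib_mat[of _ ?n ?n _ ?n] mult_smult_distrib[of _ ?n ?n _ ?n])
      moreover have "(T + z \<cdot>\<^sub>m ?J) * X = T * X + z \<cdot>\<^sub>m (?J * X)"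
        using Xc Tc by (simp add: add_mult_distrib_mat[of _ ?n ?n _ _ ?n] mult_smult_assoc_mat[of _ ?n ?n _ ?n])
      ultimately show "T' $$ (i, j) = (transpose_mat X * (T + z \<cdot>\<^sub>m ?J)) $$ (i, j) + ((T + z \<cdot>\<^sub>m ?J) * X) $$ (i, j)
          - (p $ i * a' $ j + a' $ i * p $ j)"
        using ij Xc Tc sp_skew[OF X] by (simp add: T'_def del: index_mult_mat(1))
    qed
    ultimately have *: "(\<Sum>l\<le>K. z ^ l * S.dir_deriv (F l) \<gamma> \<eta>) = 0" for z
    proof -
      have "coeff (\<Sum>l\<le>K. [:z ^ l:] * S.line_poly (F l) \<gamma> \<eta>) 1 = 0"
        using \<open>\<And>z. (\<Sum>l\<le>K. [:z ^ l:] * S.line_poly (F l) \<gamma> \<eta>) = D z\<close> \<open>\<And>z. coeff (D z) 1 = 0\<close> by simp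
      then show ?thesis by (simp add: coeff_sum S.dir_deriv_def)
    qed
    define q where "q = (\<Sum>l\<le>K. Polynomial.monom (S.dir_deriv (F l) \<gamma> \<eta>) l)"
    have "poly q z = 0" for z
      using *[of z] by (simp add: q_def poly_sum poly_monom mult.commute)
    then have "q = 0" using poly_all_0_iff_0 by blast
    moreover have "coeff q k = S.dir_deriv (F k) \<gamma> \<eta>"
      by (simp add: q_def coeff_sum K_def)
    ultimately show ?thesis by (simp add: F_def \<eta>_def)
  qed
  then show ?thesis
    using bordered_coeff_in[OF b] by (auto simp: S.sym_invariants_iff)
qed

section \<open>An affine section for the semidirect product\<close>

text \<open>The section consists of the functionals with coordinates \<open>section_mat m d\<close> and the basis vector with index \<open>m\<close>.
  For \<open>d = 0\<close> the matrix \<open>T J\<close> is nilpotent with two Jordan blocks of size \<open>m\<close>.\<close>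

definition section_mat :: "nat \<Rightarrow> (nat \<Rightarrow> 'a::comm_ring_1) \<Rightarrow> 'a mat" where
  "section_mat m d = mat (2 * m) (2 * m) (\<lambda>(i, j). (if i = j \<and> i < m then d i else 0)
     - (if j = m + 1 + i then 1 else 0) - (if i = m + 1 + j then 1 else 0))"

lemma section_mat_carrier [simp]: "section_mat m d \<in> carrier_mat (2 * m) (2 * m)"
  by (simp add: section_mat_def)

lemma section_mat_sym: "section_mat m d \<in> sym_mats (2 * m)"
  by (rule sym_matsI') (auto simp: section_mat_def)

subsection \<open>The bordered determinant on the section\<close>

text \<open>Column operations with a solution of \<open>M x = - p\<close> clear the first column below its top entry.\<close>

lemma det_bordered_solution:
  fixes M :: "'a::field mat"
  assumes M: "M \<in> carrier_mat n n"
    and x: "\<And>i. i < n \<Longrightarrow> (\<Sum>j<n. M $$ (i, j) * x j) = - p $ i"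
  shows "det (bordered n M p) = (\<Sum>j<n. p $ j * x j) * det M"
proof -
  let ?g = "\<Sum>j<n. p $ j * x j"
  define C where "C = mat (Suc n) (Suc n) (\<lambda>(i, j). if i = j then 1 else if j = 0 then x (i - 1) else 0)"
  define R where "R = four_block_mat (mat 1 1 (\<lambda>_. ?g)) (mat 1 n (\<lambda>(i, j). p $ j)) (0\<^sub>m n 1) M"
  have C: "C \<in> carrier_mat (Suc n) (Suc n)" by (simp add: C_def)
  have "bordered n M p * C = R"
  proof (rule eq_matI)
    fix i j assume "i < dim_row R" "j < dim_col R"
    then have ij: "i < Suc n" "j < Suc n" using M by (auto simp: R_def)
    have e: "(bordered n M p * C) $$ (i, j) =
        bordered n M p $$ (i, 0) * C $$ (0, j) + (\<Sum>r<n. bordered n M p $$ (i, Suc r) * C $$ (Suc r, j))"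
      using ij by (simp add: mult_index_sum[OF bordered_carrier C] sum.lessThan_Suc_shift
        del: index_mult_mat(1) sum.lessThan_Suc)
    show "(bordered n M p * C) $$ (i, j) = R $$ (i, j)"
    proof (cases j)
      case 0
      have "C $$ (Suc r, 0) = x r" if "r < n" for r using that by (simp add: C_def)
      moreover have "C $$ (0, 0) = 1" by (simp add: C_def)
      ultimately show ?thesis
        unfolding e using ij 0 x M by (cases i) (simp_all add: R_def bordered_index)
    next
      case (Suc l)
      have "C $$ (Suc r, Suc l) = (if r = l then 1 else 0)" if "r < n" for r
        using that ij Suc by (simp add: C_def)
      moreover have "C $$ (0, Suc l) = 0" using ij Suc by (simp add: C_def)
      ultimately have "(bordered n M p * C) $$ (i, j) =
          (\<Sum>r<n. if r = l then bordered n M p $$ (i, Suc r) else 0)"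
        unfolding e unfolding Suc by (simp add: if_distrib[of "\<lambda>x. _ * x"] cong: if_cong)
      also have "\<dots> = R $$ (i, j)"
        using ij Suc M by (cases i) (simp_all add: R_def bordered_index)
      finally show ?thesis .
    qed
  qed (use M in \<open>auto simp: R_def C_def bordered_def\<close>)
  moreover have "det C = 1"
  proof -
    have "det C = prod_list (diag_mat C)"
      by (rule det_lower_triangular[OF _ C]) (auto simp: C_def)
    then show ?thesis by (simp add: prod_list_diag_prod) (simp add: C_def)
  qed
  moreover have "det R = ?g * det M"
    unfolding R_def using M by (subst det_four_block_mat_lower_left_zero[of _ 1 _ n]) (auto simp: det_single)
  ultimately show ?thesis using det_mult[OF bordered_carrier C, of M p] by simp
qed

lemma sum_lessThan_double:
  fixes f :: "nat \<Rightarrow> 'b::comm_monoid_add"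
  shows "(\<Sum>j<2 * m. f j) = (\<Sum>j<m. f j) + (\<Sum>j<m. f (m + j))"
proof -
  have "(\<Sum>j<2 * m. f j) = (\<Sum>j<m. f j) + (\<Sum>j=m..<m + m. f j)"
    using sum.atLeastLessThan_concat[of 0 m "m + m" f] by (simp add: atLeast0LessThan mult_2)
  also have "(\<Sum>j=m..<m + m. f j) = (\<Sum>j=0..<m. f (m + j))"
    using sum.shift_bounds_nat_ivl[of f 0 m m] by (simp add: add.commute)
  finally show ?thesis by (simp add: atLeast0LessThan)
qed

lemma section_mat_mult:
  assumes "k < 2 * m"
  shows "(\<Sum>j<2 * m. section_mat m d $$ (k, j) * v j) =
    (if k < m then d k * v k - (if k + 1 < m then v (m + 1 + k) else 0)
     else if k = m then 0 else - v (k - m - 1))"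
proof -
  have "(\<Sum>j<2 * m. section_mat m d $$ (k, j) * v j) =
      (\<Sum>j<2 * m. (if j = k then (if k < m then d k * v k else 0) else 0))
      - (\<Sum>j<2 * m. (if j = m + 1 + k then v j else 0)) - (\<Sum>j<2 * m. (if k = m + 1 + j then v j else 0))"
    unfolding sum_subtractf[symmetric]
    by (rule sum.cong) (use assms in \<open>auto simp: section_mat_def left_diff_distrib\<close>)
  moreover have "(\<Sum>j<2 * m. (if k = m + 1 + j then v j else 0)) = (if m < k then v (k - m - 1) else 0)"
  proof -
    have "(\<Sum>j<2 * m. (if k = m + 1 + j then v j else 0)) =
        (\<Sum>j<2 * m. (if j = k - m - 1 then (if m < k then v j else 0) else 0))"
      by (rule sum.cong) auto
    then show ?thesis using assms by auto
  qed
  ultimately show ?thesis using assms by auto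
qed

text \<open>The pencil is \<open>J\<close> times a lower block triangular matrix whose diagonal blocks are triangular with \<open>z\<close> on the
  diagonal.\<close>

lemma det_section_pencil:
  fixes z :: "'a::field"
  shows "det (section_mat m d + z \<cdot>\<^sub>m symp_J m) = det (symp_J m :: 'a mat) * z ^ (2 * m)"
proof -
  let ?n = "2 * m" and ?J = "symp_J m :: 'a mat"
  define M where "M = section_mat m d + z \<cdot>\<^sub>m ?J"
  have M: "M \<in> carrier_mat ?n ?n" by (simp add: M_def)
  define A where "A = mat m m (\<lambda>(i, j). (if i = j then z else 0) + (if i = j + 1 then 1 else 0))"
  define D where "D = mat m m (\<lambda>(i, j). if i = j then d i else 0)"
  define E where "E = mat m m (\<lambda>(i, j). (if i = j then z else 0) - (if j = i + 1 then 1 else 0))"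
  define K where "K = four_block_mat A (0\<^sub>m m m) D E"
  have K: "K \<in> carrier_mat ?n ?n" unfolding K_def mult_2 by (intro four_block_carrier_mat) (auto simp: A_def E_def)
  have "?J * K = M"
  proof (rule eq_matI)
    fix i j assume "i < dim_row M" "j < dim_col M"
    then have ij: "i < ?n" "j < ?n" using M by auto
    have "(?J * K) $$ (i, j) = partner_sign m i * K $$ (partner m i, j)"
      by (rule symp_J_mult_index[OF K ij])
    also have "\<dots> = M $$ (i, j)"
      using ij unfolding K_def M_def
      by (auto simp: partner_sign_def partner_def A_def D_def E_def section_mat_def symp_J_index)
    finally show "(?J * K) $$ (i, j) = M $$ (i, j)" .
  qed (use M K in auto)
  then have "det M = det ?J * det K" using det_mult[OF symp_J_carrier K] by simp
  moreover have "det K = det A * det E"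
    unfolding K_def by (rule det_four_block_mat_upper_right_zero[of _ m _ m]) (auto simp: A_def D_def E_def)
  moreover have "det A = z ^ m"
  proof -
    have "det A = prod_list (diag_mat A)"
      by (rule det_lower_triangular[of m]) (auto simp: A_def)
    then show ?thesis by (simp add: prod_list_diag_prod) (simp add: A_def)
  qed
  moreover have "det E = z ^ m"
  proof -
    have "det E = prod_list (diag_mat E)"
      by (rule det_upper_triangular[of _ m]) (auto simp: E_def)
    then show ?thesis by (simp add: prod_list_diag_prod) (simp add: E_def)
  qed
  ultimately show ?thesis by (simp add: M_def power_add mult_2)
qed

text \<open>Over the field, for \<open>z \<noteq> 0\<close>, the system \<open>(T + z J) x = - p\<close> is solved by back substitution along the two
  chains of the nilpotent part; the entry of \<open>x\<close> paired with \<open>p\<close> is linear in \<open>d\<close>.\<close>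

lemma bordered_poly_section:
  fixes d :: "nat \<Rightarrow> 'a::field_char_0"
  assumes m: "m > 0"
  shows "bordered_poly m (section_mat m d) (unit_vec (2 * m) m) =
    (\<Sum>l<m. Polynomial.monom ((- 1) ^ (l + 1) * det (symp_J m :: 'a mat) * d l) (2 * m - 2 - 2 * l))"
    (is "?p = ?q")
proof -
  let ?n = "2 * m" and ?J = "symp_J m :: 'a mat"
  have "poly ?p z = poly ?q z" if z: "z \<noteq> 0" for z
  proof -
    define w where "w = inverse z"
    have zw: "z * w = 1" using z by (simp add: w_def)
    have zw': "z * (w * u) = u" for u using zw by (simp add: mult.assoc[symmetric])
    define M where "M = section_mat m d + z \<cdot>\<^sub>m ?J"
    \<comment> \<open>The first half of the solution is a geometric sequence and does not see \<open>d\<close>; the second half is driven by it.\<close>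
    define x1 where "x1 = (\<lambda>l::nat. (- 1) ^ l * w ^ (l + 1))"
    define x2 where "x2 = (\<lambda>i. - (\<Sum>l\<in>{i..<m}. d l * x1 l * w ^ (l - i + 1)))"
    define x where "x = (\<lambda>j. if j < m then x1 j else x2 (j - m))"
    have x2: "z * x2 i = - (d i * x1 i) + x2 (Suc i)" if "i < m" for i
    proof -
      have "(\<Sum>l\<in>{i..<m}. d l * x1 l * w ^ (l - i + 1)) = d i * x1 i * w +
          (\<Sum>l\<in>{Suc i..<m}. d l * x1 l * w ^ (l - i + 1))"
        using that by (simp add: sum.atLeast_Suc_lessThan)
      also have "(\<Sum>l\<in>{Suc i..<m}. d l * x1 l * w ^ (l - i + 1)) =
          w * (\<Sum>l\<in>{Suc i..<m}. d l * x1 l * w ^ (l - Suc i + 1))"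
        unfolding sum_distrib_left
      proof (rule sum.cong)
        fix l assume "l \<in> {Suc i..<m}"
        then have "l - i + 1 = Suc (l - Suc i + 1)" by auto
        then show "d l * x1 l * w ^ (l - i + 1) = w * (d l * x1 l * w ^ (l - Suc i + 1))"
          by (simp only: power_Suc) simp
      qed simp
      finally have "x2 i = - (w * (d i * x1 i)) + w * x2 (Suc i)"
        unfolding x2_def by (simp add: algebra_simps)
      then show ?thesis by (simp add: distrib_left right_diff_distrib zw')
    qed
    have sol: "(\<Sum>j<?n. M $$ (i, j) * x j) = - unit_vec ?n m $ i" if i: "i < ?n" for i
    proof -
      have "(\<Sum>j<?n. M $$ (i, j) * x j) = (\<Sum>j<?n. section_mat m d $$ (i, j) * x j) +
          z * (\<Sum>j<?n. ?J $$ (i, j) * x j)"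
        using i by (simp add: M_def distrib_right sum.distrib sum_distrib_left mult.assoc)
      also have "(\<Sum>j<?n. ?J $$ (i, j) * x j) = partner_sign m i * x (partner m i)"
      proof -
        have "(\<Sum>j<?n. ?J $$ (i, j) * x j) = (\<Sum>j<?n. if j = partner m i then partner_sign m i * x j else 0)"
          by (rule sum.cong) (use i in \<open>auto simp: symp_J_index\<close>)
        then show ?thesis using i by simp
      qed
      finally have e: "(\<Sum>j<?n. M $$ (i, j) * x j) = (\<Sum>j<?n. section_mat m d $$ (i, j) * x j) +
          z * (partner_sign m i * x (partner m i))" .
      consider "i < m" | "i = m" | "m < i" by linarith
      then show ?thesis
      proof cases
        case 1
        have "x2 (Suc i) = 0" if "\<not> i + 1 < m" using that by (simp add: x2_def)
        then show ?thesis
          unfolding e section_mat_mult[OF i] using 1 i x2[OF 1]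
          by (auto simp: partner_sign_def partner_def x_def)
      next
        case 2
        then show ?thesis
          unfolding e section_mat_mult[OF i] using i m zw
          by (simp add: partner_sign_def partner_def x_def x1_def)
      next
        case 3
        then obtain r where r: "i = m + Suc r" using less_imp_Suc_add by auto
        then have rm: "Suc r < m" using i by simp
        have "z * x1 (Suc r) = - x1 r" using zw by (simp add: x1_def zw' algebra_simps)
        then show ?thesis
          unfolding e section_mat_mult[OF i] using i rm r
          by (simp add: partner_sign_def partner_def x_def)
      qed
    qed
    have "poly ?p z = det (bordered ?n M (unit_vec ?n m))"
      unfolding M_def by (rule poly_bordered_poly) simp
    also have "\<dots> = (\<Sum>j<?n. unit_vec ?n m $ j * x j) * det M"
      by (rule det_bordered_solution) (use sol in \<open>auto simp: M_def\<close>)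
    also have "(\<Sum>j<?n. unit_vec ?n m $ j * x j) = (\<Sum>j<?n. if j = m then x j else 0)"
      by (rule sum.cong) (auto simp: unit_vec_def)
    also have "\<dots> = x2 0" using m by (simp add: x_def)
    also have "det M = det ?J * z ^ ?n" unfolding M_def by (rule det_section_pencil)
    also have "x2 0 * (det ?J * z ^ ?n) = poly ?q z"
    proof -
      have "x2 0 * (det ?J * z ^ ?n) = (\<Sum>l<m. - (d l * x1 l * w ^ (l + 1)) * (det ?J * z ^ ?n))"
        by (simp add: x2_def sum_distrib_right sum_negf atLeast0LessThan)
      also have "\<dots> = (\<Sum>l<m. (- 1) ^ (l + 1) * det ?J * d l * z ^ (2 * m - 2 - 2 * l))"
      proof (rule sum.cong)
        fix l assume "l \<in> {..<m}"
        then have n: "?n = (2 * m - 2 - 2 * l) + (2 * l + 2)" by auto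
        have "w ^ (l + 1) * w ^ (l + 1) * z ^ ?n = z ^ (2 * m - 2 - 2 * l)"
        proof -
          have "w ^ (l + 1) * w ^ (l + 1) = w ^ (2 * l + 2)" by (simp add: power_add[symmetric] mult_2)
          moreover have "w ^ (2 * l + 2) * z ^ (2 * l + 2) = 1"
            using zw by (simp only: power_mult_distrib[symmetric] mult.commute[of w] power_one)
          moreover have "z ^ ?n = z ^ (2 * m - 2 - 2 * l) * z ^ (2 * l + 2)"
            by (subst n) (rule power_add)
          ultimately show ?thesis
            using mult.left_commute[of "w ^ (2 * l + 2)" "z ^ (2 * m - 2 - 2 * l)" "z ^ (2 * l + 2)"]
            by (simp only: mult_1_right)
        qed
        then show "- (d l * x1 l * w ^ (l + 1)) * (det ?J * z ^ ?n) =
            (- 1) ^ (l + 1) * det ?J * d l * z ^ (2 * m - 2 - 2 * l)"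
          by (simp add: x1_def mult_ac flip: \<open>w ^ (l + 1) * w ^ (l + 1) * z ^ ?n = z ^ (2 * m - 2 - 2 * l)\<close>)
      qed simp
      finally show ?thesis by (simp add: poly_sum poly_monom)
    qed
    finally show ?thesis .
  qed
  \<comment> \<open>The factor \<open>z\<close> absorbs the excluded value \<open>z = 0\<close>.\<close>
  then have "poly ([:0, 1:] * (?p - ?q)) z = 0" for z by (cases "z = 0") auto
  then have "[:0, 1:] * (?p - ?q) = 0" using poly_all_0_iff_0 by blast
  then have "[:0, 1:] = (0 :: 'a poly) \<or> ?p - ?q = 0" by (rule iffD1[OF mult_eq_0_iff])
  moreover have "[:0, 1:] \<noteq> (0 :: 'a poly)" by simp
  ultimately have "?p - ?q = 0" by blast
  then show ?thesis by simp
qed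

subsection \<open>Transversality of the section to the coadjoint orbits\<close>

text \<open>The matrix \<open>Q\<close> represents a linear form killing the section and the orbit, and \<open>Z\<close> stands for \<open>J T Q\<close>.  The
  equations relate entries of \<open>Q\<close> along the shifts given by the nilpotent part of \<open>T\<close>.  In the upper left block they
  propagate the zeros on and next to the diagonal along antidiagonals; in the mixed block they propagate the zeros of row \<open>m\<close> and
  of the outer boundary along diagonals; in the lower right block they move row by row, starting from row \<open>m\<close>.  The
  parameters \<open>d\<close> only multiply entries already known to be zero.\<close>

lemma section_transversal_core:
  fixes Q :: "nat \<Rightarrow> nat \<Rightarrow> 'a::field_char_0"
  assumes m: "m > 0"
    and sym: "\<And>i j. Q i j = Q j i"
    and diag: "\<And>i. i < m \<Longrightarrow> Q i i = 0"
    and row: "\<And>k. k < 2 * m \<Longrightarrow> Q m k = 0"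
    and Z: "\<And>i j. i < 2 * m \<Longrightarrow> Z i j = (if i < m then (if i = 0 then 0 else - Q (i - 1) j)
        else - (d (i - m) * Q (i - m) j) + (if i - m + 1 < m then Q (i + 1) j else 0))"
    and eqs: "\<And>i j. 0 < i \<Longrightarrow> i < 2 * m \<Longrightarrow> 0 < j \<Longrightarrow> j < 2 * m \<Longrightarrow> Z i j + Z j i = 0"
    and ij: "i < 2 * m" "j < 2 * m"
  shows "Q i j = 0"
proof -
  \<comment> \<open>Both indices below \<open>m\<close>: the pair \<open>(a, b)\<close> moves inwards to \<open>(a + 1, b - 1)\<close>.\<close>
  have A': "b < m \<Longrightarrow> a \<le> b \<Longrightarrow> Q a b = 0" for a b
  proof (induction "b - a" arbitrary: a b rule: less_induct)
    case less
    consider "a = b" | "b = Suc a" | "Suc a < b" using less(3) by linarith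
    then show ?case
    proof cases
      case 1
      then show ?thesis using diag less by simp
    next
      case 2
      have "Z b b + Z b b = 0" using 2 less by (intro eqs) auto
      then show ?thesis using 2 less Z[of b b] by simp
    next
      case 3
      have "Z (Suc a) b + Z b (Suc a) = 0" using 3 less by (intro eqs) auto
      moreover have "Z (Suc a) b = - Q a b" "Z b (Suc a) = - Q (b - 1) (Suc a)"
        using 3 less Z[of "Suc a" b] Z[of b "Suc a"] by auto
      ultimately have "- (Q a b + Q (b - 1) (Suc a)) = 0" by (simp add: minus_add_distrib)
      then have "Q a b + Q (b - 1) (Suc a) = 0" by (simp only: neg_equal_0_iff_equal)
      moreover have "Q (Suc a) (b - 1) = 0" using 3 less(2) by (intro less(1)) auto
      ultimately show ?thesis using sym[of "b - 1" "Suc a"] by simp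
    qed
  qed
  have A: "Q a b = 0" if "a < m" "b < m" for a b
    using A'[of a b] A'[of b a] sym[of a b] that by (cases "a \<le> b") auto
  \<comment> \<open>Mixed indices: the pair moves along the diagonal, towards row \<open>m\<close> or out of range.\<close>
  have B0: "Q a (m + c) = (if c + 1 < m then Q (Suc a) (m + c + 1) else 0)" if "Suc a < m" "c < m" for a c
  proof -
    have "Z (Suc a) (m + c) + Z (m + c) (Suc a) = 0" using that by (intro eqs) auto
    moreover have "Z (Suc a) (m + c) = - Q a (m + c)" using that Z[of "Suc a" "m + c"] by simp
    moreover have "Z (m + c) (Suc a) = (if c + 1 < m then Q (m + c + 1) (Suc a) else 0)"
      using that Z[of "m + c" "Suc a"] A[of c "Suc a"] by simp
    ultimately show ?thesis using sym[of "Suc a" "m + c + 1"] by (simp split: if_splits)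
  qed
  have B1: "c \<le> a \<Longrightarrow> a < m \<Longrightarrow> Q a (m + c) = 0" for a c
  proof (induction c arbitrary: a)
    case 0
    then show ?case using row[of a] sym[of a m] by simp
  next
    case (Suc c)
    then obtain a' where a': "a = Suc a'" by (cases a) auto
    then have "Q a' (m + c) = Q a (m + Suc c)" using B0[of a' c] Suc by simp
    then show ?case using Suc a' by simp
  qed
  have B2: "a < c \<Longrightarrow> c < m \<Longrightarrow> Q a (m + c) = 0" for a c
  proof (induction "m - c" arbitrary: a c rule: less_induct)
    case less
    show ?case
    proof (cases "c + 1 < m")
      case True
      then have "Q (Suc a) (m + Suc c) = 0" using less(2) by (intro less(1)) auto
      then show ?thesis using B0[of a c] less True by simp
    next
      case False
      then show ?thesis using B0[of a c] less by simp
    qed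
  qed
  have B: "Q a (m + c) = 0" if "a < m" "c < m" for a c
    using B1[of c a] B2[of a c] that by (cases "c \<le> a") auto
  have C: "r < m \<Longrightarrow> s < m \<Longrightarrow> Q (m + r) (m + s) = 0" for r s
  proof (induction r arbitrary: s)
    case 0
    then show ?case using row[of "m + s"] by simp
  next
    case (Suc r)
    have "Z (m + r) (m + s) + Z (m + s) (m + r) = 0" using Suc m by (intro eqs) auto
    moreover have "Z (m + r) (m + s) = Q (m + Suc r) (m + s)"
      using Suc Z[of "m + r" "m + s"] B[of r s] by simp
    moreover have "Z (m + s) (m + r) = (if s + 1 < m then Q (m + s + 1) (m + r) else 0)"
      using Suc Z[of "m + s" "m + r"] B[of s r] by simp
    moreover have "Q (m + s + 1) (m + r) = 0" if "s + 1 < m"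
      using Suc.IH[of "Suc s"] Suc.prems that sym[of "m + s + 1" "m + r"] by simp
    ultimately show ?case by (simp split: if_splits)
  qed
  consider "i < m" "j < m" | "i < m" "m \<le> j" | "m \<le> i" "j < m" | "m \<le> i" "m \<le> j" by linarith
  then show ?thesis
  proof cases
    case 1
    then show ?thesis by (rule A)
  next
    case 2
    then show ?thesis using B[of i "j - m"] ij by simp
  next
    case 3
    then show ?thesis using B[of j "i - m"] ij sym[of i j] by simp
  next
    case 4
    then show ?thesis using C[of "i - m" "j - m"] ij by simp
  qed
qed

lemma of_coords_line:
  assumes "A \<in> carrier_mat (2 * m) (2 * m)" "B \<in> carrier_mat (2 * m) (2 * m)"
    and "u \<in> carrier_vec (2 * m)" "v \<in> carrier_vec (2 * m)"
  shows "of_coords b m (A + c \<cdot>\<^sub>m B) (u + c \<cdot>\<^sub>v v) =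
    dual_line (sp_semidirect m) (of_coords b m A u) (of_coords b m B v) c"
proof -
  have "mat_pair (2 * m) (A + c \<cdot>\<^sub>m B) P = mat_pair (2 * m) A P + c * mat_pair (2 * m) B P" for P
    using assms by (simp add: mat_pair_def distrib_right sum.distrib sum_distrib_left mult.assoc)
  moreover have "(\<Sum>i<2 * m. (u + c \<cdot>\<^sub>v v) $ i * w $ i) = (\<Sum>i<2 * m. u $ i * w $ i) + c * (\<Sum>i<2 * m. v $ i * w $ i)" for w
    using assms by (simp add: distrib_right sum.distrib sum_distrib_left mult.assoc)
  ultimately show ?thesis
    by (auto simp: of_coords_def dual_line_def algebra_simps)
qed

lemma dual_linear_expand:
  fixes l :: "('a::field_char_0 mat \<times> 'a vec \<Rightarrow> 'a) \<Rightarrow> 'a"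
  assumes lin: "\<And>\<eta> \<zeta> t. \<eta> \<in> lie_dual (sp_semidirect m) \<Longrightarrow> \<zeta> \<in> lie_dual (sp_semidirect m) \<Longrightarrow>
      l (dual_line (sp_semidirect m) \<eta> \<zeta> t) = l \<eta> + t * l \<zeta>"
    and T: "T \<in> sym_mats (2 * m)" and p: "p \<in> carrier_vec (2 * m)"
  shows "l (of_coords b m T p) =
    (\<Sum>i<2 * m. \<Sum>j<2 * m. T $$ (i, j) * l (of_coords b m (sym_unit (2 * m) i j) (0\<^sub>v (2 * m)))) / 2 +
    (\<Sum>i<2 * m. p $ i * l (of_coords b m (0\<^sub>m (2 * m) (2 * m)) (unit_vec (2 * m) i)))"
proof -
  let ?n = "2 * m"
  have L: "l (of_coords b m (A + c \<cdot>\<^sub>m B) (u + c \<cdot>\<^sub>v v)) = l (of_coords b m A u) + c * l (of_coords b m B v)"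
    if "A \<in> carrier_mat ?n ?n" "B \<in> carrier_mat ?n ?n" "u \<in> carrier_vec ?n" "v \<in> carrier_vec ?n" for A B u v c
    using that by (simp only: of_coords_line lin of_coords_in)
  have Tc: "T \<in> carrier_mat ?n ?n" using T by (rule sym_matsD)
  have "T + 1 \<cdot>\<^sub>m 0\<^sub>m ?n ?n = T" "0\<^sub>v ?n + 1 \<cdot>\<^sub>v p = p"
    using Tc p by auto
  then have "l (of_coords b m T p) = l (of_coords b m T (0\<^sub>v ?n)) + l (of_coords b m (0\<^sub>m ?n ?n) p)"
    using L[of T "0\<^sub>m ?n ?n" "0\<^sub>v ?n" p 1] Tc p by simp
  moreover have "l (of_coords b m T (0\<^sub>v ?n)) =
      (\<Sum>i<?n. \<Sum>j<?n. T $$ (i, j) * l (of_coords b m (sym_unit ?n i j) (0\<^sub>v ?n))) / 2"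
  proof (rule sym_linear_expand[OF _ T])
    fix A B :: "'a mat" and c
    assume "A \<in> sym_mats ?n" "B \<in> sym_mats ?n"
    moreover have "0\<^sub>v ?n + c \<cdot>\<^sub>v 0\<^sub>v ?n = (0\<^sub>v ?n :: 'a vec)" by auto
    ultimately show "l (of_coords b m (A + c \<cdot>\<^sub>m B) (0\<^sub>v ?n)) =
        l (of_coords b m A (0\<^sub>v ?n)) + c * l (of_coords b m B (0\<^sub>v ?n))"
      using L[of A B "0\<^sub>v ?n" "0\<^sub>v ?n" c] by (simp add: sym_matsD)
  qed
  moreover have "l (of_coords b m (0\<^sub>m ?n ?n) p) = (\<Sum>i<?n. p $ i * l (of_coords b m (0\<^sub>m ?n ?n) (unit_vec ?n i)))"
  proof (rule vec_linear_expand[OF _ p])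
    fix u v :: "'a vec" and c
    assume "u \<in> carrier_vec ?n" "v \<in> carrier_vec ?n"
    moreover have "0\<^sub>m ?n ?n + c \<cdot>\<^sub>m 0\<^sub>m ?n ?n = (0\<^sub>m ?n ?n :: 'a mat)" by auto
    ultimately show "l (of_coords b m (0\<^sub>m ?n ?n) (u + c \<cdot>\<^sub>v v)) =
        l (of_coords b m (0\<^sub>m ?n ?n) u) + c * l (of_coords b m (0\<^sub>m ?n ?n) v)"
      using L[of "0\<^sub>m ?n ?n" "0\<^sub>m ?n ?n" u v c] by simp
  qed
  ultimately show ?thesis by simp
qed

lemma symp_J_mult_sym_in_sp:
  fixes S :: "'a::field mat"
  assumes S: "S \<in> sym_mats (2 * m)"
  shows "symp_J m * S \<in> carrier (sp m)"
proof -
  have Sc: "S \<in> carrier_mat (2 * m) (2 * m)" using S by (rule sym_matsD)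
  then have c: "symp_J m * S \<in> carrier_mat (2 * m) (2 * m)" by auto
  show ?thesis
    unfolding sp_iff_index[OF c]
  proof (intro allI impI)
    fix i j assume ij: "i < 2 * m" "j < 2 * m"
    have "partner_sign m k * (symp_J m * S) $$ (partner m k, l) = - S $$ (k, l)"
      if "k < 2 * m" "l < 2 * m" for k l
      using that by (simp add: symp_J_mult_index[OF Sc] mult.assoc[symmetric] del: index_mult_mat(1))
    then show "partner_sign m i * (symp_J m * S) $$ (partner m i, j) =
        partner_sign m j * (symp_J m * S) $$ (partner m j, i)"
      using ij sym_mats_index[OF S ij] by simp
  qed
qed

text \<open>Represent \<open>l\<close> by a symmetric matrix \<open>Q\<close> and a vector \<open>w\<close>.  The translations \<open>(0, a)\<close> force row \<open>m\<close> of \<open>Q\<close> to vanish.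
  The elements \<open>(J S, 0)\<close> with \<open>S\<close> a symmetrised unit then give equations for the entries of \<open>J T Q\<close>; \<open>w\<close> occurs
  only in those with an index 0, because the vector part of the section is the basis vector paired with index 0.  The
  other equations determine \<open>Q = 0\<close>, and then those with an index 0 give \<open>w = 0\<close>.\<close>

lemma section_transversal:
  fixes l :: "('a::field_char_0 mat \<times> 'a vec \<Rightarrow> 'a) \<Rightarrow> 'a"
  assumes b: "b \<noteq> 0" and m: "m > 0"
    and lin: "\<And>\<eta> \<zeta> t. \<eta> \<in> lie_dual (sp_semidirect m) \<Longrightarrow> \<zeta> \<in> lie_dual (sp_semidirect m) \<Longrightarrow>
      l (dual_line (sp_semidirect m) \<eta> \<zeta> t) = l \<eta> + t * l \<zeta>"
    and tang: "\<And>k. k < m \<Longrightarrow> l (of_coords b m (sym_unit (2 * m) k k) (0\<^sub>v (2 * m))) = 0"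
    and coad: "\<And>x. x \<in> carrier (sp_semidirect m) \<Longrightarrow>
      l (coad (sp_semidirect m) x (of_coords b m (section_mat m d) (unit_vec (2 * m) m))) = 0"
    and \<gamma>: "\<gamma> \<in> lie_dual (sp_semidirect m)"
  shows "l \<gamma> = 0"
proof -
  let ?n = "2 * m" and ?J = "symp_J m :: 'a mat"
  define T where "T = (section_mat m d :: 'a mat)"
  have T: "T \<in> sym_mats ?n" and Tc: "T \<in> carrier_mat ?n ?n" by (simp_all add: T_def section_mat_sym)
  define q where "q = (\<lambda>i j. l (of_coords b m (sym_unit ?n i j) (0\<^sub>v ?n)))"
  define w where "w = (\<lambda>i. l (of_coords b m (0\<^sub>m ?n ?n) (unit_vec ?n i)))"
  define Q where "Q = mat ?n ?n (\<lambda>(i, j). q i j)"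
  have qsym: "q i j = q j i" for i j by (simp add: q_def sym_unit_commute[of _ i j])
  have Qc: "Q \<in> carrier_mat ?n ?n" by (simp add: Q_def)
  have Q: "Q \<in> sym_mats ?n" by (rule sym_matsI') (simp_all add: Q_def qsym)
  have expand: "l (of_coords b m A p) = mat_pair ?n A Q / 2 + (\<Sum>i<?n. p $ i * w i)"
    if "A \<in> sym_mats ?n" "p \<in> carrier_vec ?n" for A p
    using dual_linear_expand[of m l A p b, OF lin that] by (simp add: mat_pair_def Q_def q_def w_def)
  let ?e = "unit_vec ?n m :: 'a vec"
  have key: "mat_pair ?n (T * X) Q - (\<Sum>k<?n. Q $$ (m, k) * (?J *\<^sub>v a) $ k) + (\<Sum>k<?n. X $$ (m, k) * w k) = 0"
    if X: "X \<in> carrier (sp m)" and a: "a \<in> carrier_vec ?n" for X a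
  proof -
    let ?a = "?J *\<^sub>v a"
    have Xc: "X \<in> carrier_mat ?n ?n" using X by (rule sp_carrier_mat)
    define A where "A = mat ?n ?n (\<lambda>(i, j). (transpose_mat X * T) $$ (i, j) + (T * X) $$ (i, j)
        - (?e $ i * ?a $ j + ?a $ i * ?e $ j))"
    have tr: "transpose_mat (T * X) = transpose_mat X * T"
      using Tc Xc sym_matsD(2)[OF T] by (simp add: transpose_mult[of _ ?n ?n _ ?n])
    then have e: "(transpose_mat X * T) $$ (k, i) = (T * X) $$ (i, k)" if "k < ?n" "i < ?n" for k i
      using that Tc Xc by (metis index_transpose_mat(1) carrier_matD index_mult_mat(2,3))
    have A: "A \<in> sym_mats ?n"
      by (rule sym_matsI') (simp_all add: A_def e algebra_simps del: index_mult_mat(1))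
    have "l (coad (sp_semidirect m) (X, a) (of_coords b m T ?e)) = 0"
      using coad[of "(X, a)"] X a by (simp add: T_def sp_semidirect_simps)
    then have "l (of_coords b m A (transpose_mat X *\<^sub>v ?e)) = 0"
      using coad_of_coords[OF X a T, of ?e b] by (simp add: A_def)
    then have *: "mat_pair ?n A Q / 2 + (\<Sum>i<?n. (transpose_mat X *\<^sub>v ?e) $ i * w i) = 0"
      using expand[OF A, of "transpose_mat X *\<^sub>v ?e"] Xc by (simp add: mult_mat_vec_carrier[of _ ?n ?n])
    have "(\<Sum>i<?n. (transpose_mat X *\<^sub>v ?e) $ i * w i) = (\<Sum>k<?n. X $$ (m, k) * w k)"
    proof (rule sum.cong)
      fix i assume "i \<in> {..<?n}"
      then show "(transpose_mat X *\<^sub>v ?e) $ i * w i = X $$ (m, i) * w i"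
        using Xc m by simp
    qed simp
    moreover have "mat_pair ?n A Q = 2 * mat_pair ?n (T * X) Q - 2 * (\<Sum>k<?n. Q $$ (m, k) * ?a $ k)"
    proof -
      have "mat_pair ?n A Q = mat_pair ?n (transpose_mat X * T) Q + mat_pair ?n (T * X) Q
          - ((\<Sum>i<?n. \<Sum>j<?n. ?e $ i * ?a $ j * Q $$ (i, j)) + (\<Sum>i<?n. \<Sum>j<?n. ?a $ i * ?e $ j * Q $$ (i, j)))"
        unfolding mat_pair_def
        by (simp add: A_def left_diff_distrib distrib_right sum.distrib sum_subtractf del: index_mult_mat(1) index_unit_vec)
      moreover have "mat_pair ?n (transpose_mat X * T) Q = mat_pair ?n (T * X) Q"
        using mat_pair_transpose[of "T * X" ?n Q] Tc Xc Qc sym_matsD(2)[OF Q] by (simp add: tr)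
      moreover have "(\<Sum>i<?n. \<Sum>j<?n. ?e $ i * ?a $ j * Q $$ (i, j)) = (\<Sum>k<?n. Q $$ (m, k) * ?a $ k)"
      proof -
        have "(\<Sum>i<?n. \<Sum>j<?n. ?e $ i * ?a $ j * Q $$ (i, j)) =
            (\<Sum>i<?n. if i = m then (\<Sum>j<?n. Q $$ (m, j) * ?a $ j) else 0)"
          by (rule sum.cong) (auto simp: unit_vec_def mult.commute)
        then show ?thesis using m by simp
      qed
      moreover have "(\<Sum>i<?n. \<Sum>j<?n. ?a $ i * ?e $ j * Q $$ (i, j)) = (\<Sum>i<?n. \<Sum>j<?n. ?e $ i * ?a $ j * Q $$ (i, j))"
        by (subst sum.swap) (intro sum.cong refl, use sym_mats_index[OF Q] in \<open>auto simp: mult_ac\<close>)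
      ultimately show ?thesis by simp
    qed
    ultimately show ?thesis using * by (simp add: diff_divide_distrib)
  qed
  have zero_sp: "0\<^sub>m ?n ?n \<in> carrier (sp m :: ('a, 'a mat) lie_algebra)" by (rule zero_in_sp)
  have row: "Q $$ (m, k) = 0" if k: "k < ?n" for k
  proof -
    have "?J *\<^sub>v (?J *\<^sub>v (- unit_vec ?n k)) = (unit_vec ?n k :: 'a vec)"
    proof -
      have "?J *\<^sub>v (?J *\<^sub>v (- unit_vec ?n k)) = (?J * ?J) *\<^sub>v (- unit_vec ?n k)"
        by (rule assoc_mult_mat_vec[symmetric, of _ ?n ?n _ ?n]) auto
      then show ?thesis by (simp add: symp_J_square)
    qed
    then have "(\<Sum>i<?n. Q $$ (m, i) * (unit_vec ?n k :: 'a vec) $ i) = 0"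
      using key[OF zero_sp, of "?J *\<^sub>v (- unit_vec ?n k)"] Tc m
      by (simp add: mult_mat_vec_carrier[of _ ?n ?n] mat_pair_def)
    moreover have "(\<Sum>i<?n. Q $$ (m, i) * (unit_vec ?n k :: 'a vec) $ i) = (\<Sum>i<?n. if i = k then Q $$ (m, i) else 0)"
      by (rule sum.cong) (use k in \<open>auto simp: unit_vec_def\<close>)
    ultimately show ?thesis using k by simp
  qed
  define Z where "Z = ?J * (T * Q)"
  have Zc: "Z \<in> carrier_mat ?n ?n" using Tc Qc by (auto simp: Z_def)
  have keyZ: "Z $$ (i, j) + Z $$ (j, i) + ((if i = 0 then w j else 0) + (if j = 0 then w i else 0)) = 0"
    if ij: "i < ?n" "j < ?n" for i j
  proof -
    define S where "S = (sym_unit ?n i j :: 'a mat)"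
    have S: "S \<in> sym_mats ?n" and Sc: "S \<in> carrier_mat ?n ?n" by (simp_all add: S_def)
    have "mat_pair ?n (T * (?J * S)) Q = mat_pair ?n (?J * S) (T * Q)"
      using mat_pair_mult_left[OF Tc mult_carrier_mat[OF symp_J_carrier Sc] Qc] sym_matsD(2)[OF T] by simp
    also have "\<dots> = mat_pair ?n S (- ?J * (T * Q))"
      using mat_pair_mult_left[OF symp_J_carrier Sc, of "T * Q"] Tc Qc by (simp add: transpose_symp_J)
    also have "- ?J * (T * Q) = - Z" unfolding Z_def using Tc Qc by simp
    also have "mat_pair ?n S (- Z) = - (Z $$ (i, j) + Z $$ (j, i))"
      unfolding S_def using mat_pair_sym_unit[OF _ ij, of "- Z"] Zc ij by simp
    finally have 1: "mat_pair ?n (T * (?J * S)) Q = - (Z $$ (i, j) + Z $$ (j, i))" .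
    have "(\<Sum>k<?n. (?J * S) $$ (m, k) * w k) =
        - (\<Sum>k<?n. (if k = j then (if i = 0 then w k else 0) else 0) + (if k = i then (if j = 0 then w k else 0) else 0))"
      unfolding sum_negf[symmetric]
    proof (rule sum.cong)
      fix k assume k: "k \<in> {..<?n}"
      have "(?J * S) $$ (m, k) = - S $$ (0, k)"
        using symp_J_mult_index[OF Sc, of m k] k m by (simp add: partner_def partner_sign_def)
      then show "(?J * S) $$ (m, k) * w k =
        - ((if k = j then (if i = 0 then w k else 0) else 0) + (if k = i then (if j = 0 then w k else 0) else 0))"
        using k m by (simp add: S_def sym_unit_index)
    qed simp
    then have 2: "(\<Sum>k<?n. (?J * S) $$ (m, k) * w k) = - ((if i = 0 then w j else 0) + (if j = 0 then w i else 0))"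
      using ij by (simp add: sum.distrib)
    define W where "W = (if i = 0 then w j else 0) + (if j = 0 then w i else 0)"
    have 3: "(\<Sum>k<?n. Q $$ (m, k) * (?J *\<^sub>v 0\<^sub>v ?n) $ k) = 0"
      by (rule sum.neutral) (use row in auto)
    have "- (Z $$ (i, j) + Z $$ (j, i)) - 0 + - W = 0"
      using key[OF symp_J_mult_sym_in_sp[OF S] zero_carrier_vec] unfolding 1 2 3 W_def .
    then have "- (Z $$ (i, j) + Z $$ (j, i) + W) = 0" by (simp only: minus_add_distrib diff_0_right)
    then show ?thesis unfolding W_def by (simp only: neg_equal_0_iff_equal)
  qed
  have Zidx: "Z $$ (i, j) = (if i < m then (if i = 0 then 0 else - q (i - 1) j)
        else - (d (i - m) * q (i - m) j) + (if i - m + 1 < m then q (i + 1) j else 0))"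
    if ij: "i < ?n" "j < ?n" for i j
  proof -
    have TQ: "(T * Q) $$ (k, j) = (\<Sum>r<?n. section_mat m d $$ (k, r) * q r j)" if "k < ?n" for k
      using that ij mult_index_sum[OF Tc Qc, of k j] by (simp add: T_def Q_def)
    have "Z $$ (i, j) = partner_sign m i * (T * Q) $$ (partner m i, j)"
      unfolding Z_def using ij Tc Qc by (intro symp_J_mult_index) auto
    also have "\<dots> = (if i < m then (if i = 0 then 0 else - q (i - 1) j)
        else - (d (i - m) * q (i - m) j) + (if i - m + 1 < m then q (i + 1) j else 0))"
      using ij by (auto simp: TQ section_mat_mult partner_def partner_sign_def)
    finally show ?thesis .
  qed
  define q' where "q' = (\<lambda>i j. if i < ?n \<and> j < ?n then q i j else 0)"
  define Z' where "Z' = (\<lambda>i j. if j < ?n then Z $$ (i, j) else 0)"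
  have qz: "q i j = 0" if ij: "i < ?n" "j < ?n" for i j
  proof -
    have "q' i j = 0"
    proof (rule section_transversal_core[where Z = Z' and d = d and m = m])
      show "q' i j = q' j i" for i j by (auto simp: q'_def qsym)
      show "q' k k = 0" if "k < m" for k using tang[OF that] that by (simp add: q'_def q_def)
      show "q' m k = 0" if "k < ?n" for k using row[OF that] that m by (simp add: q'_def Q_def)
      show "Z' i j = (if i < m then (if i = 0 then 0 else - q' (i - 1) j)
        else - (d (i - m) * q' (i - m) j) + (if i - m + 1 < m then q' (i + 1) j else 0))"
        if "i < ?n" for i j
        using that by (auto simp: Z'_def q'_def Zidx)
      show "Z' i j + Z' j i = 0" if "0 < i" "i < ?n" "0 < j" "j < ?n" for i j
        using keyZ[of i j] that by (simp add: Z'_def)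
    qed (use m ij in auto)
    then show ?thesis using ij by (simp add: q'_def)
  qed
  have "w j = 0" if j: "j < ?n" for j
  proof -
    have "Z $$ (k, i) = 0" if "k < ?n" "i < ?n" for k i
      using that by (auto simp: Zidx qz)
    then have "w j + (if j = 0 then w 0 else 0) = 0" using keyZ[of 0 j] m j by simp
    then show ?thesis by (cases "j = 0") auto
  qed
  moreover have "mat_pair ?n A Q = 0" for A by (simp add: mat_pair_def Q_def qz)
  ultimately have "l (of_coords b m (mat_coord b m \<gamma>) (vec_coord b m \<gamma>)) = 0"
    using expand[OF mat_coord_sym vec_coord_carrier, of b \<gamma> b \<gamma>] by simp
  then show ?thesis by (simp add: of_coords_coords[OF b \<gamma>])
qed

text \<open>The coefficient with index \<open>2 m - 2 i\<close> restricts to a multiple of the coordinate \<open>d (i - 1)\<close> of the section.  The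
  symmetrised unit used as a direction of the section has the diagonal entry 2, whence the factors 2 in the proof.\<close>

theorem bordered_coeffs_freely_generate:
  fixes b \<kappa> :: "'a::field_char_0"
  assumes b: "b \<noteq> 0" and \<kappa>: "\<kappa> \<noteq> 0" and m: "m > 0"
  shows "freely_generated_by (sp_semidirect m) (sym_invariants (sp_semidirect m)) {1..m}
    (\<lambda>i. sym_mult (sp_semidirect m) (sym_const (sp_semidirect m) \<kappa>) (bordered_coeff b m (2 * m - 2 * i)))"
proof -
  let ?n = "2 * m" and ?L = "sp_semidirect m :: ('a, 'a mat \<times> 'a vec) lie_algebra"
  interpret S: lin_lie ?L by (rule lin_lie_sp_semidirect)
  define H where "H = (\<lambda>i. sym_mult ?L (sym_const ?L \<kappa>) (bordered_coeff b m (?n - 2 * i)))"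
  define a where "a = of_coords b m (section_mat m (\<lambda>_. 0)) (unit_vec ?n m)"
  define \<tau> where "\<tau> = (\<lambda>i. of_coords b m (sym_unit ?n (i - 1) (i - 1)) (0\<^sub>v ?n))"
  define D where "D = (\<lambda>d i. 2 * (d (Suc i) :: 'a))"
  have pt: "S.affine_point {1..m} a \<tau> d = of_coords b m (section_mat m (D d)) (unit_vec ?n m)" for d
  proof (rule S.dual_eqI)
    show "S.affine_point {1..m} a \<tau> d \<in> lie_dual ?L"
      by (rule S.affine_point_in) (simp_all add: a_def \<tau>_def of_coords_in)
    fix x assume x: "x \<in> carrier ?L"
    then obtain X w where xw: "x = (X, w)" "X \<in> carrier (sp m)" "w \<in> carrier_vec ?n"
      by (auto simp: sp_semidirect_simps)
    obtain P where P: "P \<in> sym_mats ?n" "X = P * symp_J m" using xw(2) by (rule sp_carrierE)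
    have Pc: "P \<in> carrier_mat ?n ?n" using P(1) by (rule sym_matsD)
    have "mat_pair ?n (section_mat m e) P = mat_pair ?n (section_mat m (\<lambda>_. 0)) P + (\<Sum>i<m. e i * P $$ (i, i))" for e
    proof -
      have "mat_pair ?n (section_mat m e) P = (\<Sum>i<?n. (\<Sum>j<?n. section_mat m (\<lambda>_. 0) $$ (i, j) * P $$ (i, j)) +
          (\<Sum>j<?n. if j = i then (if i < m then e i * P $$ (i, i) else 0) else 0))"
        unfolding mat_pair_def sum.distrib[symmetric]
        by (intro sum.cong refl) (auto simp: section_mat_def left_diff_distrib)
      also have "\<dots> = mat_pair ?n (section_mat m (\<lambda>_. 0)) P + (\<Sum>i<?n. if i < m then e i * P $$ (i, i) else 0)"
        unfolding mat_pair_def sum.distrib by simp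
      also have "(\<Sum>i<?n. if i < m then e i * P $$ (i, i) else 0) = (\<Sum>i<m. e i * P $$ (i, i))"
        by (simp add: sum_lessThan_double)
      finally show ?thesis .
    qed
    note sec = this
    have "(\<Sum>i\<in>{1..m}. d i * \<tau> i x) = b * (\<Sum>i<m. D d i * P $$ (i, i))"
    proof -
      have "(\<Sum>i\<in>{1..m}. d i * \<tau> i x) = (\<Sum>i<m. d (Suc i) * \<tau> (Suc i) x)"
        by (rule sum.reindex_bij_witness[of _ Suc "\<lambda>i. i - 1"]) auto
      also have "\<dots> = (\<Sum>i<m. b * (D d i * P $$ (i, i)))"
      proof (rule sum.cong)
        fix i assume "i \<in> {..<m}"
        then show "d (Suc i) * \<tau> (Suc i) x = b * (D d i * P $$ (i, i))"
          unfolding \<tau>_def xw(1) P(2) of_coords_apply[OF P(1) xw(3)]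
          using xw(3) mat_pair_sym_unit[OF Pc, of i i] by (simp add: D_def)
      qed simp
      finally show ?thesis by (simp add: sum_distrib_left)
    qed
    moreover have "a x = b * (mat_pair ?n (section_mat m (\<lambda>_. 0)) P + 2 * (\<Sum>i<?n. unit_vec ?n m $ i * w $ i))"
      unfolding a_def xw(1) P(2) of_coords_apply[OF P(1) xw(3)] ..
    ultimately have "S.affine_point {1..m} a \<tau> d x = b * (mat_pair ?n (section_mat m (\<lambda>_. 0)) P +
        2 * (\<Sum>i<?n. unit_vec ?n m $ i * w $ i)) + b * (\<Sum>i<m. D d i * P $$ (i, i))"
      using x by (simp add: S.affine_point_def)
    also have "\<dots> = of_coords b m (section_mat m (D d)) (unit_vec ?n m) x"
      unfolding xw(1) P(2) of_coords_apply[OF P(1) xw(3)] sec[of "D d"] by (simp add: algebra_simps)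
    finally show "S.affine_point {1..m} a \<tau> d x = of_coords b m (section_mat m (D d)) (unit_vec ?n m) x" .
  qed (rule of_coords_in)
  have "freely_generated_by ?L (sym_invariants ?L) {1..m} H"
  proof (rule S.affine_section_criterion[where \<mu> = "\<lambda>i. \<kappa> * ((- 1) ^ i * det (symp_J m) * 2)"])
    show "finite {1..m}" by simp
    show "H i \<in> sym_invariants ?L" for i
      unfolding H_def by (intro S.invariants_mult S.invariants_const bordered_coeff_invariant b)
    show "a \<in> lie_dual ?L" "\<tau> i \<in> lie_dual ?L" for i by (simp_all add: a_def \<tau>_def of_coords_in)
    show "\<kappa> * ((- 1) ^ i * det (symp_J m) * 2) \<noteq> 0" for i :: nat
      using \<kappa> det_symp_J_nonzero by simp
    show "H i (S.affine_point {1..m} a \<tau> d) = \<kappa> * ((- 1) ^ i * det (symp_J m) * 2) * d i"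
      if i: "i \<in> {1..m}" for i d
    proof -
      have "H i (S.affine_point {1..m} a \<tau> d) =
          \<kappa> * coeff (bordered_poly m (section_mat m (D d)) (unit_vec ?n m)) (?n - 2 * i)"
        unfolding pt H_def using b
        by (simp add: S.sym_apply of_coords_in bordered_coeff_def mat_coord_of_coords section_mat_sym vec_coord_of_coords)
      also have "coeff (bordered_poly m (section_mat m (D d)) (unit_vec ?n m)) (?n - 2 * i) =
          (\<Sum>l<m. if l = i - 1 then (- 1) ^ (l + 1) * det (symp_J m) * D d l else 0)"
        unfolding bordered_poly_section[OF m] coeff_sum
      proof (rule sum.cong)
        fix l assume "l \<in> {..<m}"
        then have "?n - 2 - 2 * l = ?n - 2 * i \<longleftrightarrow> l = i - 1" using i by auto
        then show "coeff (Polynomial.monom ((- 1) ^ (l + 1) * det (symp_J m) * D d l) (?n - 2 - 2 * l)) (?n - 2 * i) =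
            (if l = i - 1 then (- 1) ^ (l + 1) * det (symp_J m) * D d l else 0)" by simp
      qed simp
      also have "\<dots> = (- 1) ^ i * det (symp_J m) * (2 * d i)"
        using i by (auto simp: D_def)
      finally show ?thesis by (simp add: mult_ac)
    qed
    show "l \<gamma> = 0"
      if lin: "\<And>\<eta> \<zeta> t. \<eta> \<in> lie_dual ?L \<Longrightarrow> \<zeta> \<in> lie_dual ?L \<Longrightarrow> l (dual_line ?L \<eta> \<zeta> t) = l \<eta> + t * l \<zeta>"
        and tang: "\<And>i. i \<in> {1..m} \<Longrightarrow> l (\<tau> i) = 0"
        and co: "\<And>x. x \<in> carrier ?L \<Longrightarrow> l (coad ?L x (S.affine_point {1..m} a \<tau> d)) = 0"
        and \<gamma>: "\<gamma> \<in> lie_dual ?L" for d l \<gamma>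
    proof (rule section_transversal[OF b m lin _ _ \<gamma>])
      show "l (of_coords b m (sym_unit ?n k k) (0\<^sub>v ?n)) = 0" if "k < m" for k
        using tang[of "Suc k"] that by (simp add: \<tau>_def)
      show "l (coad ?L x (of_coords b m (section_mat m (D d)) (unit_vec ?n m))) = 0" if "x \<in> carrier ?L" for x
        using co[OF that] unfolding pt .
    qed
  qed
  then show ?thesis by (simp add: H_def)
qed

section \<open>Principal minors and the characteristic polynomial\<close>

lemma bij_betw_pick:
  assumes "finite I"
  shows "bij_betw (pick I) {..<card I} I"
proof -
  have sub: "pick I ` {..<card I} \<subseteq> I" using pick_in_set by auto
  have sup: "I \<subseteq> pick I ` {..<card I}"
  proof
    fix i assume i: "i \<in> I"
    have "{a \<in> I. a < i} \<subset> I" using i by auto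
    then have "card {a \<in> I. a < i} < card I" using assms by (rule psubset_card_mono[rotated])
    then show "i \<in> pick I ` {..<card I}"
      using pick_card_in_set[OF i] by (intro image_eqI[of _ _ "card {a \<in> I. a < i}"]) auto
  qed
  have "pick I ` {..<card I} = I" using sub sup by blast
  moreover have "inj_on (pick I) {..<card I}"
    by (rule eq_card_imp_inj_on) (use \<open>pick I ` {..<card I} = I\<close> in auto)
  ultimately show ?thesis by (simp add: bij_betw_def)
qed

text \<open>Reindexing along the increasing enumeration of \<open>I\<close> turns permutations of \<open>I\<close> into permutations of an initial
  segment, with the same sign.\<close>

lemma det_principal_submatrix:
  fixes X :: "'a::comm_ring_1 mat"
  assumes I: "I \<subseteq> {..<n}" and X: "X \<in> carrier_mat n n"
  shows "det (submatrix X I I) = (\<Sum>p | p permutes I. of_int (sign p) * (\<Prod>i\<in>I. X $$ (i, p i)))"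
proof -
  have fin: "finite I" using I finite_subset by blast
  define k where "k = card I"
  define f where "f = pick I"
  have f: "bij_betw f {..<k} I" unfolding f_def k_def using fin by (rule bij_betw_pick)
  have cI: "{i. i < dim_row X \<and> i \<in> I} = I" "{i. i < dim_col X \<and> i \<in> I} = I" using I X by auto
  have S: "submatrix X I I \<in> carrier_mat k k"
    unfolding submatrix_def cI k_def by simp
  have idx: "submatrix X I I $$ (a, b) = X $$ (f a, f b)" if "a < k" "b < k" for a b
    using that by (simp add: submatrix_def cI k_def f_def)
  define F where "F = (\<lambda>\<pi> x. if x \<in> I then f (\<pi> (inv_into {..<k} f x)) else x)"
  have F: "bij_betw F {\<pi>. \<pi> permutes {..<k}} {\<pi>. \<pi> permutes I}"
    unfolding F_def by (rule bij_betw_permutations[OF f])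
  have "(\<Sum>p | p permutes I. of_int (sign p) * (\<Prod>i\<in>I. X $$ (i, p i))) =
      (\<Sum>p | p permutes {..<k}. of_int (sign (F p)) * (\<Prod>i\<in>I. X $$ (i, F p i)))"
    by (rule sum.reindex_bij_betw[OF F, symmetric])
  also have "\<dots> = (\<Sum>p | p permutes {..<k}. of_int (sign p) * (\<Prod>a<k. submatrix X I I $$ (a, p a)))"
  proof (rule sum.cong)
    fix p assume "p \<in> {p. p permutes {..<k}}"
    then have p: "p permutes {..<k}" by simp
    have inv: "inv_into {..<k} f (f a) = a" if "a < k" for a
      using f that by (simp add: bij_betw_def inv_into_f_f)
    have "sign (F p) = sign p"
      unfolding F_def by (rule permutes_bij_finite.sign_p', unfold_locales) (use p f inv in auto)
    moreover have "(\<Prod>i\<in>I. X $$ (i, F p i)) = (\<Prod>a<k. submatrix X I I $$ (a, p a))"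
    proof -
      have "(\<Prod>i\<in>I. X $$ (i, F p i)) = (\<Prod>a\<in>{..<k}. X $$ (f a, F p (f a)))"
        by (rule prod.reindex_bij_betw[OF f, symmetric])
      also have "\<dots> = (\<Prod>a<k. submatrix X I I $$ (a, p a))"
      proof (rule prod.cong)
        fix a assume "a \<in> {..<k}"
        then have a: "a < k" by simp
        then have "p a < k" using permutes_in_image[OF p, of a] by simp
        moreover have "f a \<in> I" using f a by (auto simp: bij_betw_def)
        ultimately show "X $$ (f a, F p (f a)) = submatrix X I I $$ (a, p a)"
          using a inv by (simp add: idx F_def)
      qed simp
      finally show ?thesis .
    qed
    ultimately show "of_int (sign (F p)) * (\<Prod>i\<in>I. X $$ (i, F p i)) =
        of_int (sign p) * (\<Prod>a<k. submatrix X I I $$ (a, p a))" by simp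
  qed simp
  also have "\<dots> = det (submatrix X I I)"
    unfolding det_def'[OF S] by (simp add: atLeast0LessThan)
  finally show ?thesis ..
qed

definition shift_pencil :: "nat \<Rightarrow> 'a::comm_ring_1 mat \<Rightarrow> 'a poly mat" where
  "shift_pencil n X = mat n n (\<lambda>(i, j). [:X $$ (i, j), if i = j then 1 else 0:])"

text \<open>In the Leibniz formula, a permutation contributes \<open>z\<close> only at fixed points.  Choosing the set of indices where \<open>z\<close> is
  not taken groups the terms by sets \<open>I\<close> that contain all points moved by the permutation.\<close>

lemma det_shift_pencil:
  fixes X :: "'a::comm_ring_1 mat"
  assumes X: "X \<in> carrier_mat n n"
  shows "det (shift_pencil n X) =
    (\<Sum>I\<in>Pow {..<n}. Polynomial.monom (det (submatrix X I I)) (n - card I))"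
proof -
  let ?N = "{0..<n}"
  let ?g = "\<lambda>p i. if i = p i then [:0, 1:] else (0 :: 'a poly)"
  have M: "shift_pencil n X \<in> carrier_mat n n" by (simp add: shift_pencil_def)
  have fac: "(\<Prod>i\<in>?N - I. ?g p i) = (if p permutes I then Polynomial.monom 1 (n - card I) else 0)"
    if p: "p permutes ?N" and I: "I \<subseteq> ?N" for p I
  proof (cases "p permutes I")
    case True
    then have "(\<Prod>i\<in>?N - I. ?g p i) = (\<Prod>i\<in>?N - I. [:0, 1:])"
      by (intro prod.cong) (auto simp: permutes_not_in)
    also have "\<dots> = [:0, 1:] ^ (n - card I)"
      using I by (simp add: card_Diff_subset finite_subset)
    finally show ?thesis using True by (simp add: monom_altdef)
  next
    case False
    have "\<exists>i\<in>?N - I. p i \<noteq> i"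
    proof (rule ccontr)
      assume "\<not> (\<exists>i\<in>?N - I. p i \<noteq> i)"
      then have "p permutes I" using p permutes_superset[of p ?N I] by auto
      then show False using False by simp
    qed
    then have "\<exists>i\<in>?N - I. ?g p i = 0" by metis
    then have "(\<Prod>i\<in>?N - I. ?g p i) = 0" by (intro prod_zero) auto
    then show ?thesis using False by simp
  qed
  have "det (shift_pencil n X) = (\<Sum>p | p permutes ?N. of_int (sign p) * (\<Prod>i\<in>?N. [:X $$ (i, p i):] + ?g p i))"
    unfolding det_def'[OF M]
  proof (rule sum.cong)
    fix p assume "p \<in> {p. p permutes ?N}"
    then have p: "p permutes ?N" by simp
    have "shift_pencil n X $$ (i, p i) = [:X $$ (i, p i):] + ?g p i" if "i \<in> ?N" for i
      using that permutes_in_image[OF p, of i] by (simp add: shift_pencil_def)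
    then have "(\<Prod>i = 0..<n. shift_pencil n X $$ (i, p i)) = (\<Prod>i\<in>?N. [:X $$ (i, p i):] + ?g p i)"
      by (intro prod.cong) auto
    then show "of_int (sign p) * (\<Prod>i = 0..<n. shift_pencil n X $$ (i, p i)) =
        of_int (sign p) * (\<Prod>i\<in>?N. [:X $$ (i, p i):] + ?g p i)" by simp
  qed simp
  also have "\<dots> = (\<Sum>p | p permutes ?N. \<Sum>I\<in>Pow ?N. if p permutes I then
      of_int (sign p) * (\<Prod>i\<in>I. [:X $$ (i, p i):]) * Polynomial.monom 1 (n - card I) else 0)"
  proof (rule sum.cong)
    fix p assume "p \<in> {p. p permutes ?N}"
    then have p: "p permutes ?N" by simp
    have "of_int (sign p) * (\<Prod>i\<in>?N. [:X $$ (i, p i):] + ?g p i) =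
        (\<Sum>I\<in>Pow ?N. of_int (sign p) * ((\<Prod>i\<in>I. [:X $$ (i, p i):]) * (\<Prod>i\<in>?N - I. ?g p i)))"
      by (subst prod_add) (simp_all add: sum_distrib_left)
    also have "\<dots> = (\<Sum>I\<in>Pow ?N. if p permutes I then
      of_int (sign p) * (\<Prod>i\<in>I. [:X $$ (i, p i):]) * Polynomial.monom 1 (n - card I) else 0)"
    proof (rule sum.cong)
      fix I assume "I \<in> Pow ?N"
      then have "I \<subseteq> ?N" by simp
      then show "of_int (sign p) * ((\<Prod>i\<in>I. [:X $$ (i, p i):]) * (\<Prod>i\<in>?N - I. ?g p i)) =
        (if p permutes I then of_int (sign p) * (\<Prod>i\<in>I. [:X $$ (i, p i):]) * Polynomial.monom 1 (n - card I) else 0)"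
        by (simp only: fac[OF p]) simp
    qed simp
    finally show "of_int (sign p) * (\<Prod>i\<in>?N. [:X $$ (i, p i):] + ?g p i) = \<dots>" .
  qed simp
  also have "\<dots> = (\<Sum>I\<in>Pow ?N. \<Sum>p | p permutes ?N. if p permutes I then
      of_int (sign p) * (\<Prod>i\<in>I. [:X $$ (i, p i):]) * Polynomial.monom 1 (n - card I) else 0)"
    by (rule sum.swap)
  also have "\<dots> = (\<Sum>I\<in>Pow ?N. Polynomial.monom (det (submatrix X I I)) (n - card I))"
  proof (rule sum.cong)
    fix I assume "I \<in> Pow ?N"
    then have I: "I \<subseteq> ?N" by simp
    have "(\<Sum>p | p permutes ?N. if p permutes I then
        of_int (sign p) * (\<Prod>i\<in>I. [:X $$ (i, p i):]) * Polynomial.monom 1 (n - card I) else 0) =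
      (\<Sum>p | p permutes I. of_int (sign p) * (\<Prod>i\<in>I. [:X $$ (i, p i):]) * Polynomial.monom 1 (n - card I))"
      by (rule sum.mono_neutral_cong_right)
         (use I in \<open>auto simp: finite_permutations intro: permutes_subset\<close>)
    also have "\<dots> = (\<Sum>p | p permutes I. [:of_int (sign p) * (\<Prod>i\<in>I. X $$ (i, p i)):] * Polynomial.monom 1 (n - card I))"
    proof (rule sum.cong)
      fix p
      interpret c: comm_ring_hom "\<lambda>x::'a. [:x:]" by unfold_locales auto
      show "of_int (sign p) * (\<Prod>i\<in>I. [:X $$ (i, p i):]) * Polynomial.monom 1 (n - card I) =
        [:of_int (sign p) * (\<Prod>i\<in>I. X $$ (i, p i)):] * Polynomial.monom 1 (n - card I)"
        by (simp only: c.hom_mult c.hom_prod c.hom_of_int)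
    qed simp
    also have "\<dots> = [:\<Sum>p | p permutes I. of_int (sign p) * (\<Prod>i\<in>I. X $$ (i, p i)):] * Polynomial.monom 1 (n - card I)"
    proof -
      interpret c: comm_ring_hom "\<lambda>x::'a. [:x:]" by unfold_locales auto
      show ?thesis by (simp only: c.hom_sum sum_distrib_right)
    qed
    also have "\<dots> = [:det (submatrix X I I):] * Polynomial.monom 1 (n - card I)"
      using det_principal_submatrix[OF _ X, of I] I by (simp add: atLeast0LessThan)
    finally show "(\<Sum>p | p permutes ?N. if p permutes I then
        of_int (sign p) * (\<Prod>i\<in>I. [:X $$ (i, p i):]) * Polynomial.monom 1 (n - card I) else 0) =
      Polynomial.monom (det (submatrix X I I)) (n - card I)"
      by (simp add: smult_monom)
  qed simp
  finally show ?thesis by (simp add: atLeast0LessThan)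
qed

lemma principal_minors_sum_coeff:
  fixes X :: "'a::comm_ring_1 mat"
  assumes X: "X \<in> carrier_mat n n" and k: "k \<le> n"
  shows "principal_minors_sum k X = coeff (det (shift_pencil n X)) (n - k)"
proof -
  have "coeff (det (shift_pencil n X)) (n - k) =
      (\<Sum>I\<in>Pow {..<n}. if card I = k then det (submatrix X I I) else 0)"
    unfolding det_shift_pencil[OF X] coeff_sum
  proof (rule sum.cong)
    fix I assume "I \<in> Pow {..<n}"
    then have "card I \<le> n" using card_mono[of "{..<n}" I] by simp
    then have "n - card I = n - k \<longleftrightarrow> card I = k" using k by linarith
    then show "coeff (Polynomial.monom (det (submatrix X I I)) (n - card I)) (n - k) =
        (if card I = k then det (submatrix X I I) else 0)" by simp
  qed simp
  also have "\<dots> = (\<Sum>I | I \<subseteq> {..<n} \<and> card I = k. det (submatrix X I I))"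
    by (rule sum.mono_neutral_cong_right) auto
  finally show ?thesis using X by (simp add: principal_minors_sum_def)
qed

section \<open>Invariant forms on the symplectic Lie algebra\<close>

text \<open>The trace form \<open>tr (X Y)\<close>, see \<open>sp_form_trace\<close>, written so that it is the pairing of the symmetric matrices attached
  to \<open>X\<close> and \<open>Y\<close>.\<close>

definition sp_form :: "nat \<Rightarrow> 'a::comm_ring_1 mat \<Rightarrow> 'a mat \<Rightarrow> 'a" where
  "sp_form m X Y = mat_pair (2 * m) (symp_J m * X) (sp_sym m Y)"

definition rank_one :: "nat \<Rightarrow> (nat \<Rightarrow> 'a::comm_ring_1) \<Rightarrow> 'a mat" where
  "rank_one n w = mat n n (\<lambda>(i, j). w i * w j)"

text \<open>The vector \<open>J w\<close>; then \<open>omega\<close> is the symplectic form up to sign.  Vectors are functions here, which makes rank one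
  elements easy to name.\<close>

definition symp_vec :: "nat \<Rightarrow> (nat \<Rightarrow> 'a::comm_ring_1) \<Rightarrow> nat \<Rightarrow> 'a" where
  "symp_vec m w i = partner_sign m i * w (partner m i)"

definition omega :: "nat \<Rightarrow> (nat \<Rightarrow> 'a::comm_ring_1) \<Rightarrow> (nat \<Rightarrow> 'a) \<Rightarrow> 'a" where
  "omega m w z = (\<Sum>k<2 * m. symp_vec m w k * z k)"

lemma rank_one_in [simp]: "rank_one n w \<in> sym_mats n"
  by (rule sym_matsI') (auto simp: rank_one_def)

lemma rank_one_carrier [simp]: "rank_one n w \<in> carrier_mat n n"
  by (simp add: rank_one_def)

lemma rank_one_J_index:
  "i < 2 * m \<Longrightarrow> j < 2 * m \<Longrightarrow> (rank_one (2 * m) w * symp_J m) $$ (i, j) = - w i * symp_vec m w j"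
  by (simp add: mult_symp_J_index[OF rank_one_carrier] del: index_mult_mat(1))
     (simp add: rank_one_def symp_vec_def)

lemma J_rank_one_J:
  "symp_J m * (rank_one (2 * m) w * symp_J m) = - rank_one (2 * m) (symp_vec m w)"
proof (rule eq_matI)
  fix i j assume "i < dim_row (- rank_one (2 * m) (symp_vec m w))" "j < dim_col (- rank_one (2 * m) (symp_vec m w))"
  then have ij: "i < 2 * m" "j < 2 * m" by (auto simp: rank_one_def)
  have "(symp_J m * (rank_one (2 * m) w * symp_J m)) $$ (i, j) =
      partner_sign m i * (rank_one (2 * m) w * symp_J m) $$ (partner m i, j)"
    by (rule symp_J_mult_index[OF mult_carrier_mat[OF rank_one_carrier symp_J_carrier] ij])
  then show "(symp_J m * (rank_one (2 * m) w * symp_J m)) $$ (i, j) = (- rank_one (2 * m) (symp_vec m w)) $$ (i, j)"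
    using ij by (simp add: rank_one_J_index del: index_mult_mat(1)) (simp add: rank_one_def symp_vec_def)
qed (auto simp: rank_one_def)

lemma omega_expand:
  "omega m w z = (\<Sum>j<m. w (m + j) * z j) - (\<Sum>j<m. w j * z (m + j))"
  by (simp add: omega_def sum_lessThan_double symp_vec_def partner_def partner_sign_def sum_negf add.commute)

lemma omega_self: "omega m w w = 0"
  unfolding omega_expand by (simp add: mult.commute)

lemma omega_skew: "omega m z w = - omega m w z"
  unfolding omega_expand by (simp add: mult.commute)

lemma mat_pair_rank_one:
  "P \<in> carrier_mat n n \<Longrightarrow> mat_pair n (rank_one n w) P = (\<Sum>i<n. \<Sum>j<n. w i * P $$ (i, j) * w j)"
  by (simp add: mat_pair_def rank_one_def mult_ac)

lemma mat_pair_rank_one_rank_one: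
  "mat_pair (2 * m) (rank_one (2 * m) (symp_vec m w)) (rank_one (2 * m) z) = omega m w z * omega m w z"
proof -
  have "omega m w z * omega m w z = (\<Sum>i<2 * m. \<Sum>j<2 * m. symp_vec m w i * z i * (symp_vec m w j * z j))"
    unfolding omega_def by (rule sum_product)
  also have "\<dots> = mat_pair (2 * m) (rank_one (2 * m) (symp_vec m w)) (rank_one (2 * m) z)"
    unfolding mat_pair_def by (intro sum.cong refl) (simp add: rank_one_def mult_ac)
  finally show ?thesis ..
qed

text \<open>Since \<open>e\<^sup>2 = 0\<close>, the double bracket of \<open>Y\<close> is \<open>- 2 e Y e\<close>, which is a multiple of \<open>e\<close> as \<open>e\<close> has rank one.\<close>

lemma double_bracket_rank_one:
  fixes w :: "nat \<Rightarrow> 'a::field"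
  assumes P: "P \<in> sym_mats (2 * m)"
  defines "e \<equiv> rank_one (2 * m) w * symp_J m"
  shows "lie_bracket (sp m) e (lie_bracket (sp m) e (P * symp_J m)) =
    (2 * mat_pair (2 * m) (rank_one (2 * m) (symp_vec m w)) P) \<cdot>\<^sub>m e"
proof -
  let ?n = "2 * m"
  have e: "e \<in> carrier (sp m)" unfolding e_def by (rule sp_of_sym) simp
  have ec: "e \<in> carrier_mat ?n ?n" using e by (rule sp_carrier_mat)
  have Pc: "P \<in> carrier_mat ?n ?n" using P by (rule sym_matsD)
  define g where "g = (\<lambda>j. - (\<Sum>k<?n. symp_vec m w k * P $$ (k, j)))"
  have step: "(e * Q) $$ (i, j) = w i * - (\<Sum>k<?n. symp_vec m w k * Q $$ (k, j))"
    if "Q \<in> carrier_mat ?n ?n" "i < ?n" "j < ?n" for Q i j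
  proof -
    have "(e * Q) $$ (i, j) = (\<Sum>k<?n. e $$ (i, k) * Q $$ (k, j))"
      using that by (rule mult_index_sum[OF ec])
    also have "\<dots> = (\<Sum>k<?n. - w i * symp_vec m w k * Q $$ (k, j))"
      using that by (intro sum.cong) (auto simp: e_def rank_one_J_index simp del: index_mult_mat(1))
    finally show ?thesis by (simp add: sum_distrib_left sum_negf mult.assoc)
  qed
  define Q where "Q = e * P + transpose_mat (e * P)"
  have Q: "Q \<in> sym_mats ?n" unfolding Q_def using ec Pc by (intro sym_mats_plus_transpose) auto
  have Qc: "Q \<in> carrier_mat ?n ?n" using Q by (rule sym_matsD)
  have Qi: "Q $$ (i, j) = w i * g j + w j * g i" if "i < ?n" "j < ?n" for i j
    using that ec Pc step[OF Pc] by (simp add: Q_def g_def del: index_mult_mat(1))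
  define c where "c = mat_pair ?n (rank_one ?n (symp_vec m w)) P"
  have c: "(\<Sum>k<?n. symp_vec m w k * g k) = - c"
  proof -
    have "(\<Sum>k<?n. symp_vec m w k * g k) = - (\<Sum>k<?n. \<Sum>l<?n. symp_vec m w k * (symp_vec m w l * P $$ (l, k)))"
      by (simp add: g_def sum_negf sum_distrib_left)
    also have "(\<Sum>k<?n. \<Sum>l<?n. symp_vec m w k * (symp_vec m w l * P $$ (l, k))) =
        (\<Sum>l<?n. \<Sum>k<?n. symp_vec m w l * P $$ (l, k) * symp_vec m w k)"
      by (subst sum.swap) (simp add: mult_ac)
    finally show ?thesis by (simp add: c_def mat_pair_rank_one[OF Pc])
  qed
  have eQ: "(e * Q) $$ (i, j) = c * w i * w j" if ij: "i < ?n" "j < ?n" for i j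
  proof -
    have "(\<Sum>k<?n. symp_vec m w k * Q $$ (k, j)) =
        (\<Sum>k<?n. symp_vec m w k * w k) * g j + (\<Sum>k<?n. symp_vec m w k * g k) * w j"
      using ij by (simp add: Qi distrib_left sum.distrib sum_distrib_left mult_ac)
    also have "\<dots> = - c * w j" using omega_self[of m w] by (simp add: c omega_def)
    finally show ?thesis using step[OF Qc ij] by simp
  qed
  have "e * Q + transpose_mat (e * Q) = (2 * c) \<cdot>\<^sub>m rank_one ?n w"
    by (rule eq_matI) (use ec Qc in \<open>auto simp: eQ rank_one_def simp del: index_mult_mat(1)\<close>)
  then have "lie_bracket (sp m) e (Q * symp_J m) = ((2 * c) \<cdot>\<^sub>m rank_one ?n w) * symp_J m"
    using sp_bracket_sym[OF e Q] by simp
  moreover have "lie_bracket (sp m) e (P * symp_J m) = Q * symp_J m"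
    unfolding Q_def by (rule sp_bracket_sym[OF e P])
  ultimately show ?thesis
    by (simp add: c_def e_def mult_smult_assoc_mat[OF rank_one_carrier symp_J_carrier])
qed

text \<open>Two proper subspaces do not cover the space.\<close>

lemma omega_common:
  fixes w u :: "nat \<Rightarrow> 'a::field"
  assumes "\<exists>k<2 * m. w k \<noteq> 0" "\<exists>k<2 * m. u k \<noteq> 0"
  shows "\<exists>z. omega m w z \<noteq> 0 \<and> omega m u z \<noteq> 0"
proof -
  have nz: "\<exists>k<2 * m. symp_vec m v k \<noteq> 0" if ex: "\<exists>k<2 * m. v k \<noteq> 0" for v :: "nat \<Rightarrow> 'a"
  proof -
    obtain k where k: "k < 2 * m" "v k \<noteq> 0" using ex by blast
    then have "symp_vec m v (partner m k) \<noteq> 0" by (simp add: symp_vec_def partner_sign_def)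
    then show ?thesis using k partner_less by blast
  qed
  obtain k where k: "k < 2 * m" "symp_vec m w k \<noteq> 0" using nz[OF assms(1)] by blast
  obtain l where l: "l < 2 * m" "symp_vec m u l \<noteq> 0" using nz[OF assms(2)] by blast
  define E where "E = (\<lambda>(k::nat) i. if i = k then 1 else (0::'a))"
  have oE: "omega m v (E k) = symp_vec m v k" if "k < 2 * m" for v k
    using that by (simp add: omega_def E_def if_distrib[of "\<lambda>x. _ * x"] cong: if_cong)
  have oadd: "omega m v (\<lambda>i. E k i + E l i) = symp_vec m v k + symp_vec m v l" for v
    using oE[OF k(1), of v] oE[OF l(1), of v] by (simp add: omega_def distrib_left sum.distrib)
  consider "symp_vec m u k \<noteq> 0" | "symp_vec m w l \<noteq> 0" | "symp_vec m u k = 0" "symp_vec m w l = 0" by blast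
  then show ?thesis
  proof cases
    case 1
    then show ?thesis using k oE[OF k(1)] by (intro exI[of _ "E k"]) simp
  next
    case 2
    then show ?thesis using l oE[OF l(1)] by (intro exI[of _ "E l"]) simp
  next
    case 3
    then show ?thesis using k l oadd by (intro exI[of _ "\<lambda>i. E k i + E l i"]) simp
  qed
qed

lemma sym_unit_rank_one:
  fixes P :: "'a::field_char_0 mat"
  assumes ij: "i < n" "j < n"
  defines "E \<equiv> (\<lambda>(k::nat) l. if l = k then 1 else (0::'a))"
  shows "sym_unit n i j = rank_one n (\<lambda>l. E i l + E j l) + (- 1) \<cdot>\<^sub>m rank_one n (E i) + (- 1) \<cdot>\<^sub>m rank_one n (E j)"
proof (rule eq_matI)
  let ?R = "rank_one n (\<lambda>l. E i l + E j l) + (- 1) \<cdot>\<^sub>m rank_one n (E i) + (- 1) \<cdot>\<^sub>m rank_one n (E j)"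
  fix k l assume "k < dim_row ?R" "l < dim_col ?R"
  then have kl: "k < n" "l < n" by (simp_all add: rank_one_def)
  then have R: "?R $$ (k, l) = (E i k + E j k) * (E i l + E j l) - E i k * E i l - E j k * E j l"
    by (simp add: rank_one_def)
  show "sym_unit n i j $$ (k, l) = ?R $$ (k, l)"
    unfolding R sym_unit_index[OF kl] unfolding E_def
    by (cases "k = i"; cases "k = j"; cases "l = i"; cases "l = j"; simp)
qed (simp_all add: rank_one_def)

text \<open>For \<open>e = w w\<^sup>T J\<close> and \<open>f = z z\<^sup>T J\<close> invariance moves the double bracket with \<open>e\<close> from one
  argument to the other, which expresses \<open>B(e, y)\<close> through \<open>B(e, f)\<close>.  The resulting scalar is the same
  for \<open>w\<close> and \<open>z\<close> by symmetry, hence for any two nonzero vectors through a common \<open>z\<close>.\<close>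

lemma invariant_form_eq:
  fixes B :: "'a::field_char_0 mat \<Rightarrow> 'a mat \<Rightarrow> 'a"
  assumes B: "invariant_form (sp m) B" and m: "m > 0"
  shows "\<exists>b. b \<noteq> 0 \<and> (\<forall>X\<in>carrier (sp m). \<forall>Y\<in>carrier (sp m). B X Y = b * sp_form m X Y)"
proof -
  let ?n = "2 * m" and ?J = "symp_J m :: 'a mat"
  define x where "x = (\<lambda>w. rank_one ?n w * ?J)"
  have x: "x w \<in> carrier (sp m)" for w unfolding x_def by (rule sp_of_sym) simp
  have Bd: "restrict (B X) (carrier (sp m)) \<in> lie_dual (sp m)" if "X \<in> carrier (sp m)" for X
    using B that by (simp add: invariant_form_def)
  have Bsym: "B X Y = B Y X" if "X \<in> carrier (sp m)" "Y \<in> carrier (sp m)" for X Y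
    using B that by (simp add: invariant_form_def)
  have Binv: "B (lie_bracket (sp m) X Y) Z = B X (lie_bracket (sp m) Y Z)"
    if "X \<in> carrier (sp m)" "Y \<in> carrier (sp m)" "Z \<in> carrier (sp m)" for X Y Z
    using B that by (simp add: invariant_form_def)
  have Bnd: "X = 0\<^sub>m ?n ?n" if "X \<in> carrier (sp m)" "\<And>Y. Y \<in> carrier (sp m) \<Longrightarrow> B X Y = 0" for X
    using B that by (simp add: invariant_form_def zero_sp)
  have Bsm: "B X (c \<cdot>\<^sub>m Y) = c * B X Y" if "X \<in> carrier (sp m)" "Y \<in> carrier (sp m)" for X Y c
    using lie_dual_smult[OF Bd[OF that(1)] that(2), of c] that(2) sp_smult_closed[OF that(2), of c]
    by (simp add: smult_sp)
  have Badd: "B X (Y + Z) = B X Y + B X Z" if "X \<in> carrier (sp m)" "Y \<in> carrier (sp m)" "Z \<in> carrier (sp m)" for X Y Z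
    using lie_dual_add[OF Bd[OF that(1)] that(2,3)] that(2,3) sp_add_closed[OF that(2,3)]
    by (simp add: add_sp)
  have skew: "lie_bracket (sp m) X Y = (- 1) \<cdot>\<^sub>m lie_bracket (sp m) Y X"
    if "X \<in> carrier (sp m)" "Y \<in> carrier (sp m)" for X Y :: "'a mat"
    unfolding lie_bracket_sp
    by (rule eq_matI) (use sp_carrier_mat[OF that(1)] sp_carrier_mat[OF that(2)] in \<open>auto simp del: index_mult_mat(1)\<close>)
  have ad: "B (lie_bracket (sp m) e u) f = - B u (lie_bracket (sp m) e f)"
    if "e \<in> carrier (sp m)" "u \<in> carrier (sp m)" "f \<in> carrier (sp m)" for e u f
  proof -
    have "B (lie_bracket (sp m) e u) f = B f ((- 1) \<cdot>\<^sub>m lie_bracket (sp m) u e)"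
      using Bsym[OF sp_bracket_closed[OF that(1,2)] that(3)] skew[OF that(1,2)] by simp
    also have "\<dots> = - B f (lie_bracket (sp m) u e)"
      using that by (simp add: Bsm sp_bracket_closed)
    also have "B f (lie_bracket (sp m) u e) = B (lie_bracket (sp m) u e) f"
      using that by (intro Bsym sp_bracket_closed)
    finally show ?thesis using Binv[OF that(2,1,3)] by simp
  qed
  have rel: "omega m w z * omega m w z * B (x w) Y = mat_pair ?n (rank_one ?n (symp_vec m w)) (sp_sym m Y) * B (x w) (x z)"
    if Y: "Y \<in> carrier (sp m)" for w z Y
  proof -
    let ?ad = "lie_bracket (sp m) (x w)"
    obtain P where P: "P \<in> sym_mats ?n" "Y = P * ?J" using Y by (rule sp_carrierE)
    have "B (?ad (?ad Y)) (x z) = B Y (?ad (?ad (x z)))"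
      using ad x Y by (simp add: sp_bracket_closed)
    moreover have "?ad (?ad Y) = (2 * mat_pair ?n (rank_one ?n (symp_vec m w)) P) \<cdot>\<^sub>m x w"
      unfolding P(2) x_def by (rule double_bracket_rank_one[OF P(1)])
    moreover have "?ad (?ad (x z)) = (2 * (omega m w z * omega m w z)) \<cdot>\<^sub>m x w"
      unfolding x_def double_bracket_rank_one[OF rank_one_in] mat_pair_rank_one_rank_one ..
    moreover have "sp_sym m Y = P" using sp_sym_mult[OF sym_matsD(1)[OF P(1)]] P(2) by simp
    ultimately show ?thesis
      using Bsym[OF sp_smult_closed[OF x] x, of "2 * mat_pair ?n (rank_one ?n (symp_vec m w)) P" w z]
        Bsm[OF x x, of z "2 * mat_pair ?n (rank_one ?n (symp_vec m w)) P" w]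
        Bsym[OF x x, of z w] Bsym[OF Y x, of w] Bsm[OF Y x] by simp
  qed
  define E0 where "E0 = (\<lambda>i::nat. if i = 0 then 1 else (0::'a))"
  have E0: "\<exists>k<?n. E0 k \<noteq> 0" using m by (intro exI[of _ 0]) (simp add: E0_def)
  define beta where "beta = (\<lambda>w z. - B (x w) (x z) / (omega m w z * omega m w z))"
  have Jx: "sp_form m (x w) Y = - mat_pair ?n (rank_one ?n (symp_vec m w)) (sp_sym m Y)" if "Y \<in> carrier (sp m)" for w Y
    unfolding sp_form_def x_def J_rank_one_J
    by (rule mat_pair_uminus) (use sp_sym_carrier[OF sp_carrier_mat[OF that]] in auto)
  have rel': "B (x w) Y = beta w z * sp_form m (x w) Y" if "Y \<in> carrier (sp m)" "omega m w z \<noteq> 0" for w z Y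
    using rel[OF that(1), of w z] that(2) unfolding Jx[OF that(1)] beta_def by (simp add: field_simps)
  have sf: "sp_form m (x w) (x z) = - (omega m w z * omega m w z)" for w z
  proof -
    have "sp_sym m (x z) = rank_one ?n z" unfolding x_def by (rule sp_sym_mult) simp
    then show ?thesis using Jx[OF x, of w z] by (simp only: mat_pair_rank_one_rank_one)
  qed
  have beta_sym: "beta w z = beta z w" for w z
    unfolding beta_def using Bsym[OF x x, of w z] omega_skew[of m w z] by simp
  have beta_const: "beta w z = beta w z'" if "omega m w z \<noteq> 0" "omega m w z' \<noteq> 0" for w z z'
  proof -
    have "beta w z * sp_form m (x w) (x z) = beta w z' * sp_form m (x w) (x z)"
      using rel'[OF x that(1)] rel'[OF x that(2)] by metis
    then show ?thesis using that by (simp add: sf)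
  qed
  obtain z0 where z0: "omega m E0 z0 \<noteq> 0" using omega_common[OF E0 E0] by blast
  define b where "b = beta E0 z0"
  have Bx: "B (x w) Y = b * sp_form m (x w) Y" if Y: "Y \<in> carrier (sp m)" for w Y
  proof (cases "\<exists>k<?n. w k \<noteq> 0")
    case True
    obtain z where z: "omega m E0 z \<noteq> 0" "omega m w z \<noteq> 0" using omega_common[OF E0 True] by blast
    have z': "omega m z E0 \<noteq> 0" "omega m z w \<noteq> 0" using z omega_skew by (metis neg_equal_0_iff_equal)+
    have "beta w z = beta z w" by (rule beta_sym)
    also have "\<dots> = beta z E0" using z' by (intro beta_const)
    also have "\<dots> = beta E0 z" by (rule beta_sym)
    also have "\<dots> = b" unfolding b_def using z z0 by (intro beta_const)
    finally show ?thesis using rel'[OF Y z(2)] by simp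
  next
    case False
    then have r0: "rank_one ?n w = 0 \<cdot>\<^sub>m rank_one ?n w" by (intro eq_matI) (auto simp: rank_one_def)
    then have "x w = 0 \<cdot>\<^sub>m x w" unfolding x_def using mult_smult_assoc_mat[OF rank_one_carrier symp_J_carrier, where k = 0] by metis
    then have "B Y (x w) = 0" using Bsm[OF Y x, of 0 w] by simp
    moreover have "symp_vec m w k = 0" if "k < ?n" for k using False that partner_less by (auto simp: symp_vec_def)
    then have "mat_pair ?n (rank_one ?n (symp_vec m w)) (sp_sym m Y) = 0" by (simp add: mat_pair_def rank_one_def)
    ultimately show ?thesis using Jx[OF Y] Bsym[OF x Y, of w] by simp
  qed
  have all: "B X Y = b * sp_form m X Y" if X: "X \<in> carrier (sp m)" and Y: "Y \<in> carrier (sp m)" for X Y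
  proof -
    define D where "D = (\<lambda>Q. B Y (Q * ?J) - b * sp_form m (Q * ?J) Y)"
    have lin: "D (A + c \<cdot>\<^sub>m C) = D A + c * D C" if "A \<in> sym_mats ?n" "C \<in> sym_mats ?n" for A C c
    proof -
      have AC: "A \<in> carrier_mat ?n ?n" "C \<in> carrier_mat ?n ?n" using that by (auto dest: sym_matsD)
      have e: "(A + c \<cdot>\<^sub>m C) * ?J = A * ?J + c \<cdot>\<^sub>m (C * ?J)"
        using AC by (simp add: add_mult_distrib_mat[of _ ?n ?n _ _ ?n] mult_smult_assoc_mat[of _ ?n ?n _ ?n])
      have "?J * (A * ?J + c \<cdot>\<^sub>m (C * ?J)) = ?J * (A * ?J) + c \<cdot>\<^sub>m (?J * (C * ?J))"
        using AC mult_add_distrib_mat[of ?J ?n ?n "A * ?J" ?n "c \<cdot>\<^sub>m (C * ?J)"] mult_smult_distrib[of ?J ?n ?n "C * ?J" ?n c] by simp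
      moreover have "?J * (A * ?J) \<in> carrier_mat ?n ?n" "?J * (C * ?J) \<in> carrier_mat ?n ?n"
        by (rule mult_carrier_mat[OF symp_J_carrier mult_carrier_mat[OF AC(1) symp_J_carrier]],
            rule mult_carrier_mat[OF symp_J_carrier mult_carrier_mat[OF AC(2) symp_J_carrier]])
      ultimately have "sp_form m ((A + c \<cdot>\<^sub>m C) * ?J) Y = sp_form m (A * ?J) Y + c * sp_form m (C * ?J) Y"
        unfolding e sp_form_def using AC sp_sym_carrier[OF sp_carrier_mat[OF Y]]
        by (simp add: mat_pair_add mat_pair_smult)
      moreover have "B Y ((A + c \<cdot>\<^sub>m C) * ?J) = B Y (A * ?J) + c * B Y (C * ?J)"
        unfolding e using Y sp_of_sym[OF that(1)] sp_of_sym[OF that(2)]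
        by (simp add: Badd Bsm sp_smult_closed)
      ultimately show ?thesis by (simp add: D_def algebra_simps)
    qed
    have D0: "D (rank_one ?n w) = 0" for w
      using Bx[OF Y, of w] Bsym[OF x Y, of w] by (simp add: D_def x_def)
    have Du: "D (sym_unit ?n i j) = 0" if "i < ?n" "j < ?n" for i j
    proof -
      let ?E = "\<lambda>(k::nat) l. if l = k then 1 else (0::'a)"
      have "D (sym_unit ?n i j) = D (rank_one ?n (\<lambda>l. ?E i l + ?E j l) + (- 1) \<cdot>\<^sub>m rank_one ?n (?E i)) + (- 1) * D (rank_one ?n (?E j))"
        unfolding sym_unit_rank_one[OF that] by (intro lin sym_mats_add sym_mats_smult rank_one_in)
      also have "\<dots> = 0" using lin[OF rank_one_in rank_one_in] by (simp only: D0) simp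
      finally show ?thesis .
    qed
    obtain P where P: "P \<in> sym_mats ?n" "X = P * ?J" using X by (rule sp_carrierE)
    have "D P = (\<Sum>i<?n. \<Sum>j<?n. P $$ (i, j) * D (sym_unit ?n i j)) / 2"
      by (rule sym_linear_expand[OF lin P(1)])
    also have "\<dots> = 0" by (simp add: Du)
    finally show ?thesis using Bsym[OF X Y] by (simp add: D_def P(2))
  qed
  have "b \<noteq> 0"
  proof
    assume "b = 0"
    then have "x E0 = 0\<^sub>m ?n ?n" using all x by (intro Bnd) auto
    moreover have "x E0 $$ (0, m) \<noteq> 0"
      using m rank_one_J_index[of 0 m m E0] by (simp add: x_def symp_vec_def partner_def partner_sign_def E0_def del: index_mult_mat(1))
    ultimately show False using m by simp
  qed
  then show ?thesis using all by blast
qed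

section \<open>The Killing form\<close>

lemma sp_dual_combination:
  fixes \<phi> :: "'a::field_char_0 mat \<Rightarrow> 'a" and c :: "nat \<Rightarrow> 'a"
  assumes \<phi>: "\<phi> \<in> lie_dual (sp m)" and b: "\<And>k. k < N \<Longrightarrow> b k \<in> carrier (sp m)"
  defines "z \<equiv> mat (2 * m) (2 * m) (\<lambda>ij. \<Sum>k<N. c k * sp_sym m (b k) $$ ij)"
  shows "z \<in> sym_mats (2 * m)" "\<phi> (z * symp_J m) = (\<Sum>k<N. c k * \<phi> (b k))"
proof -
  let ?n = "2 * m" and ?u = "\<lambda>i j. \<phi> (sym_unit (2 * m) i j * symp_J m)"
  show z: "z \<in> sym_mats ?n"
  proof (rule sym_matsI')
    fix i j assume ij: "i < ?n" "j < ?n"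
    have "c k * sp_sym m (b k) $$ (i, j) = c k * sp_sym m (b k) $$ (j, i)" if "k \<in> {..<N}" for k
      using sym_mats_index[OF sp_sym_in[OF b] ij] that by simp
    then have "(\<Sum>k<N. c k * sp_sym m (b k) $$ (i, j)) = (\<Sum>k<N. c k * sp_sym m (b k) $$ (j, i))"
      by (rule sum.cong[OF refl])
    then show "z $$ (i, j) = z $$ (j, i)" using ij by (simp add: z_def)
  qed (simp add: z_def)
  have bk: "\<phi> (b k) = (\<Sum>i<?n. \<Sum>j<?n. sp_sym m (b k) $$ (i, j) * ?u i j) / 2" if "k < N" for k
    using sp_dual_expand[OF \<phi> sp_sym_in[OF b[OF that]]] mult_sp_sym[OF sp_carrier_mat[OF b[OF that]]] by simp
  have "\<phi> (z * symp_J m) = (\<Sum>i<?n. \<Sum>j<?n. (\<Sum>k<N. c k * sp_sym m (b k) $$ (i, j)) * ?u i j) / 2"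
    unfolding sp_dual_expand[OF \<phi> z] by (simp add: z_def)
  also have "(\<Sum>i<?n. \<Sum>j<?n. (\<Sum>k<N. c k * sp_sym m (b k) $$ (i, j)) * ?u i j) =
      (\<Sum>i<?n. \<Sum>j<?n. \<Sum>k<N. c k * (sp_sym m (b k) $$ (i, j) * ?u i j))"
    by (simp add: sum_distrib_right mult.assoc)
  also have "\<dots> = (\<Sum>i<?n. \<Sum>k<N. \<Sum>j<?n. c k * (sp_sym m (b k) $$ (i, j) * ?u i j))"
    by (intro sum.cong refl sum.swap)
  also have "\<dots> = (\<Sum>k<N. \<Sum>i<?n. \<Sum>j<?n. c k * (sp_sym m (b k) $$ (i, j) * ?u i j))"
    by (rule sum.swap)
  also have "\<dots> / 2 = (\<Sum>k<N. c k * \<phi> (b k))"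
    unfolding sum_divide_distrib
    by (rule sum.cong) (simp_all add: bk sum_distrib_left sum_divide_distrib)
  finally show "\<phi> (z * symp_J m) = (\<Sum>k<N. c k * \<phi> (b k))" .
qed

lemma mat_add_neg_eq_0:
  fixes A B :: "'a::comm_ring_1 mat"
  assumes A: "A \<in> carrier_mat k n" and B: "B \<in> carrier_mat k n" and eq: "A + (- 1) \<cdot>\<^sub>m B = 0\<^sub>m k n"
  shows "A = B"
proof (rule eq_matI)
  fix i j assume "i < dim_row B" "j < dim_col B"
  then have ij: "i < k" "j < n" using B by auto
  then have "(A + (- 1) \<cdot>\<^sub>m B) $$ (i, j) = 0" by (simp add: eq)
  then show "A $$ (i, j) = B $$ (i, j)" using ij A B by simp
qed (use A B in auto)

text \<open>The symmetrised units form a frame of the symplectic Lie algebra in which every element of a basis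
  is counted with total weight \<open>2\<close>; a trace can therefore be computed from it.\<close>

lemma trace_via_sym_units:
  fixes T :: "'a::field_char_0 mat \<Rightarrow> 'a mat"
  assumes db: "dual_bases (sp m) N b \<phi>"
    and T: "\<And>X. X \<in> carrier (sp m) \<Longrightarrow> T X \<in> carrier (sp m)"
    and add: "\<And>X Y. X \<in> carrier (sp m) \<Longrightarrow> Y \<in> carrier (sp m) \<Longrightarrow> T (X + Y) = T X + T Y"
    and smult: "\<And>X c. X \<in> carrier (sp m) \<Longrightarrow> T (c \<cdot>\<^sub>m X) = c \<cdot>\<^sub>m T X"
  shows "(\<Sum>k<N. \<phi> k (T (b k))) =
    (\<Sum>i<2 * m. \<Sum>j<2 * m. sp_sym m (T (sym_unit (2 * m) i j * symp_J m)) $$ (i, j)) / 2"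
proof -
  let ?n = "2 * m" and ?J = "symp_J m :: 'a mat"
  have b: "b k \<in> carrier (sp m)" and \<phi>: "\<phi> k \<in> lie_dual (sp m)" if "k < N" for k
    using db that by (auto simp: dual_bases_def)
  have dual: "\<phi> k (b l) = (if k = l then 1 else 0)" if "k < N" "l < N" for k l
    using db that by (simp add: dual_bases_def)
  have span: "X = 0\<^sub>m ?n ?n" if "X \<in> carrier (sp m)" "\<And>k. k < N \<Longrightarrow> \<phi> k X = 0" for X
    using db that by (simp add: dual_bases_def zero_sp)
  have expand: "sp_sym m y $$ (i, j) = (\<Sum>k<N. \<phi> k y * sp_sym m (b k) $$ (i, j))"
    if y: "y \<in> carrier (sp m)" and ij: "i < ?n" "j < ?n" for y i j
  proof -
    define z where "z = mat ?n ?n (\<lambda>ij. \<Sum>k<N. \<phi> k y * sp_sym m (b k) $$ ij)"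
    have zs: "z \<in> sym_mats ?n"
    proof (cases "N = 0")
      case True
      then show ?thesis by (intro sym_matsI') (auto simp: z_def)
    next
      case False
      then show ?thesis unfolding z_def using sp_dual_combination(1)[OF \<phi>[of 0] b] by simp
    qed
    then have zJ: "z * ?J \<in> carrier (sp m)" by (rule sp_of_sym)
    have "y + (- 1) \<cdot>\<^sub>m (z * ?J) = 0\<^sub>m ?n ?n"
    proof (rule span)
      show "y + (- 1) \<cdot>\<^sub>m (z * ?J) \<in> carrier (sp m)" using y zJ by (intro sp_add_closed sp_smult_closed)
      fix l assume l: "l < N"
      have "\<phi> l (z * ?J) = (\<Sum>k<N. \<phi> k y * \<phi> l (b k))"
        unfolding z_def by (rule sp_dual_combination(2)[OF \<phi>[OF l] b])
      also have "\<dots> = (\<Sum>k<N. if k = l then \<phi> k y else 0)"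
        using l by (intro sum.cong) (auto simp: dual)
      also have "\<dots> = \<phi> l y" using l by simp
      finally have "\<phi> l (z * ?J) = \<phi> l y" .
      then show "\<phi> l (y + (- 1) \<cdot>\<^sub>m (z * ?J)) = 0"
        using lie_dual_add[OF \<phi>[OF l] y sp_smult_closed[OF zJ]] lie_dual_smult[OF \<phi>[OF l] zJ, of "- 1"]
        by (simp add: sp_simps)
    qed
    then have "y = z * ?J" by (rule mat_add_neg_eq_0[OF sp_carrier_mat[OF y] sp_carrier_mat[OF zJ]])
    then have "sp_sym m y = z" using sp_sym_mult[OF sym_matsD(1)[OF zs]] by simp
    then show ?thesis using ij by (simp add: z_def)
  qed
  have u: "sym_unit ?n i j * ?J \<in> carrier (sp m)" for i j by (rule sp_of_sym) simp
  have Tb: "\<phi> k (T (b k)) = (\<Sum>i<?n. \<Sum>j<?n. sp_sym m (b k) $$ (i, j) * \<phi> k (T (sym_unit ?n i j * ?J))) / 2"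
    if k: "k < N" for k
  proof -
    define \<psi> where "\<psi> = restrict (\<lambda>X. \<phi> k (T X)) (carrier (sp m))"
    have "\<psi> \<in> lie_dual (sp m)"
    proof -
      have "\<phi> k (T X + T Y) = \<phi> k (T X) + \<phi> k (T Y)" if "X \<in> carrier (sp m)" "Y \<in> carrier (sp m)" for X Y
        using lie_dual_add[OF \<phi>[OF k] T[OF that(1)] T[OF that(2)]] by (simp add: add_sp)
      moreover have "\<phi> k (c \<cdot>\<^sub>m T X) = c * \<phi> k (T X)" if "X \<in> carrier (sp m)" for X c
        using lie_dual_smult[OF \<phi>[OF k] T[OF that]] by (simp add: smult_sp)
      ultimately show ?thesis
        unfolding lie_dual_def \<psi>_def by (simp add: add_sp smult_sp sp_add_closed sp_smult_closed add smult)
    qed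
    then have "\<psi> (sp_sym m (b k) * ?J) = (\<Sum>i<?n. \<Sum>j<?n. sp_sym m (b k) $$ (i, j) * \<psi> (sym_unit ?n i j * ?J)) / 2"
      using b[OF k] by (intro sp_dual_expand sp_sym_in)
    then show ?thesis
      using b[OF k] u mult_sp_sym[OF sp_carrier_mat[OF b[OF k]]] by (simp add: \<psi>_def)
  qed
  have "(\<Sum>k<N. \<phi> k (T (b k))) =
      (\<Sum>k<N. \<Sum>i<?n. \<Sum>j<?n. \<phi> k (T (sym_unit ?n i j * ?J)) * sp_sym m (b k) $$ (i, j)) / 2"
    unfolding sum_divide_distrib[of _ "{..<N}"] by (rule sum.cong) (simp_all add: Tb mult.commute)
  also have "(\<Sum>k<N. \<Sum>i<?n. \<Sum>j<?n. \<phi> k (T (sym_unit ?n i j * ?J)) * sp_sym m (b k) $$ (i, j)) =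
      (\<Sum>i<?n. \<Sum>k<N. \<Sum>j<?n. \<phi> k (T (sym_unit ?n i j * ?J)) * sp_sym m (b k) $$ (i, j))"
    by (rule sum.swap)
  also have "\<dots> = (\<Sum>i<?n. \<Sum>j<?n. \<Sum>k<N. \<phi> k (T (sym_unit ?n i j * ?J)) * sp_sym m (b k) $$ (i, j))"
    by (intro sum.cong refl sum.swap)
  also have "\<dots> = (\<Sum>i<?n. \<Sum>j<?n. sp_sym m (T (sym_unit ?n i j * ?J)) $$ (i, j))"
    by (intro sum.cong refl) (simp add: expand T[OF u])
  finally show ?thesis .
qed

text \<open>Existence is needed because the trace is defined by a definite description over all dual bases; the
  units with \<open>i \<le> j\<close> form a basis, the diagonal ones being twice a matrix unit.\<close>

lemma dual_bases_sp_exist: "\<exists>N b \<phi>. dual_bases (sp m :: ('a::field_char_0, 'a mat) lie_algebra) N b \<phi>"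
proof -
  let ?n = "2 * m" and ?J = "symp_J m :: 'a mat"
  define S where "S = {(i, j). i \<le> j \<and> j < ?n}"
  have "S \<subseteq> {..<?n} \<times> {..<?n}" by (auto simp: S_def)
  then have "finite S" by (rule finite_subset) simp
  then obtain e where e: "bij_betw e {0..<card S} S" using ex_bij_betw_nat_finite by blast
  define N where "N = card S"
  define b where "b = (\<lambda>k. sym_unit ?n (fst (e k)) (snd (e k)) * ?J)"
  define \<phi> where "\<phi> = (\<lambda>k. \<lambda>X\<in>carrier (sp m). sp_sym m X $$ e k * (if fst (e k) = snd (e k) then 1 / 2 else (1::'a)))"
  have eS: "e k \<in> S" if "k < N" for k using e that by (auto simp: bij_betw_def N_def)
  have en: "fst (e k) < ?n" "snd (e k) < ?n" "fst (e k) \<le> snd (e k)" if "k < N" for k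
    using eS[OF that] by (auto simp: S_def)
  have bin: "b k \<in> carrier (sp m)" for k unfolding b_def by (rule sp_of_sym) simp
  have "\<phi> k \<in> lie_dual (sp m)" if k: "k < N" for k
  proof -
    obtain i j where ij: "e k = (i, j)" by (cases "e k")
    have n: "i < ?n" "j < ?n" using en[OF k] by (auto simp: ij)
    have "sp_sym m (X + Y) $$ (i, j) = sp_sym m X $$ (i, j) + sp_sym m Y $$ (i, j)"
      if "X \<in> carrier (sp m)" "Y \<in> carrier (sp m)" for X Y :: "'a mat"
      using n that[THEN sp_carrier_mat] by (simp add: sp_sym_add sp_sym_carrier[THEN carrier_matD(1)] sp_sym_carrier[THEN carrier_matD(2)])
    moreover have "sp_sym m (c \<cdot>\<^sub>m X) $$ (i, j) = c * sp_sym m X $$ (i, j)" if "X \<in> carrier (sp m)" for X :: "'a mat" and c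
      using n that[THEN sp_carrier_mat] by (simp add: sp_sym_smult sp_sym_carrier[THEN carrier_matD(1)] sp_sym_carrier[THEN carrier_matD(2)])
    ultimately show ?thesis
      unfolding lie_dual_def \<phi>_def ij
      by (simp add: add_sp smult_sp sp_add_closed sp_smult_closed add_divide_distrib)
  qed
  moreover have "\<phi> k (b l) = (if k = l then 1 else 0)" if kl: "k < N" "l < N" for k l
  proof -
    obtain i j where ij: "e k = (i, j)" by (cases "e k")
    obtain i' j' where ij': "e l = (i', j')" by (cases "e l")
    have eq: "k = l \<longleftrightarrow> (i, j) = (i', j')"
      using e kl by (auto simp: bij_betw_def N_def inj_on_eq_iff ij[symmetric] ij'[symmetric])
    have n: "i < ?n" "j < ?n" "i \<le> j" "i' \<le> j'" using en[OF kl(1)] en[OF kl(2)] by (auto simp: ij ij')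
    have "sp_sym m (b l) = sym_unit ?n i' j'" unfolding b_def ij' by (simp add: sp_sym_mult)
    then have p: "\<phi> k (b l) = sym_unit ?n i' j' $$ (i, j) * (if i = j then 1 / 2 else 1)"
      using bin by (simp add: \<phi>_def ij)
    show ?thesis
    proof (cases "k = l")
      case True
      then have "i' = i" "j' = j" using eq by auto
      then show ?thesis using True unfolding p by (cases "i = j") (use n in \<open>simp_all add: sym_unit_index\<close>)
    next
      case False
      then have "\<not> (i = i' \<and> j = j')" using eq by auto
      moreover have "\<not> (i = j' \<and> j = i')" using calculation n by auto
      ultimately show ?thesis using False unfolding p sym_unit_index[OF n(1,2)] by auto
    qed
  qed
  moreover have "X = 0\<^sub>m ?n ?n" if X: "X \<in> carrier (sp m)" and z: "\<forall>k<N. \<phi> k X = 0" for X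
  proof -
    have zz: "sp_sym m X $$ (i, j) = 0" if "i \<le> j" "j < ?n" for i j
    proof -
      have "(i, j) \<in> S" using that by (simp add: S_def)
      then have "(i, j) \<in> e ` {0..<N}" using e by (simp add: bij_betw_def N_def)
      then obtain k where "(i, j) = e k" "k \<in> {0..<N}" by (rule imageE)
      then have k: "k < N" "e k = (i, j)" by auto
      then have "\<phi> k X = 0" using z by simp
      then show ?thesis using X k(2) by (auto simp: \<phi>_def split: if_splits)
    qed
    have sX: "sp_sym m X = 0\<^sub>m ?n ?n"
    proof (rule eq_matI)
      fix i j assume "i < dim_row (0\<^sub>m ?n ?n :: 'a mat)" "j < dim_col (0\<^sub>m ?n ?n :: 'a mat)"
      then have ij: "i < ?n" "j < ?n" by auto
      show "sp_sym m X $$ (i, j) = 0\<^sub>m ?n ?n $$ (i, j)"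
      proof (cases "i \<le> j")
        case True
        then show ?thesis using zz ij by simp
      next
        case False
        then show ?thesis using zz[of j i] ij sym_mats_index[OF sp_sym_in[OF X] ij] by simp
      qed
    qed (use sp_sym_carrier[OF sp_carrier_mat[OF X]] in auto)
    have "X = sp_sym m X * ?J" by (rule mult_sp_sym[OF sp_carrier_mat[OF X], symmetric])
    then show ?thesis unfolding sX by (simp only: zero_mult_symp_J)
  qed
  ultimately have "dual_bases (sp m) N b \<phi>" using bin by (simp add: dual_bases_def zero_sp)
  then show ?thesis by blast
qed

text \<open>The symmetrised unit is the sum of two matrix units; one gives the product of traces and the other the
  trace of the product with a transpose.\<close>

lemma sum_sym_unit_conjugate:
  fixes A B :: "'a::comm_ring_1 mat"
  assumes A: "A \<in> carrier_mat n n" and B: "B \<in> carrier_mat n n"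
  shows "(\<Sum>i<n. \<Sum>j<n. (A * sym_unit n i j * B) $$ (i, j)) =
    mat_pair n A (1\<^sub>m n) * mat_pair n B (1\<^sub>m n) + mat_pair n A B"
proof -
  have tr: "mat_pair n C (1\<^sub>m n) = (\<Sum>i<n. C $$ (i, i))" for C :: "'a mat"
  proof -
    have "mat_pair n C (1\<^sub>m n) = (\<Sum>i<n. \<Sum>j<n. if j = i then C $$ (i, i) else 0)"
      unfolding mat_pair_def by (intro sum.cong refl) auto
    then show ?thesis by simp
  qed
  have "(A * sym_unit n i j * B) $$ (i, j) = A $$ (i, i) * B $$ (j, j) + A $$ (i, j) * B $$ (i, j)"
    if ij: "i < n" "j < n" for i j
  proof -
    have AS: "A * sym_unit n i j \<in> carrier_mat n n" using A by simp
    have ASi: "(A * sym_unit n i j) $$ (i, l) = (if l = j then A $$ (i, i) else 0) + (if l = i then A $$ (i, j) else 0)"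
      if l: "l < n" for l
    proof -
      have "(A * sym_unit n i j) $$ (i, l) = (\<Sum>k<n. A $$ (i, k) * sym_unit n i j $$ (k, l))"
        by (rule mult_index_sum[OF A sym_unit_carrier ij(1) l])
      also have "\<dots> = (\<Sum>k<n. (if k = i then (if l = j then A $$ (i, k) else 0) else 0) +
          (if k = j then (if l = i then A $$ (i, k) else 0) else 0))"
        by (rule sum.cong) (simp_all add: sym_unit_index l)
      finally show ?thesis using ij by (simp add: sum.distrib)
    qed
    have "(A * sym_unit n i j * B) $$ (i, j) = (\<Sum>l<n. (A * sym_unit n i j) $$ (i, l) * B $$ (l, j))"
      by (rule mult_index_sum[OF AS B ij])
    also have "\<dots> = (\<Sum>l<n. (if l = j then A $$ (i, i) * B $$ (l, j) else 0) + (if l = i then A $$ (i, j) * B $$ (l, j) else 0))"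
      by (rule sum.cong) (simp_all add: ASi distrib_right del: index_mult_mat(1))
    finally show ?thesis using ij by (simp add: sum.distrib)
  qed
  then have "(\<Sum>i<n. \<Sum>j<n. (A * sym_unit n i j * B) $$ (i, j)) =
      (\<Sum>i<n. \<Sum>j<n. A $$ (i, i) * B $$ (j, j) + A $$ (i, j) * B $$ (i, j))"
    by (intro sum.cong refl) auto
  also have "\<dots> = (\<Sum>i<n. A $$ (i, i)) * (\<Sum>j<n. B $$ (j, j)) + mat_pair n A B"
    by (simp add: sum.distrib mat_pair_def sum_product)
  finally show ?thesis by (simp only: tr)
qed

lemma sp_trace_zero:
  fixes X :: "'a::field_char_0 mat"
  assumes X: "X \<in> carrier (sp m)"
  shows "mat_pair (2 * m) X (1\<^sub>m (2 * m)) = 0"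
proof -
  let ?n = "2 * m" and ?J = "symp_J m :: 'a mat"
  obtain P where P: "P \<in> sym_mats ?n" "X = P * ?J" using X by (rule sp_carrierE)
  have Pc: "P \<in> carrier_mat ?n ?n" using P(1) by (rule sym_matsD)
  have "mat_pair ?n X (1\<^sub>m ?n) = mat_pair ?n P (transpose_mat ?J)"
    unfolding P(2) using mat_pair_mult_right[OF Pc symp_J_carrier one_carrier_mat] by simp
  also have "\<dots> = mat_pair ?n P ?J"
    using mat_pair_transpose[OF Pc symp_J_carrier] sym_matsD(2)[OF P(1)] by simp
  finally have 1: "mat_pair ?n X (1\<^sub>m ?n) = mat_pair ?n P ?J" .
  have "mat_pair ?n P (transpose_mat ?J) = - mat_pair ?n P ?J"
    unfolding transpose_symp_J using mat_pair_uminus[OF symp_J_carrier Pc] by (simp add: mat_pair_sym[of _ P])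
  then show ?thesis using \<open>mat_pair ?n P (transpose_mat ?J) = mat_pair ?n P ?J\<close> 1 by simp
qed

lemma sp_form_trace:
  fixes X Y :: "'a::field mat"
  assumes X: "X \<in> carrier (sp m)" and Y: "Y \<in> carrier (sp m)"
  shows "sp_form m X Y = mat_pair (2 * m) X (transpose_mat Y)"
proof -
  let ?n = "2 * m" and ?J = "symp_J m :: 'a mat"
  have Xc: "X \<in> carrier_mat ?n ?n" and Yc: "Y \<in> carrier_mat ?n ?n" using X Y by (auto dest: sp_carrier_mat)
  have "sp_form m X Y = mat_pair ?n X (transpose_mat ?J * sp_sym m Y)"
    unfolding sp_form_def by (rule mat_pair_mult_left[OF symp_J_carrier Xc sp_sym_carrier[OF Yc]])
  also have "transpose_mat ?J * sp_sym m Y = ?J * (Y * ?J)"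
    using Yc by (simp add: transpose_symp_J sp_sym_def)
  also have "\<dots> = (?J * Y) * ?J" using Yc by (simp add: assoc_mult_mat[of _ ?n ?n _ ?n _ ?n])
  also have "\<dots> = - (transpose_mat Y * (?J * ?J))"
    using Yc by (simp add: sp_skew[OF Y] assoc_mult_mat[of _ ?n ?n _ ?n _ ?n])
  also have "\<dots> = transpose_mat Y" using Yc by (simp add: symp_J_square)
  finally show ?thesis .
qed

lemma mat_add_entry:
  "A \<in> carrier_mat k n \<Longrightarrow> B \<in> carrier_mat k n \<Longrightarrow> i < k \<Longrightarrow> j < n \<Longrightarrow> (A + B) $$ (i, j) = A $$ (i, j) + B $$ (i, j)"
  by simp

text \<open>On symmetric matrices \<open>ad X\<close> acts as \<open>P \<mapsto> X P + P X\<^sup>T\<close>.  Composing two such maps gives four terms, each of the form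
  \<open>A P B\<close>, and their traces combine to \<open>2 m + 2\<close> times the trace form, the products of traces vanishing or
  contributing \<open>2 m\<close>.\<close>

lemma killing_form_sp:
  fixes X Y :: "'a::field_char_0 mat"
  assumes X: "X \<in> carrier (sp m)" and Y: "Y \<in> carrier (sp m)"
  shows "killing_form (sp m) X Y = of_nat (2 * m + 2) * sp_form m X Y"
proof -
  let ?n = "2 * m" and ?J = "symp_J m :: 'a mat" and ?one = "1\<^sub>m (2 * m) :: 'a mat"
  interpret S: lin_lie "sp m :: ('a, 'a mat) lie_algebra" by (rule lin_lie_sp)
  have Xc: "X \<in> carrier_mat ?n ?n" and Yc: "Y \<in> carrier_mat ?n ?n" using X Y by (auto dest: sp_carrier_mat)
  define T where "T = (\<lambda>Z. lie_bracket (sp m) X (lie_bracket (sp m) Y Z))"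
  define t where "t = (\<Sum>i<?n. \<Sum>j<?n. sp_sym m (T (sym_unit ?n i j * ?J)) $$ (i, j)) / 2"
  have TC: "T Z \<in> carrier (sp m)" if "Z \<in> carrier (sp m)" for Z
    unfolding T_def using X Y that by (intro S.bracket_closed)
  have Tadd: "T (Z + W) = T Z + T W" if "Z \<in> carrier (sp m)" "W \<in> carrier (sp m)" for Z W
    using S.bracket_add[OF Y that] S.bracket_add[OF X S.bracket_closed[OF Y that(1)] S.bracket_closed[OF Y that(2)]]
    by (simp add: T_def add_sp)
  have Tsm: "T (c \<cdot>\<^sub>m Z) = c \<cdot>\<^sub>m T Z" if "Z \<in> carrier (sp m)" for Z c
    using S.bracket_smult[OF Y that] S.bracket_smult[OF X S.bracket_closed[OF Y that]]
    by (simp add: T_def smult_sp)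
  have "lie_trace (sp m) T = t"
    unfolding lie_trace_def
  proof (rule the_equality)
    obtain N b \<phi> where db: "dual_bases (sp m :: ('a, 'a mat) lie_algebra) N b \<phi>"
      using dual_bases_sp_exist by blast
    have "t = (\<Sum>k<N. \<phi> k (T (b k)))"
      unfolding t_def by (rule trace_via_sym_units[OF db TC Tadd Tsm, symmetric])
    then show "\<exists>N b \<phi>. dual_bases (sp m) N b \<phi> \<and> t = (\<Sum>i<N. \<phi> i (T (b i)))" using db by blast
  next
    fix s assume "\<exists>N b \<phi>. dual_bases (sp m) N b \<phi> \<and> s = (\<Sum>i<N. \<phi> i (T (b i)))"
    then obtain N b \<phi> where db: "dual_bases (sp m) N b \<phi>" and s: "s = (\<Sum>i<N. \<phi> i (T (b i)))" by blast
    show "s = t" unfolding s t_def by (rule trace_via_sym_units[OF db TC Tadd Tsm])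
  qed
  then have kf: "killing_form (sp m) X Y = t" by (simp add: killing_form_def T_def)
  have XY: "X * Y \<in> carrier_mat ?n ?n" using Xc Yc by simp
  have Yt: "transpose_mat Y \<in> carrier_mat ?n ?n" using Yc by simp
  define G where "G = (\<lambda>i j. (X * Y * sym_unit ?n i j * ?one) $$ (i, j) + (X * sym_unit ?n i j * transpose_mat Y) $$ (i, j))"
  have ent: "sp_sym m (T (sym_unit ?n i j * ?J)) $$ (i, j) = G i j + G j i" if ij: "i < ?n" "j < ?n" for i j
  proof -
    let ?Q = "sym_unit ?n i j :: 'a mat"
    define W where "W = Y * ?Q + transpose_mat (Y * ?Q)"
    have W: "W \<in> sym_mats ?n" unfolding W_def using Yc by (intro sym_mats_plus_transpose) simp
    have Wc: "W \<in> carrier_mat ?n ?n" using W by (rule sym_matsD)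
    have "T (?Q * ?J) = (X * W + transpose_mat (X * W)) * ?J"
      unfolding T_def sp_bracket_sym[OF Y sym_unit_in] W_def[symmetric] by (rule sp_bracket_sym[OF X W])
    then have s: "sp_sym m (T (?Q * ?J)) = X * W + transpose_mat (X * W)"
      using sp_sym_mult[of "X * W + transpose_mat (X * W)" m] Xc Wc by simp
    have XW: "X * W = X * Y * ?Q * ?one + X * ?Q * transpose_mat Y"
    proof -
      have "transpose_mat (Y * ?Q) = ?Q * transpose_mat Y"
        using Yc by (simp add: transpose_mult[of _ ?n ?n _ ?n] sym_matsD(2)[OF sym_unit_in])
      then show ?thesis
        unfolding W_def
        using Xc Yc mult_add_distrib_mat[OF Xc mult_carrier_mat[OF Yc sym_unit_carrier] mult_carrier_mat[OF sym_unit_carrier Yt], of i j i j]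
        by (simp add: assoc_mult_mat[of _ ?n ?n _ ?n _ ?n])
    qed
    have c: "X * Y * ?Q * ?one \<in> carrier_mat ?n ?n" "X * ?Q * transpose_mat Y \<in> carrier_mat ?n ?n"
      using Xc Yc by auto
    have "(X * W) $$ (i, j) = G i j" unfolding XW G_def by (rule mat_add_entry[OF c ij])
    moreover have "(X * W) $$ (j, i) = G j i"
      unfolding XW G_def sym_unit_commute[of ?n j i] by (rule mat_add_entry[OF c ij(2,1)])
    ultimately show ?thesis unfolding s using Xc Wc ij by (simp del: index_mult_mat(1))
  qed
  have sumG: "(\<Sum>i<?n. \<Sum>j<?n. G i j) = of_nat (?n + 1) * mat_pair ?n (X * Y) ?one + mat_pair ?n X (transpose_mat Y)"
  proof -
    have "mat_pair ?n ?one ?one = of_nat ?n"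
    proof -
      have "mat_pair ?n ?one ?one = (\<Sum>i<?n. \<Sum>j<?n. if j = i then 1 else 0)"
        unfolding mat_pair_def by (intro sum.cong refl) auto
      then show ?thesis by simp
    qed
    moreover have "mat_pair ?n X ?one = 0" by (rule sp_trace_zero[OF X])
    ultimately show ?thesis
      using sum_sym_unit_conjugate[OF XY one_carrier_mat] sum_sym_unit_conjugate[OF Xc Yt]
      by (simp add: G_def sum.distrib algebra_simps del: index_mult_mat(1))
  qed
  have "t = ((\<Sum>i<?n. \<Sum>j<?n. G i j) + (\<Sum>i<?n. \<Sum>j<?n. G j i)) / 2"
    unfolding t_def sum.distrib[symmetric] by (rule arg_cong[where f = "\<lambda>x. x / 2"], intro sum.cong refl) (simp add: ent)
  also have "(\<Sum>i<?n. \<Sum>j<?n. G j i) = (\<Sum>i<?n. \<Sum>j<?n. G i j)" by (rule sum.swap)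
  also have "((\<Sum>i<?n. \<Sum>j<?n. G i j) + (\<Sum>i<?n. \<Sum>j<?n. G i j)) / 2 = (\<Sum>i<?n. \<Sum>j<?n. G i j)" by simp
  also have "mat_pair ?n (X * Y) ?one = mat_pair ?n X (transpose_mat Y)"
    using mat_pair_mult_right[OF Xc Yc one_carrier_mat] Yc by simp
  then have "(\<Sum>i<?n. \<Sum>j<?n. G i j) = of_nat (?n + 2) * mat_pair ?n X (transpose_mat Y)"
    unfolding sumG by (simp add: algebra_simps)
  finally show ?thesis using kf sp_form_trace[OF X Y] by simp
qed

section \<open>Minimal nilpotent elements have rank one\<close>

lemma symp_vec_symp_vec: "i < 2 * m \<Longrightarrow> symp_vec m (symp_vec m w) i = - w i"
  by (simp add: symp_vec_def mult.assoc[symmetric])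

lemma rank_one_J_square:
  fixes w :: "nat \<Rightarrow> 'a::comm_ring_1"
  shows "(rank_one (2 * m) w * symp_J m) * (rank_one (2 * m) w * symp_J m) = 0\<^sub>m (2 * m) (2 * m)"
proof (rule eq_matI)
  let ?X = "rank_one (2 * m) w * symp_J m"
  have X: "?X \<in> carrier_mat (2 * m) (2 * m)" by (rule mult_carrier_mat[OF rank_one_carrier symp_J_carrier])
  fix i j assume "i < dim_row (0\<^sub>m (2 * m) (2 * m) :: 'a mat)" "j < dim_col (0\<^sub>m (2 * m) (2 * m) :: 'a mat)"
  then have ij: "i < 2 * m" "j < 2 * m" by auto
  have "(?X * ?X) $$ (i, j) = (\<Sum>k<2 * m. ?X $$ (i, k) * ?X $$ (k, j))"
    by (rule mult_index_sum[OF X X ij])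
  also have "\<dots> = (\<Sum>k<2 * m. w i * symp_vec m w j * (symp_vec m w k * w k))"
    by (rule sum.cong, simp, use ij in \<open>simp add: rank_one_J_index del: index_mult_mat(1)\<close>)
  also have "\<dots> = w i * symp_vec m w j * omega m w w"
    by (simp add: omega_def sum_distrib_left)
  finally show "(?X * ?X) $$ (i, j) = 0\<^sub>m (2 * m) (2 * m) $$ (i, j)"
    using ij by (simp add: omega_self)
qed (auto simp: rank_one_def)

text \<open>A minimal nilpotent element lies in the closure of the orbit of a rank one element, and the
  \<open>2 \<times> 2\<close> minors are polynomials that vanish on this orbit.\<close>

lemma minimal_nilpotent_minors:
  fixes e :: "'a::field_char_0 mat"
  assumes e: "minimal_nilpotent m e" and m: "m > 0"
    and ij: "i < 2 * m" "j < 2 * m" "k < 2 * m" "l < 2 * m"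
  shows "e $$ (i, j) * e $$ (k, l) = e $$ (i, l) * e $$ (k, j)"
proof -
  let ?n = "2 * m" and ?J = "symp_J m :: 'a mat"
  define w where "w = (\<lambda>i::nat. if i = 0 then 1 else (0::'a))"
  define X where "X = rank_one ?n w * ?J"
  have X: "X \<in> carrier (sp m)" unfolding X_def by (rule sp_of_sym) simp
  have Xc: "X \<in> carrier_mat ?n ?n" using X by (rule sp_carrier_mat)
  have "X ^\<^sub>m 2 = X * X" using Xc by (simp add: numeral_2_eq_2)
  then have "X ^\<^sub>m 2 = 0\<^sub>m ?n ?n" by (simp add: X_def rank_one_J_square)
  moreover have "X \<noteq> 0\<^sub>m ?n ?n"
  proof
    assume "X = 0\<^sub>m ?n ?n"
    then have "X $$ (0, m) = 0" using m by simp
    moreover have "X $$ (0, m) = 1"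
      using m rank_one_J_index[of 0 m m w] by (simp add: X_def symp_vec_def partner_def partner_sign_def w_def del: index_mult_mat(1))
    ultimately show False by simp
  qed
  ultimately have "X \<in> nilpotents m - {0\<^sub>m ?n ?n}"
    using X by (auto simp: nilpotents_def)
  then have cl: "e \<in> zariski_closure m (Sp_orbit m X)"
    using e by (simp add: minimal_nilpotent_def)
  let ?v = "\<lambda>i j. mpoly_var (i, j) :: (nat \<times> nat, 'a) mpoly"
  define p where "p = ?v i j * ?v k l - ?v i l * ?v k j"
  have p: "p \<in> mpolys_in ({..<?n} \<times> {..<?n})"
    unfolding p_def using ij by (intro mpolys_in_diff mpolys_in_mult mpolys_in_var) auto
  have ev: "mpoly_eval (\<lambda>ij. Y $$ ij) p = Y $$ (i, j) * Y $$ (k, l) - Y $$ (i, l) * Y $$ (k, j)" for Y :: "'a mat"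
    by (simp add: p_def mpoly_eval_diff mpoly_eval_mult)
  have "mpoly_eval (\<lambda>ij. Y $$ ij) p = 0" if Y: "Y \<in> Sp_orbit m X" for Y
  proof -
    obtain g h where gh: "g \<in> Sp_group m" "similar_mat_wit Y X g h" using Y by (auto simp: Sp_orbit_def)
    have gc: "g \<in> carrier_mat ?n ?n" using gh(1) by (simp add: Sp_group_def)
    have hc: "h \<in> carrier_mat ?n ?n" and Yeq: "Y = g * X * h"
      using gh(2) gc by (auto simp: similar_mat_wit_def Let_def)
    define \<alpha> where "\<alpha> = (\<lambda>i. - (\<Sum>r<?n. g $$ (i, r) * w r))"
    define \<beta> where "\<beta> = (\<lambda>j. \<Sum>r<?n. symp_vec m w r * h $$ (r, j))"
    have "Y $$ (a, b) = \<alpha> a * \<beta> b" if ab: "a < ?n" "b < ?n" for a b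
    proof -
      have gX: "(g * X) $$ (a, s) = \<alpha> a * symp_vec m w s" if s: "s < ?n" for s
      proof -
        have "(g * X) $$ (a, s) = (\<Sum>r<?n. g $$ (a, r) * X $$ (r, s))"
          by (rule mult_index_sum[OF gc Xc ab(1) s])
        also have "\<dots> = (\<Sum>r<?n. - (g $$ (a, r) * w r) * symp_vec m w s)"
          by (rule sum.cong) (use s in \<open>simp_all add: X_def rank_one_J_index del: index_mult_mat(1)\<close>)
        finally show ?thesis by (simp add: \<alpha>_def sum_distrib_right sum_negf)
      qed
      have "Y $$ (a, b) = (\<Sum>s<?n. (g * X) $$ (a, s) * h $$ (s, b))"
        unfolding Yeq using gc Xc by (intro mult_index_sum[OF _ hc ab]) auto
      also have "\<dots> = (\<Sum>s<?n. \<alpha> a * (symp_vec m w s * h $$ (s, b)))"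
        by (rule sum.cong) (simp_all add: gX mult.assoc del: index_mult_mat(1))
      finally show ?thesis by (simp add: \<beta>_def sum_distrib_left)
    qed
    then show ?thesis using ij by (simp add: ev mult_ac)
  qed
  then have "mpoly_eval (\<lambda>ij. e $$ ij) p = 0"
    using cl p by (simp add: zariski_closure_def)
  then show ?thesis by (simp add: ev)
qed

text \<open>\<open>S = J e\<close> is symmetric.  A nonzero symmetric matrix with vanishing \<open>2 \<times> 2\<close> minors has a nonzero diagonal entry \<open>S a a\<close>, and is a multiple
  of the product of its column \<open>a\<close> with the transpose of that column.\<close>

lemma minimal_nilpotent_rank_one:
  fixes e :: "'a::field_char_0 mat"
  assumes e: "minimal_nilpotent m e" and m: "m > 0"
  obtains c v where "c \<noteq> 0" "\<exists>k<2 * m. v k \<noteq> 0" "e = c \<cdot>\<^sub>m (rank_one (2 * m) v * symp_J m)"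
proof -
  let ?n = "2 * m" and ?J = "symp_J m :: 'a mat"
  have esp: "e \<in> carrier (sp m)" and e0: "e \<noteq> 0\<^sub>m ?n ?n"
    using e by (auto simp: minimal_nilpotent_def nilpotents_def)
  have ec: "e \<in> carrier_mat ?n ?n" using esp by (rule sp_carrier_mat)
  define S where "S = (\<lambda>i j. partner_sign m i * e $$ (partner m i, j))"
  have Ssym: "S i j = S j i" if "i < ?n" "j < ?n" for i j
    using esp[unfolded sp_iff_index[OF ec]] that by (simp add: S_def)
  have Smin: "S i j * S k l = S i l * S k j" if "i < ?n" "j < ?n" "k < ?n" "l < ?n" for i j k l
  proof -
    have "S i j * S k l = partner_sign m i * partner_sign m k * (e $$ (partner m i, j) * e $$ (partner m k, l))"
      by (simp add: S_def mult_ac)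
    also have "e $$ (partner m i, j) * e $$ (partner m k, l) = e $$ (partner m i, l) * e $$ (partner m k, j)"
      using that by (intro minimal_nilpotent_minors[OF e m]) auto
    finally show ?thesis by (simp add: S_def mult_ac)
  qed
  have eS: "e $$ (i, j) = - partner_sign m i * S (partner m i) j" if "i < ?n" for i j
    using that by (simp add: S_def mult.assoc[symmetric])
  have "\<exists>a<?n. \<exists>b<?n. S a b \<noteq> 0"
  proof (rule ccontr)
    assume "\<not> (\<exists>a<?n. \<exists>b<?n. S a b \<noteq> 0)"
    then have "e $$ (i, j) = 0" if "i < ?n" "j < ?n" for i j
      using that partner_less[of i m] by (simp add: eS)
    then have "e = 0\<^sub>m ?n ?n" using ec by (intro eq_matI) auto
    then show False using e0 by simp
  qed
  then obtain a b where ab: "a < ?n" "b < ?n" "S a b \<noteq> 0" by blast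
  have "S a a * S b b = S a b * S b a" using ab by (intro Smin)
  then have Saa: "S a a \<noteq> 0" using ab Ssym[of b a] by auto
  define c where "c = - inverse (S a a)"
  define v where "v = symp_vec m (\<lambda>k. S k a)"
  have e': "e = c \<cdot>\<^sub>m (rank_one ?n v * ?J)"
  proof (rule eq_matI)
    fix i j assume "i < dim_row (c \<cdot>\<^sub>m (rank_one ?n v * ?J))" "j < dim_col (c \<cdot>\<^sub>m (rank_one ?n v * ?J))"
    then have ij: "i < ?n" "j < ?n" by (auto simp: rank_one_def)
    let ?i = "partner m i"
    have "S ?i j * S a a = S ?i a * S a j" using ij ab by (intro Smin) auto
    then have "S ?i j = S ?i a * S j a * inverse (S a a)"
      using Saa Ssym[of a j] ij ab by (simp add: field_simps)
    moreover have "(rank_one ?n v * ?J) $$ (i, j) = v i * S j a"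
      using ij by (simp add: rank_one_J_index v_def symp_vec_symp_vec del: index_mult_mat(1))
    moreover have "(c \<cdot>\<^sub>m (rank_one ?n v * ?J)) $$ (i, j) = c * (rank_one ?n v * ?J) $$ (i, j)"
      using ij by (intro index_smult_mat(1)) (auto simp: rank_one_def)
    ultimately show "e $$ (i, j) = (c \<cdot>\<^sub>m (rank_one ?n v * ?J)) $$ (i, j)"
      using ij by (simp add: eS c_def v_def symp_vec_def[of m _ i] mult_ac)
  qed (use ec in \<open>auto simp: rank_one_def\<close>)
  have c0: "c \<noteq> 0" using Saa by (simp add: c_def)
  have "\<exists>k<?n. v k \<noteq> 0"
  proof (intro exI conjI)
    show "partner m a < ?n" using ab by simp
    show "v (partner m a) \<noteq> 0" using ab Saa by (simp add: v_def symp_vec_def partner_sign_def)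
  qed
  then show ?thesis by (rule that[OF c0 _ e'])
qed

lemma smult_entry:
  "A \<in> carrier_mat k n \<Longrightarrow> i < k \<Longrightarrow> j < n \<Longrightarrow> (a \<cdot>\<^sub>m A) $$ (i, j) = a * A $$ (i, j)"
  by simp

text \<open>The relations of the triple give \<open>[e, [e, f]] = - 2 e\<close>, while for an element of rank one this double
  bracket is \<open>- 2 tr (e f) e\<close>.\<close>

lemma sl2_triple_sp_form:
  fixes e h f :: "'a::field_char_0 mat"
  assumes e: "e = c \<cdot>\<^sub>m (rank_one (2 * m) v * symp_J m)" and c: "c \<noteq> 0" and v: "\<exists>k<2 * m. v k \<noteq> 0"
    and t: "sl2_triple (sp m) e h f"
  shows "sp_form m e f = 1"
proof -
  let ?n = "2 * m" and ?J = "symp_J m :: 'a mat"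
  let ?x = "rank_one ?n v * ?J"
  have x: "?x \<in> carrier (sp m)" by (rule sp_of_sym) simp
  have xc: "?x \<in> carrier_mat ?n ?n" using x by (rule sp_carrier_mat)
  have esp: "e \<in> carrier (sp m)" and hsp: "h \<in> carrier (sp m)" and fsp: "f \<in> carrier (sp m)"
    and he: "h * e - e * h = 2 \<cdot>\<^sub>m e" and ef: "e * f - f * e = h"
    using t by (auto simp: sl2_triple_def sp_simps)
  note ec = sp_carrier_mat[OF esp] and hc = sp_carrier_mat[OF hsp] and fc = sp_carrier_mat[OF fsp]
  obtain P where P: "P \<in> sym_mats ?n" "f = P * ?J" using fsp by (rule sp_carrierE)
  have scale: "lie_bracket (sp m) e Y = c \<cdot>\<^sub>m lie_bracket (sp m) ?x Y" if "Y \<in> carrier_mat ?n ?n" for Y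
    unfolding e lie_bracket_sp
    using mult_smult_assoc_mat[OF xc that] mult_smult_distrib[OF that xc] xc that
    by (intro eq_matI) (auto simp: right_diff_distrib simp del: index_mult_mat(1))
  have xf: "lie_bracket (sp m) ?x f \<in> carrier (sp m)" by (rule sp_bracket_closed[OF x fsp])
  define q where "q = mat_pair ?n (rank_one ?n (symp_vec m v)) P"
  have "lie_bracket (sp m) e (lie_bracket (sp m) e f) =
      c \<cdot>\<^sub>m lie_bracket (sp m) ?x (c \<cdot>\<^sub>m lie_bracket (sp m) ?x f)"
    using scale[OF fc] scale[of "c \<cdot>\<^sub>m lie_bracket (sp m) ?x f"] sp_carrier_mat[OF xf] by simp
  also have "\<dots> = c \<cdot>\<^sub>m (c \<cdot>\<^sub>m lie_bracket (sp m) ?x (lie_bracket (sp m) ?x f))"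
    using bracket_smult_mat[OF xc sp_carrier_mat[OF xf], of c] by (simp add: lie_bracket_sp)
  also have "lie_bracket (sp m) ?x (lie_bracket (sp m) ?x f) = (2 * q) \<cdot>\<^sub>m ?x"
    unfolding P(2) q_def by (rule double_bracket_rank_one[OF P(1)])
  finally have 1: "lie_bracket (sp m) e (lie_bracket (sp m) e f) = c \<cdot>\<^sub>m (c \<cdot>\<^sub>m ((2 * q) \<cdot>\<^sub>m ?x))" .
  have 2: "lie_bracket (sp m) e (lie_bracket (sp m) e f) = (- 2) \<cdot>\<^sub>m e"
  proof -
    have "lie_bracket (sp m) e (lie_bracket (sp m) e f) = e * h - h * e" by (simp add: lie_bracket_sp ef)
    also have "\<dots> = - (h * e - e * h)" by (rule eq_matI) (use ec hc in \<open>auto simp del: index_mult_mat(1)\<close>)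
    also have "\<dots> = (- 2) \<cdot>\<^sub>m e" unfolding he by (rule eq_matI) (use ec in auto)
    finally show ?thesis .
  qed
  obtain k where k: "k < ?n" "v k \<noteq> 0" using v by blast
  let ?k = "partner m k"
  have kk: "?k < ?n" using k by simp
  have xk: "?x $$ (k, ?k) \<noteq> 0"
    using k kk by (simp add: rank_one_J_index symp_vec_def partner_sign_def del: index_mult_mat(1))
  have "(c \<cdot>\<^sub>m (c \<cdot>\<^sub>m ((2 * q) \<cdot>\<^sub>m ?x))) $$ (k, ?k) = ((- 2) \<cdot>\<^sub>m (c \<cdot>\<^sub>m ?x)) $$ (k, ?k)"
    using 1 2 e by simp
  then have "c * (c * (2 * q * ?x $$ (k, ?k))) = - 2 * (c * ?x $$ (k, ?k))"
    by (simp only: smult_entry[of _ ?n ?n] smult_carrier_mat xc k(1) kk)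
  then have E: "(2 * c * ?x $$ (k, ?k)) * (c * q) = (2 * c * ?x $$ (k, ?k)) * (- 1)"
    by (simp only: mult_ac mult_minus_left mult_minus_right mult_1_right mult_1_left)
  have NZ: "2 * c * ?x $$ (k, ?k) \<noteq> 0" using c xk by (simp only: mult_eq_0_iff) simp
  have cq: "c * q = - 1" by (rule iffD1[OF mult_left_cancel[OF NZ] E])
  have "sp_form m e f = c * sp_form m ?x f"
    unfolding e sp_form_def using mult_smult_distrib[OF symp_J_carrier xc, of c]
      mat_pair_smult[OF mult_carrier_mat[OF symp_J_carrier xc] sp_sym_carrier[OF fc], of c] by simp
  also have "sp_form m ?x f = - q"
    unfolding sp_form_def J_rank_one_J q_def P(2) sp_sym_mult[OF sym_matsD(1)[OF P(1)]]
    by (rule mat_pair_uminus[OF rank_one_carrier sym_matsD(1)[OF P(1)]])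
  finally show ?thesis using cq by simp
qed

section \<open>Transitivity of the symplectic group on nonzero vectors\<close>

text \<open>The inverse is carried along, so that conjugation by \<open>g\<close> needs no choice of an inverse matrix.\<close>

definition sp_invertible :: "nat \<Rightarrow> 'a::field mat \<Rightarrow> 'a mat \<Rightarrow> bool" where
  "sp_invertible m g h \<longleftrightarrow> g \<in> carrier_mat (2 * m) (2 * m) \<and> h \<in> carrier_mat (2 * m) (2 * m) \<and>
     g * h = 1\<^sub>m (2 * m) \<and> h * g = 1\<^sub>m (2 * m) \<and> transpose_mat g * symp_J m * g = symp_J m"

lemma sp_invertible_mult:
  fixes g h g' h' :: "'a::field mat"
  assumes a: "sp_invertible m g h" and b: "sp_invertible m g' h'"
  shows "sp_invertible m (g * g') (h' * h)"
proof -
  let ?n = "2 * m" and ?J = "symp_J m :: 'a mat"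
  have c: "g \<in> carrier_mat ?n ?n" "h \<in> carrier_mat ?n ?n" "g' \<in> carrier_mat ?n ?n" "h' \<in> carrier_mat ?n ?n"
    "transpose_mat g \<in> carrier_mat ?n ?n" "transpose_mat g' \<in> carrier_mat ?n ?n"
    using a b by (auto simp: sp_invertible_def)
  note as = assoc_mult_mat[of _ ?n ?n _ ?n _ ?n]
  have "g * g' * (h' * h) = g * (g' * h') * h" using c by (simp add: as)
  also have "\<dots> = 1\<^sub>m ?n" using a b c by (simp add: sp_invertible_def)
  finally have 1: "g * g' * (h' * h) = 1\<^sub>m ?n" .
  have "h' * h * (g * g') = h' * (h * g) * g'" using c by (simp add: as)
  also have "\<dots> = 1\<^sub>m ?n" using a b c by (simp add: sp_invertible_def)
  finally have 2: "h' * h * (g * g') = 1\<^sub>m ?n" .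
  have "transpose_mat (g * g') * ?J * (g * g') = transpose_mat g' * (transpose_mat g * ?J * g) * g'"
    using c mult_carrier_mat[OF symp_J_carrier c(1)] mult_carrier_mat[OF c(5) symp_J_carrier]
      mult_carrier_mat[OF c(5) mult_carrier_mat[OF symp_J_carrier c(1)]]
    by (simp add: as transpose_mult[of _ ?n ?n _ ?n])
  also have "\<dots> = ?J" using a b by (simp add: sp_invertible_def)
  finally show ?thesis using 1 2 c by (simp add: sp_invertible_def)
qed

lemma transvection_invertible:
  fixes w :: "nat \<Rightarrow> 'a::field" and m :: nat
  defines "X \<equiv> rank_one (2 * m) w * symp_J m"
  shows "sp_invertible m (1\<^sub>m (2 * m) + a \<cdot>\<^sub>m X) (1\<^sub>m (2 * m) + (- a) \<cdot>\<^sub>m X)"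
proof -
  let ?n = "2 * m" and ?J = "symp_J m :: 'a mat"
  have X: "X \<in> carrier (sp m)" unfolding X_def by (rule sp_of_sym) simp
  have Xc: "X \<in> carrier_mat ?n ?n" using X by (rule sp_carrier_mat)
  have XX: "X * X = 0\<^sub>m ?n ?n" unfolding X_def by (rule rank_one_J_square)
  have prod: "(1\<^sub>m ?n + b \<cdot>\<^sub>m X) * (1\<^sub>m ?n + (- b) \<cdot>\<^sub>m X) = 1\<^sub>m ?n" for b
  proof -
    let ?A = "1\<^sub>m ?n + b \<cdot>\<^sub>m X"
    have A: "?A \<in> carrier_mat ?n ?n" using Xc by simp
    have "?A * (1\<^sub>m ?n + (- b) \<cdot>\<^sub>m X) = ?A * 1\<^sub>m ?n + ?A * ((- b) \<cdot>\<^sub>m X)"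
      by (rule mult_add_distrib_mat[OF A]) (use Xc in auto)
    also have "?A * ((- b) \<cdot>\<^sub>m X) = (- b) \<cdot>\<^sub>m (?A * X)" by (rule mult_smult_distrib[OF A Xc])
    also have "?A * X = 1\<^sub>m ?n * X + (b \<cdot>\<^sub>m X) * X" by (rule add_mult_distrib_mat) (use Xc in auto)
    also have "(b \<cdot>\<^sub>m X) * X = b \<cdot>\<^sub>m (X * X)" by (rule mult_smult_assoc_mat[OF Xc Xc])
    also have "1\<^sub>m ?n * X + b \<cdot>\<^sub>m (X * X) = X" unfolding XX using Xc by (intro eq_matI) auto
    also have "?A * 1\<^sub>m ?n + (- b) \<cdot>\<^sub>m X = 1\<^sub>m ?n"
      using right_mult_one_mat[OF A] Xc by (intro eq_matI) auto
    finally show ?thesis .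
  qed
  let ?g = "1\<^sub>m ?n + a \<cdot>\<^sub>m X"
  have g: "?g \<in> carrier_mat ?n ?n" using Xc by simp
  have "transpose_mat ?g * ?J = ?J * (1\<^sub>m ?n + (- a) \<cdot>\<^sub>m X)"
  proof -
    have "transpose_mat ?g = 1\<^sub>m ?n + a \<cdot>\<^sub>m transpose_mat X" by (rule eq_matI) (use Xc in auto)
    moreover have "(1\<^sub>m ?n + a \<cdot>\<^sub>m transpose_mat X) * ?J = 1\<^sub>m ?n * ?J + (a \<cdot>\<^sub>m transpose_mat X) * ?J"
      by (rule add_mult_distrib_mat) (use Xc in auto)
    moreover have "(a \<cdot>\<^sub>m transpose_mat X) * ?J = a \<cdot>\<^sub>m (transpose_mat X * ?J)"
      by (rule mult_smult_assoc_mat[of _ ?n ?n]) (use Xc in auto)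
    moreover have "?J * (1\<^sub>m ?n + (- a) \<cdot>\<^sub>m X) = ?J * 1\<^sub>m ?n + ?J * ((- a) \<cdot>\<^sub>m X)"
      by (rule mult_add_distrib_mat) (use Xc in auto)
    moreover have "?J * ((- a) \<cdot>\<^sub>m X) = (- a) \<cdot>\<^sub>m (?J * X)" by (rule mult_smult_distrib[OF symp_J_carrier Xc])
    moreover have "(- a) \<cdot>\<^sub>m (?J * X) = a \<cdot>\<^sub>m (transpose_mat X * ?J)"
      unfolding sp_skew[OF X] by (rule eq_matI) (use Xc in auto)
    ultimately show ?thesis by simp
  qed
  then have "transpose_mat ?g * ?J * ?g = ?J * (1\<^sub>m ?n + (- a) \<cdot>\<^sub>m X) * ?g" by simp
  also have "\<dots> = ?J * ((1\<^sub>m ?n + (- a) \<cdot>\<^sub>m X) * ?g)"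
    by (rule assoc_mult_mat[of _ ?n ?n _ ?n _ ?n]) (use Xc in auto)
  also have "\<dots> = ?J" using prod[of "- a"] by simp
  finally show ?thesis using g Xc prod[of a] prod[of "- a"] by (simp add: sp_invertible_def)
qed

text \<open>The transvection along \<open>y - x\<close> does it, when scaled by the inverse of \<open>omega x y\<close>.\<close>

lemma transvection_moves:
  fixes x y :: "nat \<Rightarrow> 'a::field"
  assumes xy: "omega m x y \<noteq> 0"
  shows "\<exists>g h. sp_invertible m g h \<and> (\<forall>i<2 * m. (\<Sum>j<2 * m. g $$ (i, j) * x j) = y i)"
proof -
  let ?n = "2 * m" and ?J = "symp_J m :: 'a mat"
  define w where "w = (\<lambda>i. y i - x i)"
  define a where "a = inverse (omega m x y)"
  define X where "X = rank_one ?n w * ?J"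
  have Xc: "X \<in> carrier_mat ?n ?n" unfolding X_def by (rule mult_carrier_mat[OF rank_one_carrier symp_J_carrier])
  have inv: "sp_invertible m (1\<^sub>m ?n + a \<cdot>\<^sub>m X) (1\<^sub>m ?n + (- a) \<cdot>\<^sub>m X)"
    unfolding X_def by (rule transvection_invertible)
  have owx: "omega m w x = - omega m x y"
  proof -
    have "omega m w x = omega m y x - omega m x x"
      by (simp add: omega_def w_def symp_vec_def left_diff_distrib right_diff_distrib sum_subtractf)
    then show ?thesis using omega_skew[of m y x] by (simp add: omega_self)
  qed
  have "(\<Sum>j<?n. (1\<^sub>m ?n + a \<cdot>\<^sub>m X) $$ (i, j) * x j) = y i" if i: "i < ?n" for i
  proof -
    have "(\<Sum>j<?n. (1\<^sub>m ?n + a \<cdot>\<^sub>m X) $$ (i, j) * x j) =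
        (\<Sum>j<?n. (if j = i then x j else 0) - a * w i * (symp_vec m w j * x j))"
    proof (rule sum.cong)
      fix j assume j: "j \<in> {..<?n}"
      have "X $$ (i, j) = - w i * symp_vec m w j" using i j by (simp add: X_def rank_one_J_index del: index_mult_mat(1))
      then show "(1\<^sub>m ?n + a \<cdot>\<^sub>m X) $$ (i, j) * x j = (if j = i then x j else 0) - a * w i * (symp_vec m w j * x j)"
        using i j Xc by (auto simp: algebra_simps)
    qed simp
    also have "\<dots> = x i - a * w i * omega m w x"
      using i by (simp add: sum_subtractf omega_def sum_distrib_left)
    also have "\<dots> = x i + w i" unfolding owx using xy by (simp add: a_def)
    finally show ?thesis by (simp add: w_def)
  qed
  then show ?thesis using inv by blast
qed

text \<open>Two transvections through a vector not orthogonal to either of the two vectors.\<close>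

lemma sp_transitive:
  fixes v :: "nat \<Rightarrow> 'a::field"
  assumes v: "\<exists>k<2 * m. v k \<noteq> 0" and m: "m > 0"
  obtains g h where "sp_invertible m g h" "\<And>i. i < 2 * m \<Longrightarrow> g $$ (i, 0) = v i"
proof -
  let ?n = "2 * m"
  define w where "w = (\<lambda>i::nat. if i = 0 then 1 else (0::'a))"
  have "\<exists>k<?n. w k \<noteq> 0" using m by (intro exI[of _ 0]) (simp add: w_def)
  then obtain z where z: "omega m w z \<noteq> 0" "omega m v z \<noteq> 0" using omega_common[OF _ v] by blast
  have z': "omega m z v \<noteq> 0" using z(2) omega_skew[of m z v] by simp
  obtain g1 h1 where 1: "sp_invertible m g1 h1" "\<forall>i<?n. (\<Sum>j<?n. g1 $$ (i, j) * w j) = z i"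
    using transvection_moves[OF z(1)] by blast
  obtain g2 h2 where 2: "sp_invertible m g2 h2" "\<forall>i<?n. (\<Sum>j<?n. g2 $$ (i, j) * z j) = v i"
    using transvection_moves[OF z'] by blast
  have "(g2 * g1) $$ (i, 0) = v i" if i: "i < ?n" for i
  proof -
    have c: "g1 \<in> carrier_mat ?n ?n" "g2 \<in> carrier_mat ?n ?n" using 1 2 by (auto simp: sp_invertible_def)
    have col: "g1 $$ (j, 0) = z j" if "j < ?n" for j
    proof -
      have "(\<Sum>k<?n. g1 $$ (j, k) * w k) = (\<Sum>k<?n. if k = 0 then g1 $$ (j, k) else 0)"
        by (rule sum.cong) (auto simp: w_def)
      then show ?thesis using 1(2) that m by simp
    qed
    have "(g2 * g1) $$ (i, 0) = (\<Sum>j<?n. g2 $$ (i, j) * g1 $$ (j, 0))"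
      using i m by (intro mult_index_sum[OF c(2,1)]) auto
    also have "\<dots> = (\<Sum>j<?n. g2 $$ (i, j) * z j)" by (rule sum.cong) (simp_all add: col)
    finally show ?thesis using 2(2) i by simp
  qed
  then show ?thesis using that[OF sp_invertible_mult[OF 2(1) 1(1)]] by blast
qed

section \<open>Conjugation by the symplectic group\<close>

lemma sp_invertible_inverse:
  fixes g h :: "'a::field mat"
  assumes a: "sp_invertible m g h"
  shows "sp_invertible m h g"
proof -
  let ?n = "2 * m" and ?J = "symp_J m :: 'a mat"
  have c: "g \<in> carrier_mat ?n ?n" "h \<in> carrier_mat ?n ?n" and gh: "g * h = 1\<^sub>m ?n"
    and J: "transpose_mat g * ?J * g = ?J"
    using a by (auto simp: sp_invertible_def)
  have ct: "transpose_mat g \<in> carrier_mat ?n ?n" "transpose_mat h \<in> carrier_mat ?n ?n" using c by auto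
  note as = assoc_mult_mat[of _ ?n ?n _ ?n _ ?n]
  have tt: "transpose_mat h * transpose_mat g = 1\<^sub>m ?n"
    using transpose_mult[OF c] gh by simp
  have "transpose_mat h * ?J * h = transpose_mat h * (transpose_mat g * ?J * g) * h" by (simp add: J)
  also have "\<dots> = (transpose_mat h * transpose_mat g) * ?J * (g * h)"
    using c ct mult_carrier_mat[OF symp_J_carrier c(1)] mult_carrier_mat[OF ct(1) symp_J_carrier]
      mult_carrier_mat[OF symp_J_carrier c(2)]
      mult_carrier_mat[OF ct(1) mult_carrier_mat[OF symp_J_carrier c(1)]]
      mult_carrier_mat[OF symp_J_carrier mult_carrier_mat[OF c(1) c(2)]]
    by (simp add: as)
  also have "\<dots> = ?J" by (simp add: tt gh)
  finally show ?thesis using a by (simp add: sp_invertible_def)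
qed

locale sp_conjugation =
  fixes n :: nat and g h :: "'a::field_char_0 mat"
  assumes inv: "sp_invertible n g h"
begin

abbreviation "N \<equiv> 2 * n"
abbreviation "J \<equiv> symp_J n :: 'a mat"

definition conj :: "'a mat \<Rightarrow> 'a mat" where "conj X = g * X * h"
definition unconj :: "'a mat \<Rightarrow> 'a mat" where "unconj X = h * X * g"

lemma gc: "g \<in> carrier_mat N N" and hc: "h \<in> carrier_mat N N"
  and gh: "g * h = 1\<^sub>m N" and hg: "h * g = 1\<^sub>m N"
  and gJ: "transpose_mat g * J * g = J"
  using inv by (auto simp: sp_invertible_def)

lemma conj_carrier: "X \<in> carrier_mat N N \<Longrightarrow> conj X \<in> carrier_mat N N"
  using gc hc by (auto simp: conj_def)

lemma conj_unconj: assumes X: "X \<in> carrier_mat N N" shows "conj (unconj X) = X"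
proof -
  note as = assoc_mult_mat[of _ N N _ N _ N]
  have "conj (unconj X) = (g * h) * X * (g * h)"
    using gc hc X mult_carrier_mat[OF hc X] mult_carrier_mat[OF X gc] mult_carrier_mat[OF gc hc]
      mult_carrier_mat[OF X mult_carrier_mat[OF gc hc]] mult_carrier_mat[OF hc mult_carrier_mat[OF X gc]]
    by (simp add: conj_def unconj_def as)
  then show ?thesis using X by (simp add: gh)
qed

lemma unconj_conj: assumes X: "X \<in> carrier_mat N N" shows "unconj (conj X) = X"
proof -
  note as = assoc_mult_mat[of _ N N _ N _ N]
  have "unconj (conj X) = (h * g) * X * (h * g)"
    using gc hc X mult_carrier_mat[OF gc X] mult_carrier_mat[OF X hc] mult_carrier_mat[OF hc gc]
      mult_carrier_mat[OF X mult_carrier_mat[OF hc gc]] mult_carrier_mat[OF gc mult_carrier_mat[OF X hc]]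
    by (simp add: conj_def unconj_def as)
  then show ?thesis using X by (simp add: hg)
qed

lemma conj_mult:
  assumes X: "X \<in> carrier_mat N N" and Y: "Y \<in> carrier_mat N N"
  shows "conj X * conj Y = conj (X * Y)"
proof -
  note as = assoc_mult_mat[of _ N N _ N _ N]
  have "conj X * conj Y = g * X * (h * g) * Y * h"
    using gc hc X Y mult_carrier_mat[OF gc X] mult_carrier_mat[OF gc Y] mult_carrier_mat[OF X hc]
      mult_carrier_mat[OF Y hc] mult_carrier_mat[OF hc gc] mult_carrier_mat[OF gc mult_carrier_mat[OF Y hc]]
      mult_carrier_mat[OF hc mult_carrier_mat[OF gc mult_carrier_mat[OF Y hc]]]
    by (simp add: conj_def as)
  also have "g * X * (h * g) = g * X" using gc X by (simp add: hg)
  also have "g * X * Y * h = conj (X * Y)"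
    using gc hc X Y mult_carrier_mat[OF X Y] mult_carrier_mat[OF Y hc] by (simp add: conj_def as)
  finally show ?thesis .
qed

lemma conj_add:
  assumes X: "X \<in> carrier_mat N N" and Y: "Y \<in> carrier_mat N N"
  shows "conj (X + Y) = conj X + conj Y"
  unfolding conj_def mult_add_distrib_mat[OF gc X Y]
  by (rule add_mult_distrib_mat[OF mult_carrier_mat[OF gc X] mult_carrier_mat[OF gc Y] hc])

lemma conj_smult:
  assumes X: "X \<in> carrier_mat N N"
  shows "conj (a \<cdot>\<^sub>m X) = a \<cdot>\<^sub>m conj X"
  unfolding conj_def mult_smult_distrib[OF gc X]
  by (rule mult_smult_assoc_mat[OF mult_carrier_mat[OF gc X] hc])

text \<open>On symmetric matrices conjugation is the congruence \<open>P \<mapsto> g P g\<^sup>T\<close>.\<close>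

lemma conj_mult_J:
  assumes Pc: "P \<in> carrier_mat N N"
  shows "conj (P * J) = (g * P * transpose_mat g) * J"
proof -
  note as = assoc_mult_mat[of _ N N _ N _ N]
  have gt: "transpose_mat g \<in> carrier_mat N N" using gc by simp
  have "J * h = transpose_mat g * J * g * h" by (simp add: gJ)
  also have "\<dots> = transpose_mat g * J * (g * h)"
    by (rule as[OF mult_carrier_mat[OF gt symp_J_carrier] gc hc])
  also have "\<dots> = transpose_mat g * J" using mult_carrier_mat[OF gt symp_J_carrier] by (simp add: gh)
  finally have Jh: "J * h = transpose_mat g * J" .
  have "conj (P * J) = g * (P * (J * h))"
    unfolding conj_def using as[OF gc mult_carrier_mat[OF Pc symp_J_carrier] hc] as[OF Pc symp_J_carrier hc] by simp
  also have "\<dots> = g * (P * (transpose_mat g * J))" by (simp add: Jh)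
  also have "\<dots> = g * ((P * transpose_mat g) * J)" by (simp only: as[OF Pc gt symp_J_carrier])
  also have "\<dots> = (g * (P * transpose_mat g)) * J"
    by (rule as[OF gc mult_carrier_mat[OF Pc gt] symp_J_carrier, symmetric])
  also have "g * (P * transpose_mat g) = g * P * transpose_mat g" by (rule as[OF gc Pc gt, symmetric])
  finally show ?thesis .
qed

lemma conj_sp:
  assumes X: "X \<in> carrier (sp n)"
  shows "conj X \<in> carrier (sp n)"
proof -
  obtain P where P: "P \<in> sym_mats N" "X = P * J" using X by (rule sp_carrierE)
  have Pc: "P \<in> carrier_mat N N" using P(1) by (rule sym_matsD)
  have gt: "transpose_mat g \<in> carrier_mat N N" using gc by simp
  define Q where "Q = g * P * transpose_mat g"
  have "Q \<in> sym_mats N"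
  proof (rule sym_matsI)
    show "Q \<in> carrier_mat N N" using gc Pc by (auto simp: Q_def)
    have "transpose_mat Q = transpose_mat (transpose_mat g) * transpose_mat (g * P)"
      unfolding Q_def by (rule transpose_mult[OF mult_carrier_mat[OF gc Pc] gt])
    also have "transpose_mat (g * P) = P * transpose_mat g"
      using transpose_mult[OF gc Pc] sym_matsD(2)[OF P(1)] by simp
    finally show "transpose_mat Q = Q" unfolding Q_def using assoc_mult_mat[OF gc Pc gt] by simp
  qed
  then show ?thesis unfolding P(2) conj_mult_J[OF Pc] Q_def[symmetric] by (rule sp_of_sym)
qed

lemma sp_form_conj:
  assumes X: "X \<in> carrier (sp n)" and Y: "Y \<in> carrier (sp n)"
  shows "sp_form n (conj X) (conj Y) = sp_form n X Y"
proof -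
  note as = assoc_mult_mat[of _ N N _ N _ N]
  have Xc: "X \<in> carrier_mat N N" and Yc: "Y \<in> carrier_mat N N" using X Y by (auto dest: sp_carrier_mat)
  have t: "transpose_mat g \<in> carrier_mat N N" "transpose_mat h \<in> carrier_mat N N" "transpose_mat Y \<in> carrier_mat N N"
    using gc hc Yc by auto
  have "transpose_mat (conj Y) = transpose_mat h * (transpose_mat Y * transpose_mat g)"
    unfolding conj_def transpose_mult[OF mult_carrier_mat[OF gc Yc] hc] transpose_mult[OF gc Yc] ..
  then have "transpose_mat g * transpose_mat (conj Y) = (transpose_mat g * transpose_mat h) * (transpose_mat Y * transpose_mat g)"
    using as[OF t(1,2) mult_carrier_mat[OF t(3,1)]] by simp
  also have "transpose_mat g * transpose_mat h = 1\<^sub>m N" using transpose_mult[OF hc gc] hg by simp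
  finally have 1: "transpose_mat g * transpose_mat (conj Y) = transpose_mat Y * transpose_mat g"
    by (simp only: left_mult_one_mat[OF mult_carrier_mat[OF t(3,1)]])
  have "sp_form n (conj X) (conj Y) = mat_pair N (conj X) (transpose_mat (conj Y))"
    by (rule sp_form_trace[OF conj_sp[OF X] conj_sp[OF Y]])
  also have "\<dots> = mat_pair N (g * (X * h)) (transpose_mat (conj Y))"
    unfolding conj_def[of X] as[OF gc Xc hc] ..
  also have "\<dots> = mat_pair N (X * h) (transpose_mat Y * transpose_mat g)"
    using mat_pair_mult_left[OF gc mult_carrier_mat[OF Xc hc], of "transpose_mat (conj Y)"] conj_carrier[OF Yc] 1 by simp
  also have "\<dots> = mat_pair N X (transpose_mat Y * transpose_mat g * transpose_mat h)"
    by (rule mat_pair_mult_right[OF Xc hc mult_carrier_mat[OF t(3,1)]])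
  also have "transpose_mat Y * transpose_mat g * transpose_mat h = transpose_mat Y"
    using as[OF t(3,1,2)] \<open>transpose_mat g * transpose_mat h = 1\<^sub>m N\<close> t by simp
  finally show ?thesis using sp_form_trace[OF X Y] by simp
qed

lemma det_conj_shift:
  assumes X: "X \<in> carrier_mat N N"
  shows "det (z \<cdot>\<^sub>m 1\<^sub>m N + conj X) = det (z \<cdot>\<^sub>m 1\<^sub>m N + X)"
proof -
  have c: "z \<cdot>\<^sub>m 1\<^sub>m N + X \<in> carrier_mat N N" using X by simp
  have "conj (z \<cdot>\<^sub>m 1\<^sub>m N) = z \<cdot>\<^sub>m 1\<^sub>m N"
    using conj_smult[OF one_carrier_mat, of z] gc by (simp add: conj_def gh)
  then have "z \<cdot>\<^sub>m 1\<^sub>m N + conj X = g * (z \<cdot>\<^sub>m 1\<^sub>m N + X) * h"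
    using conj_add[of "z \<cdot>\<^sub>m 1\<^sub>m N" X] X by (simp add: conj_def)
  then have "det (z \<cdot>\<^sub>m 1\<^sub>m N + conj X) = det g * det (z \<cdot>\<^sub>m 1\<^sub>m N + X) * det h"
    using det_mult[OF mult_carrier_mat[OF gc c] hc] det_mult[OF gc c] by simp
  moreover have "det g * det h = 1" using det_mult[OF gc hc] by (simp add: gh)
  ultimately show ?thesis by (simp add: mult_ac)
qed

definition frame :: "nat \<Rightarrow> nat \<Rightarrow> 'a mat" where
  "frame i j = conj (sym_unit N i j * J)"

text \<open>If \<open>\<gamma>\<close> is \<open>b\<close> times the trace form with \<open>of_frame S\<close>, then \<open>S = frame_coord b \<gamma>\<close>.  The factor 2 comes from the two
  entries of a symmetrised unit.\<close>

definition frame_coord :: "'a \<Rightarrow> ('a mat \<Rightarrow> 'a) \<Rightarrow> 'a mat" where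
  "frame_coord b \<gamma> = mat N N (\<lambda>(i, j). \<gamma> (frame i j) / (2 * b))"

lemma frame_sp: "frame i j \<in> carrier (sp n)"
  unfolding frame_def by (intro conj_sp sp_of_sym) simp

lemma frame_commute: "frame i j = frame j i"
  by (simp add: frame_def sym_unit_commute[of N i j])

lemma frame_coord_sym: "frame_coord b \<gamma> \<in> sym_mats N"
  by (rule sym_matsI') (simp_all add: frame_coord_def frame_commute)

lemma frame_expand:
  assumes b: "b \<noteq> 0" and \<gamma>: "\<gamma> \<in> lie_dual (sp n)" and Q: "Q \<in> sym_mats N"
  shows "\<gamma> (conj (Q * J)) = b * mat_pair N (frame_coord b \<gamma>) Q"
proof -
  define \<gamma>' where "\<gamma>' = restrict (\<lambda>X. \<gamma> (conj X)) (carrier (sp n))"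
  have 1: "\<gamma> (conj (x + y)) = \<gamma> (conj x) + \<gamma> (conj y)"
    if "x \<in> carrier (sp n)" "y \<in> carrier (sp n)" for x y
    using lie_dual_add[OF \<gamma> conj_sp[OF that(1)] conj_sp[OF that(2)]]
      conj_add[OF sp_carrier_mat[OF that(1)] sp_carrier_mat[OF that(2)]] by (simp add: add_sp)
  have 2: "\<gamma> (conj (a \<cdot>\<^sub>m x)) = a * \<gamma> (conj x)" if "x \<in> carrier (sp n)" for a x
    using lie_dual_smult[OF \<gamma> conj_sp[OF that], of a] conj_smult[OF sp_carrier_mat[OF that], of a]
    by (simp add: smult_sp)
  have "\<gamma>' \<in> lie_dual (sp n)"
    unfolding lie_dual_def \<gamma>'_def
    by (simp add: add_sp smult_sp sp_add_closed sp_smult_closed 1 2)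
  from sp_dual_expand[OF this Q] have "\<gamma> (conj (Q * J)) =
      (\<Sum>i<N. \<Sum>j<N. Q $$ (i, j) * \<gamma> (frame i j)) / 2"
    by (simp add: \<gamma>'_def sp_of_sym[OF Q] sp_of_sym[OF sym_unit_in] frame_def)
  then show ?thesis
    using b by (simp add: mat_pair_def frame_coord_def sum_distrib_left sum_divide_distrib mult_ac)
qed

definition of_frame :: "'a mat \<Rightarrow> 'a mat" where
  "of_frame S = conj ((- 1) \<cdot>\<^sub>m (J * S))"

lemma J_mult_neg: "S \<in> carrier_mat N N \<Longrightarrow> J * ((- 1) \<cdot>\<^sub>m (J * S)) = S"
proof -
  assume S: "S \<in> carrier_mat N N"
  have "J * ((- 1) \<cdot>\<^sub>m (J * S)) = (- 1) \<cdot>\<^sub>m (J * (J * S))"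
    by (rule mult_smult_distrib[OF symp_J_carrier mult_carrier_mat[OF symp_J_carrier S]])
  also have "J * (J * S) = - (1\<^sub>m N) * S"
    using assoc_mult_mat[OF symp_J_carrier symp_J_carrier S] by (simp add: symp_J_square)
  also have "(- 1) \<cdot>\<^sub>m (- (1\<^sub>m N) * S) = S"
    using S by (intro eq_matI) auto
  finally show ?thesis .
qed

lemma of_frame_sp: "S \<in> sym_mats N \<Longrightarrow> of_frame S \<in> carrier (sp n)"
  unfolding of_frame_def by (intro conj_sp sp_smult_closed symp_J_mult_sym_in_sp)

lemma sp_form_of_frame:
  assumes S: "S \<in> sym_mats N" and Q: "Q \<in> sym_mats N"
  shows "sp_form n (of_frame S) (conj (Q * J)) = mat_pair N S Q"
proof -
  have "sp_form n (of_frame S) (conj (Q * J)) = sp_form n ((- 1) \<cdot>\<^sub>m (J * S)) (Q * J)"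
    unfolding of_frame_def using S Q by (intro sp_form_conj sp_smult_closed symp_J_mult_sym_in_sp sp_of_sym)
  then show ?thesis
    by (simp add: sp_form_def J_mult_neg[OF sym_matsD(1)[OF S]] sp_sym_mult[OF sym_matsD(1)[OF Q]])
qed

lemma sp_eq_conj:
  assumes Y: "Y \<in> carrier (sp n)"
  obtains Q where "Q \<in> sym_mats N" "Y = conj (Q * J)"
proof -
  interpret I: sp_conjugation n h g by unfold_locales (rule sp_invertible_inverse[OF inv])
  have "I.conj Y \<in> carrier (sp n)" by (rule I.conj_sp[OF Y])
  then obtain Q where Q: "Q \<in> sym_mats N" "I.conj Y = Q * J" by (rule sp_carrierE)
  have "conj (Q * J) = Y"
    using conj_unconj[OF sp_carrier_mat[OF Y]] by (simp add: unconj_def I.conj_def Q(2)[symmetric])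
  then show ?thesis using that Q(1) by metis
qed

text \<open>The trace form pairs \<open>of_frame S\<close> with \<open>conj (Q J)\<close> to the pairing of \<open>S\<close> with \<open>Q\<close>, which is nondegenerate on symmetric
  matrices.\<close>

lemma form_inverse_eq:
  assumes b: "b \<noteq> 0"
    and B: "\<And>X Y. X \<in> carrier (sp n) \<Longrightarrow> Y \<in> carrier (sp n) \<Longrightarrow> B X Y = b * sp_form n X Y"
    and \<gamma>: "\<gamma> \<in> lie_dual (sp n)"
  shows "form_inverse (sp n) B \<gamma> = of_frame (frame_coord b \<gamma>)"
  unfolding form_inverse_def
proof (rule the_equality)
  let ?S = "frame_coord b \<gamma>"
  have S: "?S \<in> sym_mats N" by (rule frame_coord_sym)
  have val: "\<gamma> y = B (of_frame ?S) y" if y: "y \<in> carrier (sp n)" for y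
  proof -
    obtain Q where Q: "Q \<in> sym_mats N" "y = conj (Q * J)" using y by (rule sp_eq_conj)
    then show ?thesis
      using frame_expand[OF b \<gamma> Q(1)] sp_form_of_frame[OF S Q(1)] B[OF of_frame_sp[OF S] y] by simp
  qed
  then show "of_frame ?S \<in> carrier (sp n) \<and> (\<forall>y\<in>carrier (sp n). \<gamma> y = B (of_frame ?S) y)"
    using of_frame_sp[OF S] by blast
  fix X assume X: "X \<in> carrier (sp n) \<and> (\<forall>y\<in>carrier (sp n). \<gamma> y = B X y)"
  obtain S' where S': "S' \<in> sym_mats N" "X = of_frame S'"
  proof -
    obtain Q where Q: "Q \<in> sym_mats N" "X = conj (Q * J)" using X sp_eq_conj by blast
    have QJ: "Q * J \<in> carrier (sp n)" by (rule sp_of_sym[OF Q(1)])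
    define S' where "S' = J * (Q * J)"
    have S'c: "S' \<in> carrier_mat N N" unfolding S'_def by (rule mult_carrier_mat[OF symp_J_carrier sp_carrier_mat[OF QJ]])
    have "S' \<in> sym_mats N"
    proof (rule sym_matsI'[OF S'c])
      fix i j assume ij: "i < N" "j < N"
      show "S' $$ (i, j) = S' $$ (j, i)"
        using QJ[unfolded sp_iff_index[OF sp_carrier_mat[OF QJ]]] ij
        by (simp add: S'_def symp_J_mult_index[OF sp_carrier_mat[OF QJ]] del: index_mult_mat(1))
    qed
    moreover have "(- 1) \<cdot>\<^sub>m (J * S') = Q * J"
    proof -
      have "J * S' = - (1\<^sub>m N) * (Q * J)"
        unfolding S'_def using assoc_mult_mat[OF symp_J_carrier symp_J_carrier sp_carrier_mat[OF QJ]] by (simp add: symp_J_square)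
      then show ?thesis using sp_carrier_mat[OF QJ] by (intro eq_matI) auto
    qed
    ultimately show ?thesis using that Q(2) by (simp add: of_frame_def)
  qed
  have "S' = ?S"
  proof (rule eq_matI)
    fix i j assume "i < dim_row ?S" "j < dim_col ?S"
    then have ij: "i < N" "j < N" using sym_matsD(1)[OF S] by auto
    have "B X (frame i j) = B (of_frame ?S) (frame i j)"
      using X val frame_sp by metis
    then have "sp_form n (of_frame S') (frame i j) = sp_form n (of_frame ?S) (frame i j)"
      using B[OF of_frame_sp[OF S'(1)] frame_sp] B[OF of_frame_sp[OF S] frame_sp] S'(2) b by simp
    then have "mat_pair N S' (sym_unit N i j) = mat_pair N ?S (sym_unit N i j)"
      unfolding frame_def sp_form_of_frame[OF S'(1) sym_unit_in] sp_form_of_frame[OF S sym_unit_in] .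
    then have "S' $$ (i, j) + S' $$ (j, i) = ?S $$ (i, j) + ?S $$ (j, i)"
      using mat_pair_sym_unit[OF sym_matsD(1)[OF S'(1)] ij] mat_pair_sym_unit[OF sym_matsD(1)[OF S] ij]
      by (simp add: mat_pair_sym[of N _ "sym_unit N i j"])
    then show "S' $$ (i, j) = ?S $$ (i, j)"
      using sym_mats_index[OF S'(1) ij] sym_mats_index[OF S ij] by simp
  qed (use sym_matsD(1)[OF S] sym_matsD(1)[OF S'(1)] in auto)
  then show "X = of_frame ?S" using S'(2) by simp
qed

definition pencil :: "'a mat \<Rightarrow> 'a poly mat" where
  "pencil S = mat N N (\<lambda>ij. [:S $$ ij, J $$ ij:])"

lemma poly_det_pencil:
  assumes S: "S \<in> carrier_mat N N"
  shows "poly (det (pencil S)) z = det (S + z \<cdot>\<^sub>m J)"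
  unfolding pencil_def poly_det[OF mat_carrier]
  by (intro arg_cong[where f = det] eq_matI) (use S in auto)

text \<open>The sum of principal minors is a coefficient of \<open>det (z + X)\<close>; up to conjugation \<open>X = - J S\<close>, and
  \<open>z - J S = - J (S + z J)\<close>.\<close>

lemma principal_minors_sum_of_frame:
  assumes S: "S \<in> sym_mats N" and k: "k \<le> N"
  shows "principal_minors_sum k (of_frame S) = det (- J) * coeff (det (pencil S)) (N - k)"
proof -
  have Sc: "S \<in> carrier_mat N N" using S by (rule sym_matsD)
  have X: "of_frame S \<in> carrier_mat N N" by (rule sp_carrier_mat[OF of_frame_sp[OF S]])
  have JS: "J * S \<in> carrier_mat N N" by (rule mult_carrier_mat[OF symp_J_carrier Sc])
  have "poly (det (shift_pencil N (of_frame S))) z = poly ([:det (- J):] * det (pencil S)) z" for z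
  proof -
    have "poly (det (shift_pencil N (of_frame S))) z = det (z \<cdot>\<^sub>m 1\<^sub>m N + of_frame S)"
      unfolding shift_pencil_def poly_det[OF mat_carrier]
      by (intro arg_cong[where f = det] eq_matI) (use X in auto)
    also have "\<dots> = det (z \<cdot>\<^sub>m 1\<^sub>m N + (- 1) \<cdot>\<^sub>m (J * S))"
      unfolding of_frame_def by (rule det_conj_shift) (use JS in simp)
    also have "z \<cdot>\<^sub>m 1\<^sub>m N + (- 1) \<cdot>\<^sub>m (J * S) = - J * (S + z \<cdot>\<^sub>m J)"
    proof -
      have J': "- J \<in> carrier_mat N N" by simp
      have "- J * (S + z \<cdot>\<^sub>m J) = - J * S + - J * (z \<cdot>\<^sub>m J)"
        by (rule mult_add_distrib_mat[OF J' Sc]) simp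
      also have "- J * (z \<cdot>\<^sub>m J) = z \<cdot>\<^sub>m (- J * J)" by (rule mult_smult_distrib[OF J' symp_J_carrier])
      also have "- J * J = 1\<^sub>m N" by (simp add: symp_J_square)
      finally have eq: "- J * (S + z \<cdot>\<^sub>m J) = - J * S + z \<cdot>\<^sub>m 1\<^sub>m N" .
      have "- J * S = (- 1) \<cdot>\<^sub>m (J * S)" using Sc by (intro eq_matI) auto
      then show ?thesis unfolding eq using JS by (simp add: comm_add_mat[of _ N N])
    qed
    also have "det (- J * (S + z \<cdot>\<^sub>m J)) = det (- J) * det (S + z \<cdot>\<^sub>m J)"
      by (rule det_mult[of _ N]) (use Sc in auto)
    finally show ?thesis using poly_det_pencil[OF Sc] by simp
  qed
  then have "poly (det (shift_pencil N (of_frame S))) = poly ([:det (- J):] * det (pencil S))" by (rule ext)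
  then have "det (shift_pencil N (of_frame S)) = [:det (- J):] * det (pencil S)"
    by (simp only: poly_eq_poly_eq_iff)
  then show ?thesis using principal_minors_sum_coeff[OF X k] by simp
qed

end

section \<open>The centraliser of a long root vector\<close>

text \<open>The indices other than 0 and \<open>m + 1\<close>, which span the orthogonal complement of the hyperbolic plane of
  these two, are numbered compatibly with the standard form of size \<open>2 m\<close>.\<close>

definition inner_index :: "nat \<Rightarrow> nat \<Rightarrow> nat" where
  "inner_index m a = (if a < m then Suc a else a + 2)"

definition outer_index :: "nat \<Rightarrow> nat \<Rightarrow> nat" where
  "outer_index m i = (if i \<le> m then i - 1 else i - 2)"

lemma inner_index:
  assumes "a < 2 * m"
  shows "inner_index m a < 2 * Suc m" "inner_index m a \<noteq> 0" "inner_index m a \<noteq> Suc m"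
    "outer_index m (inner_index m a) = a"
    "partner (Suc m) (inner_index m a) = inner_index m (partner m a)"
    "partner_sign (Suc m) (inner_index m a) = (partner_sign m a :: 'a::comm_ring_1)"
  using assms by (auto simp: inner_index_def outer_index_def partner_def partner_sign_def)

lemma inner_index_inj: "a < 2 * m \<Longrightarrow> b < 2 * m \<Longrightarrow> inner_index m a = inner_index m b \<longleftrightarrow> a = b"
  by (auto simp: inner_index_def)

lemma outer_index:
  assumes "i < 2 * Suc m" "i \<noteq> 0" "i \<noteq> Suc m"
  shows "outer_index m i < 2 * m" "inner_index m (outer_index m i) = i"
  using assms by (auto simp: inner_index_def outer_index_def)

lemma sum_inner_index:
  fixes F :: "nat \<Rightarrow> 'b::comm_monoid_add"
  shows "(\<Sum>k<2 * Suc m. F k) = F 0 + F (Suc m) + (\<Sum>a<2 * m. F (inner_index m a))"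
proof -
  have "(\<Sum>k<2 * Suc m. F k) = (\<Sum>k<Suc m. F k) + (\<Sum>k<Suc m. F (Suc m + k))"
    by (rule sum_lessThan_double)
  also have "\<dots> = F 0 + F (Suc m) + ((\<Sum>k<m. F (Suc k)) + (\<Sum>k<m. F (Suc (Suc (m + k)))))"
    unfolding sum.lessThan_Suc_shift by (simp add: ac_simps)
  also have "(\<Sum>k<m. F (Suc k)) = (\<Sum>k<m. F (inner_index m k))"
    by (intro sum.cong) (auto simp: inner_index_def)
  also have "(\<Sum>k<m. F (Suc (Suc (m + k)))) = (\<Sum>k<m. F (inner_index m (m + k)))"
    by (intro sum.cong) (auto simp: inner_index_def)
  finally show ?thesis unfolding sum_lessThan_double[of _ m] .
qed

lemma add_transpose_entry:
  "A \<in> carrier_mat k k \<Longrightarrow> i < k \<Longrightarrow> j < k \<Longrightarrow> (A + transpose_mat A) $$ (i, j) = A $$ (i, j) + A $$ (j, i)"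
  by auto

context sp_conjugation
begin

text \<open>The symmetric matrix of an element after undoing the conjugation.\<close>

definition coords :: "'a mat \<Rightarrow> 'a mat" where "coords x = sp_sym n (unconj x)"

lemma coords_conj:
  assumes Q: "Q \<in> sym_mats N"
  shows "coords (conj (Q * J)) = Q"
  using unconj_conj[OF sp_carrier_mat[OF sp_of_sym[OF Q]]] sp_sym_mult[OF sym_matsD(1)[OF Q]]
  by (simp add: coords_def)

lemma coords_frame: "coords (frame i j) = sym_unit N i j"
  unfolding frame_def by (rule coords_conj) simp

lemma coords_sym: "x \<in> carrier (sp n) \<Longrightarrow> coords x \<in> sym_mats N"
  by (metis sp_eq_conj coords_conj)

lemma conj_coords: "x \<in> carrier (sp n) \<Longrightarrow> conj (coords x * J) = x"
  by (metis sp_eq_conj coords_conj)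

lemma coords_eqI:
  "x \<in> carrier (sp n) \<Longrightarrow> y \<in> carrier (sp n) \<Longrightarrow> coords x = coords y \<Longrightarrow> x = y"
  by (metis conj_coords)

lemma coords_add:
  assumes x: "x \<in> carrier (sp n)" and y: "y \<in> carrier (sp n)"
  shows "coords (x + y) = coords x + coords y"
proof -
  note c = coords_sym[OF x] coords_sym[OF y]
  note cc = c[THEN sym_matsD(1)]
  have "x + y = conj (coords x * J + coords y * J)"
    using conj_add[OF mult_carrier_mat[OF cc(1) symp_J_carrier] mult_carrier_mat[OF cc(2) symp_J_carrier]]
    by (simp add: conj_coords[OF x] conj_coords[OF y])
  also have "coords x * J + coords y * J = (coords x + coords y) * J"
    by (rule add_mult_distrib_mat[OF cc symp_J_carrier, symmetric])
  finally show ?thesis using coords_conj[OF sym_mats_add[OF c]] by simp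
qed

lemma coords_smult:
  assumes x: "x \<in> carrier (sp n)"
  shows "coords (a \<cdot>\<^sub>m x) = a \<cdot>\<^sub>m coords x"
proof -
  note c = coords_sym[OF x]
  note cc = c[THEN sym_matsD(1)]
  have "a \<cdot>\<^sub>m x = conj (a \<cdot>\<^sub>m (coords x * J))"
    using conj_smult[OF mult_carrier_mat[OF cc symp_J_carrier]] by (simp add: conj_coords[OF x])
  also have "a \<cdot>\<^sub>m (coords x * J) = (a \<cdot>\<^sub>m coords x) * J"
    by (rule mult_smult_assoc_mat[OF cc symp_J_carrier, symmetric])
  finally show ?thesis using coords_conj[OF sym_mats_smult[OF c]] by simp
qed

lemma coords_bracket:
  assumes x: "x \<in> carrier (sp n)" and y: "y \<in> carrier (sp n)"
  shows "coords (x * y - y * x) =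
    coords x * J * coords y + transpose_mat (coords x * J * coords y)"
proof -
  note c = coords_sym[OF x] coords_sym[OF y]
  let ?X = "coords x * J" and ?Y = "coords y * J" and ?R = "coords x * J * coords y"
  note XY = sp_of_sym[OF c(1)] sp_of_sym[OF c(2)]
  note XYc = XY[THEN sp_carrier_mat]
  have "conj (?X * ?Y) = conj (?X * ?Y - ?Y * ?X + ?Y * ?X)"
    using mult_carrier_mat[OF XYc] mult_carrier_mat[OF XYc(2,1)]
    by (intro arg_cong[where f = conj] eq_matI) (auto simp del: index_mult_mat)
  also have "\<dots> = conj (?X * ?Y - ?Y * ?X) + conj (?Y * ?X)"
    by (rule conj_add[OF minus_carrier_mat[OF mult_carrier_mat[OF XYc(2,1)]] mult_carrier_mat[OF XYc(2,1)]])
  finally have "conj (?X * ?Y - ?Y * ?X) = conj (?X * ?Y) - conj (?Y * ?X)"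
    using conj_carrier[OF minus_carrier_mat[OF mult_carrier_mat[OF XYc(2,1)]], of "?X * ?Y"]
      conj_carrier[OF mult_carrier_mat[OF XYc(2,1)]]
    by (intro eq_matI) auto
  also have "\<dots> = x * y - y * x"
    using conj_mult[OF XYc] conj_mult[OF XYc(2,1)] by (simp add: conj_coords[OF x] conj_coords[OF y])
  finally have "x * y - y * x = conj (?X * ?Y - ?Y * ?X)" ..
  also have "?X * ?Y - ?Y * ?X = (?R + transpose_mat ?R) * J"
    using sp_bracket_sym[OF XY(1) c(2)] by (simp add: lie_bracket_sp)
  finally show ?thesis
    using coords_conj[OF sym_mats_plus_transpose[OF mult_carrier_mat[OF XYc(1) sym_matsD(1)[OF c(2)]]]] by simp
qed

lemma mult_J_mult_index:
  assumes P: "P \<in> carrier_mat N N" and Q: "Q \<in> carrier_mat N N" and ij: "i < N" "j < N"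
  shows "(P * J * Q) $$ (i, j) = (\<Sum>k<N. P $$ (i, k) * (partner_sign n k * Q $$ (partner n k, j)))"
proof -
  have "(P * J * Q) $$ (i, j) = (P * (J * Q)) $$ (i, j)"
    by (simp only: assoc_mult_mat[OF P symp_J_carrier Q])
  also have "\<dots> = (\<Sum>k<N. P $$ (i, k) * (J * Q) $$ (k, j))"
    by (rule mult_index_sum[OF P mult_carrier_mat[OF symp_J_carrier Q] ij])
  also have "\<dots> = (\<Sum>k<N. P $$ (i, k) * (partner_sign n k * Q $$ (partner n k, j)))"
    by (intro sum.cong refl) (use ij symp_J_mult_index[OF Q] in auto)
  finally show ?thesis .
qed

lemma frame_zero_mult_index:
  assumes Q: "Q \<in> carrier_mat N N" and ij: "i < N" "j < N" and n: "n > 0"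
  shows "(sym_unit N 0 0 * J * Q) $$ (i, j) = (if i = 0 then 2 * Q $$ (n, j) else 0)"
proof -
  have "(sym_unit N 0 0 * J * Q) $$ (i, j) =
      (\<Sum>k<N. if k = 0 then (if i = 0 then 2 * Q $$ (n, j) else 0) else 0)"
    unfolding mult_J_mult_index[OF sym_unit_carrier Q ij]
    by (intro sum.cong refl)
       (use ij n in \<open>auto simp: sym_unit_index partner_def partner_sign_def\<close>)
  then show ?thesis using n by simp
qed

end

text \<open>The symmetrised unit with both indices 0 is twice a matrix unit, so \<open>e\<close> is conjugate to a multiple of the square of
  the first basis vector, a root vector for a long root.\<close>

locale long_root_vector = sp_conjugation +
  fixes m :: nat and c :: 'a and e :: "'a mat"
  assumes nm: "n = Suc m" and c: "c \<noteq> 0" and e: "e = c \<cdot>\<^sub>m frame 0 0"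
begin

abbreviation "Z \<equiv> centraliser (sp n) e"
abbreviation "S \<equiv> sp_semidirect m :: ('a, 'a mat \<times> 'a vec) lie_algebra"

lemma Z_simps: "x \<oplus>\<^bsub>Z\<^esub> y = x + y" "a \<odot>\<^bsub>Z\<^esub> x = a \<cdot>\<^sub>m x"
    "lie_bracket Z x y = x * y - y * x" "\<zero>\<^bsub>Z\<^esub> = 0\<^sub>m N N"
  by (simp_all add: centraliser_def sp_simps)

lemma n_less: "0 < N" "n < N" and n_neq: "n \<noteq> 0"
  using nm by auto

lemma e_sp: "e \<in> carrier (sp n)"
  unfolding e by (rule sp_smult_closed[OF frame_sp])

lemma coords_e: "coords e = c \<cdot>\<^sub>m sym_unit N 0 0"
  unfolding e coords_smult[OF frame_sp] coords_frame ..

lemma zero_sp_coords: "coords (0\<^sub>m N N) = 0\<^sub>m N N"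
proof -
  have "coords (0 \<cdot>\<^sub>m e) = 0 \<cdot>\<^sub>m coords e" by (rule coords_smult[OF e_sp])
  moreover have "0 \<cdot>\<^sub>m e = 0\<^sub>m N N" using sp_carrier_mat[OF e_sp] by (intro eq_matI) auto
  moreover have "0 \<cdot>\<^sub>m coords e = 0\<^sub>m N N" unfolding coords_e by (intro eq_matI) auto
  ultimately show ?thesis by simp
qed

text \<open>Only row 0 of \<open>E J Q\<close> is nonzero, and it is twice row \<open>n\<close> of \<open>Q\<close>, as \<open>J\<close> pairs the indices 0 and \<open>n\<close>.\<close>

lemma centraliser_iff:
  "x \<in> carrier Z \<longleftrightarrow> x \<in> carrier (sp n) \<and> (\<forall>j<N. coords x $$ (n, j) = 0)"
proof (cases "x \<in> carrier (sp n)")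
  case x: True
  let ?Q = "coords x" let ?R = "sym_unit N 0 0 * J * ?Q" let ?T = "coords e * J * ?Q"
  have Q: "?Q \<in> carrier_mat N N" by (rule sym_matsD(1)[OF coords_sym[OF x]])
  have R: "?R \<in> carrier_mat N N" by (rule mult_carrier_mat[OF mult_carrier_mat[OF sym_unit_carrier symp_J_carrier] Q])
  have T: "?T = c \<cdot>\<^sub>m ?R"
    unfolding coords_e mult_smult_assoc_mat[OF sym_unit_carrier symp_J_carrier]
    by (rule mult_smult_assoc_mat[OF mult_carrier_mat[OF sym_unit_carrier symp_J_carrier] Q])
  have br: "e * x - x * e \<in> carrier (sp n)"
    using sp_bracket_closed[OF e_sp x] by (simp add: lie_bracket_sp)
  have "x \<in> carrier Z \<longleftrightarrow> e * x - x * e = 0\<^sub>m N N"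
    using x by (simp add: centraliser_def lie_bracket_sp zero_sp)
  also have "\<dots> \<longleftrightarrow> coords (e * x - x * e) = 0\<^sub>m N N"
    using coords_eqI[OF br zero_in_sp] zero_sp_coords by auto
  also have "\<dots> \<longleftrightarrow> (\<forall>i<N. \<forall>j<N. (?T + transpose_mat ?T) $$ (i, j) = 0)"
    unfolding coords_bracket[OF e_sp x] T using R by (auto simp: mat_eq_iff simp del: index_mult_mat(1))
  also have "\<dots> \<longleftrightarrow> (\<forall>i<N. \<forall>j<N. ?R $$ (i, j) + ?R $$ (j, i) = 0)"
  proof -
    have "(?T + transpose_mat ?T) $$ (i, j) = c * (?R $$ (i, j) + ?R $$ (j, i))" if "i < N" "j < N" for i j
      unfolding T add_transpose_entry[OF smult_carrier_mat[OF R] that]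
        smult_entry[OF R that] smult_entry[OF R that(2,1)] by (simp only: distrib_left)
    then show ?thesis using c by (simp del: index_mult_mat(1) index_add_mat(1))
  qed
  also have "\<dots> \<longleftrightarrow> (\<forall>j<N. ?Q $$ (n, j) = 0)"
  proof
    assume *: "\<forall>i<N. \<forall>j<N. ?R $$ (i, j) + ?R $$ (j, i) = 0"
    show "\<forall>j<N. ?Q $$ (n, j) = 0"
    proof (intro allI impI)
      fix j assume j: "j < N"
      have "?R $$ (0, j) + ?R $$ (j, 0) = 0" using * j n_less by blast
      then show "?Q $$ (n, j) = 0"
        using frame_zero_mult_index[OF Q n_less(1) j] frame_zero_mult_index[OF Q j n_less(1)] n_neq
        by (cases "j = 0") auto
    qed
  next
    assume "\<forall>j<N. ?Q $$ (n, j) = 0"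
    then show "\<forall>i<N. \<forall>j<N. ?R $$ (i, j) + ?R $$ (j, i) = 0"
      using frame_zero_mult_index[OF Q] n_neq by (simp del: index_mult_mat(1))
  qed
  finally show ?thesis using x by simp
qed (simp add: centraliser_def)

lemma Z_sp: "x \<in> carrier Z \<Longrightarrow> x \<in> carrier (sp n)"
  by (simp add: centraliser_def)

lemma Z_row: "x \<in> carrier Z \<Longrightarrow> j < N \<Longrightarrow> coords x $$ (n, j) = 0"
  by (simp add: centraliser_iff)

lemma Z_col: "x \<in> carrier Z \<Longrightarrow> j < N \<Longrightarrow> coords x $$ (j, n) = 0"
  using Z_row[of x j] sym_mats_index[OF coords_sym[OF Z_sp] _ n_less(2)] by simp

lemma frame_Z: "i < N \<Longrightarrow> j < N \<Longrightarrow> i \<noteq> n \<Longrightarrow> j \<noteq> n \<Longrightarrow> frame i j \<in> carrier Z"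
  unfolding centraliser_iff using n_less by (auto simp: frame_sp coords_frame sym_unit_index)

lemma Z_add_closed: assumes x: "x \<in> carrier Z" and y: "y \<in> carrier Z" shows "x + y \<in> carrier Z"
  using assms n_less sym_matsD(1)[OF coords_sym[OF Z_sp[OF x]]] sym_matsD(1)[OF coords_sym[OF Z_sp[OF y]]]
  by (simp add: centraliser_iff sp_add_closed coords_add)

lemma Z_smult_closed: assumes x: "x \<in> carrier Z" shows "a \<cdot>\<^sub>m x \<in> carrier Z"
  using assms n_less sym_matsD(1)[OF coords_sym[OF Z_sp[OF x]]]
  by (simp add: centraliser_iff sp_smult_closed coords_smult)

abbreviation "\<iota> \<equiv> inner_index m"

lemma \<iota>:
  assumes "a < 2 * m"
  shows "\<iota> a < N" "\<iota> a \<noteq> 0" "\<iota> a \<noteq> n" "partner n (\<iota> a) = \<iota> (partner m a)"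
    "partner_sign n (\<iota> a) = (partner_sign m a :: 'a)"
  using inner_index[OF assms] nm by auto

definition reduced_mat :: "'a mat \<Rightarrow> 'a mat" where
  "reduced_mat x = mat (2 * m) (2 * m) (\<lambda>(a, b). coords x $$ (\<iota> a, \<iota> b))"

definition reduced_vec :: "'a mat \<Rightarrow> 'a vec" where
  "reduced_vec x = vec (2 * m) (\<lambda>a. coords x $$ (\<iota> a, 0))"

text \<open>Row \<open>n\<close> of an element of the centraliser is zero; its entry at \<open>(0, 0)\<close> is the coordinate along \<open>e\<close> and is forgotten.  The inner
  block gives the symplectic part and column 0 the vector part.\<close>

definition reduce :: "'a mat \<Rightarrow> 'a mat \<times> 'a vec" where
  "reduce x = (reduced_mat x * symp_J m, reduced_vec x)"

lemma reduced_carrier [simp]: "reduced_mat x \<in> carrier_mat (2 * m) (2 * m)"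
    "reduced_vec x \<in> carrier_vec (2 * m)"
  by (simp_all add: reduced_mat_def reduced_vec_def)

lemma reduced_mat_sym: "x \<in> carrier (sp n) \<Longrightarrow> reduced_mat x \<in> sym_mats (2 * m)"
  by (rule sym_matsI') (auto simp: reduced_mat_def \<iota> sym_mats_index[OF coords_sym])

lemma reduce_in: "x \<in> carrier (sp n) \<Longrightarrow> reduce x \<in> carrier S"
  by (simp add: reduce_def sp_semidirect_simps sp_of_sym reduced_mat_sym)

lemma reduced_add:
  assumes "x \<in> carrier (sp n)" "y \<in> carrier (sp n)"
  shows "reduced_mat (x + y) = reduced_mat x + reduced_mat y"
    "reduced_vec (x + y) = reduced_vec x + reduced_vec y"
  using sym_matsD(1)[OF coords_sym[OF assms(1)]] sym_matsD(1)[OF coords_sym[OF assms(2)]] n_less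
  by (auto intro!: eq_matI eq_vecI simp: reduced_mat_def reduced_vec_def coords_add[OF assms] \<iota>)

lemma reduced_smult:
  assumes "x \<in> carrier (sp n)"
  shows "reduced_mat (a \<cdot>\<^sub>m x) = a \<cdot>\<^sub>m reduced_mat x"
    "reduced_vec (a \<cdot>\<^sub>m x) = a \<cdot>\<^sub>v reduced_vec x"
  using sym_matsD(1)[OF coords_sym[OF assms(1)]] n_less
  by (auto intro!: eq_matI eq_vecI simp: reduced_mat_def reduced_vec_def coords_smult[OF assms] \<iota>)

text \<open>The indices 0 and \<open>n\<close> are paired by \<open>J\<close> and drop out of the sum, since column \<open>n\<close> of the first factor and row \<open>n\<close> of
  the second vanish.\<close>

lemma product_index:
  assumes x: "x \<in> carrier Z" and y: "y \<in> carrier Z" and ij: "i < N" "j < N"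
  shows "(coords x * J * coords y) $$ (i, j) =
    (\<Sum>a<2 * m. coords x $$ (i, \<iota> a) * (partner_sign m a * coords y $$ (\<iota> (partner m a), j)))"
proof -
  note c = coords_sym[OF Z_sp[OF x], THEN sym_matsD(1)] coords_sym[OF Z_sp[OF y], THEN sym_matsD(1)]
  have "partner n 0 = n" using nm by (simp add: partner_def)
  then show ?thesis
    unfolding mult_J_mult_index[OF c ij]
    using sum_inner_index[of "\<lambda>k. coords x $$ (i, k) * (partner_sign n k * coords y $$ (partner n k, j))" m]
      Z_row[OF y ij(2)] Z_col[OF x ij(1)]
    by (simp add: nm[symmetric] \<iota>)
qed

lemma reduced_product_index:
  assumes ab: "a < 2 * m" "b < 2 * m"
  shows "(reduced_mat x * symp_J m * reduced_mat y) $$ (a, b) =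
    (\<Sum>k<2 * m. coords x $$ (\<iota> a, \<iota> k) * (partner_sign m k * coords y $$ (\<iota> (partner m k), \<iota> b)))"
proof -
  have "(reduced_mat x * symp_J m * reduced_mat y) $$ (a, b) = (reduced_mat x * (symp_J m * reduced_mat y)) $$ (a, b)"
    by (simp only: assoc_mult_mat[OF reduced_carrier(1) symp_J_carrier reduced_carrier(1)])
  also have "\<dots> = (\<Sum>k<2 * m. reduced_mat x $$ (a, k) * (symp_J m * reduced_mat y) $$ (k, b))"
    by (rule mult_index_sum[OF reduced_carrier(1) mult_carrier_mat[OF symp_J_carrier reduced_carrier(1)] ab])
  also have "\<dots> = (\<Sum>k<2 * m. coords x $$ (\<iota> a, \<iota> k) * (partner_sign m k * coords y $$ (\<iota> (partner m k), \<iota> b)))"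
    by (intro sum.cong refl, subst symp_J_mult_index[OF reduced_carrier(1)]) (use ab in \<open>auto simp: reduced_mat_def\<close>)
  finally show ?thesis .
qed

lemma reduced_mult_vec_index:
  assumes a: "a < 2 * m"
  shows "(reduced_mat x * symp_J m *\<^sub>v reduced_vec y) $ a =
    (\<Sum>k<2 * m. coords x $$ (\<iota> a, \<iota> k) * (partner_sign m k * coords y $$ (\<iota> (partner m k), 0)))"
proof -
  have "(reduced_mat x * symp_J m *\<^sub>v reduced_vec y) $ a = (reduced_mat x *\<^sub>v (symp_J m *\<^sub>v reduced_vec y)) $ a"
    by (simp only: assoc_mult_mat_vec[OF reduced_carrier(1) symp_J_carrier reduced_carrier(2)])
  also have "\<dots> = (\<Sum>k<2 * m. reduced_mat x $$ (a, k) * (symp_J m *\<^sub>v reduced_vec y) $ k)"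
    using a carrier_matD[OF reduced_carrier(1)[of x]] by (simp add: scalar_prod_def atLeast0LessThan)
  also have "\<dots> = (\<Sum>k<2 * m. coords x $$ (\<iota> a, \<iota> k) * (partner_sign m k * coords y $$ (\<iota> (partner m k), 0)))"
    by (intro sum.cong refl, subst symp_J_mult_vec_index[OF reduced_carrier(2)])
       (use a in \<open>auto simp: reduced_mat_def reduced_vec_def\<close>)
  finally show ?thesis .
qed

lemma reduce_bracket:
  assumes x: "x \<in> carrier Z" and y: "y \<in> carrier Z"
  shows "reduce (x * y - y * x) = lie_bracket S (reduce x) (reduce y)"
proof -
  note xs = Z_sp[OF x] and ys = Z_sp[OF y]
  let ?R = "coords x * J * coords y" let ?r = "reduced_mat x * symp_J m * reduced_mat y"
  let ?X = "reduced_mat x * symp_J m" and ?Y = "reduced_mat y * symp_J m"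
  note c = coords_sym[OF xs, THEN sym_matsD(1)] coords_sym[OF ys, THEN sym_matsD(1)]
  have R: "?R \<in> carrier_mat N N" by (rule mult_carrier_mat[OF mult_carrier_mat[OF c(1) symp_J_carrier] c(2)])
  have Xc: "?X \<in> carrier_mat (2 * m) (2 * m)" "?Y \<in> carrier_mat (2 * m) (2 * m)"
    by (rule mult_carrier_mat[OF reduced_carrier(1) symp_J_carrier])+
  have r: "?r \<in> carrier_mat (2 * m) (2 * m)" by (rule mult_carrier_mat[OF Xc(1) reduced_carrier(1)])
  have co: "coords (x * y - y * x) $$ (i, j) = ?R $$ (i, j) + ?R $$ (j, i)" if "i < N" "j < N" for i j
    unfolding coords_bracket[OF xs ys] by (rule add_transpose_entry[OF R that])
  have "reduced_mat (x * y - y * x) = ?r + transpose_mat ?r"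
  proof (rule eq_matI)
    fix a b assume "a < dim_row (?r + transpose_mat ?r)" "b < dim_col (?r + transpose_mat ?r)"
    then have ab: "a < 2 * m" "b < 2 * m" using r by auto
    have "reduced_mat (x * y - y * x) $$ (a, b) = ?R $$ (\<iota> a, \<iota> b) + ?R $$ (\<iota> b, \<iota> a)"
      using ab by (simp add: reduced_mat_def co \<iota> del: index_mult_mat(1))
    also have "\<dots> = ?r $$ (a, b) + ?r $$ (b, a)"
      unfolding reduced_product_index[OF ab] reduced_product_index[OF ab(2,1)]
      using ab by (simp add: product_index[OF x y] \<iota> del: index_mult_mat(1))
    also have "\<dots> = (?r + transpose_mat ?r) $$ (a, b)" by (rule add_transpose_entry[OF r ab, symmetric])
    finally show "reduced_mat (x * y - y * x) $$ (a, b) = (?r + transpose_mat ?r) $$ (a, b)" .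
  qed (use r in \<open>auto simp: reduced_mat_def\<close>)
  then have 1: "reduced_mat (x * y - y * x) * symp_J m = ?X * ?Y - ?Y * ?X"
    using sp_bracket_sym[OF sp_of_sym[OF reduced_mat_sym[OF xs]] reduced_mat_sym[OF ys]]
    by (simp add: lie_bracket_sp)
  \<comment> \<open>Column 0 of the bracket has the contribution of \<open>X\<close> on the vector of \<open>y\<close> and, from the transpose, minus that of \<open>Y\<close> on the vector of \<open>x\<close>.\<close>
  have 2: "reduced_vec (x * y - y * x) = ?X *\<^sub>v reduced_vec y - ?Y *\<^sub>v reduced_vec x"
  proof (rule eq_vecI)
    fix a assume "a < dim_vec (?X *\<^sub>v reduced_vec y - ?Y *\<^sub>v reduced_vec x)"
    then have a: "a < 2 * m" using Xc by auto
    have "?R $$ (0, \<iota> a) = (\<Sum>k<2 * m. coords x $$ (0, \<iota> k) * (partner_sign m k * coords y $$ (\<iota> (partner m k), \<iota> a)))"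
      by (rule product_index[OF x y n_less(1) \<iota>(1)[OF a]])
    also have "\<dots> = (\<Sum>k<2 * m. coords x $$ (0, \<iota> (partner m k)) * (partner_sign m (partner m k) * coords y $$ (\<iota> k, \<iota> a)))"
      by (rule sum.reindex_bij_witness[of _ "partner m" "partner m"]) auto
    also have "\<dots> = - (\<Sum>k<2 * m. coords y $$ (\<iota> a, \<iota> k) * (partner_sign m k * coords x $$ (\<iota> (partner m k), 0)))"
      unfolding sum_negf[symmetric]
    proof (intro sum.cong refl)
      fix k assume "k \<in> {..<2 * m}"
      then have k: "k < 2 * m" by simp
      then have "coords y $$ (\<iota> k, \<iota> a) = coords y $$ (\<iota> a, \<iota> k)"
        using sym_mats_index[OF coords_sym[OF ys]] \<iota>(1) a by blast
      moreover have "coords x $$ (0, \<iota> (partner m k)) = coords x $$ (\<iota> (partner m k), 0)"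
        using sym_mats_index[OF coords_sym[OF xs]] \<iota>(1)[OF partner_less[OF k]] n_less(1) by blast
      ultimately show "coords x $$ (0, \<iota> (partner m k)) * (partner_sign m (partner m k) * coords y $$ (\<iota> k, \<iota> a)) =
          - (coords y $$ (\<iota> a, \<iota> k) * (partner_sign m k * coords x $$ (\<iota> (partner m k), 0)))"
        using k by (simp add: mult_ac)
    qed
    also have "\<dots> = - (?Y *\<^sub>v reduced_vec x) $ a" unfolding reduced_mult_vec_index[OF a] ..
    finally have 3: "?R $$ (0, \<iota> a) = - (?Y *\<^sub>v reduced_vec x) $ a" .
    have 4: "?R $$ (\<iota> a, 0) = (?X *\<^sub>v reduced_vec y) $ a"
      unfolding reduced_mult_vec_index[OF a] by (rule product_index[OF x y \<iota>(1)[OF a] n_less(1)])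
    have "reduced_vec (x * y - y * x) $ a = ?R $$ (\<iota> a, 0) + ?R $$ (0, \<iota> a)"
      using a by (simp add: reduced_vec_def co[OF \<iota>(1)[OF a] n_less(1)] del: index_mult_mat(1))
    then show "reduced_vec (x * y - y * x) $ a = (?X *\<^sub>v reduced_vec y - ?Y *\<^sub>v reduced_vec x) $ a"
      unfolding 3 4
      by (subst index_minus_vec(1)) (use a carrier_matD(1)[OF Xc(2)] in \<open>simp_all add: algebra_simps del: index_mult_mat_vec\<close>)
  qed (use Xc in \<open>auto simp: reduced_vec_def\<close>)
  show ?thesis by (simp add: reduce_def sp_semidirect_simps 1 2)
qed

lemma reduce_hom: "lie_hom Z S reduce"
proof -
  have "reduce (x + y) = reduce x \<oplus>\<^bsub>S\<^esub> reduce y" if "x \<in> carrier Z" "y \<in> carrier Z" for x y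
    using add_mult_distrib_mat[OF reduced_carrier(1)[of x] reduced_carrier(1)[of y] symp_J_carrier]
    by (simp add: reduce_def sp_semidirect_simps reduced_add[OF that[THEN Z_sp]])
  moreover have "reduce (a \<cdot>\<^sub>m x) = a \<odot>\<^bsub>S\<^esub> reduce x" if "x \<in> carrier Z" for a x
    using mult_smult_assoc_mat[OF reduced_carrier(1)[of x] symp_J_carrier]
    by (simp add: reduce_def sp_semidirect_simps reduced_smult[OF that[THEN Z_sp]])
  ultimately show ?thesis
    by (simp add: lie_hom_def Z_simps reduce_bracket reduce_in[OF Z_sp])
qed

lemma reduce_surj: assumes y: "y \<in> carrier S" shows "\<exists>x\<in>carrier Z. reduce x = y"
proof -
  obtain X w where y': "y = (X, w)" "X \<in> carrier (sp m)" "w \<in> carrier_vec (2 * m)"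
    using y by (auto simp: sp_semidirect_simps)
  obtain P where P: "P \<in> sym_mats (2 * m)" "X = P * symp_J m" using y'(2) by (rule sp_carrierE)
  define Q where "Q = mat N N (\<lambda>(i, j). if i = n \<or> j = n then 0
    else if i = 0 then (if j = 0 then 0 else w $ outer_index m j)
    else if j = 0 then w $ outer_index m i else P $$ (outer_index m i, outer_index m j))"
  have o: "outer_index m i < 2 * m" if "i < N" "i \<noteq> 0" "i \<noteq> n" for i
    using outer_index[of i m] that nm by simp
  have Q: "Q \<in> sym_mats N"
    by (rule sym_matsI') (auto simp: Q_def o intro: sym_mats_index[OF P(1)])
  define x where "x = conj (Q * J)"
  have cx: "coords x = Q" unfolding x_def by (rule coords_conj[OF Q])
  have xs: "x \<in> carrier (sp n)" unfolding x_def by (rule conj_sp[OF sp_of_sym[OF Q]])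
  have xZ: "x \<in> carrier Z" unfolding centraliser_iff cx using xs n_less by (simp add: Q_def)
  have "reduced_mat x = P"
    using sym_matsD(1)[OF P(1)]
    by (intro eq_matI) (auto simp: reduced_mat_def cx Q_def \<iota> inner_index(4))
  moreover have "reduced_vec x = w"
    using y'(3) n_less n_neq by (intro eq_vecI) (auto simp: reduced_vec_def cx Q_def \<iota> inner_index(4))
  ultimately show ?thesis using xZ by (intro bexI[of _ x]) (simp_all add: reduce_def y'(1) P(2))
qed

lemma reduce_frame:
  "reduce (frame 0 0) = (0\<^sub>m (2 * m) (2 * m), 0\<^sub>v (2 * m))"
  "b < 2 * m \<Longrightarrow> reduce (frame 0 (\<iota> b)) = (0\<^sub>m (2 * m) (2 * m), unit_vec (2 * m) b)"
  "a < 2 * m \<Longrightarrow> b < 2 * m \<Longrightarrow> reduce (frame (\<iota> a) (\<iota> b)) = (sym_unit (2 * m) a b * symp_J m, 0\<^sub>v (2 * m))"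
proof -
  have r: "reduced_mat (frame 0 0) = 0\<^sub>m (2 * m) (2 * m)" "reduced_vec (frame 0 0) = 0\<^sub>v (2 * m)"
    using n_less by (auto intro!: eq_matI eq_vecI simp: reduced_mat_def reduced_vec_def coords_frame sym_unit_index \<iota>)
  then show "reduce (frame 0 0) = (0\<^sub>m (2 * m) (2 * m), 0\<^sub>v (2 * m))"
    by (simp add: reduce_def zero_mult_symp_J)
  show "reduce (frame 0 (\<iota> b)) = (0\<^sub>m (2 * m) (2 * m), unit_vec (2 * m) b)" if b: "b < 2 * m"
  proof -
    have "reduced_mat (frame 0 (\<iota> b)) = 0\<^sub>m (2 * m) (2 * m)"
      using b n_less by (auto intro!: eq_matI simp: reduced_mat_def coords_frame sym_unit_index \<iota>)
    moreover have "reduced_vec (frame 0 (\<iota> b)) = unit_vec (2 * m) b"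
      using b n_less by (auto intro!: eq_vecI simp: reduced_vec_def coords_frame sym_unit_index \<iota> inner_index_inj unit_vec_def)
    ultimately show ?thesis by (simp add: reduce_def zero_mult_symp_J)
  qed
  show "reduce (frame (\<iota> a) (\<iota> b)) = (sym_unit (2 * m) a b * symp_J m, 0\<^sub>v (2 * m))" if ab: "a < 2 * m" "b < 2 * m"
  proof -
    have "reduced_mat (frame (\<iota> a) (\<iota> b)) = sym_unit (2 * m) a b"
      using ab n_less by (intro eq_matI) (auto simp: reduced_mat_def coords_frame sym_unit_index \<iota> inner_index_inj)
    moreover have "reduced_vec (frame (\<iota> a) (\<iota> b)) = 0\<^sub>v (2 * m)"
      using ab n_less by (auto intro!: eq_vecI simp: reduced_vec_def coords_frame sym_unit_index \<iota>)
    ultimately show ?thesis by (simp add: reduce_def)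
  qed
qed

lemma reduce_kernel:
  "{x \<in> carrier Z. reduce x = \<zero>\<^bsub>S\<^esub>} = range (\<lambda>a. a \<cdot>\<^sub>m e)"
proof (intro equalityI subsetI)
  fix x assume "x \<in> {x \<in> carrier Z. reduce x = \<zero>\<^bsub>S\<^esub>}"
  then have x: "x \<in> carrier Z" and "reduced_mat x * symp_J m = 0\<^sub>m (2 * m) (2 * m)" and v: "reduced_vec x = 0\<^sub>v (2 * m)"
    by (auto simp: reduce_def sp_semidirect_simps)
  then have "reduced_mat x = sp_sym m (0\<^sub>m (2 * m) (2 * m))"
    using sp_sym_mult[OF reduced_carrier(1), of x] by simp
  then have M: "reduced_mat x = 0\<^sub>m (2 * m) (2 * m)" by (simp add: sp_sym_zero)
  note xs = Z_sp[OF x]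
  define a where "a = coords x $$ (0, 0) / (2 * c)"
  have W: "coords x $$ (\<iota> k, \<iota> l) = 0" if "k < 2 * m" "l < 2 * m" for k l
    using arg_cong[OF M, of "\<lambda>M. M $$ (k, l)"] that by (simp add: reduced_mat_def)
  have V: "coords x $$ (\<iota> k, 0) = 0" if "k < 2 * m" for k
    using arg_cong[OF v, of "\<lambda>v. v $ k"] that by (simp add: reduced_vec_def)
  have idx: "i = 0 \<or> i = n \<or> (\<exists>k<2 * m. i = \<iota> k)" if "i < N" for i
    using outer_index[of i m] that nm by metis
  have "coords x $$ (i, j) = 0" if ij: "i < N" "j < N" "\<not> (i = 0 \<and> j = 0)" for i j
  proof (cases "i = n \<or> j = n")
    case True then show ?thesis using Z_row[OF x ij(2)] Z_col[OF x ij(1)] by auto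
  next
    case False
    then consider "i = 0" "\<exists>k<2 * m. j = \<iota> k" | "j = 0" "\<exists>k<2 * m. i = \<iota> k" | "\<exists>k<2 * m. i = \<iota> k" "\<exists>k<2 * m. j = \<iota> k"
      using idx[OF ij(1)] idx[OF ij(2)] ij(3) by blast
    then show ?thesis
      using V W sym_mats_index[OF coords_sym[OF xs] ij(1,2)] by cases auto
  qed
  then have "coords x = coords (a \<cdot>\<^sub>m e)"
    unfolding coords_smult[OF e_sp] coords_e using sym_matsD(1)[OF coords_sym[OF xs]] c
    by (intro eq_matI) (auto simp: sym_unit_index a_def)
  then have "x = a \<cdot>\<^sub>m e" by (rule coords_eqI[OF xs sp_smult_closed[OF e_sp]])
  then show "x \<in> range (\<lambda>a. a \<cdot>\<^sub>m e)" by blast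
next
  fix x assume "x \<in> range (\<lambda>a. a \<cdot>\<^sub>m e)"
  then obtain a where x: "x = a \<cdot>\<^sub>m e" by blast
  have f: "frame 0 0 \<in> carrier Z" using n_less n_neq by (intro frame_Z) auto
  have "reduce (d \<cdot>\<^sub>m frame 0 0) = d \<odot>\<^bsub>S\<^esub> reduce (frame 0 0)" for d
    using reduce_hom f unfolding lie_hom_def Z_simps by blast
  also have "d \<odot>\<^bsub>S\<^esub> reduce (frame 0 0) = \<zero>\<^bsub>S\<^esub>" for d
    unfolding reduce_frame by (auto simp: sp_semidirect_simps)
  finally have "reduce ((a * c) \<cdot>\<^sub>m frame 0 0) = \<zero>\<^bsub>S\<^esub>" .
  moreover have "x = (a * c) \<cdot>\<^sub>m frame 0 0" unfolding x e by auto
  ultimately show "x \<in> {x \<in> carrier Z. reduce x = \<zero>\<^bsub>S\<^esub>}" using Z_smult_closed[OF f] by simp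
qed

lemma reduce_quotient: "is_quotient_map n e reduce"
proof -
  have m: "n - 1 = m" using nm by simp
  have "reduce ` carrier Z = carrier S" using reduce_surj reduce_in[OF Z_sp] by blast
  then show ?thesis unfolding is_quotient_map_def m using reduce_hom reduce_kernel by blast
qed

end

section \<open>The highest component of the coefficients\<close>

text \<open>An element of \<open>\<S>(V)\<close> is constant along functionals that vanish on \<open>V\<close>.\<close>

lemma sym_subalg_dual_line:
  assumes F: "F \<in> sym_subalg L V" and L: "lin_lie L" and V: "V \<subseteq> carrier L"
    and \<eta>: "\<eta> \<in> lie_dual L" "\<And>x. x \<in> V \<Longrightarrow> \<eta> x = 0" and \<gamma>: "\<gamma> \<in> lie_dual L"
  shows "F (dual_line L \<gamma> \<eta> t) = F \<gamma>"
proof -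
  interpret lin_lie L by (rule L)
  show ?thesis
    using F
  proof induction
    case (gen x)
    then show ?case using V \<eta>(2) by (auto simp: sym_apply \<gamma> dual_line_in[OF \<gamma> \<eta>(1)]) (auto simp: dual_line_def)
  qed (simp_all add: sym_apply \<gamma> dual_line_in[OF \<gamma> \<eta>(1)])
qed

text \<open>Moving \<open>\<gamma>\<close> along a functional that vanishes on \<open>e\<^sup>\<bottom>\<close> and not at \<open>f\<close> varies \<open>\<gamma> f\<close> freely and fixes the coefficients,
  so the expansion in powers of \<open>f\<close> is unique.\<close>

lemma top_component_unique:
  fixes L :: "('a::field_char_0, 'v) lie_algebra"
  assumes L: "lin_lie L" and \<eta>: "\<eta> \<in> lie_dual L" "\<And>x. x \<in> killing_perp L e \<Longrightarrow> \<eta> x = 0" "\<eta> f = 1"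
    and f: "f \<in> carrier L"
    and C: "is_top_component L e f P C" and C': "is_top_component L e f P C'"
  shows "C = C'"
proof -
  interpret lin_lie L by (rule L)
  let ?V = "killing_perp L e"
  have V: "?V \<subseteq> carrier L" by (auto simp: killing_perp_def)
  obtain d c where c: "\<And>j. j \<le> d \<Longrightarrow> c j \<in> sym_subalg L ?V"
      "\<And>\<gamma>. \<gamma> \<in> dual \<Longrightarrow> P \<gamma> = (\<Sum>j\<le>d. c j \<gamma> * \<gamma> f ^ j)" "c d \<noteq> sym_const L 0" "C = c d"
    using C unfolding is_top_component_def by blast
  obtain d' c' where c': "\<And>j. j \<le> d' \<Longrightarrow> c' j \<in> sym_subalg L ?V"
      "\<And>\<gamma>. \<gamma> \<in> dual \<Longrightarrow> P \<gamma> = (\<Sum>j\<le>d'. c' j \<gamma> * \<gamma> f ^ j)" "c' d' \<noteq> sym_const L 0" "C' = c' d'"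
    using C' unfolding is_top_component_def by blast
  have coeffs: "(if j \<le> d then c j \<gamma> else 0) = (if j \<le> d' then c' j \<gamma> else 0)" if \<gamma>: "\<gamma> \<in> dual" for \<gamma> j
  proof -
    define p where "p = (\<lambda>d c. \<Sum>j\<le>d. Polynomial.monom (c j \<gamma> :: 'a) j)"
    have "poly (p d c) s = poly (p d' c') s" for s
    proof -
      let ?\<delta> = "dual_line L \<gamma> \<eta> (s - \<gamma> f)"
      have \<delta>: "?\<delta> \<in> dual" by (rule dual_line_in[OF \<gamma> \<eta>(1)])
      have \<delta>f: "?\<delta> f = s" using f \<eta>(3) by (simp add: dual_line_def)
      have "poly (p d c) s = (\<Sum>j\<le>d. c j ?\<delta> * ?\<delta> f ^ j)"
        unfolding p_def poly_sum poly_monom \<delta>f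
        by (intro sum.cong refl) (simp add: sym_subalg_dual_line[OF c(1) L V \<eta>(1,2) \<gamma>])
      also have "\<dots> = (\<Sum>j\<le>d'. c' j ?\<delta> * ?\<delta> f ^ j)"
        using c(2)[OF \<delta>] c'(2)[OF \<delta>] by simp
      also have "\<dots> = poly (p d' c') s"
        unfolding p_def poly_sum poly_monom \<delta>f
        by (intro sum.cong refl) (simp add: sym_subalg_dual_line[OF c'(1) L V \<eta>(1,2) \<gamma>])
      finally show ?thesis .
    qed
    then have "poly (p d c) = poly (p d' c')" by (rule ext)
    then have "coeff (p d c) j = coeff (p d' c') j" by (simp only: poly_eq_poly_eq_iff)
    moreover have "coeff (p d c) j = (if j \<le> d then c j \<gamma> else 0)" for d and c :: "nat \<Rightarrow> ('a, 'v) sym_elem"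
      by (simp add: p_def coeff_sum coeff_monom)
    ultimately show ?thesis by metis
  qed
  have ext: "F = G" if "F \<in> sym_subalg L ?V" "G \<in> sym_subalg L ?V" "\<And>\<gamma>. \<gamma> \<in> dual \<Longrightarrow> F \<gamma> = G \<gamma>" for F G
    using restrict_ext[of dual F G] that restrict_dual_sym_subalg by metis
  have zero: "F = sym_const L 0" if "F \<in> sym_subalg L ?V" "\<And>\<gamma>. \<gamma> \<in> dual \<Longrightarrow> F \<gamma> = 0" for F
    by (rule ext[OF that(1) sym_subalg.const]) (simp add: that(2) sym_apply)
  have "\<not> d < d'"
  proof
    assume "d < d'"
    then have "c' d' \<gamma> = 0" if "\<gamma> \<in> dual" for \<gamma> using coeffs[OF that, of d'] by simp
    then show False using zero[OF c'(1)[OF order_refl]] c'(3) by blast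
  qed
  moreover have "\<not> d' < d"
  proof
    assume "d' < d"
    then have "c d \<gamma> = 0" if "\<gamma> \<in> dual" for \<gamma> using coeffs[OF that, of d] by simp
    then show False using zero[OF c(1)[OF order_refl]] c(3) by blast
  qed
  ultimately have d: "d' = d" by simp
  have "c d \<gamma> = c' d \<gamma>" if "\<gamma> \<in> dual" for \<gamma> using coeffs[OF that, of d] d by simp
  then show ?thesis unfolding c(4) c'(4) d using ext[OF c(1) c'(1)] d by simp
qed

text \<open>Laplace expansion along row \<open>l\<close>, in which only one entry changes.\<close>

lemma det_diagonal_entry:
  fixes A A' :: "'b::comm_ring_1 mat"
  assumes A: "A \<in> carrier_mat k k" and A': "A' \<in> carrier_mat k k" and l: "l < k"
    and eq: "\<And>i j. i < k \<Longrightarrow> j < k \<Longrightarrow> \<not> (i = l \<and> j = l) \<Longrightarrow> A' $$ (i, j) = A $$ (i, j)"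
  shows "det A = det A' + (A $$ (l, l) - A' $$ (l, l)) * det (mat_delete A l l)"
proof -
  have del: "mat_delete A' l j = mat_delete A l j" if "j < k" for j
    using A A' by (intro eq_matI) (auto simp: mat_delete_def eq)
  have "A $$ (l, j) * cofactor A l j = A' $$ (l, j) * cofactor A' l j +
      (if j = l then (A $$ (l, l) - A' $$ (l, l)) * det (mat_delete A l l) else 0)" if "j < k" for j
    using that eq[OF l that] l by (simp add: cofactor_def del algebra_simps power_add[symmetric])
  then have "det A = (\<Sum>j<k. A' $$ (l, j) * cofactor A' l j +
      (if j = l then (A $$ (l, l) - A' $$ (l, l)) * det (mat_delete A l l) else 0))"
    unfolding laplace_expansion_row[OF A l] by (intro sum.cong) auto
  also have "\<dots> = det A' + (A $$ (l, l) - A' $$ (l, l)) * det (mat_delete A l l)"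
    unfolding laplace_expansion_row[OF A' l] sum.distrib using l by simp
  finally show ?thesis .
qed

lemma sp_form_dual:
  fixes X :: "'a::field mat"
  assumes X: "X \<in> carrier_mat (2 * m) (2 * m)"
  shows "restrict (sp_form m X) (carrier (sp m)) \<in> lie_dual (sp m)"
proof -
  have JX: "symp_J m * X \<in> carrier_mat (2 * m) (2 * m)" by (rule mult_carrier_mat[OF symp_J_carrier X])
  have "sp_form m X (x + y) = sp_form m X x + sp_form m X y" if "x \<in> carrier (sp m)" "y \<in> carrier (sp m)" for x y
    unfolding sp_form_def sp_sym_add[OF that[THEN sp_carrier_mat]] mat_pair_sym[of _ "symp_J m * X"]
    by (rule mat_pair_add[OF that[THEN sp_carrier_mat, THEN sp_sym_carrier] JX])
  moreover have "sp_form m X (a \<cdot>\<^sub>m x) = a * sp_form m X x" if "x \<in> carrier (sp m)" for a x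
    unfolding sp_form_def sp_sym_smult[OF that[THEN sp_carrier_mat]] mat_pair_sym[of _ "symp_J m * X"]
    by (rule mat_pair_smult[OF that[THEN sp_carrier_mat, THEN sp_sym_carrier] JX])
  ultimately show ?thesis
    by (simp add: lie_dual_def add_sp smult_sp sp_add_closed sp_smult_closed)
qed

context long_root_vector
begin

lemma compose_dual:
  assumes "\<And>x. x \<in> carrier Z \<Longrightarrow> \<phi> x \<in> carrier M"
    and "\<And>x y. x \<in> carrier Z \<Longrightarrow> y \<in> carrier Z \<Longrightarrow> \<phi> (x + y) = \<phi> x \<oplus>\<^bsub>M\<^esub> \<phi> y"
    and "\<And>a x. x \<in> carrier Z \<Longrightarrow> \<phi> (a \<cdot>\<^sub>m x) = a \<odot>\<^bsub>M\<^esub> \<phi> x"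
    and \<gamma>: "\<gamma> \<in> lie_dual M"
  shows "compose (carrier Z) \<gamma> \<phi> \<in> lie_dual Z"
  unfolding lie_dual_def compose_def
  using assms(1) lie_dual_add[OF \<gamma>] lie_dual_smult[OF \<gamma>]
  by (simp add: Z_simps Z_add_closed Z_smult_closed assms(2,3))

lemma restrict_dual: "\<gamma> \<in> lie_dual (sp n) \<Longrightarrow> compose (carrier Z) \<gamma> id \<in> lie_dual Z"
  by (rule compose_dual[where M = "sp n"]) (simp_all add: Z_sp add_sp smult_sp)

lemma reduce_dual: "\<delta> \<in> lie_dual S \<Longrightarrow> compose (carrier Z) \<delta> reduce \<in> lie_dual Z"
  by (rule compose_dual[where M = S]) (use reduce_hom in \<open>auto simp: lie_hom_def Z_simps\<close>)

text \<open>Deleting row and column \<open>n\<close> is a linear projection onto the centraliser; composing with it extends functionals.\<close>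

definition proj_coords :: "'a mat \<Rightarrow> 'a mat" where
  "proj_coords x = mat N N (\<lambda>(i, j). if i = n \<or> j = n then 0 else coords x $$ (i, j))"

lemma proj_coords_sym: "x \<in> carrier (sp n) \<Longrightarrow> proj_coords x \<in> sym_mats N"
  by (rule sym_matsI') (auto simp: proj_coords_def intro: sym_mats_index[OF coords_sym])

lemma extend_dual:
  assumes \<gamma>: "\<gamma> \<in> lie_dual Z"
  obtains \<gamma>' where "\<gamma>' \<in> lie_dual (sp n)" "compose (carrier Z) \<gamma>' id = \<gamma>"
proof -
  define p where "p = (\<lambda>x. conj (proj_coords x * J))"
  have ps: "p x \<in> carrier (sp n)" and cp: "coords (p x) = proj_coords x" if "x \<in> carrier (sp n)" for x
    unfolding p_def by (rule conj_sp[OF sp_of_sym[OF proj_coords_sym[OF that]]])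
      (rule coords_conj[OF proj_coords_sym[OF that]])
  have pZ: "p x \<in> carrier Z" if "x \<in> carrier (sp n)" for x
    unfolding centraliser_iff cp[OF that] using ps[OF that] n_less by (simp add: proj_coords_def)
  have pid: "p x = x" if x: "x \<in> carrier Z" for x
  proof (rule coords_eqI[OF ps[OF Z_sp[OF x]] Z_sp[OF x]])
    show "coords (p x) = coords x"
      unfolding cp[OF Z_sp[OF x]] using sym_matsD(1)[OF coords_sym[OF Z_sp[OF x]]] Z_row[OF x] Z_col[OF x]
      by (intro eq_matI) (auto simp: proj_coords_def)
  qed
  have padd: "p (x + y) = p x + p y" if "x \<in> carrier (sp n)" "y \<in> carrier (sp n)" for x y
  proof (rule coords_eqI[OF ps[OF sp_add_closed[OF that]] sp_add_closed[OF ps[OF that(1)] ps[OF that(2)]]])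
    show "coords (p (x + y)) = coords (p x + p y)"
      unfolding coords_add[OF ps[OF that(1)] ps[OF that(2)]] cp[OF sp_add_closed[OF that]] cp[OF that(1)] cp[OF that(2)]
      using sym_matsD(1)[OF coords_sym[OF that(1)]] sym_matsD(1)[OF coords_sym[OF that(2)]]
      by (intro eq_matI) (auto simp: proj_coords_def coords_add[OF that])
  qed
  have psmult: "p (a \<cdot>\<^sub>m x) = a \<cdot>\<^sub>m p x" if "x \<in> carrier (sp n)" for a x
  proof (rule coords_eqI[OF ps[OF sp_smult_closed[OF that]] sp_smult_closed[OF ps[OF that]]])
    show "coords (p (a \<cdot>\<^sub>m x)) = coords (a \<cdot>\<^sub>m p x)"
      unfolding coords_smult[OF ps[OF that]] cp[OF sp_smult_closed[OF that]] cp[OF that]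
      using sym_matsD(1)[OF coords_sym[OF that]]
      by (intro eq_matI) (auto simp: proj_coords_def coords_smult[OF that])
  qed
  show ?thesis
  proof
    show "(\<lambda>x\<in>carrier (sp n). \<gamma> (p x)) \<in> lie_dual (sp n)"
      using lie_dual_add[OF \<gamma> pZ pZ] lie_dual_smult[OF \<gamma> pZ] unfolding lie_dual_def
      by (simp add: Z_simps add_sp smult_sp sp_add_closed sp_smult_closed padd psmult)
    have "\<gamma> \<in> extensional (carrier Z)" using \<gamma> by (simp add: lie_dual_def)
    then show "compose (carrier Z) (\<lambda>x\<in>carrier (sp n). \<gamma> (p x)) id = \<gamma>"
      by (intro extensionalityI[of _ "carrier Z"]) (auto simp: compose_def Z_sp pid)
  qed
qed

text \<open>The form with \<open>e\<close> reads off the entry at \<open>(n, n)\<close>.  So all other members of the frame are orthogonal to \<open>e\<close>.\<close>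

lemma sp_form_e_frame:
  assumes ij: "i < N" "j < N"
  shows "sp_form n e (frame i j) = (if i = n \<and> j = n then - 4 * c else 0)"
proof -
  let ?E = "sym_unit N 0 0 :: 'a mat"
  have EJ: "?E * J \<in> carrier_mat N N" by (rule mult_carrier_mat[OF sym_unit_carrier symp_J_carrier])
  have JEJ: "J * (?E * J) \<in> carrier_mat N N" by (rule mult_carrier_mat[OF symp_J_carrier EJ])
  have p0: "partner n k = 0 \<longleftrightarrow> k = n" if "k < N" for k using that n_neq by (auto simp: partner_def)
  have idx: "(J * (?E * J)) $$ (k, l) = (if k = n \<and> l = n then - 2 else 0)" if kl: "k < N" "l < N" for k l
    unfolding symp_J_mult_index[OF EJ kl] mult_symp_J_index[OF sym_unit_carrier partner_less[OF kl(1)] kl(2)]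
    using kl p0 by (auto simp: sym_unit_index partner_sign_def)
  have "sp_form n e (frame i j) = sp_form n (c \<cdot>\<^sub>m (?E * J)) (sym_unit N i j * J)"
    unfolding e frame_def conj_smult[OF EJ, symmetric]
    by (rule sp_form_conj[OF sp_smult_closed[OF sp_of_sym] sp_of_sym]) auto
  also have "\<dots> = mat_pair N (c \<cdot>\<^sub>m (J * (?E * J))) (sym_unit N i j)"
    unfolding sp_form_def mult_smult_distrib[OF symp_J_carrier EJ] sp_sym_mult[OF sym_unit_carrier] ..
  also have "\<dots> = c * (J * (?E * J)) $$ (i, j) + c * (J * (?E * J)) $$ (j, i)"
    unfolding mat_pair_smult[OF JEJ sym_unit_carrier] mat_pair_sym[of N "J * (?E * J)"] mat_pair_sym_unit[OF JEJ ij]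
    by (rule distrib_left)
  also have "\<dots> = (if i = n \<and> j = n then - 4 * c else 0)" unfolding idx[OF ij] idx[OF ij(2,1)] by auto
  finally show ?thesis .
qed

lemma killing_perp_iff: "x \<in> killing_perp (sp n) e \<longleftrightarrow> x \<in> carrier (sp n) \<and> sp_form n e x = 0"
proof -
  have "(of_nat (2 * n + 2) :: 'a) \<noteq> 0" by (simp only: of_nat_eq_0_iff)
  then show ?thesis using killing_form_sp[OF e_sp] by (auto simp: killing_perp_def)
qed

lemma frame_perp: "i < N \<Longrightarrow> j < N \<Longrightarrow> \<not> (i = n \<and> j = n) \<Longrightarrow> frame i j \<in> killing_perp (sp n) e"
  unfolding killing_perp_iff by (auto simp: frame_sp sp_form_e_frame)

end

locale slice = long_root_vector +
  fixes b :: 'a and f :: "'a mat" and B :: "'a mat \<Rightarrow> 'a mat \<Rightarrow> 'a"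
  assumes b: "b \<noteq> 0" and m: "m > 0" and f: "f \<in> carrier (sp n)" and ef: "sp_form n e f = 1"
    and B: "\<And>X Y. X \<in> carrier (sp n) \<Longrightarrow> Y \<in> carrier (sp n) \<Longrightarrow> B X Y = b * sp_form n X Y"
begin

text \<open>The pencil \<open>S + z J\<close> without row and column \<open>n\<close>, expressed through the values of the functional on elements of the
  centraliser, so that it makes sense for functionals on the centraliser as well.\<close>

definition minor_mat :: "('a mat \<Rightarrow> 'a) \<Rightarrow> 'a poly mat" where
  "minor_mat \<gamma> = mat (N - 1) (N - 1) (\<lambda>(i, j).
     [:\<gamma> (frame (insert_index n i) (insert_index n j)) / (2 * b), J $$ (insert_index n i, insert_index n j):])"

text \<open>The constant arises from \<open>det (- J)\<close>, from the factor \<open>2 b\<close> of the coordinates, and from the coefficient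
  \<open>- 4 c\<close> of \<open>f\<close> in \<open>frame n n\<close> modulo \<open>e\<^sup>\<bottom>\<close>.\<close>

definition \<kappa> :: 'a where "\<kappa> = - (2 * c * det (- J) / b)"

lemma kappa_nonzero: "\<kappa> \<noteq> 0"
proof -
  have "- J = (- 1) \<cdot>\<^sub>m J" by (rule eq_matI) auto
  then have "det (- J) \<noteq> 0" using det_symp_J_nonzero[of n, where 'a = 'a] by (simp add: det_smult)
  then show ?thesis using c b by (simp add: \<kappa>_def)
qed

definition top_coeff :: "nat \<Rightarrow> ('a, 'a mat) sym_elem" where
  "top_coeff k = (\<lambda>\<gamma>\<in>lie_dual Z. \<kappa> * coeff (det (minor_mat \<gamma>)) (N - k))"

lemma insert_index_bound: "i < N - 1 \<Longrightarrow> insert_index n i < N" "insert_index n i \<noteq> n"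
  using n_less by (auto simp: insert_index_def)

lemma minor_mat_restrict: "minor_mat (compose (carrier Z) \<gamma> \<phi>) = minor_mat (\<gamma> \<circ> \<phi>)"
  by (rule eq_matI) (auto simp: minor_mat_def compose_def frame_Z insert_index_bound)

lemma top_coeff_in: "top_coeff k \<in> sym_alg Z"
proof -
  have "polyfun Z (carrier Z) (\<lambda>\<gamma>. \<kappa> * coeff (det (minor_mat \<gamma>)) (N - k))"
    unfolding minor_mat_def
    by (intro polyfun_mult polyfun_const polyfun_pencil_coeffs polyfun_scaled frame_Z insert_index_bound)
  then show ?thesis by (simp add: top_coeff_def polyfun_def sym_alg_def)
qed

lemma map_top_coeff:
  "sym_map Z (sp n) id (top_coeff k) = (\<lambda>\<gamma>\<in>lie_dual (sp n). \<kappa> * coeff (det (minor_mat \<gamma>)) (N - k))"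
  by (rule ext) (simp add: sym_map_def top_coeff_def restrict_dual minor_mat_restrict)

text \<open>A functional that factors through \<open>reduce\<close> vanishes on \<open>e\<close>, which makes the corner entry of the minor zero.\<close>

lemma minor_mat_reduce:
  "det (minor_mat (compose (carrier Z) \<delta> reduce)) = bordered_poly m (mat_coord b m \<delta>) (vec_coord b m \<delta>)"
  if \<delta>: "\<delta> \<in> lie_dual S"
proof -
  have N1: "N - 1 = Suc (2 * m)" using nm by simp
  have ins: "insert_index n 0 = 0" "insert_index n (Suc a) = \<iota> a" for a
    using nm by (auto simp: insert_index_def inner_index_def)
  have z: "\<delta> (0\<^sub>m (2 * m) (2 * m), 0\<^sub>v (2 * m)) = 0"
  proof -
    have "0 \<odot>\<^bsub>S\<^esub> (0\<^sub>m (2 * m) (2 * m), 0\<^sub>v (2 * m)) = (0\<^sub>m (2 * m) (2 * m), 0\<^sub>v (2 * m))"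
      by (auto simp: sp_semidirect_simps)
    then show ?thesis using lie_dual_smult[OF \<delta>, of "(0\<^sub>m (2 * m) (2 * m), 0\<^sub>v (2 * m))" 0]
      by (simp add: sp_semidirect_simps zero_in_sp)
  qed
  have J00: "J $$ (0, 0) = 0" using n_less n_neq by (simp add: symp_J_index partner_def)
  have J0: "J $$ (0, \<iota> a) = 0" "J $$ (\<iota> a, 0) = 0" if "a < 2 * m" for a
  proof -
    have "partner n 0 = n" using n_neq by (simp add: partner_def)
    then show "J $$ (0, \<iota> a) = 0" "J $$ (\<iota> a, 0) = 0"
      using \<iota>[OF that] \<iota>(2)[OF partner_less[OF that]] n_less n_neq by (auto simp: symp_J_index)
  qed
  have J1: "J $$ (\<iota> a, \<iota> d) = symp_J m $$ (a, d)" if "a < 2 * m" "d < 2 * m" for a d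
    using \<iota>[OF that(1)] \<iota>(1)[OF that(2)] inner_index_inj[OF that(2) partner_less[OF that(1)]] that
    by (simp add: symp_J_index)
  have "minor_mat (\<delta> \<circ> reduce) = bordered (2 * m)
     (mat (2 * m) (2 * m) (\<lambda>ij. [:mat_coord b m \<delta> $$ ij, symp_J m $$ ij:])) (vec (2 * m) (\<lambda>i. [:vec_coord b m \<delta> $ i:]))"
  proof (rule eq_matI)
    fix i j assume "i < dim_row (bordered (2 * m)
     (mat (2 * m) (2 * m) (\<lambda>ij. [:mat_coord b m \<delta> $$ ij, symp_J m $$ ij:])) (vec (2 * m) (\<lambda>i. [:vec_coord b m \<delta> $ i:])))"
      "j < dim_col (bordered (2 * m)
     (mat (2 * m) (2 * m) (\<lambda>ij. [:mat_coord b m \<delta> $$ ij, symp_J m $$ ij:])) (vec (2 * m) (\<lambda>i. [:vec_coord b m \<delta> $ i:])))"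
    then have ij: "i < Suc (2 * m)" "j < Suc (2 * m)" by (auto simp: bordered_def)
    have col: "reduce (frame (\<iota> a) 0) = (0\<^sub>m (2 * m) (2 * m), unit_vec (2 * m) a)" if "a < 2 * m" for a
      using reduce_frame(2)[OF that] frame_commute[of 0 "\<iota> a"] by simp
    show "minor_mat (\<delta> \<circ> reduce) $$ (i, j) = bordered (2 * m)
     (mat (2 * m) (2 * m) (\<lambda>ij. [:mat_coord b m \<delta> $$ ij, symp_J m $$ ij:])) (vec (2 * m) (\<lambda>i. [:vec_coord b m \<delta> $ i:])) $$ (i, j)"
      using ij m unfolding minor_mat_def N1
      by (cases i; cases j) (simp_all add: bordered_index ins reduce_frame col J00 J0 J1 z mat_coord_def vec_coord_def)
  qed (simp_all only: minor_mat_def N1 bordered_def dim_row_mat dim_col_mat)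
  then show ?thesis by (simp add: minor_mat_restrict bordered_poly_def)
qed

lemma map_reduce_top_coeff:
  assumes i: "1 \<le> i" "i \<le> m"
  shows "sym_map Z S reduce (top_coeff (2 * i + 2)) =
    sym_mult S (sym_const S \<kappa>) (bordered_coeff b m (2 * m - 2 * i))"
proof -
  have "N - (2 * i + 2) = 2 * m - 2 * i" using nm by simp
  then show ?thesis
    by (intro ext) (simp add: sym_map_def top_coeff_def reduce_dual minor_mat_reduce sym_mult_def sym_const_def bordered_coeff_def)
qed

text \<open>It suffices to find one functional where the coefficient does not vanish: one that comes from a point of
  the section with all parameters equal to 1.\<close>

lemma top_coeff_nonzero:
  assumes i: "1 \<le> i" "i \<le> m"
  shows "sym_map Z (sp n) id (top_coeff (2 * i + 2)) \<noteq> sym_const (sp n) 0"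
proof
  assume 0: "sym_map Z (sp n) id (top_coeff (2 * i + 2)) = sym_const (sp n) 0"
  define \<delta> where "\<delta> = of_coords b m (section_mat m (\<lambda>_. 1)) (unit_vec (2 * m) m)"
  have \<delta>: "\<delta> \<in> lie_dual S" unfolding \<delta>_def by (rule of_coords_in)
  obtain \<gamma> where \<gamma>: "\<gamma> \<in> lie_dual (sp n)" "compose (carrier Z) \<gamma> id = compose (carrier Z) \<delta> reduce"
    using extend_dual[OF reduce_dual[OF \<delta>]] by blast
  have "sym_map Z S reduce (top_coeff (2 * i + 2)) \<delta> = sym_map Z (sp n) id (top_coeff (2 * i + 2)) \<gamma>"
    using \<gamma> \<delta> by (simp add: sym_map_def)
  then have "\<kappa> * bordered_coeff b m (2 * m - 2 * i) \<delta> = 0"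
    unfolding 0 map_reduce_top_coeff[OF i] using \<gamma>(1) \<delta> by (simp add: sym_mult_def sym_const_def)
  then have "coeff (bordered_poly m (section_mat m (\<lambda>_. 1 :: 'a)) (unit_vec (2 * m) m)) (2 * m - 2 * i) = 0"
    using kappa_nonzero \<delta> unfolding \<delta>_def
    by (simp add: bordered_coeff_def mat_coord_of_coords[OF b section_mat_sym] vec_coord_of_coords[OF b])
  moreover have "coeff (bordered_poly m (section_mat m (\<lambda>_. 1 :: 'a)) (unit_vec (2 * m) m)) (2 * m - 2 * i) =
      (\<Sum>l<m. if l = i - 1 then (- 1) ^ (l + 1) * det (symp_J m) else 0)"
    unfolding bordered_poly_section[OF m] coeff_sum coeff_monom
    by (intro sum.cong refl) (use i in auto)
  moreover have "i - 1 < m" using i by simp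
  ultimately show False using det_symp_J_nonzero[of m, where 'a = 'a] by simp
qed

text \<open>The element \<open>frame n n + 4 c f\<close> is orthogonal to \<open>e\<close>, so this is an expansion of degree one in \<open>f\<close> with coefficients
  in \<open>\<S>(e\<^sup>\<bottom>)\<close>.\<close>

lemma sp_Delta_expand:
  assumes \<gamma>: "\<gamma> \<in> lie_dual (sp n)" and k: "k \<le> N"
  shows "sp_Delta n B k \<gamma> = det (- J) * coeff (det (mat N N (\<lambda>(i, j).
      [:if i = n \<and> j = n then 0 else \<gamma> (frame i j) / (2 * b), J $$ (i, j):]))) (N - k) +
    det (- J) * (\<gamma> (frame n n + (4 * c) \<cdot>\<^sub>m f) / (2 * b)) * coeff (det (minor_mat \<gamma>)) (N - k) +
    \<kappa> * coeff (det (minor_mat \<gamma>)) (N - k) * \<gamma> f"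
proof -
  let ?S = "frame_coord b \<gamma>"
  let ?A = "mat N N (\<lambda>(i, j). [:if i = n \<and> j = n then 0 else \<gamma> (frame i j) / (2 * b), J $$ (i, j):])"
  have S: "?S \<in> sym_mats N" by (rule frame_coord_sym)
  have P: "pencil ?S \<in> carrier_mat N N" by (simp add: pencil_def)
  have md: "mat_delete (pencil ?S) n n = minor_mat \<gamma>"
    by (rule eq_matI)
       (auto simp: mat_delete_def pencil_def minor_mat_def frame_coord_def insert_index_def)
  have "?A $$ (i, j) = pencil ?S $$ (i, j)" if "i < N" "j < N" "\<not> (i = n \<and> j = n)" for i j
    using that by (auto simp: pencil_def frame_coord_def)
  then have "det (pencil ?S) = det ?A + (pencil ?S $$ (n, n) - ?A $$ (n, n)) * det (minor_mat \<gamma>)"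
    unfolding md[symmetric] by (intro det_diagonal_entry[OF P mat_carrier n_less(2)])
  also have "pencil ?S $$ (n, n) - ?A $$ (n, n) = [:\<gamma> (frame n n) / (2 * b):]"
    using n_less by (simp add: pencil_def frame_coord_def)
  finally have "coeff (det (pencil ?S)) (N - k) =
      coeff (det ?A) (N - k) + \<gamma> (frame n n) / (2 * b) * coeff (det (minor_mat \<gamma>)) (N - k)" by simp
  moreover have "\<gamma> (frame n n + (4 * c) \<cdot>\<^sub>m f) = \<gamma> (frame n n) + 4 * c * \<gamma> f"
    using lie_dual_add[OF \<gamma> frame_sp sp_smult_closed[OF f]] lie_dual_smult[OF \<gamma> f] by (simp add: add_sp smult_sp)
  moreover have "sp_Delta n B k \<gamma> = det (- J) * coeff (det (pencil ?S)) (N - k)"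
    using \<gamma> by (simp add: sp_Delta_def form_inverse_eq[OF b B \<gamma>] principal_minors_sum_of_frame[OF S k])
  ultimately show ?thesis using b by (simp add: \<kappa>_def field_simps)
qed

lemma top_component:
  assumes i: "1 \<le> i" "i \<le> m"
  shows "is_top_component (sp n) e f (sp_Delta n B (2 * i + 2)) (sym_map Z (sp n) id (top_coeff (2 * i + 2)))"
proof -
  let ?k = "2 * i + 2" and ?L = "sp n :: ('a, 'a mat) lie_algebra" and ?V = "killing_perp (sp n) e"
  let ?u = "frame n n + (4 * c) \<cdot>\<^sub>m f"
  let ?c0 = "\<lambda>\<gamma>. det (- J) * coeff (det (mat N N (\<lambda>(i, j).
      [:if i = n \<and> j = n then 0 else \<gamma> (frame i j) / (2 * b), J $$ (i, j):]))) (N - ?k) +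
    det (- J) * (\<gamma> ?u / (2 * b)) * coeff (det (minor_mat \<gamma>)) (N - ?k)"
  let ?c1 = "sym_map Z (sp n) id (top_coeff ?k)"
  define C where "C = (\<lambda>j::nat. if j = 0 then restrict ?c0 (lie_dual ?L) else ?c1)"
  have k: "?k \<le> N" using i nm by simp
  have u: "?u \<in> ?V"
  proof -
    note e_dual = sp_form_dual[OF sp_carrier_mat[OF e_sp]]
    have "sp_form n e ?u = sp_form n e (frame n n) + 4 * c * sp_form n e f"
      using lie_dual_add[OF e_dual frame_sp sp_smult_closed[OF f], of n n "4 * c"] lie_dual_smult[OF e_dual f, of "4 * c"]
      by (simp add: add_sp smult_sp frame_sp f sp_smult_closed sp_add_closed)
    then show ?thesis
      using n_less by (simp add: killing_perp_iff sp_form_e_frame ef sp_add_closed frame_sp sp_smult_closed f)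
  qed
  have minor: "polyfun ?L ?V (\<lambda>\<gamma>. coeff (det (minor_mat \<gamma>)) (N - ?k))"
    unfolding minor_mat_def
    by (intro polyfun_pencil_coeffs polyfun_scaled frame_perp insert_index_bound) (simp_all add: insert_index_bound)
  have "polyfun ?L ?V (\<lambda>\<gamma>. if i = n \<and> j = n then 0 else \<gamma> (frame i j) / (2 * b))" if "i < N" "j < N" for i j
  proof (cases "i = n \<and> j = n")
    case False
    then have "polyfun ?L ?V (\<lambda>\<gamma>. \<gamma> (frame i j) / (2 * b))" by (intro polyfun_scaled frame_perp that)
    then show ?thesis unfolding if_not_P[OF False] .
  qed (simp add: polyfun_const)
  then have "polyfun ?L ?V ?c0"
    by (intro polyfun_add polyfun_mult polyfun_const polyfun_pencil_coeffs polyfun_scaled u minor)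
  moreover have "?c1 \<in> sym_subalg ?L ?V"
    unfolding map_top_coeff using polyfun_mult[OF polyfun_const minor] by (simp add: polyfun_def)
  ultimately have 1: "\<forall>j\<le>1. C j \<in> sym_subalg ?L ?V" by (simp add: C_def polyfun_def)
  have 2: "\<forall>\<gamma>\<in>lie_dual ?L. sp_Delta n B ?k \<gamma> = (\<Sum>j\<le>1. C j \<gamma> * \<gamma> f ^ j)"
  proof
    fix \<gamma> assume \<gamma>: "\<gamma> \<in> lie_dual ?L"
    show "sp_Delta n B ?k \<gamma> = (\<Sum>j\<le>1. C j \<gamma> * \<gamma> f ^ j)"
      unfolding sp_Delta_expand[OF \<gamma> k] using \<gamma> by (simp add: C_def map_top_coeff)
  qed
  have C1: "C 1 = ?c1" by (simp add: C_def)
  have 3: "C 1 \<noteq> sym_const ?L 0" unfolding C1 by (rule top_coeff_nonzero[OF i])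
  show ?thesis
    unfolding is_top_component_def
    by (rule exI[of _ 1], rule exI[of _ C], intro conjI) (fact 1, fact 2, fact 3, rule C1[symmetric])
qed

text \<open>Uniqueness has two parts: the top component is unique as a function on the dual space of the symplectic
  Lie algebra, and every functional on the centraliser extends to it.\<close>

theorem e_Delta_eq:
  assumes i: "1 \<le> i" "i \<le> m"
  shows "e_Delta n B e f (2 * i + 2) = top_coeff (2 * i + 2)"
  unfolding e_Delta_def
proof (rule the_equality)
  show "top_coeff (2 * i + 2) \<in> sym_alg Z \<and>
      is_top_component (sp n) e f (sp_Delta n B (2 * i + 2)) (sym_map Z (sp n) id (top_coeff (2 * i + 2)))"
    using top_coeff_in top_component[OF i] by blast
  fix F assume F: "F \<in> sym_alg Z \<and>
      is_top_component (sp n) e f (sp_Delta n B (2 * i + 2)) (sym_map Z (sp n) id F)"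
  define \<eta> where "\<eta> = restrict (sp_form n e) (carrier (sp n))"
  have "sym_map Z (sp n) id F = sym_map Z (sp n) id (top_coeff (2 * i + 2))"
  proof (rule top_component_unique[OF lin_lie_sp, where \<eta> = \<eta>])
    show "\<eta> \<in> lie_dual (sp n)" unfolding \<eta>_def by (rule sp_form_dual[OF sp_carrier_mat[OF e_sp]])
    show "\<eta> x = 0" if "x \<in> killing_perp (sp n) e" for x
      using that by (simp add: \<eta>_def killing_perp_iff)
    show "\<eta> f = 1" using f ef by (simp add: \<eta>_def)
  qed (use f F top_component[OF i] in auto)
  then have "F \<gamma> = top_coeff (2 * i + 2) \<gamma>" if \<gamma>: "\<gamma> \<in> lie_dual Z" for \<gamma>
  proof -
    obtain \<gamma>' where "\<gamma>' \<in> lie_dual (sp n)" "compose (carrier Z) \<gamma>' id = \<gamma>" by (rule extend_dual[OF \<gamma>])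
    then show ?thesis
      using fun_cong[OF \<open>sym_map Z (sp n) id F = _\<close>, of \<gamma>'] by (simp add: sym_map_def)
  qed
  then have "restrict F (lie_dual Z) = restrict (top_coeff (2 * i + 2)) (lie_dual Z)" by (rule restrict_ext)
  moreover have "restrict F (lie_dual Z) = F" "restrict (top_coeff (2 * i + 2)) (lie_dual Z) = top_coeff (2 * i + 2)"
    using F top_coeff_in by (auto simp only: sym_alg_def intro!: restrict_dual_sym_subalg)
  ultimately show "F = top_coeff (2 * i + 2)" by simp
qed

end

section \<open>Independence of the identification\<close>

context lin_lie
begin

lemma compose_dual_hom:
  assumes \<phi>: "lie_hom L L \<phi>" and \<gamma>: "\<gamma> \<in> dual"
  shows "compose (carrier L) \<gamma> \<phi> \<in> dual"
  using \<phi> lie_dual_add[OF \<gamma>] lie_dual_smult[OF \<gamma>]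
  unfolding lie_dual_def compose_def lie_hom_def by (auto simp: add_closed smult_closed Pi_iff)

lemma sym_map_in:
  assumes \<phi>: "lie_hom L L \<phi>" and F: "F \<in> sym_alg L"
  shows "sym_map L L \<phi> F \<in> sym_alg L"
proof -
  have *: "sym_map L L \<phi> F \<in> sym_subalg L (carrier L)" if "F \<in> sym_subalg L (carrier L)" for F
    using that
  proof induction
    case (const c)
    have "sym_map L L \<phi> (sym_const L c) = sym_const L c"
      unfolding sym_map_def sym_const_def by (rule restrict_ext) (simp add: compose_dual_hom[OF \<phi>])
    then show ?case using sym_subalg.const by metis
  next
    case (gen x)
    have "sym_map L L \<phi> (sym_gen L x) = sym_gen L (\<phi> x)"
      unfolding sym_map_def sym_gen_def
      by (rule restrict_ext) (simp add: compose_dual_hom[OF \<phi>] compose_eq[OF gen])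
    moreover have "\<phi> x \<in> carrier L" using \<phi> gen by (auto simp: lie_hom_def)
    ultimately show ?case using sym_subalg.gen by metis
  next
    case (add F G)
    have "sym_map L L \<phi> (sym_add L F G) = sym_add L (sym_map L L \<phi> F) (sym_map L L \<phi> G)"
      unfolding sym_map_def sym_add_def by (rule restrict_ext) (simp add: compose_dual_hom[OF \<phi>])
    then show ?case using sym_subalg.add[OF add.IH] by metis
  next
    case (mult F G)
    have "sym_map L L \<phi> (sym_mult L F G) = sym_mult L (sym_map L L \<phi> F) (sym_map L L \<phi> G)"
      unfolding sym_map_def sym_mult_def by (rule restrict_ext) (simp add: compose_dual_hom[OF \<phi>])
    then show ?case using sym_subalg.mult[OF mult.IH] by metis
  qed
  then show ?thesis using F by (simp add: sym_alg_def)
qed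

text \<open>An automorphism intertwines the coadjoint fields: the field of \<open>\<phi> x'\<close> at \<open>\<gamma>\<close> is carried to that of \<open>x'\<close> at
  \<open>\<gamma> \<circ> \<phi>\<close>.\<close>

lemma sym_map_invariant:
  assumes \<phi>: "lie_hom L L \<phi>" "\<phi> ` carrier L = carrier L" and F: "F \<in> sym_invariants L"
  shows "sym_map L L \<phi> F \<in> sym_invariants L"
  unfolding sym_invariants_iff
proof (intro conjI ballI)
  have F': "F \<in> sym_alg L" using F by (simp add: sym_invariants_iff)
  show "sym_map L L \<phi> F \<in> sym_alg L" by (rule sym_map_in[OF \<phi>(1) F'])
  fix x \<gamma> assume x: "x \<in> carrier L" and \<gamma>: "\<gamma> \<in> dual"
  let ?c = "\<lambda>\<gamma>. compose (carrier L) \<gamma> \<phi>"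
  obtain x' where x': "x' \<in> carrier L" "x = \<phi> x'" using x \<phi>(2) by blast
  have \<phi>C: "\<phi> y \<in> carrier L" if "y \<in> carrier L" for y using \<phi>(1) that by (auto simp: lie_hom_def)
  have "sym_map L L \<phi> F (dual_line L \<gamma> (coad L x \<gamma>) t) = F (dual_line L (?c \<gamma>) (?c (coad L x \<gamma>)) t)" for t
  proof -
    have "?c (dual_line L \<gamma> (coad L x \<gamma>) t) = dual_line L (?c \<gamma>) (?c (coad L x \<gamma>)) t"
      by (auto simp: compose_def dual_line_def \<phi>C)
    then show ?thesis using dual_line_in[OF \<gamma> coad_in[OF x \<gamma>]] by (simp add: sym_map_def)
  qed
  then have "dir_deriv (sym_map L L \<phi> F) \<gamma> (coad L x \<gamma>) = dir_deriv F (?c \<gamma>) (?c (coad L x \<gamma>))"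
    by (simp add: dir_deriv_def line_poly_def)
  also have "?c (coad L x \<gamma>) = coad L x' (?c \<gamma>)"
  proof (rule dual_eqI[OF compose_dual_hom[OF \<phi>(1) coad_in[OF x \<gamma>]] coad_in[OF x'(1) compose_dual_hom[OF \<phi>(1) \<gamma>]]])
    fix y assume y: "y \<in> carrier L"
    have "\<phi> (lie_bracket L x' y) = lie_bracket L x (\<phi> y)"
      using \<phi>(1) x' y by (auto simp: lie_hom_def)
    then show "?c (coad L x \<gamma>) y = coad L x' (?c \<gamma>) y"
      using y x' \<phi>C[OF y] bracket_closed[OF x'(1) y] by (simp add: coad_def compose_def)
  qed
  also have "dir_deriv F (?c \<gamma>) (coad L x' (?c \<gamma>)) = 0"
    using F x'(1) compose_dual_hom[OF \<phi>(1) \<gamma>] by (simp add: sym_invariants_iff)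
  finally show "dir_deriv (sym_map L L \<phi> F) \<gamma> (coad L x \<gamma>) = 0" .
qed

lemma inverse_hom:
  assumes \<phi>: "lie_hom L L \<phi>" "bij_betw \<phi> (carrier L) (carrier L)"
  shows "lie_hom L L (inv_into (carrier L) \<phi>)"
proof -
  let ?\<psi> = "inv_into (carrier L) \<phi>"
  have \<psi>C: "?\<psi> x \<in> carrier L" if "x \<in> carrier L" for x
    using bij_betw_inv_into[OF \<phi>(2)] that by (auto simp: bij_betw_def)
  have \<phi>\<psi>: "\<phi> (?\<psi> x) = x" if "x \<in> carrier L" for x by (rule bij_betw_inv_into_right[OF \<phi>(2) that])
  have un: "?\<psi> x = y" if "y \<in> carrier L" "\<phi> y = x" for x y
    using bij_betw_inv_into_left[OF \<phi>(2) that(1)] that(2) by simp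
  have "?\<psi> (x \<oplus> y) = ?\<psi> x \<oplus> ?\<psi> y" if "x \<in> carrier L" "y \<in> carrier L" for x y
    by (rule un) (use \<phi>(1) that \<psi>C in \<open>auto simp: lie_hom_def \<phi>\<psi> add_closed\<close>)
  moreover have "?\<psi> (a \<odot> x) = a \<odot> ?\<psi> x" if "x \<in> carrier L" for a x
    by (rule un) (use \<phi>(1) that \<psi>C in \<open>auto simp: lie_hom_def \<phi>\<psi> smult_closed\<close>)
  moreover have "?\<psi> (lie_bracket L x y) = lie_bracket L (?\<psi> x) (?\<psi> y)" if "x \<in> carrier L" "y \<in> carrier L" for x y
    by (rule un) (use \<phi>(1) that \<psi>C in \<open>auto simp: lie_hom_def \<phi>\<psi> bracket_closed\<close>)
  ultimately show ?thesis using \<psi>C by (simp add: lie_hom_def)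
qed

lemma sym_map_inverse:
  assumes \<phi>: "lie_hom L L \<phi>" and \<psi>: "lie_hom L L \<psi>"
    and inv: "\<And>x. x \<in> carrier L \<Longrightarrow> \<psi> (\<phi> x) = x" and F: "F \<in> sym_alg L"
  shows "sym_map L L \<psi> (sym_map L L \<phi> F) = F"
proof (rule sym_alg_eqI[OF sym_map_in[OF \<psi> sym_map_in[OF \<phi> F]] F])
  fix \<gamma> assume \<gamma>: "\<gamma> \<in> dual"
  note \<gamma>\<psi> = compose_dual_hom[OF \<psi> \<gamma>]
  have "compose (carrier L) (compose (carrier L) \<gamma> \<psi>) \<phi> = \<gamma>"
  proof (rule dual_eqI[OF compose_dual_hom[OF \<phi> \<gamma>\<psi>] \<gamma>])
    fix x assume x: "x \<in> carrier L"
    then have "\<phi> x \<in> carrier L" using \<phi> by (auto simp: lie_hom_def)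
    then show "compose (carrier L) (compose (carrier L) \<gamma> \<psi>) \<phi> x = \<gamma> x" using x by (simp add: compose_eq inv)
  qed
  then show "sym_map L L \<psi> (sym_map L L \<phi> F) \<gamma> = F \<gamma>" using \<gamma> \<gamma>\<psi> by (simp add: sym_map_def)
qed

theorem freely_generated_automorphism:
  assumes \<phi>: "lie_hom L L \<phi>" "bij_betw \<phi> (carrier L) (carrier L)"
    and H: "freely_generated_by L (sym_invariants L) I H"
  shows "freely_generated_by L (sym_invariants L) I (\<lambda>i. sym_map L L \<phi> (H i))"
proof -
  let ?A = "sym_invariants L" let ?\<psi> = "inv_into (carrier L) \<phi>"
  define G where "G = (\<lambda>p. \<lambda>\<gamma>\<in>dual. mpoly_eval (\<lambda>i. H i \<gamma>) p)"
  have \<psi>: "lie_hom L L ?\<psi>" by (rule inverse_hom[OF \<phi>])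
  have im: "\<phi> ` carrier L = carrier L" "?\<psi> ` carrier L = carrier L"
    using \<phi>(2) bij_betw_inv_into[OF \<phi>(2)] by (auto simp: bij_betw_def)
  have alg: "F \<in> sym_alg L" if "F \<in> ?A" for F using that by (simp add: sym_invariants_iff)
  have "bij_betw (sym_map L L \<phi>) ?A ?A"
  proof (rule bij_betw_byWitness[where f' = "sym_map L L ?\<psi>"])
    show "\<forall>F\<in>?A. sym_map L L ?\<psi> (sym_map L L \<phi> F) = F"
      using sym_map_inverse[OF \<phi>(1) \<psi> bij_betw_inv_into_left[OF \<phi>(2)] alg] by blast
    show "\<forall>F\<in>?A. sym_map L L \<phi> (sym_map L L ?\<psi> F) = F"
      using sym_map_inverse[OF \<psi> \<phi>(1) bij_betw_inv_into_right[OF \<phi>(2)] alg] by blast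
    show "sym_map L L \<phi> ` ?A \<subseteq> ?A" "sym_map L L ?\<psi> ` ?A \<subseteq> ?A"
      using sym_map_invariant[OF \<phi>(1) im(1)] sym_map_invariant[OF \<psi> im(2)] by blast+
  qed
  moreover have "bij_betw G (mpolys_in I) ?A" using H unfolding freely_generated_by_def G_def .
  ultimately have "bij_betw (sym_map L L \<phi> \<circ> G) (mpolys_in I) ?A" by (rule bij_betw_trans[rotated])
  moreover have "sym_map L L \<phi> (G p) = (\<lambda>\<gamma>\<in>dual. mpoly_eval (\<lambda>i. sym_map L L \<phi> (H i) \<gamma>) p)" for p
    unfolding sym_map_def G_def by (rule restrict_ext) (simp add: compose_dual_hom[OF \<phi>(1)])
  ultimately show ?thesis unfolding freely_generated_by_def comp_def by simp
qed

end

section \<open>Quotient maps of the centraliser\<close>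

context long_root_vector
begin

text \<open>Both maps are surjective with the same kernel.\<close>

lemma quotient_map_factor:
  assumes \<pi>: "is_quotient_map n e \<pi>"
  obtains \<phi> where "lie_hom S S \<phi>" "bij_betw \<phi> (carrier S) (carrier S)"
    "\<And>x. x \<in> carrier Z \<Longrightarrow> \<pi> x = \<phi> (reduce x)"
proof -
  have n1: "n - 1 = m" using nm by simp
  have hom: "lie_hom Z S \<pi>" and im: "\<pi> ` carrier Z = carrier S"
    and ker: "{x \<in> carrier Z. \<pi> x = \<zero>\<^bsub>S\<^esub>} = range (\<lambda>a. a \<cdot>\<^sub>m e)"
    using \<pi> unfolding is_quotient_map_def n1 by auto
  interpret SL: lin_lie S by (rule lin_lie_sp_semidirect)
  have Zbr: "x * y - y * x \<in> carrier Z" if x: "x \<in> carrier Z" and y: "y \<in> carrier Z" for x y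
    unfolding centraliser_iff
  proof (intro conjI allI impI)
    note c = coords_sym[OF Z_sp[OF x], THEN sym_matsD(1)] coords_sym[OF Z_sp[OF y], THEN sym_matsD(1)]
    have R: "coords x * J * coords y \<in> carrier_mat N N" by (rule mult_carrier_mat[OF mult_carrier_mat[OF c(1) symp_J_carrier] c(2)])
    show "x * y - y * x \<in> carrier (sp n)"
      using sp_bracket_closed[OF Z_sp[OF x] Z_sp[OF y]] by (simp add: lie_bracket_sp)
    fix j assume j: "j < N"
    show "coords (x * y - y * x) $$ (n, j) = 0"
      unfolding coords_bracket[OF Z_sp[OF x] Z_sp[OF y]] add_transpose_entry[OF R n_less(2) j]
        product_index[OF x y n_less(2) j] product_index[OF x y j n_less(2)]
      by (simp add: Z_row[OF x] Z_col[OF y] \<iota>)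
  qed
  have diff: "\<rho> x = \<rho> y \<longleftrightarrow> \<rho> (x + (- 1) \<cdot>\<^sub>m y) = \<zero>\<^bsub>S\<^esub>"
    if "lie_hom Z S \<rho>" "x \<in> carrier Z" "y \<in> carrier Z" for \<rho> x y
  proof -
    have "\<rho> (x + (- 1) \<cdot>\<^sub>m y) = \<rho> x \<oplus>\<^bsub>S\<^esub> (- 1) \<odot>\<^bsub>S\<^esub> \<rho> y"
      using that Z_smult_closed[OF that(3), of "- 1"] by (simp add: lie_hom_def Z_simps)
    moreover have "\<rho> x \<in> carrier (sp m) \<times> carrier_vec (2 * m)" "\<rho> y \<in> carrier (sp m) \<times> carrier_vec (2 * m)"
      using that by (auto simp: lie_hom_def sp_semidirect_simps)
    then obtain X u Y w where "\<rho> x = (X, u)" "\<rho> y = (Y, w)"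
      "X \<in> carrier_mat (2 * m) (2 * m)" "Y \<in> carrier_mat (2 * m) (2 * m)"
      "u \<in> carrier_vec (2 * m)" "w \<in> carrier_vec (2 * m)"
      using sp_carrier_mat by blast
    ultimately show ?thesis
      by (auto simp: sp_semidirect_simps mat_eq_iff vec_eq_iff add_eq_0_iff)
  qed
  have same: "\<pi> x = \<pi> y \<longleftrightarrow> reduce x = reduce y" if "x \<in> carrier Z" "y \<in> carrier Z" for x y
  proof -
    have "x + (- 1) \<cdot>\<^sub>m y \<in> carrier Z" by (intro Z_add_closed Z_smult_closed that)
    then show ?thesis
      unfolding diff[OF hom that] diff[OF reduce_hom that] using ker reduce_kernel by blast
  qed
  define \<sigma> where "\<sigma> = (\<lambda>y. SOME x. x \<in> carrier Z \<and> reduce x = y)"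
  have \<sigma>: "\<sigma> y \<in> carrier Z" "reduce (\<sigma> y) = y" if "y \<in> carrier S" for y
    using someI_ex[of "\<lambda>x. x \<in> carrier Z \<and> reduce x = y"] reduce_surj[OF that] unfolding \<sigma>_def by blast+
  define \<phi> where "\<phi> = (\<lambda>y. \<pi> (\<sigma> y))"
  have \<phi>\<sigma>: "\<phi> y = \<pi> (\<sigma> y)" for y by (simp add: \<phi>_def)
  have fac: "\<phi> (reduce x) = \<pi> x" if "x \<in> carrier Z" for x
    unfolding \<phi>_def using same[OF \<sigma>(1)[OF reduce_in[OF Z_sp[OF that]]] that] \<sigma>(2)[OF reduce_in[OF Z_sp[OF that]]] by simp
  have "lie_hom S S \<phi>"
    unfolding lie_hom_def
  proof (intro conjI ballI allI funcsetI)
    fix x assume x: "x \<in> carrier S"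
    show "\<phi> x \<in> carrier S" unfolding \<phi>_def using im \<sigma>(1)[OF x] by blast
  next
    fix x y assume x: "x \<in> carrier S" and y: "y \<in> carrier S"
    have "\<phi> (reduce (\<sigma> x + \<sigma> y)) = \<phi> x \<oplus>\<^bsub>S\<^esub> \<phi> y"
      unfolding fac[OF Z_add_closed[OF \<sigma>(1)[OF x] \<sigma>(1)[OF y]]] \<phi>\<sigma>[of x] \<phi>\<sigma>[of y]
      using hom \<sigma>(1)[OF x] \<sigma>(1)[OF y] by (simp add: lie_hom_def Z_simps)
    moreover have "reduce (\<sigma> x + \<sigma> y) = x \<oplus>\<^bsub>S\<^esub> y"
      using reduce_hom \<sigma>[OF x] \<sigma>[OF y] by (simp add: lie_hom_def Z_simps)
    ultimately show "\<phi> (x \<oplus>\<^bsub>S\<^esub> y) = \<phi> x \<oplus>\<^bsub>S\<^esub> \<phi> y" by simp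
  next
    fix a x assume x: "x \<in> carrier S"
    have "\<phi> (reduce (a \<cdot>\<^sub>m \<sigma> x)) = a \<odot>\<^bsub>S\<^esub> \<phi> x"
      unfolding fac[OF Z_smult_closed[OF \<sigma>(1)[OF x]]] \<phi>\<sigma>[of x]
      using hom \<sigma>(1)[OF x] by (simp add: lie_hom_def Z_simps)
    moreover have "reduce (a \<cdot>\<^sub>m \<sigma> x) = a \<odot>\<^bsub>S\<^esub> x"
      using reduce_hom \<sigma>[OF x] by (simp add: lie_hom_def Z_simps)
    ultimately show "\<phi> (a \<odot>\<^bsub>S\<^esub> x) = a \<odot>\<^bsub>S\<^esub> \<phi> x" by simp
  next
    fix x y assume x: "x \<in> carrier S" and y: "y \<in> carrier S"
    have "\<phi> (reduce (\<sigma> x * \<sigma> y - \<sigma> y * \<sigma> x)) = lie_bracket S (\<phi> x) (\<phi> y)"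
      unfolding fac[OF Zbr[OF \<sigma>(1)[OF x] \<sigma>(1)[OF y]]] \<phi>\<sigma>[of x] \<phi>\<sigma>[of y]
      using hom \<sigma>(1)[OF x] \<sigma>(1)[OF y] by (simp add: lie_hom_def Z_simps)
    moreover have "reduce (\<sigma> x * \<sigma> y - \<sigma> y * \<sigma> x) = lie_bracket S x y"
      using reduce_bracket[OF \<sigma>(1)[OF x] \<sigma>(1)[OF y]] \<sigma>(2)[OF x] \<sigma>(2)[OF y] by simp
    ultimately show "\<phi> (lie_bracket S x y) = lie_bracket S (\<phi> x) (\<phi> y)" by simp
  qed
  moreover have "bij_betw \<phi> (carrier S) (carrier S)"
    unfolding bij_betw_def
  proof
    show "inj_on \<phi> (carrier S)"
    proof (rule inj_onI)
      fix x y assume x: "x \<in> carrier S" and y: "y \<in> carrier S" and "\<phi> x = \<phi> y"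
      then show "x = y" using same[OF \<sigma>(1)[OF x] \<sigma>(1)[OF y]] \<sigma>(2)[OF x] \<sigma>(2)[OF y] by (simp add: \<phi>_def)
    qed
    show "\<phi> ` carrier S = carrier S"
    proof
      show "\<phi> ` carrier S \<subseteq> carrier S" using \<open>lie_hom S S \<phi>\<close> by (auto simp: lie_hom_def)
      show "carrier S \<subseteq> \<phi> ` carrier S"
      proof
        fix y assume "y \<in> carrier S"
        then obtain x where x: "x \<in> carrier Z" "y = \<pi> x" using im by blast
        then have "y = \<phi> (reduce x)" by (simp add: fac)
        then show "y \<in> \<phi> ` carrier S" using reduce_in[OF Z_sp[OF x(1)]] by blast
      qed
    qed
  qed
  ultimately show ?thesis using that fac by metis
qed

end

context slice
begin

theorem restrictions_freely_generate:
  assumes \<pi>: "is_quotient_map n e \<pi>"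
  shows "freely_generated_by S (sym_invariants S) {1..m} (\<lambda>i. sym_map Z S \<pi> (e_Delta n B e f (2 * i + 2)))"
proof -
  interpret SL: lin_lie S by (rule lin_lie_sp_semidirect)
  obtain \<phi> where \<phi>: "lie_hom S S \<phi>" "bij_betw \<phi> (carrier S) (carrier S)"
    and fac: "\<And>x. x \<in> carrier Z \<Longrightarrow> \<pi> x = \<phi> (reduce x)"
    using quotient_map_factor[OF \<pi>] by blast
  let ?H = "\<lambda>i. sym_mult S (sym_const S \<kappa>) (bordered_coeff b m (2 * m - 2 * i))"
  have free: "freely_generated_by S (sym_invariants S) {1..m} (\<lambda>i. sym_map S S \<phi> (?H i))"
    by (rule SL.freely_generated_automorphism[OF \<phi> bordered_coeffs_freely_generate[OF b kappa_nonzero m]])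
  have "sym_map Z S \<pi> (e_Delta n B e f (2 * i + 2)) = sym_map S S \<phi> (?H i)" if "i \<in> {1..m}" for i
  proof -
    have i: "1 \<le> i" "i \<le> m" using that by auto
    have "sym_map Z S \<pi> F = sym_map S S \<phi> (sym_map Z S reduce F)" for F
      unfolding sym_map_def
    proof (rule restrict_ext)
      fix \<delta> assume \<delta>: "\<delta> \<in> lie_dual S"
      have "compose (carrier Z) \<delta> \<pi> = compose (carrier Z) (compose (carrier S) \<delta> \<phi>) reduce"
        by (auto simp: compose_def fac reduce_in[OF Z_sp])
      then show "F (compose (carrier Z) \<delta> \<pi>) =
          (\<lambda>\<delta>\<in>lie_dual S. F (compose (carrier Z) \<delta> reduce)) (compose (carrier S) \<delta> \<phi>)"
        using SL.compose_dual_hom[OF \<phi>(1) \<delta>] by simp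
    qed
    then show ?thesis unfolding e_Delta_eq[OF i] map_reduce_top_coeff[OF i, symmetric] by simp
  qed
  then have "(\<lambda>\<gamma>\<in>lie_dual S. mpoly_eval (\<lambda>i. sym_map Z S \<pi> (e_Delta n B e f (2 * i + 2)) \<gamma>) p) =
      (\<lambda>\<gamma>\<in>lie_dual S. mpoly_eval (\<lambda>i. sym_map S S \<phi> (?H i) \<gamma>) p)" if "p \<in> mpolys_in {1..m}" for p
    by (intro restrict_ext mpoly_eval_cong[OF that]) simp
  then show ?thesis
    using free unfolding freely_generated_by_def by (subst bij_betw_cong) auto
qed

end

lemma (in sp_conjugation) frame_zero:
  assumes n: "n > 0"
  shows "frame 0 0 = 2 \<cdot>\<^sub>m (rank_one N (\<lambda>i. g $$ (i, 0)) * J)"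
proof -
  let ?E = "sym_unit N 0 0 :: 'a mat"
  have gE: "g * ?E \<in> carrier_mat N N" by (rule mult_carrier_mat[OF gc sym_unit_carrier])
  have gt: "transpose_mat g \<in> carrier_mat N N" using gc by simp
  have "g * ?E * transpose_mat g = 2 \<cdot>\<^sub>m rank_one N (\<lambda>i. g $$ (i, 0))"
  proof (rule eq_matI)
    fix i j assume "i < dim_row (2 \<cdot>\<^sub>m rank_one N (\<lambda>i. g $$ (i, 0)))" "j < dim_col (2 \<cdot>\<^sub>m rank_one N (\<lambda>i. g $$ (i, 0)))"
    then have ij: "i < N" "j < N" by (auto simp: rank_one_def)
    have col: "(g * ?E) $$ (i, k) = (if k = 0 then 2 * g $$ (i, 0) else 0)" if k: "k < N" for k
    proof -
      have "(g * ?E) $$ (i, k) = (\<Sum>l<N. if l = 0 then (if k = 0 then 2 * g $$ (i, 0) else 0) else 0)"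
        unfolding mult_index_sum[OF gc sym_unit_carrier ij(1) k]
        by (intro sum.cong refl) (use k in \<open>auto simp: sym_unit_index\<close>)
      then show ?thesis using n by simp
    qed
    have "(g * ?E * transpose_mat g) $$ (i, j) = (\<Sum>k<N. if k = 0 then 2 * g $$ (i, 0) * g $$ (j, 0) else 0)"
      unfolding mult_index_sum[OF gE gt ij]
      by (intro sum.cong refl) (use col ij carrier_matD[OF gc] in \<open>auto simp del: index_mult_mat(1)\<close>)
    then show "(g * ?E * transpose_mat g) $$ (i, j) = (2 \<cdot>\<^sub>m rank_one N (\<lambda>i. g $$ (i, 0))) $$ (i, j)"
      using n ij by (simp add: rank_one_def)
  qed (use carrier_matD[OF gc] in \<open>auto simp: rank_one_def\<close>)
  then show ?thesis
    unfolding frame_def conj_mult_J[OF sym_unit_carrier]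
    using mult_smult_assoc_mat[OF rank_one_carrier symp_J_carrier] by simp
qed

theorem lemma5p1:
  fixes n :: nat
    and e h f :: "'a::field_char_0 mat"
    and B :: "'a mat \<Rightarrow> 'a mat \<Rightarrow> 'a"
  assumes "n \<ge> 2"
    and "minimal_nilpotent n e"
    and "sl2_triple (sp n) e h f"
    and "invariant_form (sp n) B"
  shows "(\<exists>\<pi>. is_quotient_map n e \<pi>) \<and>
    (\<forall>\<pi>. is_quotient_map n e \<pi> \<longrightarrow>
       freely_generated_by (sp_semidirect (n - 1)) (sym_invariants (sp_semidirect (n - 1))) {1..n - 1}
         (\<lambda>i. sym_map (centraliser (sp n) e) (sp_semidirect (n - 1)) \<pi> (e_Delta n B e f (2 * i + 2))))"
proof -
  have n: "n > 0" and m: "n - 1 > 0" and nm: "n = Suc (n - 1)" using assms(1) by auto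
  obtain a v where a: "a \<noteq> 0" and v: "\<exists>k<2 * n. v k \<noteq> 0"
    and e: "e = a \<cdot>\<^sub>m (rank_one (2 * n) v * symp_J n)"
    using minimal_nilpotent_rank_one[OF assms(2) n] by blast
  have ef: "sp_form n e f = 1" by (rule sl2_triple_sp_form[OF e a v assms(3)])
  have f: "f \<in> carrier (sp n)" using assms(3) by (simp add: sl2_triple_def)
  obtain b where b: "b \<noteq> 0" and B: "\<forall>X\<in>carrier (sp n). \<forall>Y\<in>carrier (sp n). B X Y = b * sp_form n X Y"
    using invariant_form_eq[OF assms(4) n] by blast
  obtain g g' where g: "sp_invertible n g g'" and gv: "\<And>i. i < 2 * n \<Longrightarrow> g $$ (i, 0) = v i"
    using sp_transitive[OF v n] by blast
  interpret sp_conjugation n g g' by unfold_locales (rule g)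
  have rv: "rank_one (2 * n) (\<lambda>i. g $$ (i, 0)) = rank_one (2 * n) v"
    by (rule eq_matI) (auto simp: rank_one_def gv)
  have e': "e = (a / 2) \<cdot>\<^sub>m frame 0 0"
    unfolding e frame_zero[OF n] rv by auto
  interpret slice n g g' "n - 1" "a / 2" e b f B
    by unfold_locales (use nm a e' b m f ef B in auto)
  show ?thesis using reduce_quotient restrictions_freely_generate by blast
qed

end
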